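(* Let $m \geq 1$ be any positive integer. For any initial data $$u_0 \in V^{m+1}(S),\qquad \omega_0 \in V^{m}(S),$$ there exists $T > 0$ depending only on $\|u_0\|_{V^{m+1}}$ and $\|\omega_0\|_{V^{m}}$ such that the 1D model $$u_t + v u_z = 0,\qquad \omega_t + v\omega_z = u_z,\qquad v_z = H\omega,$$ with $v(\cdot,t)$ of zero mean, and with initial data $u(\cdot,0)=u_0$, $\omega(\cdot,0)=\omega_0$, has a unique solution $$u \in C([0,T]; V^{m+1}(S)) \cap C^{1}([0,T]; V^{m}(S)),\qquad \omega \in C([0,T]; V^{m}(S)) \cap C^{1}([0,T]; V^{m-1}(S)).$$
   Context: Fix $L>0$. $S$ is the circle of circumference $L$ (functions on $S$ are $L$-periodic functions of $z$), and $H^k(S)$ is the real $L^2$-based Sobolev space on $S$. For an integer $k\ge 0$, $V^k(S)=\{f\in H^k(S): \bar f=0\}$, where $\bar f=\frac1L\int_0^L f(z)\,dz$, with norm $\|f\|_{V^k}=\big[\int_0^L|\partial_z^k f(z)|^2\,dz\big]^{1/2}$. The symbol $H$ applied to a function denotes the periodic Hilbert transform $H\omega(z)=\frac1L\,\mathrm{P.V.}\int_0^L\omega(y)\cot[\mu(z-y)]\,dy$, $\mu=\pi/L$. At each time the velocity $v$ is the unique zero-mean $L$-periodic function with $v_z=H\omega$.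
   Formalization: The solution u is taken in C([0,T];H^{m+1}) ∩ C^1([0,T];H^m), without zero mean for t>0, since the mean of u_t equals the mean of u·Hω, which need not vanish: for u_0=cos(2μz), ω_0=sin(2μz) it is −1/2 at t=0. *)

theory Defs
  imports "HOL-Analysis.Analysis"
begin

text \<open>Functions on the circle of circumference \<open>L\<close> are \<open>L\<close>-periodic functions on the real line.
  Elements of the \<open>L\<^sup>2\<close>-based spaces are represented by Borel functions, and two
  representatives denote the same element when they agree almost everywhere.\<close>

definition periodic :: "real \<Rightarrow> (real \<Rightarrow> real) \<Rightarrow> bool" where
  "periodic L f \<longleftrightarrow> (\<forall>z. f (z + L) = f z)"

definition mean :: "real \<Rightarrow> (real \<Rightarrow> real) \<Rightarrow> real" where
  "mean L f = (1 / L) * (LINT z:{0..L}|lborel. f z)"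

definition L2_circle :: "real \<Rightarrow> (real \<Rightarrow> real) set" where
  "L2_circle L = {f \<in> borel_measurable borel.
     periodic L f \<and> set_integrable lborel {0..L} (\<lambda>z. (f z)\<^sup>2)}"

definition smooth_circle :: "real \<Rightarrow> (real \<Rightarrow> real) set" where
  "smooth_circle L = {\<phi>. periodic L \<phi> \<and> (\<forall>n z. (deriv ^^ n) \<phi> field_differentiable at z)}"

definition is_weak_deriv :: "real \<Rightarrow> nat \<Rightarrow> (real \<Rightarrow> real) \<Rightarrow> (real \<Rightarrow> real) \<Rightarrow> bool" where
  "is_weak_deriv L j f g \<longleftrightarrow> (\<forall>\<phi>\<in>smooth_circle L.
     (LINT z:{0..L}|lborel. f z * (deriv ^^ j) \<phi> z)
       = (-1) ^ j * (LINT z:{0..L}|lborel. g z * \<phi> z))"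

definition sobolev :: "real \<Rightarrow> nat \<Rightarrow> (real \<Rightarrow> real) set" where
  "sobolev L k = {f \<in> L2_circle L. \<forall>j\<le>k. \<exists>g\<in>L2_circle L. is_weak_deriv L j f g}"

text \<open>A weak derivative is determined only up to a null set; an arbitrary representative is
  chosen, and all uses below are insensitive to that choice.\<close>

definition weak_deriv :: "real \<Rightarrow> nat \<Rightarrow> (real \<Rightarrow> real) \<Rightarrow> real \<Rightarrow> real" where
  "weak_deriv L j f = (SOME g. g \<in> L2_circle L \<and> is_weak_deriv L j f g)"

definition sobolev_norm :: "real \<Rightarrow> nat \<Rightarrow> (real \<Rightarrow> real) \<Rightarrow> real" where
  "sobolev_norm L k f = sqrt (\<Sum>j\<le>k. LINT z:{0..L}|lborel. (weak_deriv L j f z)\<^sup>2)"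

text \<open>The spaces \<open>V\<^sup>k(S)\<close> and their norms.\<close>

definition V_space :: "real \<Rightarrow> nat \<Rightarrow> (real \<Rightarrow> real) set" where
  "V_space L k = {f \<in> sobolev L k. mean L f = 0}"

definition V_norm :: "real \<Rightarrow> nat \<Rightarrow> (real \<Rightarrow> real) \<Rightarrow> real" where
  "V_norm L k f = sqrt (LINT z:{0..L}|lborel. (weak_deriv L k f z)\<^sup>2)"

text \<open>The classes \<open>C([0,T]; X)\<close> and \<open>C\<^sup>1([0,T]; X)\<close> for a space \<open>X\<close> with norm \<open>N\<close>; in the
  latter, \<open>f'\<close> is the time derivative in the norm of \<open>X\<close> (one-sided at the endpoints).\<close>

definition C0_path ::
  "(real \<Rightarrow> real) set \<Rightarrow> ((real \<Rightarrow> real) \<Rightarrow> real) \<Rightarrow> real \<Rightarrow> (real \<Rightarrow> real \<Rightarrow> real) \<Rightarrow> bool" where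
  "C0_path X N T f \<longleftrightarrow> (\<forall>t\<in>{0..T}. f t \<in> X \<and>
     ((\<lambda>s. N (\<lambda>z. f s z - f t z)) \<longlongrightarrow> 0) (at t within {0..T}))"

definition C1_path ::
  "(real \<Rightarrow> real) set \<Rightarrow> ((real \<Rightarrow> real) \<Rightarrow> real) \<Rightarrow> real \<Rightarrow>
   (real \<Rightarrow> real \<Rightarrow> real) \<Rightarrow> (real \<Rightarrow> real \<Rightarrow> real) \<Rightarrow> bool" where
  "C1_path X N T f f' \<longleftrightarrow> C0_path X N T f \<and> C0_path X N T f' \<and>
     (\<forall>t\<in>{0..T}. ((\<lambda>s. N (\<lambda>z. (f s z - f t z) / (s - t) - f' t z)) \<longlongrightarrow> 0)
        (at t within {0..T}))"

text \<open>The kernel \<open>cot (\<mu> (z - y))\<close> is singular at every \<open>y\<close> congruent to \<open>z\<close> modulo \<open>L\<close>; the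
  principal value removes the points of \<open>[0,L]\<close> at circle distance less than \<open>\<epsilon>\<close> from \<open>z\<close>.\<close>

definition hilbert :: "real \<Rightarrow> (real \<Rightarrow> real) \<Rightarrow> real \<Rightarrow> real" where
  "hilbert L w z = (1 / L) * Lim (at_right 0) (\<lambda>\<epsilon>.
     LINT y:{y\<in>{0..L}. \<forall>k::int. \<epsilon> \<le> \<bar>z - y - of_int k * L\<bar>}|lborel.
       w y * cot (pi / L * (z - y)))"

definition is_velocity :: "real \<Rightarrow> (real \<Rightarrow> real) \<Rightarrow> (real \<Rightarrow> real) \<Rightarrow> bool" where
  "is_velocity L w v \<longleftrightarrow> periodic L v \<and> mean L v = 0 \<and>
     (\<forall>z. (v has_real_derivative hilbert L w z) (at z))"

text \<open>Solutions on \<open>[0,T]\<close> of \<open>u\<^sub>t + v u\<^sub>z = 0\<close>, \<open>\<omega>\<^sub>t + v \<omega>\<^sub>z = u\<^sub>z\<close>, \<open>v\<^sub>z = H \<omega>\<close>.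

  The vorticity takes values in the zero-mean spaces. For \<open>u\<close> only the initial datum can be
  required to have zero mean, so \<open>u\<close> is taken in \<open>C([0,T]; H\<^sup>m\<^sup>+\<^sup>1) \<inter> C\<^sup>1([0,T]; H\<^sup>m)\<close> rather than in
  the corresponding \<open>V\<close> spaces: integrating the first equation over a period shows that the mean of
  \<open>u\<^sub>t\<close> is the mean of \<open>u H \<omega>\<close>, which need not vanish (for \<open>u\<^sub>0 = cos (2 \<mu> z)\<close>,
  \<open>\<omega>\<^sub>0 = sin (2 \<mu> z)\<close> one has \<open>H \<omega>\<^sub>0 = - cos (2 \<mu> z)\<close>, and the mean of \<open>u\<^sub>t\<close> at time \<open>0\<close> is
  \<open>- 1/2\<close>). Thus for these data no solution has \<open>u\<close> of zero mean on any time interval. A solution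
  with \<open>u\<close> in the \<open>V\<close> spaces is in particular a solution in the sense below, so uniqueness
  covers it.\<close>

definition is_solution ::
  "real \<Rightarrow> nat \<Rightarrow> real \<Rightarrow> (real \<Rightarrow> real) \<Rightarrow> (real \<Rightarrow> real) \<Rightarrow>
   (real \<Rightarrow> real \<Rightarrow> real) \<Rightarrow> (real \<Rightarrow> real \<Rightarrow> real) \<Rightarrow> bool" where
  "is_solution L m T u0 w0 u w \<longleftrightarrow>
     C0_path (sobolev L (m + 1)) (sobolev_norm L (m + 1)) T u \<and>
     C0_path (V_space L m) (V_norm L m) T w \<and>
     (AE z in lborel. u 0 z = u0 z) \<and>
     (AE z in lborel. w 0 z = w0 z) \<and>
     (\<exists>ut wt v.
        C1_path (sobolev L m) (sobolev_norm L m) T u ut \<and>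
        C1_path (V_space L (m - 1)) (V_norm L (m - 1)) T w wt \<and>
        (\<forall>t\<in>{0..T}.
           is_velocity L (w t) (v t) \<and>
           (AE z in lborel. ut t z + v t z * weak_deriv L 1 (u t) z = 0) \<and>
           (AE z in lborel. wt t z + v t z * weak_deriv L 1 (w t) z = weak_deriv L 1 (u t) z)))"

end

theory Submission
  imports Defs "HOL-Real_Asymp.Real_Asymp"
begin

text \<open>Let \<open>\<eta>\<close> be the flow of \<open>v\<close>. In the Lagrangian variables \<open>\<rho> = \<eta>\<^sub>z\<close> and \<open>W = \<omega> \<circ> \<eta>\<close> the transport terms
disappear: \<open>u \<circ> \<eta> = u\<^sub>0\<close>, \<open>W\<^sub>t = u\<^sub>0' / \<rho>\<close> and \<open>\<rho>\<^sub>t = \<rho> (v\<^sub>z \<circ> \<eta>)\<close>. The velocity is the logarithmic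
potential \<open>v = (1/\<pi>) ln |sin (\<mu> \<cdot>)| * \<omega>\<close>, and \<open>v\<^sub>z\<close> is the same potential of \<open>\<omega>\<^sub>z\<close>. Pulled back by \<open>\<eta>\<close> this
potential gains one derivative, and it depends in a Lipschitz way on \<open>\<rho>\<close>, because the difference of two pulled back
kernels has a derivative with an integrable singularity. Hence \<open>(\<rho>, W)\<close> solves an ordinary differential
equation in \<open>H\<^sup>m\<close> with a locally Lipschitz right-hand side, and Picard iteration yields a solution on a time interval
that depends only on the norms of the data. Composition with the inverse flow is strongly continuous on every
\<open>H\<^sup>k\<close>, which gives the regularity of \<open>u\<close> and \<open>\<omega>\<close>. For uniqueness, Gronwall's inequality applies to the sum of the
squared \<open>L\<^sup>2\<close> norms of the differences of \<open>u\<close>, \<open>u\<^sub>z\<close> and \<open>\<omega>\<close>: the terms that contain one derivative too many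
are integrated by parts.\<close>

section \<open>The Hilbert space of square-integrable functions\<close>

text \<open>Posed directly, the system has no locally Lipschitz right-hand side, since v \<omega>_z
  costs a derivative. In Lagrangian form the only derivative falls on W, and the potential gives it
  back. The obstacle is the potential: the derivative of a pulled back logarithmic kernel has a
  cotangent pole and is not integrable. On the flat circle Fourier series supply the bound in L^2,
  and every other \<rho> is compared with \<rho> = 1. In a difference of kernels the poles cancel up
  to the modulus of continuity of \<rho>; as \<rho> is merely in H^1, the singularity |z - y|^(-1/2)
  is left, which explains the weight \<open>wgt\<close> and Schur's test. The bound \<rho> >= 1/2,
  kept on a small ball around \<rho> = 1, is the origin of \<open>kap\<close> and of the constants
  3/4. A function with m derivatives is recorded by its mean and its m-th derivative, so the
  iteration runs in the one Banach space \<open>l2 \<times> real \<times> l2\<close>; the datum is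
  carried along as a parameter, which makes the existence time uniform over a ball of data. Time
  derivatives in Eulerian variables are first found weakly, against trigonometric functions.\<close>

definition sqint :: "(real => real) set" where
 "sqint = {f \<in> borel_measurable borel. integrable lborel (\<lambda>x. (f x)\<^sup>2)}"

lemma sqint_measurable: "f \<in> sqint ==> f \<in> borel_measurable borel"
 by (simp add: sqint_def)

lemma sqint_mult:
 assumes "f \<in> sqint" "g \<in> sqint"
 shows "integrable lborel (\<lambda>x. f x * g x)"
proof (rule Bochner_Integration.integrable_bound)
 show "integrable lborel (\<lambda>x. (f x)\<^sup>2 + (g x)\<^sup>2)"
  using assms by (auto simp: sqint_def)
 show "(\<lambda>x. f x * g x) \<in> borel_measurable lborel"
  using assms by (auto simp: sqint_def)
 have "\<bar>a * b\<bar> \<le> a\<^sup>2 + b\<^sup>2" for a b :: real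
 proof -
  have "0 \<le> \<bar>a\<bar> * \<bar>b\<bar>" by simp
  then show ?thesis using sum_squares_bound[of "\<bar>a\<bar>" "\<bar>b\<bar>"] unfolding abs_mult power2_abs by linarith
 qed
 then show "AE x in lborel. norm (f x * g x) \<le> norm ((f x)\<^sup>2 + (g x)\<^sup>2)"
  by simp
qed

lemma sqint_add: assumes "f \<in> sqint" "g \<in> sqint" shows "(\<lambda>x. f x + g x) \<in> sqint"
 using assms sqint_mult[OF assms] by (auto simp: sqint_def power2_sum mult.assoc)

lemma sqint_scale: "f \<in> sqint ==> (\<lambda>x. c * f x) \<in> sqint"
 by (auto simp: sqint_def power_mult_distrib)

lemma sqint_zero: "(\<lambda>x. 0) \<in> sqint"
 by (auto simp: sqint_def)

\<comment> \<open>A type cannot depend on \<open>L\<close>, so the space is built over the whole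
  line. The functions on a circle of any circumference embed into it by cutting off to one period
  (\<open>toL2\<close>); they form the range of the projection
  \<open>\<lambda>x. toL2 (ofL2 x)\<close>.\<close>
quotient_type l2 = "real => real" / partial:
 "\<lambda>f g. f \<in> sqint \<and> g \<in> sqint \<and> (AE x in lborel. f x = g x)"
proof (rule part_equivpI)
 show "\<exists>x. x \<in> sqint \<and> x \<in> sqint \<and> (AE xa in lborel. x xa = x xa)"
  using sqint_zero by auto
 show "symp (\<lambda>f g. f \<in> sqint \<and> g \<in> sqint \<and> (AE x in lborel. f x = g x))"
  by (auto simp: symp_def eq_commute)
 show "transp (\<lambda>f g. f \<in> sqint \<and> g \<in> sqint \<and> (AE x in lborel. f x = g x))"
  unfolding transp_def by (auto elim: AE_mp)
qed

instantiation l2 :: real_inner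
begin

lift_definition zero_l2 :: l2 is "\<lambda>x. 0" by (simp add: sqint_zero)
lift_definition plus_l2 :: "l2 => l2 => l2" is "\<lambda>f g x. f x + g x"
 by (auto simp: sqint_add)
lift_definition scaleR_l2 :: "real => l2 => l2" is "\<lambda>c f x. c * f x"
 by (auto simp: sqint_scale)
lift_definition inner_l2 :: "l2 => l2 => real" is "\<lambda>f g. LINT x|lborel. f x * g x"
 by (rule integral_cong_AE) (auto simp: sqint_def)
definition uminus_l2 :: "l2 => l2" where "uminus_l2 x = (-1) *\<^sub>R x"
definition minus_l2 :: "l2 => l2 => l2" where "minus_l2 x y = x + (-1) *\<^sub>R y"
definition norm_l2 :: "l2 => real" where "norm_l2 x = sqrt (inner x x)"
definition dist_l2 :: "l2 => l2 => real" where "dist_l2 x y = norm (x - y)"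
definition sgn_l2 :: "l2 => l2" where "sgn_l2 x = inverse (norm x) *\<^sub>R x"
definition uniformity_l2 :: "(l2 \<times> l2) filter"
 where "uniformity_l2 = (INF e\<in>{0 <..}. principal {(x, y). dist x y < e})"
definition open_l2 :: "l2 set => bool"
 where "open_l2 U \<longleftrightarrow> (\<forall>x\<in>U. \<forall>\<^sub>F (x', y) in uniformity. x' = x \<longrightarrow> y \<in> U)"

instance
proof
 fix x y z :: l2 and a b :: real
 show "x + y + z = x + (y + z)"
  by transfer (auto intro!: sqint_add simp: add.assoc)
 show "x + y = y + x" by transfer (auto intro!: sqint_add simp: add.commute)
 show "0 + x = x" by transfer auto
 show "- x + x = 0" unfolding uminus_l2_def by transfer (auto intro!: sqint_add sqint_zero sqint_scale[where c = "-1", simplified])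
 show "x - y = x + - y" by (simp add: minus_l2_def uminus_l2_def)
 show "a *\<^sub>R (x + y) = a *\<^sub>R x + a *\<^sub>R y"
  by transfer (auto intro!: sqint_add sqint_scale simp: distrib_left)
 show "(a + b) *\<^sub>R x = a *\<^sub>R x + b *\<^sub>R x"
  by transfer (auto intro!: sqint_add sqint_scale simp: distrib_right)
 show "a *\<^sub>R b *\<^sub>R x = (a * b) *\<^sub>R x"
  by transfer (auto intro!: sqint_scale simp: mult.assoc)
 show "1 *\<^sub>R x = x" by transfer auto
 show "dist x y = norm (x - y)" by (rule dist_l2_def)
 show "sgn x = inverse (norm x) *\<^sub>R x" by (simp add: sgn_l2_def)
 show "uniformity = (INF e\<in>{0 <..}. principal {(x::l2, y). dist x y < e})"
  by (rule uniformity_l2_def)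
 show "open U = (\<forall>x\<in>U. \<forall>\<^sub>F (x', y) in uniformity. x' = x \<longrightarrow> y \<in> U)" for U :: "l2 set"
  by (rule open_l2_def)
 show "inner x y = inner y x" by transfer (simp add: mult.commute)
 show "inner (x + y) z = inner x z + inner y z"
  by transfer (simp add: distrib_right sqint_mult)
 show "inner (a *\<^sub>R x) y = a * inner x y"
  by transfer (simp add: mult.assoc)
 show "0 \<le> inner x x" by transfer simp
 show "(inner x x = 0) = (x = 0)"
 proof (transfer, goal_cases)
  case (1 x)
  then have i: "integrable lborel (\<lambda>t. x t * x t)" using sqint_mult by blast
  show ?case using 1 integral_nonneg_eq_0_iff_AE[OF i] by (auto simp: sqint_zero)
 qed
 show "norm x = sqrt (inner x x)" by (rule norm_l2_def)
qed
end

lemma rep_l2_sqint: "rep_l2 x \<in> sqint"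
 using Quotient_rep_reflp[OF Quotient_l2] by blast

lemma abs_rep_l2 [simp]: "abs_l2 (rep_l2 x) = x"
 using Quotient_abs_rep[OF Quotient_l2] by blast

lemma abs_l2_eq_iff: "f \<in> sqint ==> g \<in> sqint ==> abs_l2 f = abs_l2 g \<longleftrightarrow> (AE x in lborel. f x = g x)"
 using Quotient_rel[OF Quotient_l2, of f g] by auto

lemma rep_abs_l2: "f \<in> sqint ==> AE x in lborel. rep_l2 (abs_l2 f) x = f x"
 using abs_l2_eq_iff[OF rep_l2_sqint, of f "abs_l2 f"] by simp

lemma inner_abs_l2: "f \<in> sqint ==> g \<in> sqint ==> inner (abs_l2 f) (abs_l2 g) = (LINT x|lborel. f x * g x)"
 using inner_l2.abs_eq by auto

lemma add_abs_l2: "f \<in> sqint ==> g \<in> sqint ==> abs_l2 f + abs_l2 g = abs_l2 (\<lambda>x. f x + g x)"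
 using plus_l2.abs_eq by auto

lemma scaleR_abs_l2: "f \<in> sqint ==> c *\<^sub>R abs_l2 f = abs_l2 (\<lambda>x. c * f x)"
 using scaleR_l2.abs_eq by auto

lemma sqint_diff: assumes "f \<in> sqint" "g \<in> sqint" shows "(\<lambda>x. f x - g x) \<in> sqint"
 using sqint_add[OF assms(1) sqint_scale[OF assms(2), of "-1"]] by simp

lemma diff_abs_l2: "f \<in> sqint ==> g \<in> sqint ==> abs_l2 f - abs_l2 g = abs_l2 (\<lambda>x. f x - g x)"
 using add_abs_l2[of f "\<lambda>x. -1 * g x"] scaleR_abs_l2[of g "-1"] sqint_scale[of g "-1"]
 by (simp add: diff_conv_add_uminus del: add_uminus_conv_diff)

lemma zero_abs_l2: "abs_l2 (\<lambda>x. 0) = 0"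
 by (simp add: zero_l2.abs_eq)

lemma sqint_abs: "f \<in> sqint ==> (\<lambda>x. \<bar>f x\<bar>) \<in> sqint"
 by (auto simp: sqint_def)

lemma norm_abs_l2: "f \<in> sqint ==> (norm (abs_l2 f))\<^sup>2 = (LINT x|lborel. (f x)\<^sup>2)"
 unfolding power2_norm_eq_inner by (simp add: inner_abs_l2 power2_eq_square)

lemma norm_abs_l2_abs: "f \<in> sqint ==> norm (abs_l2 (\<lambda>x. \<bar>f x\<bar>)) = norm (abs_l2 f)"
 by (rule power2_eq_imp_eq) (simp_all add: norm_abs_l2 sqint_abs)

text \<open>The Riesz-Fischer argument: the sums of the absolute increments increase and stay below
  2 in norm, so by monotone convergence they are finite almost everywhere, and there the telescoping
  series converges absolutely.\<close>

lemma sqint_fast_Cauchy_AE: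
 assumes f: "\<And>k. f k \<in> sqint" and d: "\<And>k. norm (abs_l2 (\<lambda>x. f (Suc k) x - f k x)) \<le> (1/2)^k"
 shows "AE x in lborel. convergent (\<lambda>k. f k x)"
proof -
 define g where "g n x = (\<Sum>k<n. \<bar>f (Suc k) x - f k x\<bar>)" for n x
 have gs: "g n \<in> sqint \<and> norm (abs_l2 (g n)) \<le> (\<Sum>k<n. (1/2)^k)" for n
 proof (induction n)
  case 0
  then show ?case by (simp add: g_def[abs_def] sqint_zero zero_abs_l2)
 next
  case (Suc n)
  have a: "(\<lambda>x. \<bar>f (Suc n) x - f n x\<bar>) \<in> sqint" by (intro sqint_abs sqint_diff f)
  have e: "g (Suc n) = (\<lambda>x. g n x + \<bar>f (Suc n) x - f n x\<bar>)" by (simp add: g_def[abs_def])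
  have "norm (abs_l2 (g (Suc n))) \<le> norm (abs_l2 (g n)) + norm (abs_l2 (\<lambda>x. \<bar>f (Suc n) x - f n x\<bar>))"
   unfolding e using add_abs_l2[OF conjunct1[OF Suc.IH] a]
    norm_triangle_ineq[of "abs_l2 (g n)" "abs_l2 (\<lambda>x. \<bar>f (Suc n) x - f n x\<bar>)"] by simp
  also have "\<dots> \<le> (\<Sum>k<n. (1/2)^k) + (1/2)^n"
   using Suc d[of n] norm_abs_l2_abs[OF sqint_diff[OF f f]] by (simp add: add_mono)
  finally show ?case using e Suc a sqint_add by simp
 qed
 have sle: "(\<Sum>k<n. (1/2::real)^k) \<le> 2" for n
  using sum_le_suminf[of "\<lambda>k. (1/2::real)^k" "{..<n}"] suminf_geometric[of "1/2::real"] by simp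
 have gm: "g n \<in> borel_measurable borel" for n using gs[of n] by (auto simp: sqint_def)
 have bnd: "(\<integral>\<^sup>+x. ennreal ((g n x)\<^sup>2) \<partial>lborel) \<le> ennreal 4" for n
 proof -
  have "(\<integral>\<^sup>+x. ennreal ((g n x)\<^sup>2) \<partial>lborel) = ennreal (LINT x|lborel. (g n x)\<^sup>2)"
   using gs[of n] by (intro nn_integral_eq_integral) (auto simp: sqint_def)
  also have "(LINT x|lborel. (g n x)\<^sup>2) = (norm (abs_l2 (g n)))\<^sup>2" using norm_abs_l2 gs by simp
  also have "\<dots> \<le> 2\<^sup>2" using gs[of n] sle[of n] by (intro power_mono) auto
  finally show ?thesis by (simp add: ennreal_leI del: ennreal_numeral)
 qed
 have inc: "incseq (\<lambda>n x. ennreal ((g n x)\<^sup>2))"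
 proof (rule incseq_SucI, rule le_funI)
  fix n x
  have "0 \<le> g n x" "g n x \<le> g (Suc n) x" by (auto simp: g_def sum_nonneg)
  then show "ennreal ((g n x)\<^sup>2) \<le> ennreal ((g (Suc n) x)\<^sup>2)" by (intro ennreal_leI power_mono)
 qed
 have "(\<integral>\<^sup>+x. (SUP n. ennreal ((g n x)\<^sup>2)) \<partial>lborel) = (SUP n. (\<integral>\<^sup>+x. ennreal ((g n x)\<^sup>2) \<partial>lborel))"
  using inc gm by (intro nn_integral_monotone_convergence_SUP) auto
 also have "\<dots> \<le> ennreal 4" using bnd by (intro SUP_least) auto
 also have "\<dots> < \<infinity>" by simp
 finally have "(\<integral>\<^sup>+x. (SUP n. ennreal ((g n x)\<^sup>2)) \<partial>lborel) \<noteq> \<infinity>" by simp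
 then have "AE x in lborel. (SUP n. ennreal ((g n x)\<^sup>2)) \<noteq> \<infinity>"
  using gm by (intro nn_integral_PInf_AE) auto
 then show ?thesis
 proof (rule AE_mp, intro AE_I2 impI)
  fix x assume fin: "(SUP n. ennreal ((g n x)\<^sup>2)) \<noteq> \<infinity>"
  then obtain c where c: "(SUP n. ennreal ((g n x)\<^sup>2)) = ennreal c" "c \<ge> 0"
   by (cases "SUP n. ennreal ((g n x)\<^sup>2)" rule: ennreal_cases) auto
  have "(g n x)\<^sup>2 \<le> c" for n
   using SUP_upper[of n UNIV "\<lambda>n. ennreal ((g n x)\<^sup>2)"] c by (simp)
  then have b: "g n x \<le> sqrt c" for n by (simp add: real_le_rsqrt)
  have "summable (\<lambda>k. \<bar>f (Suc k) x - f k x\<bar>)"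
   by (rule bounded_imp_summable[where B="sqrt c"])
    (use b[of "Suc _"] in \<open>auto simp: g_def lessThan_Suc_atMost\<close>)
  then have "summable (\<lambda>k. f (Suc k) x - f k x)" by (rule summable_rabs_cancel)
  then have "convergent (\<lambda>n. \<Sum>k<n. f (Suc k) x - f k x)" by (simp add: summable_iff_convergent)
  then have "convergent (\<lambda>n. f n x - f 0 x)"
   unfolding sum_lessThan_telescope[of "\<lambda>k. f k x"] .
  then have "convergent (\<lambda>n. (f n x - f 0 x) + f 0 x)" by (intro convergent_add convergent_const)
  then show "convergent (\<lambda>k. f k x)" by simp
 qed
qed

lemma sqint_Fatou:
 assumes f: "\<And>k::nat. f k \<in> sqint" and l: "AE x in lborel. (\<lambda>k. f k x) \<longlonglongrightarrow> h x"
  and h: "h \<in> borel_measurable borel" and b: "\<And>k. norm (abs_l2 (f k)) \<le> c"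
 shows "h \<in> sqint \<and> norm (abs_l2 h) \<le> c"
proof -
 have c0: "c \<ge> 0" using b[of 0] norm_ge_zero order_trans by blast
 have "(\<integral>\<^sup>+x. ennreal ((h x)\<^sup>2) \<partial>lborel) = (\<integral>\<^sup>+x. liminf (\<lambda>k. ennreal ((f k x)\<^sup>2)) \<partial>lborel)"
 proof (rule nn_integral_cong_AE, rule AE_mp[OF l], intro AE_I2 impI)
  fix x assume "(\<lambda>k. f k x) \<longlonglongrightarrow> h x"
  then have "(\<lambda>k. ennreal ((f k x)\<^sup>2)) \<longlonglongrightarrow> ennreal ((h x)\<^sup>2)"
   by (intro tendsto_ennrealI tendsto_power)
  then show "ennreal ((h x)\<^sup>2) = liminf (\<lambda>k. ennreal ((f k x)\<^sup>2))"
   by (intro lim_imp_Liminf[symmetric]) simp_all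
 qed
 also have "\<dots> \<le> liminf (\<lambda>k. \<integral>\<^sup>+x. ennreal ((f k x)\<^sup>2) \<partial>lborel)"
  using sqint_measurable[OF f] by (intro nn_integral_liminf) auto
 also have "\<dots> \<le> liminf (\<lambda>k::nat. ennreal (c\<^sup>2))"
 proof (rule Liminf_mono, rule always_eventually, rule allI)
  fix k
  have "(\<integral>\<^sup>+x. ennreal ((f k x)\<^sup>2) \<partial>lborel) = ennreal (LINT x|lborel. (f k x)\<^sup>2)"
   using f[of k] by (intro nn_integral_eq_integral) (auto simp: sqint_def)
  also have "(LINT x|lborel. (f k x)\<^sup>2) = (norm (abs_l2 (f k)))\<^sup>2" using norm_abs_l2 f by simp
  also have "\<dots> \<le> c\<^sup>2" using b by (intro power_mono) auto
  finally show "(\<integral>\<^sup>+x. ennreal ((f k x)\<^sup>2) \<partial>lborel) \<le> ennreal (c\<^sup>2)" using ennreal_leI by blast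
 qed
 finally have le: "(\<integral>\<^sup>+x. ennreal ((h x)\<^sup>2) \<partial>lborel) \<le> ennreal (c\<^sup>2)" by (simp add: Liminf_const)
 have i: "integrable lborel (\<lambda>x. (h x)\<^sup>2)"
  using le h by (intro integrableI_bounded) (auto simp: le_less_trans)
 then have hs: "h \<in> sqint" using h by (auto simp: sqint_def)
 have "ennreal (LINT x|lborel. (h x)\<^sup>2) = (\<integral>\<^sup>+x. ennreal ((h x)\<^sup>2) \<partial>lborel)"
  using i by (simp add: nn_integral_eq_integral)
 with le have "ennreal (LINT x|lborel. (h x)\<^sup>2) \<le> ennreal (c\<^sup>2)" by metis
 then have "(LINT x|lborel. (h x)\<^sup>2) \<le> c\<^sup>2" by (subst (asm) ennreal_le_iff) simp_all
 then have "(norm (abs_l2 h))\<^sup>2 \<le> c\<^sup>2" using norm_abs_l2 hs by simp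
 then show ?thesis using hs c0 power2_le_imp_le by blast
qed

instance l2 :: complete_space
proof
 fix X :: "nat => l2" assume X: "Cauchy X"
 have "\<exists>N. \<forall>m\<ge>N. \<forall>n\<ge>N. dist (X m) (X n) < (1/2)^k" for k :: nat
  using metric_CauchyD[OF X] by simp
 then obtain N where N: "\<And>k m n. m \<ge> N k ==> n \<ge> N k ==> dist (X m) (X n) < (1/2)^k" by metis
 \<comment> \<open>The sum dominates every \<open>N i\<close> with \<open>i \<le> k\<close>; the
   summand \<open>k\<close> makes the indices strictly increasing.\<close>
 define r where "r k = (\<Sum>i\<le>k. N i) + k" for k
 have rN: "N k \<le> r j" if "k \<le> j" for k j
  using that member_le_sum[of k "{..j}" N] by (auto simp: r_def)
 have rs: "strict_mono r" by (intro strict_monoI_Suc) (auto simp: r_def)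
 define f where "f k = rep_l2 (X (r k))" for k
 have fs: "f k \<in> sqint" for k by (simp add: f_def rep_l2_sqint)
 have af: "abs_l2 (f k) = X (r k)" for k by (simp add: f_def)
 have df: "norm (abs_l2 (\<lambda>x. f n x - f k x)) \<le> (1/2)^j" if "j \<le> k" "j \<le> n" for j k n
  using N[OF rN[OF that(2)] rN[OF that(1)]] diff_abs_l2[OF fs fs, of n k] af
  by (simp add: dist_norm)
 have ae: "AE x in lborel. convergent (\<lambda>k. f k x)"
  by (rule sqint_fast_Cauchy_AE[OF fs]) (use df in auto)
 define h where "h x = lim (\<lambda>k. f k x)" for x
 have hm: "h \<in> borel_measurable borel"
  unfolding h_def[abs_def] by (rule borel_measurable_lim_metric) (use fs in \<open>auto simp: sqint_def\<close>)
 have conv: "AE x in lborel. (\<lambda>k. f k x) \<longlonglongrightarrow> h x"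
  using ae by eventually_elim (simp add: h_def convergent_LIMSEQ_iff)
 have hb: "(\<lambda>x. h x - f j x) \<in> sqint \<and> norm (abs_l2 (\<lambda>x. h x - f j x)) \<le> (1/2)^j" for j
 proof (rule sqint_Fatou[where f = "\<lambda>k x. f (k + j) x - f j x"])
  show "AE x in lborel. (\<lambda>k. f (k + j) x - f j x) \<longlonglongrightarrow> h x - f j x"
   using conv
  proof eventually_elim
   case (elim x)
   show ?case by (intro tendsto_diff tendsto_const LIMSEQ_ignore_initial_segment elim)
  qed
  show "(\<lambda>x. h x - f j x) \<in> borel_measurable borel"
   using hm fs[of j] by (auto simp: sqint_def)
 qed (use df sqint_diff[OF fs fs] in auto)
 have hs: "h \<in> sqint" using sqint_add[OF fs[of 0] conjunct1[OF hb[of 0]]] by simp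
 have "(\<lambda>k. X (r k)) \<longlonglongrightarrow> abs_l2 h"
 proof (rule metric_LIMSEQ_I)
  fix e :: real assume "e > 0"
  then obtain K where K: "(1/2)^K < e" using real_arch_pow_inv[of e "1/2"] by auto
  have "dist (X (r k)) (abs_l2 h) < e" if "k \<ge> K" for k
  proof -
   have "dist (X (r k)) (abs_l2 h) = norm (abs_l2 (\<lambda>x. h x - f k x))"
    using af diff_abs_l2[OF hs fs, of k] by (simp add: dist_norm norm_minus_commute)
   also have "\<dots> \<le> (1/2)^k" using hb by simp
   also have "\<dots> \<le> (1/2)^K" using that by (simp add: power_decreasing)
   finally show ?thesis using K by simp
  qed
  then show "\<exists>no. \<forall>n\<ge>no. dist (X (r n)) (abs_l2 h) < e" by blast
 qed
 then have "X \<longlonglongrightarrow> abs_l2 h"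
  using Cauchy_converges_subseq[of X r "abs_l2 h"] X rs by (auto simp: o_def)
 then show "convergent X" by (auto simp: convergent_def)
qed

instance l2 :: banach ..

section \<open>Locally absolutely continuous functions\<close>

text \<open>Not oriented: for \<open>b < a\<close> the interval is empty and the value is 0. This is
  why formulas for increments carry the hypothesis \<open>a \<le> b\<close> and why primitives based
  at 0 have two branches.\<close>

definition itg :: "real => real => (real => real) => real" where
 "itg a b f = (LINT x:{a..b}|lborel. f x)"

definition locint :: "(real => real) => bool" where
 "locint f \<longleftrightarrow> f \<in> borel_measurable borel \<and> (\<forall>a b. set_integrable lborel {a..b} f)"

lemma locint_measurable: "locint f ==> f \<in> borel_measurable borel"
 by (simp add: locint_def)

lemma locint_set_integrable: "locint f ==> set_integrable lborel {a..b} f"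
 by (simp add: locint_def)

lemma locint_integrable_on: "locint f ==> f integrable_on {a..b}"
 by (rule set_borel_integral_eq_integral(1)) (rule locint_set_integrable)

lemma itg_eq_integral: "locint f ==> itg a b f = integral {a..b} f"
 unfolding itg_def by (rule set_borel_integral_eq_integral(2)) (rule locint_set_integrable)

lemma locint_continuous:
 assumes "continuous_on UNIV f" shows "locint f"
 unfolding locint_def
proof (intro conjI allI)
 show "f \<in> borel_measurable borel" using assms by (rule borel_measurable_continuous_onI)
 show "set_integrable lborel {a..b} f" for a b
  by (rule borel_integrable_compact[unfolded set_integrable_def[symmetric], simplified])
   (use assms in \<open>auto intro: continuous_on_subset simp: set_integrable_def\<close>)
qed

lemma locint_const: "locint (\<lambda>x. c)"
 by (intro locint_continuous continuous_intros)

lemma locint_add: "locint f ==> locint g ==> locint (\<lambda>x. f x + g x)"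
 by (auto simp: locint_def intro: set_integral_add)

lemma locint_diff: "locint f ==> locint g ==> locint (\<lambda>x. f x - g x)"
 by (auto simp: locint_def intro: set_integral_diff)

lemma locint_cmult: "locint f ==> locint (\<lambda>x. c * f x)"
 by (auto simp: locint_def)

lemma locint_abs: "locint f ==> locint (\<lambda>x. \<bar>f x\<bar>)"
 by (auto simp: locint_def intro: set_integrable_abs)

lemma locint_mult_cont:
 assumes f: "continuous_on UNIV f" and g: "locint g" shows "locint (\<lambda>x. f x * g x)"
 unfolding locint_def
proof (intro conjI allI)
 have fm: "f \<in> borel_measurable borel" using f by (rule borel_measurable_continuous_onI)
 then show "(\<lambda>x. f x * g x) \<in> borel_measurable borel" using g by (auto simp: locint_def)
 fix a b
 have "compact (f ` {a..b})" using f by (intro compact_continuous_image) (auto intro: continuous_on_subset)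
 then obtain B where B: "\<And>x. x \<in> {a..b} ==> \<bar>f x\<bar> \<le> B"
  by (metis bounded_iff compact_imp_bounded imageI real_norm_def)
 have "set_integrable lborel {a..b} (\<lambda>x. B * g x)" using g by (auto simp: locint_def)
 then show "set_integrable lborel {a..b} (\<lambda>x. f x * g x)"
  unfolding set_integrable_def
  by (rule Bochner_Integration.integrable_bound)
   (use fm g B in \<open>auto simp: locint_def indicator_def abs_mult intro!: AE_I2 mult_right_mono order_trans[OF B]\<close>)
qed

lemma itg_add: "locint f ==> locint g ==> itg a b (\<lambda>x. f x + g x) = itg a b f + itg a b g"
 unfolding itg_def by (rule set_integral_add) (auto simp: locint_def)

lemma itg_diff: "locint f ==> locint g ==> itg a b (\<lambda>x. f x - g x) = itg a b f - itg a b g"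
 unfolding itg_def by (rule set_integral_diff) (auto simp: locint_def)

lemma itg_cmult: "itg a b (\<lambda>x. c * f x) = c * itg a b f"
 unfolding itg_def by simp

lemma itg_minus: "itg a b (\<lambda>x. - f x) = - itg a b f"
 using itg_cmult[of a b "-1" f] by simp

lemma itg_const: "a \<le> b ==> itg a b (\<lambda>x. c) = (b - a) * c"
 unfolding itg_def set_lebesgue_integral_def by simp

lemma itg_refl: "itg a a f = 0"
 unfolding itg_def set_lebesgue_integral_def
 by (rule integral_eq_zero_AE, rule AE_mp[OF AE_lborel_singleton[of a]]) (auto simp: indicator_def)

lemma itg_cong: "(\<And>x. a \<le> x ==> x \<le> b ==> f x = g x) ==> itg a b f = itg a b g"
 unfolding itg_def by (rule set_lebesgue_integral_cong) auto

lemma itg_cong_AE: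
 assumes "f \<in> borel_measurable borel" "g \<in> borel_measurable borel" "AE x in lborel. f x = g x"
 shows "itg a b f = itg a b g"
 unfolding itg_def by (rule set_lebesgue_integral_cong_AE) (use assms in auto)

lemma itg_mono:
 assumes "locint f" "locint g" "\<And>x. a \<le> x ==> x \<le> b ==> f x \<le> g x"
 shows "itg a b f \<le> itg a b g"
 unfolding itg_def by (rule set_integral_mono) (use assms in \<open>auto simp: locint_def\<close>)

lemma itg_nonneg: "(\<And>x. a \<le> x ==> x \<le> b ==> 0 \<le> f x) ==> 0 \<le> itg a b f"
 unfolding itg_def set_lebesgue_integral_def by (rule integral_nonneg_AE) (auto simp: indicator_def)

lemma itg_abs: "\<bar>itg a b f\<bar> \<le> itg a b (\<lambda>x. \<bar>f x\<bar>)"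
 unfolding itg_def set_lebesgue_integral_def
 using integral_norm_bound[of lborel "\<lambda>x. indicator {a..b} x *\<^sub>R f x"] by (simp add: abs_mult)

lemma itg_abs_bound:
 assumes "locint f" "a \<le> b" "\<And>x. a \<le> x ==> x \<le> b ==> \<bar>f x\<bar> \<le> B"
 shows "\<bar>itg a b f\<bar> \<le> (b - a) * B"
 using itg_abs[of a b f] itg_mono[OF locint_abs[OF assms(1)] locint_const[of B], of a b] assms itg_const[of a b B]
 by force

lemma itg_combine:
 assumes "locint f" "a \<le> c" "c \<le> b" shows "itg a c f + itg c b f = itg a b f"
 using Henstock_Kurzweil_Integration.integral_combine[OF assms(2,3) locint_integrable_on] assms
 by (simp add: itg_eq_integral)

lemma itg_shift: "itg (a + c) (b + c) f = itg a b (\<lambda>x. f (x + c))"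
 unfolding itg_def set_lebesgue_integral_def
 by (subst lborel_integral_real_affine[where c=1 and t=c])
  (auto intro!: Bochner_Integration.integral_cong split: split_indicator simp: add.commute)

lemma set_integrable_shift:
 "set_integrable lborel {a + c..b + c} f \<longleftrightarrow> set_integrable lborel {a..b} (\<lambda>x. f (x + c :: real) :: real)"
 unfolding set_integrable_def
 by (subst lborel_integrable_real_affine_iff[where c=1 and t=c, symmetric])
  (auto intro!: Bochner_Integration.integrable_cong split: split_indicator simp: add.commute)

text \<open>The positive and the negative part of \<open>h\<close> are densities of two measures
  that agree on all closed intervals. These generate the Borel sets, are closed under intersection
  and have finite measure along an exhaustion of the line, so the measures agree; and a density is
  unique almost everywhere.\<close>

lemma itg_zero_imp_AE:
 assumes h: "locint h" and z: "\<And>a b. a \<le> b ==> itg a b h = 0"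
 shows "AE x in lborel. h x = 0"
proof -
 define hp hm where "hp x = max (h x) 0" and "hm x = max (- h x) 0" for x
 have m: "h \<in> borel_measurable borel" using h by (simp add: locint_def)
 then have mm: "hp \<in> borel_measurable borel" "hm \<in> borel_measurable borel"
  by (auto simp: hp_def[abs_def] hm_def[abs_def])
 have p: "hp = (\<lambda>x. (1/2) * (\<bar>h x\<bar> + h x))" "hm = (\<lambda>x. (1/2) * (\<bar>h x\<bar> - h x))"
  by (auto simp: hp_def hm_def)
 have li: "locint hp" "locint hm"
  unfolding p by (intro locint_cmult locint_add locint_diff locint_abs h)+
 have em: "emeasure (density lborel (\<lambda>x. ennreal (f x))) {a..b} = ennreal (itg a b f)"
  if "locint f" "\<And>x. 0 \<le> f x" for f a b
 proof -
  have "emeasure (density lborel (\<lambda>x. ennreal (f x))) {a..b} = (\<integral>\<^sup>+x. ennreal (f x) * indicator {a..b} x \<partial>lborel)"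
   using that by (subst emeasure_density) (auto simp: locint_def)
  also have "\<dots> = (\<integral>\<^sup>+x. ennreal (indicator {a..b} x *\<^sub>R f x) \<partial>lborel)"
   by (rule nn_integral_cong) (auto simp: indicator_def)
  also have "\<dots> = ennreal (itg a b f)"
   unfolding itg_def set_lebesgue_integral_def
   by (rule nn_integral_eq_integral) (use that in \<open>auto simp: locint_def set_integrable_def\<close>)
  finally show ?thesis .
 qed
 have eq: "itg a b hp = itg a b hm" for a b
 proof (cases "a \<le> b")
  case True
  have "itg a b (\<lambda>x. hp x - hm x) = itg a b h" by (rule itg_cong) (auto simp: hp_def hm_def)
  then show ?thesis using itg_diff[OF li, of a b] z[OF True] by simp
 next
  case False
  then show ?thesis by (intro itg_cong) auto
 qed
 have "density lborel (\<lambda>x. ennreal (hp x)) = density lborel (\<lambda>x. ennreal (hm x))"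
 proof (rule measure_eqI_generator_eq[where E="range (\<lambda>(a,b). {a..b})" and \<Omega>=UNIV and A="\<lambda>n. {- real n..real n}"])
  show "Int_stable (range (\<lambda>(a, b). {a..b::real}))"
   by (auto simp: Int_stable_def Int_atLeastAtMost image_iff)
  show "sets (density lborel (\<lambda>x. ennreal (hp x))) = sigma_sets UNIV (range (\<lambda>(a, b). {a..b}))"
   "sets (density lborel (\<lambda>x. ennreal (hm x))) = sigma_sets UNIV (range (\<lambda>(a, b). {a..b}))"
   by (simp_all add: borel_eq_atLeastAtMost)
  show "(\<Union>i. {- real i..real i}) = UNIV"
  proof (intro set_eqI iffI UNIV_I)
   fix x :: real
   obtain n where "\<bar>x\<bar> \<le> real n" using real_arch_simple by blast
   then show "x \<in> (\<Union>i. {- real i..real i})" by (intro UN_I[of n]) auto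
  qed
  show "emeasure (density lborel (\<lambda>x. ennreal (hp x))) {- real i..real i} \<noteq> \<infinity>" for i
   by (subst em) (auto simp: li hp_def)
  show "emeasure (density lborel (\<lambda>x. ennreal (hp x))) X = emeasure (density lborel (\<lambda>x. ennreal (hm x))) X"
   if Xr: "X \<in> range (\<lambda>(a, b). {a..b})" for X
  proof -
   obtain a b where X: "X = {a..b}" using Xr by auto
   show ?thesis unfolding X by (subst (1 2) em) (auto simp: li eq hp_def hm_def)
  qed
 qed auto
 then have "AE x in lborel. ennreal (hp x) = ennreal (hm x)"
  using mm by (subst (asm) sigma_finite_measure.density_unique_iff[OF sigma_finite_lborel]) auto
 then show ?thesis
 proof eventually_elim
  case (elim x)
  then have "hp x = hm x" by (simp add: hp_def hm_def)
  then show ?case by (auto simp: hp_def hm_def)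
 qed
qed

lemma itg_eq_imp_AE:
 assumes "locint f" "locint g" "\<And>a b. a \<le> b ==> itg a b f = itg a b g"
 shows "AE x in lborel. f x = g x"
 using itg_zero_imp_AE[OF locint_diff[OF assms(1,2)]] assms by (simp add: itg_diff)

lemma sqint_indicator:
 assumes "f \<in> borel_measurable borel" "set_integrable lborel {a..b} (\<lambda>x. (f x)\<^sup>2)"
 shows "(\<lambda>x. f x * indicator {a..b} x) \<in> sqint"
proof -
 have "(\<lambda>x. (f x * indicator {a..b} x)\<^sup>2) = (\<lambda>x. indicator {a..b} x *\<^sub>R (f x)\<^sup>2)"
  by (auto simp: indicator_def)
 then show ?thesis using assms by (auto simp: sqint_def set_integrable_def)
qed

lemma itg_Cauchy_Schwarz:
 assumes "f \<in> borel_measurable borel" "set_integrable lborel {a..b} (\<lambda>x. (f x)\<^sup>2)"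
  "g \<in> borel_measurable borel" "set_integrable lborel {a..b} (\<lambda>x. (g x)\<^sup>2)"
 shows "\<bar>itg a b (\<lambda>x. f x * g x)\<bar> \<le> sqrt (itg a b (\<lambda>x. (f x)\<^sup>2)) * sqrt (itg a b (\<lambda>x. (g x)\<^sup>2))"
proof -
 define F G where "F = (\<lambda>x. f x * indicator {a..b} x)" and "G = (\<lambda>x. g x * indicator {a..b} x)"
 have FG: "F \<in> sqint" "G \<in> sqint" using assms sqint_indicator by (auto simp: F_def G_def)
 have 1: "itg a b (\<lambda>x. f x * g x) = inner (abs_l2 F) (abs_l2 G)"
  unfolding inner_abs_l2[OF FG] itg_def set_lebesgue_integral_def
  by (rule Bochner_Integration.integral_cong) (auto simp: F_def G_def indicator_def)
 have 2: "itg a b (\<lambda>x. (f x)\<^sup>2) = inner (abs_l2 F) (abs_l2 F)"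
  unfolding inner_abs_l2[OF FG(1) FG(1)] itg_def set_lebesgue_integral_def
  by (rule Bochner_Integration.integral_cong) (auto simp: F_def indicator_def power2_eq_square)
 have 3: "itg a b (\<lambda>x. (g x)\<^sup>2) = inner (abs_l2 G) (abs_l2 G)"
  unfolding inner_abs_l2[OF FG(2) FG(2)] itg_def set_lebesgue_integral_def
  by (rule Bochner_Integration.integral_cong) (auto simp: G_def indicator_def power2_eq_square)
 show ?thesis unfolding 1 2 3 using Cauchy_Schwarz_ineq2[of "abs_l2 F" "abs_l2 G"]
  by (simp add: norm_eq_sqrt_inner)
qed

lemma abs_diff_mult_le: "\<bar>p * q - r * t\<bar> \<le> \<bar>p\<bar> * \<bar>q\<bar> + \<bar>r\<bar> * \<bar>t\<bar>" for p q r t :: real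
 using abs_triangle_ineq4[of "p * q" "r * t"] by (simp add: abs_mult)

text \<open>Additivity over a fine subdivision: a local estimate with small constant \<open>e\<close> globalises.\<close>

lemma itg_of_local_estimate:
 fixes h :: "real => real"
 assumes G: "locint G" and K: "locint K" and ab: "a \<le> b"
  and loc: "\<And>e. e > 0 ==> \<exists>d>0. \<forall>x y. a \<le> x \<longrightarrow> x \<le> y \<longrightarrow> y \<le> b \<longrightarrow> y < x + d \<longrightarrow>
   \<bar>h y - h x - itg x y G\<bar> \<le> e * itg x y K"
 shows "h b - h a = itg a b G"
proof -
 have main: "\<bar>h b - h a - itg a b G\<bar> \<le> e * itg a b K" if e: "e > 0" for e
 proof -
  obtain d where d: "d > 0" and D: "\<And>x y. a \<le> x ==> x \<le> y ==> y \<le> b ==> y < x + d ==>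
   \<bar>h y - h x - itg x y G\<bar> \<le> e * itg x y K" using loc[OF e] by blast
  obtain n :: nat where n: "b - a < real n * d" using reals_Archimedean3[OF d] by blast
  have n0: "n > 0" using n ab d by (cases n) auto
  define p where "p i = a + (b - a) / n * real i" for i :: nat
  have st: "p (Suc i) = p i + (b - a) / n" for i by (simp add: p_def distrib_left)
  have sm: "0 \<le> (b - a) / n" "(b - a) / n < d" using n n0 ab by (auto simp: field_simps)
  have pb: "p i \<le> b" if "i \<le> n" for i
  proof -
   have "(b - a) * (real i / n) \<le> (b - a) * 1" using that n0 ab by (intro mult_left_mono) auto
   then show ?thesis by (simp add: p_def)
  qed
  have pa: "a \<le> p i" for i using ab by (simp add: p_def)
  have "i \<le> n ==> \<bar>h (p i) - h a - itg a (p i) G\<bar> \<le> e * itg a (p i) K" for i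
  proof (induction i)
   case 0
   then show ?case by (simp add: p_def itg_refl)
  next
   case (Suc i)
   have i: "\<bar>h (p i) - h a - itg a (p i) G\<bar> \<le> e * itg a (p i) K" using Suc by simp
   have j: "\<bar>h (p (Suc i)) - h (p i) - itg (p i) (p (Suc i)) G\<bar> \<le> e * itg (p i) (p (Suc i)) K"
    by (rule D) (use pa pb[OF Suc.prems] st[of i] sm in auto)
   have le: "p i \<le> p (Suc i)" using st[of i] sm by simp
   have "itg a (p (Suc i)) G = itg a (p i) G + itg (p i) (p (Suc i)) G"
    "itg a (p (Suc i)) K = itg a (p i) K + itg (p i) (p (Suc i)) K"
    using itg_combine[OF G pa le] itg_combine[OF K pa le] by auto
   then show ?case using i j by (simp add: distrib_left)
  qed
  from this[of n] show ?thesis using n0 by (simp add: p_def)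
 qed
 have "\<bar>h b - h a - itg a b G\<bar> \<le> 0"
 proof (rule field_le_epsilon)
  fix e :: real assume e: "e > 0"
  define q where "q = \<bar>itg a b K\<bar> + 1"
  have q: "q > 0" by (simp add: q_def)
  have "\<bar>h b - h a - itg a b G\<bar> \<le> e / q * itg a b K" using main[of "e/q"] e q by simp
  also have "\<dots> \<le> e / q * q" using e q by (intro mult_left_mono) (auto simp: q_def)
  finally show "\<bar>h b - h a - itg a b G\<bar> \<le> 0 + e" using q by simp
 qed
 then show ?thesis by simp
qed

text \<open>\<open>g\<close> is the a.e. derivative of the locally absolutely continuous function \<open>f\<close>.\<close>

definition acd :: "(real => real) => (real => real) => bool" where
 "acd f g \<longleftrightarrow> locint g \<and> (\<forall>a b. a \<le> b \<longrightarrow> f b - f a = itg a b g)"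

lemma acdD: "acd f g ==> a \<le> b ==> f b - f a = itg a b g"
 by (simp add: acd_def)

lemma acd_locint: "acd f g ==> locint g"
 by (simp add: acd_def)

lemma acd_continuous:
 assumes "acd f g" shows "continuous_on UNIV f"
proof -
 have c: "continuous_on {a..b} f" for a b
 proof -
  have "continuous_on {a..b} (\<lambda>x. f a + integral {a..x} g)"
   by (intro continuous_intros indefinite_integral_continuous_1 locint_integrable_on acd_locint[OF assms])
  then show ?thesis
   by (rule continuous_on_eq) (use assms itg_eq_integral[OF acd_locint[OF assms]] acdD[OF assms] in force)
 qed
 have "isCont f x" for x
  using continuous_on_interior[OF c[of "x - 1" "x + 1"], of x] by simp
 then show ?thesis by (simp add: continuous_at_imp_continuous_on)
qed

lemma acd_locint1: "acd f g ==> locint f"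
 using acd_continuous locint_continuous by blast

lemma acd_unif:
 assumes "acd f g" "e > 0"
 shows "\<exists>d>0. \<forall>x y. a \<le> x \<longrightarrow> x \<le> b \<longrightarrow> a \<le> y \<longrightarrow> y \<le> b \<longrightarrow> \<bar>y - x\<bar> < d \<longrightarrow> \<bar>f y - f x\<bar> < e"
proof -
 have "uniformly_continuous_on {a..b} f"
  using acd_continuous[OF assms(1)] by (intro compact_uniformly_continuous) (auto intro: continuous_on_subset)
 then obtain d where "d > 0" "\<And>x y. x \<in> {a..b} ==> y \<in> {a..b} ==> \<bar>y - x\<bar> < d ==> \<bar>f y - f x\<bar> < e"
  using assms(2) unfolding uniformly_continuous_on_def dist_real_def by metis
 then show ?thesis by (intro exI[of _ d]) auto
qed

text \<open>Differentiability almost everywhere is avoided. On a short interval the increment of the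
  product is the integral with \<open>g\<close> frozen at the right end and \<open>f\<close> at the
  left end. Uniform continuity makes the error at most \<open>e\<close> times the integral of
  \<open>\<bar>f'\<bar> + \<bar>g'\<bar>\<close>, a quantity that adds up over a
  subdivision.\<close>

lemma acd_mult:
 assumes f: "acd f f'" and g: "acd g g'"
 shows "acd (\<lambda>x. f x * g x) (\<lambda>x. f' x * g x + f x * g' x)"
 unfolding acd_def
proof (intro conjI allI impI)
 have l1: "locint f'" "locint g'" using f g acd_locint by auto
 have l2: "locint (\<lambda>x. f' x * g x)" "locint (\<lambda>x. f x * g' x)"
  using locint_mult_cont[OF acd_continuous[OF g] l1(1)] locint_mult_cont[OF acd_continuous[OF f] l1(2)]
  by (auto simp: mult.commute)
 then show l3: "locint (\<lambda>x. f' x * g x + f x * g' x)" by (rule locint_add)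
 fix a b :: real assume ab: "a \<le> b"
 show "f b * g b - f a * g a = itg a b (\<lambda>x. f' x * g x + f x * g' x)"
 proof (rule itg_of_local_estimate[OF l3 locint_add[OF locint_abs[OF l1(1)] locint_abs[OF l1(2)]] ab])
  fix e :: real assume e: "e > 0"
  obtain d1 where d1: "d1 > 0" "\<And>x y. a \<le> x ==> x \<le> b ==> a \<le> y ==> y \<le> b ==> \<bar>y - x\<bar> < d1 ==> \<bar>f y - f x\<bar> < e"
   using acd_unif[OF f e, of a b] by blast
  obtain d2 where d2: "d2 > 0" "\<And>x y. a \<le> x ==> x \<le> b ==> a \<le> y ==> y \<le> b ==> \<bar>y - x\<bar> < d2 ==> \<bar>g y - g x\<bar> < e"
   using acd_unif[OF g e, of a b] by blast
  have "\<bar>f y * g y - f x * g x - itg x y (\<lambda>x. f' x * g x + f x * g' x)\<bar> \<le> e * itg x y (\<lambda>x. \<bar>f' x\<bar> + \<bar>g' x\<bar>)"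
   if xy: "a \<le> x" "x \<le> y" "y \<le> b" "y < x + min d1 d2" for x y
  proof -
   have lx: "locint (\<lambda>s. g y * f' s + f x * g' s)" by (intro locint_add locint_cmult l1)
   have "f y * g y - f x * g x = g y * (f y - f x) + f x * (g y - g x)" by (simp add: algebra_simps)
   also have "\<dots> = itg x y (\<lambda>s. g y * f' s + f x * g' s)"
    using acdD[OF f xy(2)] acdD[OF g xy(2)] by (simp add: itg_add locint_cmult l1 itg_cmult)
   finally have E: "f y * g y - f x * g x - itg x y (\<lambda>x. f' x * g x + f x * g' x)
     = itg x y (\<lambda>s. g y * f' s + f x * g' s - (f' s * g s + f s * g' s))"
    by (simp add: itg_diff lx l3)
   have "\<bar>f y * g y - f x * g x - itg x y (\<lambda>x. f' x * g x + f x * g' x)\<bar> \<le> itg x y (\<lambda>s. \<bar>g y * f' s + f x * g' s - (f' s * g s + f s * g' s)\<bar>)" unfolding E by (rule itg_abs)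
   also have "\<dots> \<le> itg x y (\<lambda>s. e * (\<bar>f' s\<bar> + \<bar>g' s\<bar>))"
   proof (rule itg_mono)
    fix s assume s: "x \<le> s" "s \<le> y"
    have "y < x + d1" "y < x + d2" using xy(4) by auto
    then have "\<bar>y - s\<bar> < d2" "\<bar>s - x\<bar> < d1" "a \<le> s" "s \<le> b" "a \<le> y" "x \<le> b" using s xy(1-3) by linarith+
    then have "\<bar>g y - g s\<bar> < e" and "\<bar>f s - f x\<bar> < e" using d2(2) d1(2) xy(1,3) by blast+
    then have 1: "\<bar>g y - g s\<bar> \<le> e" "\<bar>f s - f x\<bar> \<le> e" by auto
    have "\<bar>g y * f' s + f x * g' s - (f' s * g s + f s * g' s)\<bar> = \<bar>(g y - g s) * f' s - (f s - f x) * g' s\<bar>"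
     by (simp add: algebra_simps)
    also have "\<dots> \<le> \<bar>g y - g s\<bar> * \<bar>f' s\<bar> + \<bar>f s - f x\<bar> * \<bar>g' s\<bar>" by (rule abs_diff_mult_le)
    also have "\<dots> \<le> e * \<bar>f' s\<bar> + e * \<bar>g' s\<bar>" using 1 by (intro add_mono mult_right_mono) auto
    finally show "\<bar>g y * f' s + f x * g' s - (f' s * g s + f s * g' s)\<bar> \<le> e * (\<bar>f' s\<bar> + \<bar>g' s\<bar>)"
     by (simp add: distrib_left)
   qed (intro locint_abs locint_diff lx l3 locint_cmult locint_add l1)+
   also have "\<dots> = e * itg x y (\<lambda>x. \<bar>f' x\<bar> + \<bar>g' x\<bar>)" by (rule itg_cmult)
   finally show ?thesis .
  qed
  then show "\<exists>d>0. \<forall>x y. a \<le> x \<longrightarrow> x \<le> y \<longrightarrow> y \<le> b \<longrightarrow> y < x + d \<longrightarrow>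
    \<bar>f y * g y - f x * g x - itg x y (\<lambda>x. f' x * g x + f x * g' x)\<bar> \<le> e * itg x y (\<lambda>x. \<bar>f' x\<bar> + \<bar>g' x\<bar>)"
   using d1(1) d2(1) by (intro exI[of _ "min d1 d2"]) auto
 qed
qed

lemma acd_inverse:
 assumes f: "acd f f'" and c: "c > 0" "\<And>x. c \<le> f x"
 shows "acd (\<lambda>x. 1 / f x) (\<lambda>x. - (f' x * (1 / f x) * (1 / f x)))"
 unfolding acd_def
proof (intro conjI allI impI)
 have cf: "continuous_on UNIV f" by (rule acd_continuous[OF f])
 have fp: "f x > 0" for x using c(1) c(2)[of x] by simp
 have nz: "f x \<noteq> 0" for x using fp[of x] by simp
 have l1: "locint f'" using f acd_locint by auto
 have "locint (\<lambda>x. - (1 / f x * (1 / f x)) * f' x)"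
  by (rule locint_mult_cont[OF _ l1]) (intro continuous_intros cf, use nz in auto)
 moreover have "(\<lambda>x. - (1 / f x * (1 / f x)) * f' x) = (\<lambda>x. - (f' x * (1 / f x) * (1 / f x)))" by auto
 ultimately show l3: "locint (\<lambda>x. - (f' x * (1 / f x) * (1 / f x)))" by simp
 have rb: "0 < 1 / f x" "1 / f x \<le> 1 / c" for x using fp[of x] c by (auto intro: divide_left_mono)
 fix a b :: real assume ab: "a \<le> b"
 show "1 / f b - 1 / f a = itg a b (\<lambda>x. - (f' x * (1 / f x) * (1 / f x)))"
 proof (rule itg_of_local_estimate[OF l3 locint_abs[OF l1] ab])
  fix e :: real assume e: "e > 0"
  \<comment> \<open>Freezing two factors causes two errors, each an oscillation \<open>e1\<close> of
    \<open>1 / f\<close> times the bound \<open>1 / c\<close> of the other factor; together they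
    make up \<open>e\<close>.\<close>
  define e1 where "e1 = e * c / 2"
  have e1: "e1 > 0" using e c by (simp add: e1_def)
  have "uniformly_continuous_on {a..b} (\<lambda>x. 1 / f x)"
   by (intro compact_uniformly_continuous continuous_intros continuous_on_subset[OF cf]) (use nz in auto)
  then obtain d where d: "d > 0" "\<And>x y. a \<le> x ==> x \<le> b ==> a \<le> y ==> y \<le> b ==> \<bar>y - x\<bar> < d ==> \<bar>1 / f y - 1 / f x\<bar> < e1"
   using e1 unfolding uniformly_continuous_on_def dist_real_def by (metis atLeastAtMost_iff)
  have "\<bar>1 / f y - 1 / f x - itg x y (\<lambda>x. - (f' x * (1 / f x) * (1 / f x)))\<bar> \<le> e * itg x y (\<lambda>x. \<bar>f' x\<bar>)"
   if xy: "a \<le> x" "x \<le> y" "y \<le> b" "y < x + d" for x y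
  proof -
   have "1 / f y - 1 / f x = - (1 / f x * (1 / f y)) * (f y - f x)" using nz[of x] nz[of y] by (simp add: field_simps)
   also have "\<dots> = itg x y (\<lambda>s. - (1 / f x * (1 / f y)) * f' s)"
    using acdD[OF f xy(2)] by (simp only: itg_cmult)
   finally have E: "1 / f y - 1 / f x - itg x y (\<lambda>x. - (f' x * (1 / f x) * (1 / f x)))
     = itg x y (\<lambda>s. - (1 / f x * (1 / f y)) * f' s - (- (f' s * (1 / f s) * (1 / f s))))"
    by (simp only: itg_diff[OF locint_cmult[OF l1] l3])
   have "\<bar>1 / f y - 1 / f x - itg x y (\<lambda>x. - (f' x * (1 / f x) * (1 / f x)))\<bar>
     \<le> itg x y (\<lambda>s. \<bar>- (1 / f x * (1 / f y)) * f' s - (- (f' s * (1 / f s) * (1 / f s)))\<bar>)"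
    unfolding E by (rule itg_abs)
   also have "\<dots> \<le> itg x y (\<lambda>s. e * \<bar>f' s\<bar>)"
   proof (rule itg_mono)
    fix s assume s: "x \<le> s" "s \<le> y"
    have "\<bar>y - s\<bar> < d" "\<bar>s - x\<bar> < d" "a \<le> s" "s \<le> b" "a \<le> y" "x \<le> b" using s xy by linarith+
    then have "\<bar>1 / f s - 1 / f x\<bar> < e1" "\<bar>1 / f y - 1 / f s\<bar> < e1" using d(2) xy(1,3) by blast+
    then have 1: "\<bar>1 / f s - 1 / f x\<bar> \<le> e1" "\<bar>1 / f y - 1 / f s\<bar> \<le> e1" by auto
    define X Y S where "X = 1 / f x" and "Y = 1 / f y" and "S = 1 / f s"
    have "\<bar>- (X * Y) * f' s - (- (f' s * S * S))\<bar> = \<bar>(S - X) * S - X * (Y - S)\<bar> * \<bar>f' s\<bar>"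
     unfolding abs_mult[symmetric] by (simp add: algebra_simps)
    also have "\<dots> \<le> e * \<bar>f' s\<bar>"
    proof (rule mult_right_mono)
     have "\<bar>(S - X) * S - X * (Y - S)\<bar> \<le> \<bar>S - X\<bar> * \<bar>S\<bar> + \<bar>X\<bar> * \<bar>Y - S\<bar>" by (rule abs_diff_mult_le)
     also have "\<dots> \<le> e1 * (1/c) + (1/c) * e1"
      using 1 rb[of s] rb[of x] e1 c(1) unfolding X_def Y_def S_def
      by (intro add_mono mult_mono) auto
     also have "\<dots> = e" using c(1) by (simp add: e1_def)
     finally show "\<bar>(S - X) * S - X * (Y - S)\<bar> \<le> e" .
    qed simp
    finally show "\<bar>- (1 / f x * (1 / f y)) * f' s - (- (f' s * (1 / f s) * (1 / f s)))\<bar> \<le> e * \<bar>f' s\<bar>"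
     by (simp add: X_def Y_def S_def)
   qed (intro locint_abs locint_diff locint_cmult l3 l1)+
   also have "\<dots> = e * itg x y (\<lambda>x. \<bar>f' x\<bar>)" by (rule itg_cmult)
   finally show ?thesis .
  qed
  then show "\<exists>d>0. \<forall>x y. a \<le> x \<longrightarrow> x \<le> y \<longrightarrow> y \<le> b \<longrightarrow> y < x + d \<longrightarrow>
    \<bar>1 / f y - 1 / f x - itg x y (\<lambda>x. - (f' x * (1 / f x) * (1 / f x)))\<bar> \<le> e * itg x y (\<lambda>x. \<bar>f' x\<bar>)"
   using d(1) by blast
 qed
qed

lemma acd_add: "acd f f' ==> acd g g' ==> acd (\<lambda>x. f x + g x) (\<lambda>x. f' x + g' x)"
 unfolding acd_def by (auto simp: itg_add locint_add) (smt (verit))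

lemma acd_cmult: "acd f f' ==> acd (\<lambda>x. c * f x) (\<lambda>x. c * f' x)"
 unfolding acd_def by (auto simp: itg_cmult locint_cmult simp flip: right_diff_distrib)

lemma acd_diff: "acd f f' ==> acd g g' ==> acd (\<lambda>x. f x - g x) (\<lambda>x. f' x - g' x)"
 using acd_add[of f f' "\<lambda>x. -1 * g x" "\<lambda>x. -1 * g' x"] acd_cmult[of g g' "-1"] by simp

lemma acd_const: "acd (\<lambda>x. c) (\<lambda>x. 0)"
 unfolding acd_def by (auto simp: itg_const locint_const)

lemma acd_of_deriv:
 assumes d: "\<And>x. (f has_real_derivative g x) (at x)" and c: "continuous_on UNIV g"
 shows "acd f g"
 unfolding acd_def
proof (intro conjI allI impI)
 show l: "locint g" by (rule locint_continuous[OF c])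
 fix a b :: real assume ab: "a \<le> b"
 have "(g has_integral (f b - f a)) {a..b}"
  by (rule fundamental_theorem_of_calculus[OF ab])
   (use d in \<open>auto simp: has_real_derivative_iff_has_vector_derivative[symmetric] intro: DERIV_subset\<close>)
 then show "f b - f a = itg a b g" by (simp add: itg_eq_integral[OF l] integral_unique)
qed

lemma acd_has_deriv:
 assumes f: "acd f g" and c: "continuous_on UNIV g"
 shows "(f has_real_derivative g x) (at x)"
proof -
 have 1: "((\<lambda>u. integral {x-1..u} g) has_real_derivative g x) (at x within {x-1..x+1})"
  by (rule integral_has_real_derivative) (use c in \<open>auto intro: continuous_on_subset\<close>)
 have 2: "at x within {x-1..x+1} = at x" by (rule at_within_interior) auto
 have "((\<lambda>u. f (x - 1) + integral {x-1..u} g) has_real_derivative g x) (at x)"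
  using 1 unfolding 2 by (auto intro!: derivative_eq_intros)
 then show ?thesis
 proof (rule has_field_derivative_transform_within_open[of _ _ _ "{x-1<..}"])
  show "\<And>u. u \<in> {x - 1<..} ==> f (x - 1) + integral {x - 1..u} g = f u"
   using acdD[OF f] itg_eq_integral[OF acd_locint[OF f]] by (smt (verit) greaterThan_iff)
 qed auto
qed

lemma acd_unique: "acd f g ==> acd f h ==> AE x in lborel. g x = h x"
 by (rule itg_eq_imp_AE) (auto simp: acd_def)

lemma acd_indefinite:
 assumes "locint g"
 shows "acd (\<lambda>x. if 0 \<le> x then itg 0 x g else - itg x 0 g) g"
 unfolding acd_def
proof (intro conjI allI impI assms)
 fix a b :: real assume "a \<le> b"
 then show "(if 0 \<le> b then itg 0 b g else - itg b 0 g) - (if 0 \<le> a then itg 0 a g else - itg a 0 g) = itg a b g"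
  using itg_combine[OF assms, of 0 a b] itg_combine[OF assms, of a 0 b] itg_combine[OF assms, of a b 0]
  by auto
qed

lemma set_integrable_lborel_iff:
 fixes f :: "real => real"
 assumes "f \<in> borel_measurable borel" "S \<in> sets borel"
 shows "f absolutely_integrable_on S \<longleftrightarrow> set_integrable lborel S f"
 unfolding set_integrable_def by (rule integrable_completion) (use assms in auto)

lemma strict_mono_image_Icc:
 fixes h :: "real => real"
 assumes "strict_mono h" "continuous_on UNIV h" "a \<le> b"
 shows "h ` {a..b} = {h a..h b}"
proof
 show "h ` {a..b} \<subseteq> {h a..h b}" using assms(1) by (auto simp: strict_mono_less_eq)
 show "{h a..h b} \<subseteq> h ` {a..b}"
 proof
  fix y assume "y \<in> {h a..h b}"
  then have "\<exists>x. a \<le> x \<and> x \<le> b \<and> h x = y"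
   by (intro IVT') (use assms in \<open>auto intro: continuous_on_subset\<close>)
  then show "y \<in> h ` {a..b}" by auto
 qed
qed

text \<open>Substitution is taken for functions absolutely integrable in the completed measure, and
  Borel measurability of both integrands carries it to \<open>lborel\<close>. \<open>F\<close> need
  not be continuous: this is what composing L^2 functions with a flow requires.\<close>

lemma locint_change_of_variables:
 assumes d: "\<And>x. (h has_real_derivative r x) (at x)" and c: "continuous_on UNIV r" and p: "\<And>x. r x > 0"
  and F: "locint F"
 shows "locint (\<lambda>x. F (h x) * r x)" and "a \<le> b ==> itg (h a) (h b) F = itg a b (\<lambda>x. F (h x) * r x)"
proof -
 have sm: "strict_mono h"
  by (rule strict_monoI, rule DERIV_pos_imp_increasing) (use d p in auto)
 have ch: "continuous_on UNIV h" using d by (meson DERIV_isCont continuous_at_imp_continuous_on)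
 have mF: "F \<in> borel_measurable borel" using F by (rule locint_measurable)
 have m: "(\<lambda>x. F (h x) * r x) \<in> borel_measurable borel"
  using mF borel_measurable_continuous_onI[OF ch] borel_measurable_continuous_onI[OF c] by measurable
 have main: "set_integrable lborel {a..b} (\<lambda>x. F (h x) * r x) \<and> itg (h a) (h b) F = itg a b (\<lambda>x. F (h x) * r x)" if ab: "a \<le> b" for a b
 proof -
  have "inj_on h {a..b}" using sm by (auto simp: inj_on_def strict_mono_eq)
  then have *: "((\<lambda>x. \<bar>r x\<bar> * F (h x)) absolutely_integrable_on {a..b} \<and>
     integral {a..b} (\<lambda>x. \<bar>r x\<bar> * F (h x)) = integral (h ` {a..b}) F)
  \<longleftrightarrow> F absolutely_integrable_on (h ` {a..b}) \<and> integral (h ` {a..b}) F = integral (h ` {a..b}) F"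
   by (intro has_absolute_integral_change_of_variables_1') (auto intro: DERIV_subset[OF d])
  have "F absolutely_integrable_on (h ` {a..b})"
   unfolding strict_mono_image_Icc[OF sm ch ab]
   by (subst set_integrable_lborel_iff) (use mF F in \<open>auto simp: locint_def\<close>)
  moreover have e: "(\<lambda>x. \<bar>r x\<bar> * F (h x)) = (\<lambda>x. F (h x) * r x)"
   using p by (auto simp: abs_of_pos mult.commute)
  ultimately have A: "(\<lambda>x. F (h x) * r x) absolutely_integrable_on {a..b}"
   "integral {a..b} (\<lambda>x. F (h x) * r x) = integral {h a..h b} F"
   using * unfolding strict_mono_image_Icc[OF sm ch ab] e by auto
  then have S: "set_integrable lborel {a..b} (\<lambda>x. F (h x) * r x)"
   using set_integrable_lborel_iff[OF m, of "{a..b}"] by simp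
  then show ?thesis
   using A(2) itg_eq_integral[OF F] unfolding itg_def[of a b] by (simp add: set_borel_integral_eq_integral(2))
 qed
 show li: "locint (\<lambda>x. F (h x) * r x)"
  unfolding locint_def
 proof (intro conjI allI m)
  fix a b
  show "set_integrable lborel {a..b} (\<lambda>x. F (h x) * r x)"
  proof (cases "a \<le> b")
   case False
   then show ?thesis by (simp add: set_integrable_def)
  qed (use main in blast)
 qed
 show "a \<le> b ==> itg (h a) (h b) F = itg a b (\<lambda>x. F (h x) * r x)" using main by blast
qed

lemma itg_subinterval_mono:
 assumes "locint f" "\<And>x. 0 \<le> f x" "a \<le> c" "c \<le> d" "d \<le> b"
 shows "itg c d f \<le> itg a b f"
 using itg_combine[OF assms(1), of a c b] itg_combine[OF assms(1), of c d b] itg_nonneg[of a c f] itg_nonneg[of d b f] assms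
 by auto

section \<open>Periodic functions\<close>

locale circle =
 fixes L :: real
 assumes L_pos: "L > 0"
begin

lemma periodic_int: assumes "periodic L f" shows "f (z + of_int k * L) = f z"
proof -
 have n: "f (x + of_nat n * L) = f x" for n :: nat and x
 proof (induction n)
  case (Suc n)
  have "x + of_nat (Suc n) * L = (x + of_nat n * L) + L" by (simp add: algebra_simps)
  then show ?case using assms Suc unfolding periodic_def by metis
 qed simp
 show ?thesis
 proof (cases k)
  case (nonneg n) then show ?thesis using n by simp
 next
  case (neg n)
  have "of_int k = - (of_nat (Suc n) :: real)" using neg by simp
  then have "(z + of_int k * L) + of_nat (Suc n) * L = z" by (simp only: minus_mult_left[symmetric] diff_add_cancel add_uminus_conv_diff)
  then have "f z = f ((z + of_int k * L) + of_nat (Suc n) * L)" by (simp only:)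
  then show ?thesis using n by metis
 qed
qed

definition wrap :: "real => real" where "wrap z = z - of_int \<lfloor>z / L\<rfloor> * L"

lemma wrap_bounds: "0 \<le> wrap z" "wrap z < L"
proof -
 have "of_int \<lfloor>z / L\<rfloor> \<le> z / L" "z / L < of_int \<lfloor>z / L\<rfloor> + 1" by linarith+
 then have "of_int \<lfloor>z / L\<rfloor> * L \<le> z / L * L" "z / L * L < (of_int \<lfloor>z / L\<rfloor> + 1) * L"
  using L_pos by (intro mult_right_mono mult_strict_right_mono; simp)+
 then show "0 \<le> wrap z" "wrap z < L" using L_pos by (auto simp: wrap_def algebra_simps)
qed

lemma periodic_wrap: "periodic L f ==> f (wrap z) = f z"
 using periodic_int[of f z "- \<lfloor>z / L\<rfloor>"] by (simp add: wrap_def)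

lemma wrap_id: "0 \<le> z ==> z < L ==> wrap z = z"
proof -
 assume "0 \<le> z" "z < L"
 then have "\<lfloor>z / L\<rfloor> = 0" by (intro floor_unique) auto
 then show ?thesis by (simp add: wrap_def)
qed

lemma wrap_periodic: "wrap (z + L) = wrap z"
proof -
 have "(z + L) / L = z / L + 1" using L_pos by (simp add: field_simps)
 then show ?thesis by (simp add: wrap_def algebra_simps)
qed

lemma wrap_measurable: "wrap \<in> borel_measurable borel"
 unfolding wrap_def[abs_def] by measurable

lemma locint_periodic:
 assumes m: "f \<in> borel_measurable borel" and p: "periodic L f" and i: "set_integrable lborel {0..L} f"
 shows "locint f"
 unfolding locint_def
proof (intro conjI allI m)
 fix a b
 have one: "set_integrable lborel {of_int k * L..of_int k * L + L} f" for k :: int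
 proof -
  have "set_integrable lborel {0 + of_int k * L..L + of_int k * L} f"
   unfolding set_integrable_shift using i periodic_int[OF p] by simp
  then show ?thesis by (simp add: add.commute)
 qed
 have "set_integrable lborel (\<Union>k\<in>{\<lfloor>a / L\<rfloor>..\<lfloor>b / L\<rfloor>}. {of_int k * L..of_int k * L + L}) f"
  by (rule set_integrable_UN) (use one in auto)
 then show "set_integrable lborel {a..b} f"
 proof (rule set_integrable_subset)
  show "{a..b} \<subseteq> (\<Union>k\<in>{\<lfloor>a / L\<rfloor>..\<lfloor>b / L\<rfloor>}. {of_int k * L..of_int k * L + L})"
  proof
   fix x assume x: "x \<in> {a..b}"
   have "\<lfloor>a / L\<rfloor> \<le> \<lfloor>x / L\<rfloor>" "\<lfloor>x / L\<rfloor> \<le> \<lfloor>b / L\<rfloor>" using x L_pos by (auto intro!: floor_mono divide_right_mono)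
   moreover have "of_int \<lfloor>x / L\<rfloor> * L \<le> x" "x \<le> of_int \<lfloor>x / L\<rfloor> * L + L"
    using wrap_bounds[of x] by (auto simp: wrap_def)
   ultimately show "x \<in> (\<Union>k\<in>{\<lfloor>a / L\<rfloor>..\<lfloor>b / L\<rfloor>}. {of_int k * L..of_int k * L + L})"
    by (intro UN_I[of "\<lfloor>x / L\<rfloor>"]) auto
  qed
 qed auto
qed

lemma itg_period:
 assumes "locint f" "periodic L f" shows "itg a (a + L) f = itg 0 L f"
proof -
 define b where "b = wrap a"
 have ab: "a = b + of_int \<lfloor>a / L\<rfloor> * L" by (simp add: b_def wrap_def)
 have "itg a (a + L) f = itg (b + of_int \<lfloor>a / L\<rfloor> * L) ((b + L) + of_int \<lfloor>a / L\<rfloor> * L) f"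
  using ab by (simp add: add_ac)
 also have "\<dots> = itg b (b + L) f"
  unfolding itg_shift using periodic_int[OF assms(2)] by simp
 also have "\<dots> = itg b L f + itg L (b + L) f"
  using wrap_bounds[of a] by (intro itg_combine[symmetric] assms) (auto simp: b_def)
 also have "itg L (b + L) f = itg 0 b f"
  using itg_shift[of 0 L b f] assms(2) by (simp add: periodic_def)
 also have "itg b L f + itg 0 b f = itg 0 L f"
  using wrap_bounds[of a] itg_combine[OF assms(1), of 0 b L] by (auto simp: b_def)
 finally show ?thesis .
qed

abbreviation "\<L>2 \<equiv> L2_circle L"

lemma L2_measurable: "f \<in> \<L>2 ==> f \<in> borel_measurable borel"
 by (simp add: L2_circle_def)

lemma L2_periodic: "f \<in> \<L>2 ==> periodic L f"
 by (simp add: L2_circle_def)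

definition toL2 :: "(real => real) => l2" where
 "toL2 f = abs_l2 (\<lambda>x. f x * indicator {0..L} x)"

lemma L2_sqint: "f \<in> \<L>2 ==> (\<lambda>x. f x * indicator {0..L} x) \<in> sqint"
 by (rule sqint_indicator) (auto simp: L2_circle_def)

lemma periodic_mult: "periodic L f ==> periodic L g ==> periodic L (\<lambda>z. f z * g z)"
 by (simp add: periodic_def)

lemma L2_mult_locint:
 assumes f: "f \<in> \<L>2" and g: "g \<in> \<L>2" shows "locint (\<lambda>z. f z * g z)"
proof (rule locint_periodic)
 have "(\<lambda>x. indicator {0..L} x *\<^sub>R (f x * g x)) = (\<lambda>x. (f x * indicator {0..L} x) * (g x * indicator {0..L} x))"
  by (auto simp: indicator_def)
 then show "set_integrable lborel {0..L} (\<lambda>z. f z * g z)"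
  using sqint_mult[OF L2_sqint[OF f] L2_sqint[OF g]] by (simp add: set_integrable_def)
qed (use assms L2_measurable L2_periodic periodic_mult in auto)

lemma L2_intro_cont: assumes "continuous_on UNIV f" "periodic L f" shows "f \<in> \<L>2"
proof -
 have "locint (\<lambda>z. (f z)\<^sup>2)" by (intro locint_continuous continuous_intros assms)
 then show ?thesis
  using assms borel_measurable_continuous_onI by (auto simp: L2_circle_def locint_def)
qed

lemma L2_const: "(\<lambda>z. c) \<in> \<L>2"
 by (intro L2_intro_cont) (auto simp: periodic_def)

lemma L2_locint: "f \<in> \<L>2 ==> locint f"
 using L2_mult_locint[OF L2_const[of 1]] by simp

lemma L2_add: assumes "f \<in> \<L>2" "g \<in> \<L>2" shows "(\<lambda>z. f z + g z) \<in> \<L>2"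
proof -
 have "locint (\<lambda>z. (f z * f z + g z * g z) + 2 * (f z * g z))"
  by (intro locint_add locint_cmult L2_mult_locint assms)
 moreover have "(\<lambda>z. (f z * f z + g z * g z) + 2 * (f z * g z)) = (\<lambda>z. (f z + g z)\<^sup>2)"
  by (rule ext) (simp add: power2_eq_square algebra_simps)
 ultimately show ?thesis using assms by (auto simp: L2_circle_def periodic_def locint_def)
qed

lemma L2_cmult: "f \<in> \<L>2 ==> (\<lambda>z. c * f z) \<in> \<L>2"
 by (auto simp: L2_circle_def periodic_def power_mult_distrib)

lemma L2_minus: "f \<in> \<L>2 ==> (\<lambda>z. - f z) \<in> \<L>2"
 using L2_cmult[of f "-1"] by simp

lemma L2_diff: "f \<in> \<L>2 ==> g \<in> \<L>2 ==> (\<lambda>z. f z - g z) \<in> \<L>2"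
 using L2_add[of f "\<lambda>z. -1 * g z"] L2_cmult[of g "-1"] by simp

lemma L2_bounded_mult:
 assumes f: "f \<in> borel_measurable borel" "periodic L f" "\<And>z. \<bar>f z\<bar> \<le> B" and g: "g \<in> \<L>2"
 shows "(\<lambda>z. f z * g z) \<in> \<L>2"
proof -
 have "set_integrable lborel {0..L} (\<lambda>z. (f z * g z)\<^sup>2)"
  unfolding set_integrable_def
 proof (rule Bochner_Integration.integrable_bound)
  have "set_integrable lborel {0..L} (\<lambda>x. B\<^sup>2 * (g x)\<^sup>2)"
   using g by (auto simp: L2_circle_def)
  then show "integrable lborel (\<lambda>x. indicator {0..L} x *\<^sub>R (B\<^sup>2 * (g x)\<^sup>2))"
   unfolding set_integrable_def .
  have "(f x)\<^sup>2 * (g x)\<^sup>2 \<le> B\<^sup>2 * (g x)\<^sup>2" for x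
   using power_mono[OF f(3)[of x] abs_ge_zero, of 2] by (intro mult_right_mono) simp_all
  then show "AE x in lborel. norm (indicator {0..L} x *\<^sub>R (f x * g x)\<^sup>2) \<le> norm (indicator {0..L} x *\<^sub>R (B\<^sup>2 * (g x)\<^sup>2))"
   by (intro AE_I2) (simp add: power_mult_distrib indicator_def)
  show "(\<lambda>x. indicator {0..L} x *\<^sub>R (f x * g x)\<^sup>2) \<in> borel_measurable lborel"
   using f(1) L2_measurable[OF g] by measurable
 qed
 moreover have "(\<lambda>z. f z * g z) \<in> borel_measurable borel" using f(1) L2_measurable[OF g] by measurable
 ultimately show ?thesis using periodic_mult[OF f(2) L2_periodic[OF g]] by (simp add: L2_circle_def)
qed

lemma L2_cont_mult:
 assumes f: "continuous_on UNIV f" "periodic L f" and g: "g \<in> \<L>2"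
 shows "(\<lambda>z. f z * g z) \<in> \<L>2"
proof -
 have "compact (f ` {0..L})" using f by (intro compact_continuous_image) (auto intro: continuous_on_subset)
 then obtain B where "\<forall>y\<in>f ` {0..L}. norm y \<le> B"
  using compact_imp_bounded bounded_iff by blast
 then have B: "\<And>x. x \<in> {0..L} ==> \<bar>f x\<bar> \<le> B" by simp
 have "\<bar>f z\<bar> \<le> B" for z
  using B[of "wrap z"] wrap_bounds[of z] periodic_wrap[OF f(2), of z] by auto
 then show ?thesis by (intro L2_bounded_mult[OF borel_measurable_continuous_onI[OF f(1)] f(2) _ g])
qed

lemma inner_toL2:
 assumes "f \<in> \<L>2" "g \<in> \<L>2" shows "inner (toL2 f) (toL2 g) = itg 0 L (\<lambda>z. f z * g z)"
 unfolding toL2_def inner_abs_l2[OF L2_sqint[OF assms(1)] L2_sqint[OF assms(2)]] itg_def set_lebesgue_integral_def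
 by (rule Bochner_Integration.integral_cong) (auto simp: indicator_def)

lemma toL2_add: "f \<in> \<L>2 ==> g \<in> \<L>2 ==> toL2 (\<lambda>z. f z + g z) = toL2 f + toL2 g"
 unfolding toL2_def by (subst add_abs_l2) (simp_all add: L2_sqint distrib_right)

lemma toL2_cmult: "f \<in> \<L>2 ==> toL2 (\<lambda>z. c * f z) = c *\<^sub>R toL2 f"
 unfolding toL2_def by (subst scaleR_abs_l2) (simp_all add: L2_sqint mult.assoc)

lemma toL2_minus: "f \<in> \<L>2 ==> toL2 (\<lambda>z. - f z) = - toL2 f"
 using toL2_cmult[of f "-1"] by simp

lemma toL2_diff: "f \<in> \<L>2 ==> g \<in> \<L>2 ==> toL2 (\<lambda>z. f z - g z) = toL2 f - toL2 g"
 using toL2_add[of f "\<lambda>z. - g z"] toL2_minus[of g] L2_minus[of g] by simp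

abbreviation nrm :: "(real => real) => real" where "nrm f \<equiv> norm (toL2 f)"

lemma norm_toL2: "f \<in> \<L>2 ==> nrm f = sqrt (itg 0 L (\<lambda>z. (f z)\<^sup>2))"
 using inner_toL2[of f f] by (simp add: norm_eq_sqrt_inner power2_eq_square)

lemma norm_toL2_sq: "f \<in> \<L>2 ==> (nrm f)\<^sup>2 = itg 0 L (\<lambda>z. (f z)\<^sup>2)"
 using norm_toL2[of f] itg_nonneg[of 0 L "\<lambda>z. (f z)\<^sup>2"] by simp

text \<open>The translates of a null set by the multiples of \<open>L\<close> are null, and there
  are countably many of them.\<close>

lemma AE_periodic:
 assumes P: "AE x in lborel. 0 \<le> x \<and> x \<le> L \<longrightarrow> h x = (0::real)" and p: "periodic L h" and m: "h \<in> borel_measurable borel"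
 shows "AE x in lborel. h x = 0"
proof -
 have "AE x in lborel. \<forall>k::int. 0 \<le> x - of_int k * L \<and> x - of_int k * L \<le> L \<longrightarrow> h (x - of_int k * L) = 0"
 proof (subst AE_all_countable, rule allI)
  fix k :: int
  have "AE x in lborel. (0 \<le> (- (of_int k * L)) + 1 * x \<and> (- (of_int k * L)) + 1 * x \<le> L \<longrightarrow> h ((- (of_int k * L)) + 1 * x) = 0)"
   by (rule AE_borel_affine[OF _ _ P]) (use m in auto)
  then show "AE x in lborel. 0 \<le> x - of_int k * L \<and> x - of_int k * L \<le> L \<longrightarrow> h (x - of_int k * L) = 0"
   by (simp add: add.commute)
 qed
 then show ?thesis
 proof eventually_elim
  case (elim x)
  have "h (wrap x) = 0" using elim[rule_format, of "\<lfloor>x / L\<rfloor>"] wrap_bounds[of x] by (simp add: wrap_def)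
  then show ?case by (simp add: periodic_wrap[OF p])
 qed
qed

lemma toL2_eq_iff:
 assumes f: "f \<in> \<L>2" and g: "g \<in> \<L>2" shows "toL2 f = toL2 g \<longleftrightarrow> (AE x in lborel. f x = g x)"
proof
 assume "toL2 f = toL2 g"
 then have "AE x in lborel. f x * indicator {0..L} x = g x * indicator {0..L} x"
  unfolding toL2_def by (subst (asm) abs_l2_eq_iff) (use f g L2_sqint in auto)
 then have "AE x in lborel. 0 \<le> x \<and> x \<le> L \<longrightarrow> f x - g x = 0"
  by eventually_elim (auto simp: indicator_def split: if_splits)
 then have "AE x in lborel. f x - g x = 0"
  by (rule AE_periodic) (use L2_diff[OF f g] L2_periodic L2_measurable in auto)
 then show "AE x in lborel. f x = g x" by simp
next
 assume "AE x in lborel. f x = g x"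
 then show "toL2 f = toL2 g"
  unfolding toL2_def by (subst abs_l2_eq_iff) (use f g L2_sqint in \<open>auto elim: eventually_mono\<close>)
qed

lemma toL2_cong_AE: "f \<in> \<L>2 ==> g \<in> \<L>2 ==> AE x in lborel. f x = g x ==> toL2 f = toL2 g"
 by (simp add: toL2_eq_iff)

lemma norm_toL2_mult_le:
 assumes f: "f \<in> borel_measurable borel" "periodic L f" "\<And>z. \<bar>f z\<bar> \<le> B" and g: "g \<in> \<L>2"
 shows "nrm (\<lambda>z. f z * g z) \<le> B * nrm g"
proof -
 have B: "B \<ge> 0" using f(3)[of 0] by linarith
 have fg: "(\<lambda>z. f z * g z) \<in> \<L>2" by (rule L2_bounded_mult[OF f g])
 have "(nrm (\<lambda>z. f z * g z))\<^sup>2 \<le> (B * nrm g)\<^sup>2"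
  unfolding power_mult_distrib norm_toL2_sq[OF fg] norm_toL2_sq[OF g] itg_cmult[symmetric]
 proof (rule itg_mono)
  show "locint (\<lambda>x. (f x)\<^sup>2 * (g x)\<^sup>2)" using L2_mult_locint[OF fg fg] by (simp add: power2_eq_square mult_ac)
  show "locint (\<lambda>x. B\<^sup>2 * (g x)\<^sup>2)" using locint_cmult[OF L2_mult_locint[OF g g]] by (simp add: power2_eq_square)
  show "(f x)\<^sup>2 * (g x)\<^sup>2 \<le> B\<^sup>2 * (g x)\<^sup>2" for x
   using power_mono[OF f(3) abs_ge_zero, of x 2] by (intro mult_right_mono) auto
 qed
 then show ?thesis by (rule power2_le_imp_le) (use B in simp)
qed

lemma norm_toL2_le_sup:
 assumes f: "f \<in> \<L>2" "\<And>z. \<bar>f z\<bar> \<le> B" shows "nrm f \<le> B * sqrt L"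
proof -
 have "nrm (\<lambda>z. f z * 1) \<le> B * nrm (\<lambda>z. 1)"
  by (rule norm_toL2_mult_le) (use f L2_measurable L2_periodic L2_const in auto)
 then show ?thesis using norm_toL2[OF L2_const[of 1]] L_pos by (simp add: itg_const)
qed

lemma itg_toL2_bound:
 assumes "f \<in> \<L>2" "g \<in> \<L>2" shows "\<bar>itg 0 L (\<lambda>z. f z * g z)\<bar> \<le> nrm f * nrm g"
 using Cauchy_Schwarz_ineq2[of "toL2 f" "toL2 g"] inner_toL2[OF assms] by simp

lemma toL2_zero: "toL2 (\<lambda>z. 0) = 0"
 by (simp add: toL2_def zero_abs_l2)

text \<open>Since \<open>wrap\<close> takes values in the half-open period, the value at
  \<open>L\<close> is discarded. Almost everywhere this is harmless, and it makes the extension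
  periodic at every point.\<close>

definition ofL2 :: "l2 => real => real" where "ofL2 x z = rep_l2 x (wrap z)"

lemma ofL2_L2: "ofL2 x \<in> \<L>2"
proof -
 have r: "rep_l2 x \<in> sqint" by (rule rep_l2_sqint)
 have m: "ofL2 x \<in> borel_measurable borel"
  unfolding ofL2_def[abs_def] using sqint_measurable[OF r] wrap_measurable by measurable
 have "integrable lborel (\<lambda>z. indicator {0..<L} z *\<^sub>R (rep_l2 x z)\<^sup>2)"
  by (rule integrable_mult_indicator) (use r in \<open>auto simp: sqint_def\<close>)
 then have "integrable lborel (\<lambda>z. indicator {0..L} z *\<^sub>R (ofL2 x z)\<^sup>2)"
 proof (rule integrable_cong_AE[THEN iffD1, rotated 3])
  show "AE z in lborel. indicator {0..<L} z *\<^sub>R (rep_l2 x z)\<^sup>2 = indicator {0..L} z *\<^sub>R (ofL2 x z)\<^sup>2"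
   using AE_lborel_singleton[of L] by eventually_elim (auto simp: indicator_def ofL2_def wrap_id)
 qed (use m sqint_measurable[OF r] in measurable)
 then show ?thesis using m wrap_periodic by (auto simp: L2_circle_def periodic_def ofL2_def set_integrable_def)
qed

lemma ofL2_toL2: assumes "f \<in> \<L>2" shows "AE z in lborel. ofL2 (toL2 f) z = f z"
proof -
 have "AE z in lborel. rep_l2 (toL2 f) z = f z * indicator {0..L} z"
  unfolding toL2_def by (rule rep_abs_l2[OF L2_sqint[OF assms]])
 with AE_lborel_singleton[of L] have "AE z in lborel. 0 \<le> z \<and> z \<le> L \<longrightarrow> ofL2 (toL2 f) z - f z = 0"
  by eventually_elim (auto simp: ofL2_def wrap_id)
 then have "AE z in lborel. ofL2 (toL2 f) z - f z = 0"
  by (rule AE_periodic) (use L2_diff[OF ofL2_L2 assms] L2_periodic L2_measurable in auto)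
 then show ?thesis by simp
qed

lemma toL2_ofL2_toL2: "f \<in> \<L>2 ==> toL2 (ofL2 (toL2 f)) = toL2 f"
 using ofL2_toL2 ofL2_L2 toL2_eq_iff by blast

lemma ofL2_add: "AE z in lborel. ofL2 (x + y) z = ofL2 x z + ofL2 y z"
proof -
 have "AE z in lborel. rep_l2 (abs_l2 (\<lambda>z. rep_l2 x z + rep_l2 y z)) z = rep_l2 x z + rep_l2 y z"
  by (rule rep_abs_l2[OF sqint_add[OF rep_l2_sqint rep_l2_sqint]])
 moreover have "abs_l2 (\<lambda>z. rep_l2 x z + rep_l2 y z) = x + y"
  using add_abs_l2[OF rep_l2_sqint rep_l2_sqint, of x y] by simp
 ultimately have "AE z in lborel. rep_l2 (x + y) z = rep_l2 x z + rep_l2 y z" by simp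
 with AE_lborel_singleton[of L] have "AE z in lborel. 0 \<le> z \<and> z \<le> L \<longrightarrow> ofL2 (x + y) z - (ofL2 x z + ofL2 y z) = 0"
  by eventually_elim (auto simp: ofL2_def wrap_id)
 then have "AE z in lborel. ofL2 (x + y) z - (ofL2 x z + ofL2 y z) = 0"
  by (rule AE_periodic) (use L2_diff[OF ofL2_L2 L2_add[OF ofL2_L2 ofL2_L2]] L2_periodic L2_measurable in auto)
 then show ?thesis by simp
qed

lemma ofL2_scaleR: "AE z in lborel. ofL2 (c *\<^sub>R x) z = c * ofL2 x z"
proof -
 have "AE z in lborel. rep_l2 (abs_l2 (\<lambda>z. c * rep_l2 x z)) z = c * rep_l2 x z"
  by (rule rep_abs_l2[OF sqint_scale[OF rep_l2_sqint]])
 moreover have "abs_l2 (\<lambda>z. c * rep_l2 x z) = c *\<^sub>R x"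
  using scaleR_abs_l2[OF rep_l2_sqint, of c x] by simp
 ultimately have "AE z in lborel. rep_l2 (c *\<^sub>R x) z = c * rep_l2 x z" by simp
 with AE_lborel_singleton[of L] have "AE z in lborel. 0 \<le> z \<and> z \<le> L \<longrightarrow> ofL2 (c *\<^sub>R x) z - (c * ofL2 x z) = 0"
  by eventually_elim (auto simp: ofL2_def wrap_id)
 then have "AE z in lborel. ofL2 (c *\<^sub>R x) z - (c * ofL2 x z) = 0"
  by (rule AE_periodic) (use L2_diff[OF ofL2_L2 L2_cmult[OF ofL2_L2]] L2_periodic L2_measurable in auto)
 then show ?thesis by simp
qed

lemma linear_toL2_ofL2: "linear (\<lambda>x. toL2 (ofL2 x))"
proof (rule linearI)
 show "toL2 (ofL2 (x + y)) = toL2 (ofL2 x) + toL2 (ofL2 y)" for x y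
  using toL2_cong_AE[OF ofL2_L2 L2_add[OF ofL2_L2 ofL2_L2] ofL2_add, of x y] by (simp add: toL2_add ofL2_L2)
 show "toL2 (ofL2 (c *\<^sub>R x)) = c *\<^sub>R toL2 (ofL2 x)" for c x
  using toL2_cong_AE[OF ofL2_L2 L2_cmult[OF ofL2_L2] ofL2_scaleR, of c x] by (simp add: toL2_cmult ofL2_L2)
qed

lemma norm_toL2_ofL2: "nrm (ofL2 x) \<le> norm x"
proof -
 have r: "rep_l2 x \<in> sqint" by (rule rep_l2_sqint)
 have "(nrm (ofL2 x))\<^sup>2 = (LINT z|lborel. indicator {0..L} z *\<^sub>R (ofL2 x z)\<^sup>2)"
  by (simp add: norm_toL2_sq ofL2_L2 itg_def set_lebesgue_integral_def)
 also have "\<dots> \<le> (LINT z|lborel. (rep_l2 x z)\<^sup>2)"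
 proof (rule integral_mono_AE)
  show "AE z in lborel. indicator {0..L} z *\<^sub>R (ofL2 x z)\<^sup>2 \<le> (rep_l2 x z)\<^sup>2"
   using AE_lborel_singleton[of L] by eventually_elim (auto simp: indicator_def ofL2_def wrap_id)
 qed (use r ofL2_L2[of x] in \<open>auto simp: sqint_def L2_circle_def set_integrable_def\<close>)
 also have "\<dots> = (norm x)\<^sup>2" using norm_abs_l2[OF r] by simp
 finally show ?thesis by (rule power2_le_imp_le) simp
qed

lemma dist_toL2_ofL2: "norm (toL2 (ofL2 x) - toL2 (ofL2 y)) \<le> dist x y"
 using norm_toL2_ofL2[of "x - y"] linear_diff[OF linear_toL2_ofL2, of x y] by (simp add: dist_norm)

text \<open>\<open>dvt f g\<close>: the periodic function \<open>f\<close> is the continuous representative of an \<open>H\<^sup>1\<close> function, and \<open>g\<close>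
 represents its weak derivative.\<close>

definition dvt :: "(real => real) => (real => real) => bool" where
 "dvt f g \<longleftrightarrow> periodic L f \<and> g \<in> \<L>2 \<and> acd f g"

lemma dvtD: assumes "dvt f g" shows "periodic L f" "g \<in> \<L>2" "acd f g" "continuous_on UNIV f" "f \<in> \<L>2"
 using assms acd_continuous L2_intro_cont by (auto simp: dvt_def)

lemma dvt_add: "dvt f f' ==> dvt g g' ==> dvt (\<lambda>x. f x + g x) (\<lambda>x. f' x + g' x)"
 unfolding dvt_def using acd_add L2_add by (auto simp: periodic_def)

lemma dvt_cmult: "dvt f f' ==> dvt (\<lambda>x. c * f x) (\<lambda>x. c * f' x)"
 unfolding dvt_def using acd_cmult L2_cmult by (auto simp: periodic_def)

lemma dvt_diff: "dvt f f' ==> dvt g g' ==> dvt (\<lambda>x. f x - g x) (\<lambda>x. f' x - g' x)"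
 unfolding dvt_def using acd_diff L2_diff by (auto simp: periodic_def)

lemma dvt_const: "dvt (\<lambda>x. c) (\<lambda>x. 0)"
 unfolding dvt_def using acd_const L2_const by (auto simp: periodic_def)

lemma dvt_mult:
 assumes "dvt f f'" "dvt g g'" shows "dvt (\<lambda>x. f x * g x) (\<lambda>x. f' x * g x + f x * g' x)"
proof -
 have "(\<lambda>x. f' x * g x) \<in> \<L>2" using L2_cont_mult[of g f'] dvtD[OF assms(1)] dvtD[OF assms(2)] by (simp add: mult.commute)
 moreover have "(\<lambda>x. f x * g' x) \<in> \<L>2" using L2_cont_mult[of f g'] dvtD[OF assms(1)] dvtD[OF assms(2)] by simp
 ultimately have "(\<lambda>x. f' x * g x + f x * g' x) \<in> \<L>2" by (rule L2_add)
 then show ?thesis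
  using acd_mult[OF dvtD(3)[OF assms(1)] dvtD(3)[OF assms(2)]]
   periodic_mult[OF dvtD(1)[OF assms(1)] dvtD(1)[OF assms(2)]] by (simp add: dvt_def)
qed

lemma dvt_inverse:
 assumes f: "dvt f f'" and c: "c > 0" "\<And>x. c \<le> f x"
 shows "dvt (\<lambda>x. 1 / f x) (\<lambda>x. - (f' x * (1 / f x) * (1 / f x)))"
proof -
 have nz: "f x \<noteq> 0" for x using c(1) c(2)[of x] by auto
 have "(\<lambda>x. (- (1 / f x) * (1 / f x)) * f' x) \<in> \<L>2"
 proof (rule L2_cont_mult)
  show "continuous_on UNIV (\<lambda>x. - (1 / f x) * (1 / f x))"
   by (intro continuous_intros dvtD(4)[OF f]) (use nz in auto)
  show "periodic L (\<lambda>x. - (1 / f x) * (1 / f x))"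
   using dvtD(1)[OF f] unfolding periodic_def by simp
 qed (rule dvtD(2)[OF f])
 moreover have "(\<lambda>x. (- (1 / f x) * (1 / f x)) * f' x) = (\<lambda>x. - (f' x * (1 / f x) * (1 / f x)))" by auto
 moreover have "periodic L (\<lambda>x. 1 / f x)" using dvtD(1)[OF f] unfolding periodic_def by simp
 ultimately show ?thesis using acd_inverse[OF dvtD(3)[OF f] c] by (simp only: dvt_def)
qed

lemma dvt_unique: "dvt f g ==> dvt f h ==> AE x in lborel. g x = h x"
 using acd_unique by (auto simp: dvt_def)

lemma dvt_cong_AE: "dvt f g ==> h \<in> \<L>2 ==> AE x in lborel. g x = h x ==> dvt f h"
 unfolding dvt_def acd_def using itg_cong_AE[of g h] L2_measurable L2_locint by auto

lemma dvt_of_deriv: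
 assumes "\<And>x. (f has_real_derivative g x) (at x)" "continuous_on UNIV g" "periodic L f"
 shows "dvt f g"
proof -
 have "g (x + L) = g x" for x
 proof -
  have "((\<lambda>x. f (x + L)) has_real_derivative g (x + L)) (at x)"
   using assms(1)[of "x + L"] by (subst DERIV_shift[symmetric]) simp
  moreover have e: "(\<lambda>x. f (x + L)) = f" using assms(3) by (auto simp: periodic_def)
  ultimately show ?thesis using DERIV_unique[OF _ assms(1)[of x]] by simp
 qed
 then have "periodic L g" by (simp add: periodic_def)
 then show ?thesis using assms acd_of_deriv L2_intro_cont by (auto simp: dvt_def)
qed

lemma dvt_mean_zero: assumes "dvt f g" shows "itg 0 L g = 0"
proof -
 have "f L - f 0 = itg 0 L g" using acdD[OF dvtD(3)[OF assms], of 0 L] L_pos by simp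
 moreover have "f (0 + L) = f 0" using dvtD(1)[OF assms] unfolding periodic_def by blast
 ultimately show ?thesis by simp
qed

lemma itg_parts:
 assumes "dvt f f'" "dvt g g'" shows "itg 0 L (\<lambda>x. f' x * g x) = - itg 0 L (\<lambda>x. f x * g' x)"
proof -
 have l: "locint (\<lambda>x. f' x * g x)" "locint (\<lambda>x. f x * g' x)" using assms dvtD L2_mult_locint by auto
 show ?thesis using dvt_mean_zero[OF dvt_mult[OF assms]] itg_add[OF l, of 0 L] by simp
qed

text \<open>Cauchy-Schwarz on the interval between the points: the embedding of H^1 into the Hoelder
  functions of exponent 1/2. The distance is limited to \<open>L\<close> so that the interval lies
  within one period, where the norm of \<open>g\<close> is available.\<close>

lemma dvt_Hoelder:
 assumes f: "dvt f g" and zy: "\<bar>z - y\<bar> \<le> L"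
 shows "\<bar>f z - f y\<bar> \<le> nrm g * sqrt \<bar>z - y\<bar>"
proof -
 have *: "\<bar>f b - f a\<bar> \<le> nrm g * sqrt (b - a)" if ab: "a \<le> b" "b \<le> a + L" for a b
 proof -
  have g: "g \<in> \<L>2" using dvtD[OF f] by simp
  have gg: "locint (\<lambda>x. (g x)\<^sup>2)" using L2_mult_locint[OF g g] by (simp add: power2_eq_square)
  have "\<bar>f b - f a\<bar> = \<bar>itg a b (\<lambda>x. g x * 1)\<bar>" using acdD[OF dvtD(3)[OF f] ab(1)] by simp
  also have "\<dots> \<le> sqrt (itg a b (\<lambda>x. (g x)\<^sup>2)) * sqrt (itg a b (\<lambda>x. 1\<^sup>2))"
   by (rule itg_Cauchy_Schwarz) (use gg g L2_measurable locint_const[of 1] in \<open>auto simp: locint_def\<close>)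
  also have "itg a b (\<lambda>x. 1\<^sup>2) = b - a" using itg_const[OF ab(1), of 1] by simp
  also have "sqrt (itg a b (\<lambda>x. (g x)\<^sup>2)) \<le> sqrt (itg a (a + L) (\<lambda>x. (g x)\<^sup>2))"
   using itg_subinterval_mono[OF gg, of a a b "a + L"] ab by simp
  also have "itg a (a + L) (\<lambda>x. (g x)\<^sup>2) = itg 0 L (\<lambda>x. (g x)\<^sup>2)"
   using L2_periodic[OF g] by (intro itg_period gg) (simp add: periodic_def)
  finally show ?thesis using ab norm_toL2[OF g] by (simp add: mult_right_mono)
 qed
 show ?thesis
 proof (cases "y \<le> z")
  case True then show ?thesis using *[of y z] zy by simp
 next
  case False then show ?thesis using *[of z y] zy by (simp add: abs_minus_commute)
 qed
qed

lemma dvt_osc: assumes f: "dvt f g" shows "\<bar>f z - f y\<bar> \<le> nrm g * sqrt L"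
proof -
 have w: "\<bar>wrap z - wrap y\<bar> \<le> L" using wrap_bounds[of z] wrap_bounds[of y] by (simp add: abs_if)
 have "\<bar>f (wrap z) - f (wrap y)\<bar> \<le> nrm g * sqrt \<bar>wrap z - wrap y\<bar>"
  by (rule dvt_Hoelder[OF f w])
 also have "\<dots> \<le> nrm g * sqrt L" using w by (intro mult_left_mono) auto
 finally show ?thesis using periodic_wrap[OF dvtD(1)[OF f]] by simp
qed

lemma itg_abs_L2: "f \<in> \<L>2 ==> itg 0 L (\<lambda>x. \<bar>f x\<bar>) \<le> sqrt L * nrm f"
proof -
 assume f: "f \<in> \<L>2"
 have gg: "locint (\<lambda>x. (f x)\<^sup>2)" using L2_mult_locint[OF f f] by (simp add: power2_eq_square)
 have "itg 0 L (\<lambda>x. \<bar>f x\<bar>) \<le> \<bar>itg 0 L (\<lambda>x. \<bar>f x\<bar> * 1)\<bar>" by simp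
 also have "\<dots> \<le> sqrt (itg 0 L (\<lambda>x. \<bar>f x\<bar>\<^sup>2)) * sqrt (itg 0 L (\<lambda>x. 1\<^sup>2))"
  by (rule itg_Cauchy_Schwarz) (use gg f L2_measurable locint_const[of 1] in \<open>auto simp: locint_def\<close>)
 also have "\<dots> = sqrt L * nrm f" using norm_toL2[OF f] itg_const[of 0 L 1] L_pos by simp
 finally show ?thesis .
qed

text \<open>Averaging over \<open>y\<close> the bound of \<open>\<bar>f z\<bar>\<close> by
  \<open>\<bar>f y\<bar>\<close> plus the oscillation gives the factors \<open>1 / sqrt L\<close>
  and \<open>sqrt L\<close>. Their sum is used for both norms, which keeps later constants
  short.\<close>

lemma dvt_sup:
 assumes f: "dvt f g"
 shows "\<bar>f z\<bar> \<le> (sqrt L + 1 / sqrt L) * (nrm f + nrm g)"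
proof -
 have "\<bar>f z\<bar> * L = itg 0 L (\<lambda>y. \<bar>f z\<bar>)" using L_pos by (simp add: itg_const)
 also have "\<dots> \<le> itg 0 L (\<lambda>y. \<bar>f y\<bar> + nrm g * sqrt L)"
 proof (rule itg_mono)
  show "\<bar>f z\<bar> \<le> \<bar>f y\<bar> + nrm g * sqrt L" for y using dvt_osc[OF f, of z y] by linarith
 qed (intro locint_const locint_add locint_abs L2_locint dvtD(5)[OF f])+
 also have "\<dots> = itg 0 L (\<lambda>y. \<bar>f y\<bar>) + L * (nrm g * sqrt L)"
  using L_pos by (simp add: itg_add locint_const locint_abs L2_locint dvtD(5)[OF f] itg_const)
 also have "\<dots> \<le> sqrt L * nrm f + L * (nrm g * sqrt L)"
  using itg_abs_L2[OF dvtD(5)[OF f]] by simp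
 finally have "\<bar>f z\<bar> * L \<le> (nrm f / sqrt L + nrm g * sqrt L) * L"
 proof -
  assume a: "\<bar>f z\<bar> * L \<le> sqrt L * nrm f + L * (nrm g * sqrt L)"
  have "nrm f / sqrt L * L = sqrt L * nrm f"
   using L_pos real_sqrt_mult_self[of L] by (simp add: field_simps)
  then have "(nrm f / sqrt L + nrm g * sqrt L) * L = sqrt L * nrm f + L * (nrm g * sqrt L)"
   unfolding distrib_right by simp
  then show ?thesis using a by simp
 qed
 then have "\<bar>f z\<bar> \<le> nrm f / sqrt L + nrm g * sqrt L" using L_pos by simp
 also have "\<dots> = 1 / sqrt L * nrm f + sqrt L * nrm g" by simp
 also have "\<dots> \<le> (sqrt L + 1 / sqrt L) * nrm f + (sqrt L + 1 / sqrt L) * nrm g"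
  using L_pos by (intro add_mono mult_right_mono) auto
 also have "\<dots> = (sqrt L + 1 / sqrt L) * (nrm f + nrm g)"
  by (rule distrib_left[symmetric])
 finally show ?thesis .
qed

lemma dvt_mean_zero_sup:
 assumes f: "dvt f g" and z0: "itg 0 L f = 0"
 shows "\<bar>f z\<bar> \<le> sqrt L * nrm g"
proof -
 have "f z * L = itg 0 L (\<lambda>y. f z - f y)" using L_pos z0
  by (simp add: itg_diff locint_const L2_locint[OF dvtD(5)[OF f]] itg_const)
 also have "\<bar>\<dots>\<bar> \<le> (L - 0) * (nrm g * sqrt L)"
  by (rule itg_abs_bound) (use L_pos dvt_osc[OF f] in \<open>auto intro: locint_diff locint_const L2_locint[OF dvtD(5)[OF f]]\<close>)
 finally have "\<bar>f z\<bar> * L \<le> (sqrt L * nrm g) * L" using L_pos by (simp add: abs_mult mult_ac)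
 then show ?thesis using L_pos by simp
qed

lemma mean_itg: "mean L f = itg 0 L f / L"
 by (simp add: mean_def itg_def)

text \<open>Subtracting the mean of \<open>g\<close> makes the primitive periodic; subtracting the
  mean of the primitive makes the choice canonical. Thus \<open>prim\<close> is linear and inverts
  the weak derivative on functions of mean zero.\<close>

definition prim :: "(real => real) => real => real" where
 "prim g = (let h = (\<lambda>x. g x - mean L g); P = (\<lambda>x. if 0 \<le> x then itg 0 x h else - itg x 0 h) in (\<lambda>x. P x - mean L P))"

lemma prim: assumes g: "g \<in> \<L>2"
 shows "dvt (prim g) (\<lambda>x. g x - mean L g)" "itg 0 L (prim g) = 0"
proof -
 define h where "h = (\<lambda>x. g x - mean L g)"
 define P where "P = (\<lambda>x. if 0 \<le> x then itg 0 x h else - itg x 0 h)"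
 have h: "h \<in> \<L>2" unfolding h_def by (intro L2_diff g L2_const)
 have P: "acd P h" unfolding P_def by (rule acd_indefinite[OF L2_locint[OF h]])
 have h0: "itg 0 L h = 0" using L_pos by (simp add: h_def itg_diff L2_locint[OF g] locint_const itg_const mean_itg)
 have "periodic L P"
  unfolding periodic_def
 proof
  fix z
  have "P (z + L) - P z = itg z (z + L) h" using acdD[OF P] L_pos by simp
  then show "P (z + L) = P z" using itg_period[OF L2_locint[OF h] L2_periodic[OF h]] h0 by simp
 qed
 then have dP: "dvt P h" using P h by (simp add: dvt_def)
 have e: "prim g = (\<lambda>x. P x - mean L P)" unfolding prim_def Let_def P_def h_def by simp
 show "dvt (prim g) (\<lambda>x. g x - mean L g)"
  using dvt_diff[OF dP dvt_const[of "mean L P"]] by (simp add: e h_def)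
 show "itg 0 L (prim g) = 0"
  using L_pos unfolding e by (simp add: itg_diff L2_locint[OF dvtD(5)[OF dP]] locint_const itg_const mean_itg)
qed

lemma dvt_zero_const: assumes "dvt f (\<lambda>x. 0)" shows "f x = f y"
 using acdD[OF dvtD(3)[OF assms], of x y] acdD[OF dvtD(3)[OF assms], of y x] itg_cmult[of _ _ 0 "\<lambda>x. 0"]
 by (cases "x \<le> y") auto

lemma dvt_eq_plus_const:
 assumes f: "dvt f g" and h: "dvt h g" shows "f x = h x + (mean L f - mean L h)"
proof -
 have d: "dvt (\<lambda>x. f x - h x) (\<lambda>x. 0)" using dvt_diff[OF f h] by simp
 define c where "c = f 0 - h 0"
 have e: "f y = h y + c" for y using dvt_zero_const[OF d, of y 0] by (simp add: c_def)
 have "f = (\<lambda>y. h y + c)" using e by auto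
 then have "itg 0 L f = itg 0 L h + L * c"
  using L_pos by (simp add: itg_add L2_locint[OF dvtD(5)[OF h]] locint_const itg_const)
 then have "mean L f - mean L h = c" using L_pos by (simp add: mean_itg field_simps)
 then show ?thesis using e by simp
qed

lemma dvt_prim: assumes "dvt f g" shows "f x = mean L f + prim g x"
proof -
 have g: "g \<in> \<L>2" by (rule dvtD(2)[OF assms])
 have "mean L g = 0" using dvt_mean_zero[OF assms] by (simp add: mean_itg)
 then have "dvt (prim g) g" using prim(1)[OF g] by simp
 from dvt_eq_plus_const[OF assms this, of x] prim(2)[OF g] show ?thesis by (simp add: mean_itg)
qed

lemma prim_cong_AE:
 assumes "f \<in> \<L>2" "g \<in> \<L>2" "AE x in lborel. f x = g x" shows "prim f = prim g"
proof -
 have m: "mean L f = mean L g" unfolding mean_itg using itg_cong_AE[of f g 0 L] assms L2_measurable by simp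
 have "dvt (prim f) (\<lambda>x. g x - mean L g)"
  by (rule dvt_cong_AE[OF prim(1)[OF assms(1)]]) (use assms m in \<open>auto intro: L2_diff L2_const elim: eventually_mono\<close>)
 from dvt_eq_plus_const[OF this prim(1)[OF assms(2)]] prim(2)[OF assms(1)] prim(2)[OF assms(2)]
 show ?thesis by (auto simp: mean_itg)
qed

lemma prim_add: assumes "f \<in> \<L>2" "g \<in> \<L>2" shows "prim (\<lambda>x. f x + g x) = (\<lambda>x. prim f x + prim g x)"
proof -
 have m: "mean L (\<lambda>x. f x + g x) = mean L f + mean L g"
  unfolding mean_itg using assms by (simp add: itg_add L2_locint add_divide_distrib)
 have 1: "dvt (prim (\<lambda>x. f x + g x)) (\<lambda>x. (f x - mean L f) + (g x - mean L g))"
  using prim(1)[OF L2_add[OF assms]] unfolding m by (simp add: algebra_simps)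
 have 2: "itg 0 L (\<lambda>x. prim f x + prim g x) = 0"
  using prim[OF assms(1)] prim[OF assms(2)] by (simp add: itg_add L2_locint dvtD(5))
 from dvt_eq_plus_const[OF 1 dvt_add[OF prim(1)[OF assms(1)] prim(1)[OF assms(2)]]] prim(2)[OF L2_add[OF assms]] 2
 show ?thesis by (auto simp: mean_itg)
qed

lemma prim_cmult: assumes "f \<in> \<L>2" shows "prim (\<lambda>x. c * f x) = (\<lambda>x. c * prim f x)"
proof -
 have m: "mean L (\<lambda>x. c * f x) = c * mean L f"
  unfolding mean_itg by (simp add: itg_cmult)
 have 1: "dvt (prim (\<lambda>x. c * f x)) (\<lambda>x. c * (f x - mean L f))"
  using prim(1)[OF L2_cmult[OF assms], of c] unfolding m by (simp add: algebra_simps)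
 have 2: "itg 0 L (\<lambda>x. c * prim f x) = 0"
  using prim[OF assms(1)] by (simp add: itg_cmult)
 from dvt_eq_plus_const[OF 1 dvt_cmult[OF prim(1)[OF assms(1)]]] prim(2)[OF L2_cmult[OF assms]] 2
 show ?thesis by (auto simp: mean_itg)
qed

lemma prim_diff: assumes "f \<in> \<L>2" "g \<in> \<L>2" shows "prim (\<lambda>x. f x - g x) = (\<lambda>x. prim f x - prim g x)"
 using prim_add[OF assms(1) L2_cmult[OF assms(2), of "-1"]] prim_cmult[OF assms(2), of "-1"] by simp

lemma mean_sub_L2_norm: assumes "g \<in> \<L>2" shows "nrm (\<lambda>x. g x - mean L g) \<le> nrm g"
proof -
 define c where "c = mean L g"
 have c: "(\<lambda>x. g x - c) \<in> \<L>2" by (intro L2_diff assms L2_const)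
 have gi: "itg 0 L g = c * L" using L_pos by (simp add: c_def mean_itg)
 have l: "locint (\<lambda>x. (g x)\<^sup>2)" using L2_mult_locint[OF assms assms] by (simp add: power2_eq_square)
 have "itg 0 L (\<lambda>x. (g x - c)\<^sup>2) = itg 0 L (\<lambda>x. ((g x)\<^sup>2 - (2 * c) * g x) + c\<^sup>2)"
  by (rule itg_cong) (simp add: power2_diff)
 also have "\<dots> = itg 0 L (\<lambda>x. (g x)\<^sup>2) - 2 * c * (c * L) + L * c\<^sup>2"
  using L_pos by (simp add: itg_add itg_diff l locint_const locint_diff locint_cmult L2_locint[OF assms] itg_const itg_cmult gi)
 also have "\<dots> \<le> itg 0 L (\<lambda>x. (g x)\<^sup>2)" using L_pos by (simp add: power2_eq_square)
 finally show ?thesis unfolding c_def[symmetric] norm_toL2[OF assms] norm_toL2[OF c] by simp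
qed

lemma prim_sup: assumes "g \<in> \<L>2" shows "\<bar>prim g z\<bar> \<le> sqrt L * nrm g"
 using order_trans[OF dvt_mean_zero_sup[OF prim[OF assms]] mult_left_mono[OF mean_sub_L2_norm[OF assms]]] L_pos by simp

end

section \<open>Orthogonal series; elementary inequalities for the sine and the logarithm\<close>

lemma orthogonal_summable:
 fixes x :: "nat => 'a :: {real_inner, banach}"
 assumes o: "\<And>m n. m \<noteq> n ==> inner (x m) (x n) = 0" and s: "summable (\<lambda>n. (norm (x n))\<^sup>2)"
 shows "summable x"
 unfolding summable_Cauchy
proof (intro allI impI)
 fix e :: real assume "e > 0"
 then have "e\<^sup>2 > 0" by simp
 then obtain N where N: "\<And>m n. m \<ge> N ==> norm (\<Sum>k\<in>{m..<n}. (norm (x k))\<^sup>2) < e\<^sup>2"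
  using s unfolding summable_Cauchy by blast
 have "norm (sum x {m..<n}) < e" if "m \<ge> N" for m n
 proof -
  have "(norm (sum x {m..<n}))\<^sup>2 = (\<Sum>k\<in>{m..<n}. (norm (x k))\<^sup>2)"
   by (rule norm_sum_Pythagorean) (auto simp: pairwise_def orthogonal_def o)
  also have "\<dots> < e\<^sup>2" using N[OF that, of n] by simp
  finally show ?thesis using \<open>e > 0\<close> by (rule_tac power2_less_imp_less) auto
 qed
 then show "\<exists>N. \<forall>m\<ge>N. \<forall>n. norm (sum x {m..<n}) < e" by blast
qed

lemma abs_sin_nat_le: "\<bar>sin (real n * t)\<bar> \<le> real n * \<bar>sin t\<bar>"
proof (induction n)
 case (Suc n)
 have "\<bar>sin (real (Suc n) * t)\<bar> = \<bar>sin (real n * t) * cos t + cos (real n * t) * sin t\<bar>"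
 proof -
  have "real (Suc n) * t = real n * t + t" by (simp add: distrib_right)
  then show ?thesis by (simp only: sin_add)
 qed
 also have "\<dots> \<le> \<bar>sin (real n * t)\<bar> * \<bar>cos t\<bar> + \<bar>cos (real n * t)\<bar> * \<bar>sin t\<bar>"
  by (metis abs_mult abs_triangle_ineq)
 also have "\<dots> \<le> \<bar>sin (real n * t)\<bar> * 1 + 1 * \<bar>sin t\<bar>" by (intro add_mono mult_mono) auto
 finally show ?case using Suc by (simp add: distrib_right)
qed simp

lemma sin_ge_cos: assumes "0 \<le> x" "x \<le> pi" shows "x * cos x \<le> sin x"
proof -
 have "(\<lambda>x. sin x - x * cos x) 0 \<le> (\<lambda>x. sin x - x * cos x) x"
 proof (rule DERIV_nonneg_imp_nondecreasing[OF assms(1)])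
  fix t assume t: "0 \<le> t" "t \<le> x"
  have "((\<lambda>x. sin x - x * cos x) has_real_derivative t * sin t) (at t)"
   by (auto intro!: derivative_eq_intros)
  moreover have "0 \<le> t * sin t" using t assms by (intro mult_nonneg_nonneg sin_ge_zero) auto
  ultimately show "\<exists>y. ((\<lambda>x. sin x - x * cos x) has_real_derivative y) (at t) \<and> 0 \<le> y" by blast
 qed
 then show ?thesis by simp
qed

text \<open>By the half angle: \<open>(1 + cos x) / 2\<close> is \<open>(cos (x/2))\<^sup>2\<close>,
  and \<open>sin_ge_cos\<close> at \<open>x/2\<close> absorbs one of the cosines. The factor is
  positive up to pi, so it yields a linear lower bound on every interval short of pi.\<close>

lemma sin_ge_linear: assumes "0 \<le> x" "x \<le> pi" shows "x * ((1 + cos x) / 2) \<le> sin x"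
proof -
 have "x * ((1 + cos x) / 2) = 2 * ((x / 2) * cos (x / 2)) * cos (x / 2)"
  using cos_double_cos[of "x/2"] by (simp add: power2_eq_square)
 also have "\<dots> \<le> 2 * sin (x / 2) * cos (x / 2)"
  using sin_ge_cos[of "x/2"] assms by (intro mult_right_mono cos_ge_zero) auto
 also have "\<dots> = sin x" using sin_double[of "x/2"] by simp
 finally show ?thesis .
qed

lemma sin_ge_half: assumes "0 \<le> x" "x \<le> pi / 2" shows "x / 2 \<le> sin x"
proof -
 have "x * (1 / 2) \<le> x * ((1 + cos x) / 2)" using cos_ge_zero[of x] assms by (intro mult_left_mono) auto
 then show ?thesis using sin_ge_linear[of x] assms by simp
qed

text \<open>From \<open>ln r \<le> r\<close> with \<open>r = 1 / s powr (1/4)\<close>. The fourth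
  root is chosen so that the square of the logarithm is controlled by the weight
  \<open>1 / sqrt s\<close>.\<close>

lemma abs_ln_le: assumes "0 < s" "s \<le> 1" shows "(ln s)\<^sup>2 \<le> 16 / sqrt s"
proof -
 define r where "r = 1 / s powr (1/4)"
 have r: "r > 0" using assms by (simp add: r_def)
 have "ln r = - ln s / 4" using assms by (simp add: r_def ln_div ln_powr)
 then have l: "- ln s = 4 * ln r" by simp
 have "ln r \<le> r" using ln_le_minus_one[OF r] by simp
 moreover have "0 \<le> - ln s" using assms by simp
 ultimately have "(- ln s)\<^sup>2 \<le> (4 * r)\<^sup>2" using l by (intro power_mono) auto
 also have "(4 * r)\<^sup>2 = 16 / (s powr (1/4) * s powr (1/4))" by (simp add: r_def power_mult_distrib power_divide power2_eq_square)
 also have "s powr (1/4) * s powr (1/4) = sqrt s" using assms by (simp add: powr_add[symmetric] powr_half_sqrt)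
 finally show ?thesis by simp
qed

context circle
begin

section \<open>The logarithmic potential\<close>

definition mu :: real where "mu = pi / L"

lemma mu_pos: "mu > 0" using L_pos by (simp add: mu_def)

lemma mu_L: "mu * L = pi" using L_pos by (simp add: mu_def)

lemma sin_mu_shift: "sin (mu * (x + L)) = - sin (mu * x)"
 by (simp add: distrib_left mu_L)

lemma abs_sin_periodic: "periodic L (\<lambda>x. F \<bar>sin (mu * x)\<bar>)"
 by (simp add: periodic_def sin_mu_shift)

text \<open>Its derivative is \<open>cot (mu * x) / L\<close>, the kernel of the Hilbert transform,
  so convolution of the vorticity with \<open>lam\<close> is the velocity. At the multiples of
  \<open>L\<close> the convention \<open>ln 0 = 0\<close> gives the value 0.\<close>

definition lam :: "real => real" where "lam x = (1 / pi) * ln \<bar>sin (mu * x)\<bar>"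

lemma lam_periodic: "periodic L lam"
 unfolding lam_def[abs_def] by (rule abs_sin_periodic)

lemma lam_even: "lam (- x) = lam x"
 by (simp add: lam_def)

lemma lam_measurable: "lam \<in> borel_measurable borel"
 unfolding lam_def[abs_def] by measurable

text \<open>The model singularity of all kernel estimates. Its exponent is the order 1 of the
  cotangent pole, lowered by the Hoelder exponent 1/2 of H^1 functions. Division by zero makes it 0
  at the multiples of \<open>L\<close>, where the dominated kernels vanish as well.\<close>

definition wgt :: "real => real" where "wgt x = 1 / sqrt \<bar>sin (mu * x)\<bar>"

lemma wgt_nonneg: "0 \<le> wgt x" by (simp add: wgt_def)

lemma wgt_periodic: "periodic L wgt"
 unfolding wgt_def[abs_def] by (rule abs_sin_periodic)

lemma wgt_measurable: "wgt \<in> borel_measurable borel"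
 unfolding wgt_def[abs_def] by measurable

lemma sin_mu_ge: assumes "0 \<le> x" "x \<le> L / 2" shows "mu * x / 2 \<le> sin (mu * x)"
proof (rule sin_ge_half)
 show "0 \<le> mu * x" using mu_pos assms by simp
 have "mu * x \<le> mu * (L / 2)" using mu_pos assms by (intro mult_left_mono) auto
 then show "mu * x \<le> pi / 2" using mu_L by simp
qed

lemma sin_mu_reflect: "sin (mu * (L - x)) = sin (mu * x)"
 by (simp add: right_diff_distrib mu_L sin_diff)

lemma abs_sin_mu_ge: assumes "\<bar>x\<bar> \<le> L / 2" shows "mu * \<bar>x\<bar> / 2 \<le> \<bar>sin (mu * x)\<bar>"
proof -
 have "mu * \<bar>x\<bar> / 2 \<le> \<bar>sin (mu * \<bar>x\<bar>)\<bar>" using sin_mu_ge[of "\<bar>x\<bar>"] assms by simp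
 then show ?thesis by (cases "x \<ge> 0") auto
qed

lemma inverse_sqrt_integrable: assumes "c > 0" shows "set_integrable lborel {0..c} (\<lambda>x. 1 / sqrt x)"
proof -
 have "((\<lambda>x. x powr (-1/2)) has_integral c powr (-1/2 + 1) / (-1/2 + 1)) {0..c}"
  by (rule has_integral_powr_from_0) (use assms in auto)
 then have "(\<lambda>x. x powr (-1/2)) absolutely_integrable_on {0..c}"
  by (subst absolutely_integrable_on_iff_nonneg) auto
 then have "set_integrable lborel {0..c} (\<lambda>x. x powr (-1/2))"
  by (subst (asm) set_integrable_lborel_iff) auto
 moreover have "indicator {0..c} x *\<^sub>R (x powr (-1/2)) = indicator {0..c} x *\<^sub>R (1 / sqrt x)" for x
  by (cases "x = 0") (auto simp: indicator_def powr_minus_divide powr_half_sqrt)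
 ultimately show ?thesis by (simp add: set_integrable_def)
qed

lemma wgt_locint: "locint wgt"
proof (rule locint_periodic[OF wgt_measurable wgt_periodic])
 define f where "f x = sqrt (2 / mu) * (1 / sqrt x)" for x
 have fi: "set_integrable lborel {0..L/2} f"
  unfolding f_def[abs_def] by (intro set_integrable_mult_right inverse_sqrt_integrable) (use L_pos in simp)
 have 1: "set_integrable lborel {0..L/2} wgt"
  unfolding set_integrable_def
 proof (rule Bochner_Integration.integrable_bound[OF fi[unfolded set_integrable_def]])
  have "wgt x \<le> f x" if "0 \<le> x" "x \<le> L / 2" for x
  proof (cases "x = 0")
   case False
   then have x: "x > 0" using that by simp
   have "0 < mu * x / 2" using x mu_pos by simp
   then have "0 < sin (mu * x)" using sin_mu_ge[OF that] by linarith
   then have "1 / sqrt \<bar>sin (mu * x)\<bar> \<le> 1 / sqrt (mu * x / 2)"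
    using sin_mu_ge[OF that] x mu_pos by (intro divide_left_mono real_sqrt_le_mono mult_pos_pos) auto
   also have "\<dots> = f x" using x mu_pos by (simp add: f_def real_sqrt_divide real_sqrt_mult)
   finally show ?thesis by (simp add: wgt_def)
  qed (simp add: wgt_def f_def)
  then show "AE x in lborel. norm (indicator {0..L/2} x *\<^sub>R wgt x) \<le> norm (indicator {0..L/2} x *\<^sub>R f x)"
   using wgt_nonneg by (intro AE_I2) (fastforce simp: indicator_def intro: order_trans)
 qed (use wgt_measurable in measurable)
 have "integrable lborel (\<lambda>x. indicator {0..L/2} (L + (-1) * x) *\<^sub>R wgt (L + (-1) * x))"
  using 1 unfolding set_integrable_def by (subst lborel_integrable_real_affine_iff) auto
 moreover have "indicator {0..L/2} (L + (-1) * x) *\<^sub>R wgt (L + (-1) * x) = indicator {L/2..L} x *\<^sub>R wgt x" for x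
  by (auto simp: indicator_def wgt_def sin_mu_reflect)
 ultimately have 2: "set_integrable lborel {L/2..L} wgt" by (simp add: set_integrable_def)
 have "set_integrable lborel ({0..L/2} \<union> {L/2..L}) wgt"
  by (rule set_integrable_Un[OF 1 2]) auto
 moreover have "{0..L/2} \<union> {L/2..L} = {0..L}" using L_pos by auto
 ultimately show "set_integrable lborel {0..L} wgt" by simp
qed

lemma lam_sq_le: "(lam x)\<^sup>2 \<le> (16 / pi\<^sup>2) * wgt x"
proof (cases "sin (mu * x) = 0")
 case False
 then have "(ln \<bar>sin (mu * x)\<bar>)\<^sup>2 \<le> 16 / sqrt \<bar>sin (mu * x)\<bar>" by (intro abs_ln_le) auto
 then have "(ln \<bar>sin (mu * x)\<bar>)\<^sup>2 / pi\<^sup>2 \<le> 16 / sqrt \<bar>sin (mu * x)\<bar> / pi\<^sup>2" by (rule divide_right_mono) simp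
 moreover have "(lam x)\<^sup>2 = (ln \<bar>sin (mu * x)\<bar>)\<^sup>2 / pi\<^sup>2" by (simp add: lam_def power_mult_distrib power_divide)
 ultimately show ?thesis by (simp add: wgt_def mult.commute)
qed (simp add: lam_def wgt_def)

lemma lam_L2: "lam \<in> \<L>2"
proof -
 have "set_integrable lborel {0..L} (\<lambda>x. (lam x)\<^sup>2)"
  unfolding set_integrable_def
 proof (rule Bochner_Integration.integrable_bound)
  have "set_integrable lborel {0..L} (\<lambda>x. (16 / pi\<^sup>2) * wgt x)" by (rule locint_set_integrable[OF locint_cmult[OF wgt_locint]])
  then show "integrable lborel (\<lambda>x. indicator {0..L} x *\<^sub>R ((16 / pi\<^sup>2) * wgt x))" unfolding set_integrable_def .
  have "norm ((lam x)\<^sup>2) \<le> norm ((16 / pi\<^sup>2) * wgt x)" for x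
   using lam_sq_le[of x] wgt_nonneg[of x] by simp
  then show "AE x in lborel. norm (indicator {0..L} x *\<^sub>R (lam x)\<^sup>2) \<le> norm (indicator {0..L} x *\<^sub>R ((16 / pi\<^sup>2) * wgt x))"
   by (intro AE_I2) (simp add: indicator_def)
 qed (use lam_measurable in measurable)
 then show ?thesis using lam_periodic lam_measurable by (simp add: L2_circle_def)
qed

lemma L2_reflect: assumes "f \<in> \<L>2" shows "(\<lambda>y. f (z - y)) \<in> \<L>2" "nrm (\<lambda>y. f (z - y)) = nrm f"
proof -
 have m: "f \<in> borel_measurable borel" by (rule L2_measurable[OF assms])
 have l: "locint (\<lambda>x. (f x)\<^sup>2)" using L2_mult_locint[OF assms assms] by (simp add: power2_eq_square)
 have i0: "indicator {z-L..z} (z + (-1) * x) = (indicator {0..L} x :: real)" for x by (auto simp: indicator_def)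
 have "integrable lborel (\<lambda>x. indicator {z-L..z} (z + (-1) * x) *\<^sub>R (f (z + (-1) * x))\<^sup>2)"
  using locint_set_integrable[OF l, of "z-L" z] unfolding set_integrable_def by (subst lborel_integrable_real_affine_iff) auto
 then have "set_integrable lborel {0..L} (\<lambda>y. (f (z - y))\<^sup>2)" unfolding i0 by (simp add: set_integrable_def)
 moreover have "f (z - (y + L)) = f (z - y)" for y
  using L2_periodic[OF assms] unfolding periodic_def by (metis add_diff_cancel_right' diff_add_eq diff_diff_eq)
 ultimately show L: "(\<lambda>y. f (z - y)) \<in> \<L>2" using m by (simp add: L2_circle_def periodic_def)
 have "itg 0 L (\<lambda>y. (f (z - y))\<^sup>2) = itg (z - L) ((z - L) + L) (\<lambda>x. (f x)\<^sup>2)"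
  unfolding itg_def set_lebesgue_integral_def
  by (subst (2) lborel_integral_real_affine[where c="-1" and t=z]) (auto intro!: Bochner_Integration.integral_cong simp: i0[simplified])
 also have "\<dots> = itg 0 L (\<lambda>x. (f x)\<^sup>2)"
  by (rule itg_period[OF l]) (use L2_periodic[OF assms] in \<open>simp add: periodic_def\<close>)
 finally show "nrm (\<lambda>y. f (z - y)) = nrm f" using norm_toL2[OF L] norm_toL2[OF assms] by simp
qed

definition Lam1 :: "(real => real) => real => real" where
 "Lam1 g z = itg 0 L (\<lambda>y. lam (z - y) * g y)"

lemma Lam1_sup: "g \<in> \<L>2 ==> \<bar>Lam1 g z\<bar> \<le> nrm lam * nrm g"
 unfolding Lam1_def using itg_toL2_bound[OF L2_reflect(1)[OF lam_L2], of g z] L2_reflect(2)[OF lam_L2, of z] by simp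

lemma Lam1_periodic: "periodic L (Lam1 g)"
proof -
 have "lam (z + L - y) = lam (z - y)" for z y
  using lam_periodic unfolding periodic_def by (metis add_diff_eq add.commute)
 then show ?thesis by (simp add: periodic_def Lam1_def)
qed

section \<open>Fourier coefficients and the conjugate series\<close>

definition Cn :: "nat => real => real" where "Cn n x = cos (2 * mu * real n * x)"
definition Sn :: "nat => real => real" where "Sn n x = sin (2 * mu * real n * x)"

lemma two_pi_int: "sin (2 * mu * of_int k * (x + L)) = sin (2 * mu * of_int k * x)"
 "cos (2 * mu * of_int k * (x + L)) = cos (2 * mu * of_int k * x)"
proof -
 have "2 * mu * of_int k * (x + L) = 2 * mu * of_int k * x + of_int k * (2 * pi)"
  using mu_L by (simp add: algebra_simps)
 then show "sin (2 * mu * of_int k * (x + L)) = sin (2 * mu * of_int k * x)"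
  "cos (2 * mu * of_int k * (x + L)) = cos (2 * mu * of_int k * x)"
  using sin.plus_of_int[of "2 * mu * of_int k * x" k] cos.plus_of_int[of "2 * mu * of_int k * x" k] by simp_all
qed

lemma itg_trig: assumes "k \<noteq> 0"
 shows "itg 0 L (\<lambda>x. cos (2 * mu * of_int k * x)) = 0" "itg 0 L (\<lambda>x. sin (2 * mu * of_int k * x)) = 0"
proof -
 define c where "c = 2 * mu * of_int k"
 have c: "c \<noteq> 0" using assms mu_pos by (simp add: c_def)
 have "dvt (\<lambda>x. sin (c * x) / c) (\<lambda>x. cos (c * x))"
  by (rule dvt_of_deriv) (use c two_pi_int[of k] in \<open>auto intro!: derivative_eq_intros continuous_intros simp: periodic_def c_def\<close>)
 from dvt_mean_zero[OF this] show "itg 0 L (\<lambda>x. cos (2 * mu * of_int k * x)) = 0" by (simp add: c_def)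
 have "dvt (\<lambda>x. - cos (c * x) / c) (\<lambda>x. sin (c * x))"
  by (rule dvt_of_deriv) (use c two_pi_int[of k] in \<open>auto intro!: derivative_eq_intros continuous_intros simp: periodic_def c_def\<close>)
 from dvt_mean_zero[OF this] show "itg 0 L (\<lambda>x. sin (2 * mu * of_int k * x)) = 0" by (simp add: c_def)
qed

lemma itg_sin_int: "itg 0 L (\<lambda>x. sin (2 * mu * of_int k * x)) = 0"
 using itg_trig(2)[of k] itg_const[of 0 L 0] L_pos by (cases "k = 0") auto

lemma CS_L2: "Cn n \<in> \<L>2" "Sn n \<in> \<L>2"
 unfolding Cn_def[abs_def] Sn_def[abs_def] using two_pi_int[of "int n"]
 by (auto intro!: L2_intro_cont continuous_intros simp: periodic_def)

lemma inner_trig: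
 assumes "m \<ge> 1" "n \<ge> 1"
 shows "inner (toL2 (Cn m)) (toL2 (Cn n)) = (if m = n then L / 2 else 0)"
  "inner (toL2 (Sn m)) (toL2 (Sn n)) = (if m = n then L / 2 else 0)"
  "inner (toL2 (Sn m)) (toL2 (Cn n)) = 0"
proof -
 let ?d = "int m - int n" and ?s = "int m + int n"
 have ds: "2 * mu * of_int ?d * x = 2 * mu * real m * x - 2 * mu * real n * x"
  "2 * mu * of_int ?s * x = 2 * mu * real m * x + 2 * mu * real n * x" for x
  by (simp_all add: algebra_simps)
 have l: "locint (\<lambda>x. cos (2 * mu * of_int k * x))" "locint (\<lambda>x. sin (2 * mu * of_int k * x))" for k :: int
  by (auto intro!: locint_continuous continuous_intros)
 have s: "itg 0 L (\<lambda>x. cos (2 * mu * of_int ?s * x)) = 0" by (rule itg_trig) (use assms in auto)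
 have d: "itg 0 L (\<lambda>x. cos (2 * mu * of_int ?d * x)) = (if m = n then L else 0)"
  using itg_trig(1)[of ?d] itg_const[of 0 L 1] L_pos by auto
 have "itg 0 L (\<lambda>z. Cn m z * Cn n z) = itg 0 L (\<lambda>x. (1/2) * (cos (2 * mu * of_int ?d * x) + cos (2 * mu * of_int ?s * x)))"
  unfolding Cn_def cos_times_cos ds by simp
 then show "inner (toL2 (Cn m)) (toL2 (Cn n)) = (if m = n then L / 2 else 0)"
  unfolding inner_toL2[OF CS_L2(1) CS_L2(1)] itg_cmult itg_add[OF l(1) l(1)] s d by (cases "m = n") simp_all
 have "itg 0 L (\<lambda>z. Sn m z * Sn n z) = itg 0 L (\<lambda>x. (1/2) * (cos (2 * mu * of_int ?d * x) - cos (2 * mu * of_int ?s * x)))"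
  unfolding Sn_def sin_times_sin ds by simp
 then show "inner (toL2 (Sn m)) (toL2 (Sn n)) = (if m = n then L / 2 else 0)"
  unfolding inner_toL2[OF CS_L2(2) CS_L2(2)] itg_cmult itg_diff[OF l(1) l(1)] s d by (cases "m = n") simp_all
 have "itg 0 L (\<lambda>z. Sn m z * Cn n z) = itg 0 L (\<lambda>x. (1/2) * (sin (2 * mu * of_int ?s * x) + sin (2 * mu * of_int ?d * x)))"
  unfolding Sn_def Cn_def sin_times_cos ds by simp
 then show "inner (toL2 (Sn m)) (toL2 (Cn n)) = 0"
  unfolding inner_toL2[OF CS_L2(2) CS_L2(1)] itg_cmult itg_add[OF l(2) l(2)] itg_sin_int by simp
qed

definition fa :: "(real => real) => nat => real" where "fa g n = itg 0 L (\<lambda>y. Cn n y * g y)"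
definition fb :: "(real => real) => nat => real" where "fb g n = itg 0 L (\<lambda>y. Sn n y * g y)"

text \<open>Compared with \<open>four_term\<close>, the cosine is replaced by the sine and the sine
  by minus the cosine: this is the action of the Hilbert transform. The index is shifted by one, as
  the constant term has no conjugate.\<close>

definition conj_term :: "(real => real) => nat => l2" where
 "conj_term g n = (2 / L) *\<^sub>R (fa g (Suc n) *\<^sub>R toL2 (Sn (Suc n)) - fb g (Suc n) *\<^sub>R toL2 (Cn (Suc n)))"
definition four_term :: "(real => real) => nat => l2" where
 "four_term g n = (2 / L) *\<^sub>R (fa g (Suc n) *\<^sub>R toL2 (Cn (Suc n)) + fb g (Suc n) *\<^sub>R toL2 (Sn (Suc n)))"

lemma inner_trig_CS: "m \<ge> 1 ==> n \<ge> 1 ==> inner (toL2 (Cn m)) (toL2 (Sn n)) = 0"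
 using inner_trig(3) inner_commute by metis

lemma four_orth: "m \<noteq> n ==> inner (four_term g m) (four_term g n) = 0"
 "m \<noteq> n ==> inner (conj_term g m) (conj_term g n) = 0"
 by (auto simp: four_term_def conj_term_def inner_add_left inner_add_right inner_diff_left inner_diff_right inner_trig inner_trig_CS)

lemma four_norm: "(norm (four_term g n))\<^sup>2 = (2 / L) * ((fa g (Suc n))\<^sup>2 + (fb g (Suc n))\<^sup>2)"
 "(norm (conj_term g n))\<^sup>2 = (2 / L) * ((fa g (Suc n))\<^sup>2 + (fb g (Suc n))\<^sup>2)"
 using L_pos unfolding power2_norm_eq_inner
 by (auto simp: four_term_def conj_term_def inner_add_left inner_add_right inner_diff_left inner_diff_right
   inner_trig inner_trig_CS power2_eq_square field_simps)

text \<open>Bessel's inequality holds for \<open>four_term\<close>, and the conjugate terms have the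
  same norms. The boundedness of the Hilbert transform on L^2 comes from here.\<close>

lemma Bessel: assumes g: "g \<in> \<L>2" shows "(\<Sum>n<N. (norm (conj_term g n))\<^sup>2) \<le> (nrm g)\<^sup>2"
proof -
 have a: "inner (toL2 g) (four_term g n) = (norm (four_term g n))\<^sup>2" for n
 proof -
  have "inner (toL2 g) (toL2 (Cn k)) = fa g k" "inner (toL2 g) (toL2 (Sn k)) = fb g k" for k
   using inner_toL2[OF g CS_L2(1), of k] inner_toL2[OF g CS_L2(2), of k] by (simp_all add: fa_def fb_def mult.commute)
  then show ?thesis unfolding four_norm
   by (simp add: four_term_def inner_add_right inner_scaleR_right power2_eq_square)
 qed
 define s where "s = (\<Sum>n<N. four_term g n)"
 have ss: "(norm s)\<^sup>2 = (\<Sum>n<N. (norm (four_term g n))\<^sup>2)" unfolding s_def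
  by (rule norm_sum_Pythagorean) (auto simp: pairwise_def orthogonal_def four_orth)
 have gs: "inner (toL2 g) s = (norm s)\<^sup>2" unfolding ss by (simp add: s_def inner_sum_right a)
 have "0 \<le> (norm (toL2 g - s))\<^sup>2" by simp
 also have "\<dots> = (nrm g)\<^sup>2 - (norm s)\<^sup>2"
  using gs unfolding power2_norm_eq_inner by (simp add: inner_diff_left inner_diff_right inner_commute)
 finally show ?thesis unfolding ss by (simp add: four_norm)
qed

lemma conj_summable: assumes g: "g \<in> \<L>2" shows "summable (conj_term g)" "norm (suminf (conj_term g)) \<le> nrm g"
proof -
 have "summable (\<lambda>n. (norm (conj_term g n))\<^sup>2)"
  by (rule bounded_imp_summable[where B="(nrm g)\<^sup>2"])
   (use Bessel[OF g, of "Suc _"] in \<open>auto simp: lessThan_Suc_atMost\<close>)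
 then show s: "summable (conj_term g)" by (rule orthogonal_summable[rotated]) (rule four_orth)
 have "norm (\<Sum>n<N. conj_term g n) \<le> nrm g" for N
 proof (rule power2_le_imp_le)
  have "(norm (\<Sum>n<N. conj_term g n))\<^sup>2 = (\<Sum>n<N. (norm (conj_term g n))\<^sup>2)"
   by (rule norm_sum_Pythagorean) (auto simp: pairwise_def orthogonal_def four_orth)
  then show "(norm (\<Sum>n<N. conj_term g n))\<^sup>2 \<le> (nrm g)\<^sup>2" using Bessel[OF g, of N] by simp
 qed simp
 then show "norm (suminf (conj_term g)) \<le> nrm g"
  by (intro LIMSEQ_le_const2[OF tendsto_norm[OF summable_LIMSEQ[OF s]]]) auto
qed

lemma sin_mu_pos: "0 < x ==> x < L ==> sin (mu * x) > 0"
proof (rule sin_gt_zero)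
 assume "0 < x" "x < L"
 then show "0 < mu * x" using mu_pos by simp
 have "mu * x < mu * L" using \<open>x < L\<close> mu_pos by simp
 then show "mu * x < pi" by (simp add: mu_L)
qed

lemma lam_deriv: assumes "0 < x" "x < L" shows "(lam has_real_derivative (1 / L) * cot (mu * x)) (at x)"
proof -
 have s: "sin (mu * x) > 0" by (rule sin_mu_pos[OF assms])
 have "((\<lambda>x. (1 / pi) * ln (sin (mu * x))) has_real_derivative (1 / L) * cot (mu * x)) (at x)"
  using s L_pos by (auto intro!: derivative_eq_intros simp: cot_def mu_def field_simps)
 then show ?thesis
 proof (rule has_field_derivative_transform_within_open[of _ _ _ "{0<..<L}"])
  show "\<And>x. x \<in> {0<..<L} ==> 1 / pi * ln (sin (mu * x)) = lam x" by (simp add: lam_def abs_of_pos sin_mu_pos)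
 qed (use assms in auto)
qed

lemma AE_sin_nz: "AE y in lborel. sin (mu * (z - y)) \<noteq> 0"
proof -
 have "countable (range (\<lambda>k::int. z - of_int k * L))" by simp
 then have "AE y in lborel. y \<notin> range (\<lambda>k::int. z - of_int k * L)" by (intro AE_not_in countable_imp_null_set_lborel)
 then show ?thesis
 proof eventually_elim
  case (elim y)
  show ?case
  proof
   assume "sin (mu * (z - y)) = 0"
   then obtain k :: int where "mu * (z - y) = of_int k * pi" using sin_zero_iff_int2 by blast
   then have "mu * (z - y) = mu * (of_int k * L)" using mu_L by (simp add: mult.left_commute)
   then have "z - y = of_int k * L" using mu_pos by simp
   then have "y = z - of_int k * L" by simp
   then show False using elim by auto
  qed
 qed
qed

lemma itg_tendsto_L2:
 assumes f: "\<And>N. f N \<in> \<L>2" and h: "h \<in> \<L>2" and lim: "(\<lambda>N::nat. toL2 (f N)) \<longlonglongrightarrow> toL2 h" and ab: "a \<le> b" "b \<le> a + L"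
 shows "(\<lambda>N. itg a b (f N)) \<longlonglongrightarrow> itg a b h"
proof -
 have "(\<lambda>N. itg a b (f N) - itg a b h) \<longlonglongrightarrow> 0"
 proof (rule Lim_null_comparison[where g="\<lambda>N. sqrt L * norm (toL2 (f N) - toL2 h)"])
  show "\<forall>\<^sub>F N in sequentially. norm (itg a b (f N) - itg a b h) \<le> sqrt L * norm (toL2 (f N) - toL2 h)"
  proof (intro always_eventually allI)
   fix N
   have d: "(\<lambda>x. f N x - h x) \<in> \<L>2" by (intro L2_diff f h)
   have la: "locint (\<lambda>x. \<bar>f N x - h x\<bar>)" by (intro locint_abs L2_locint d)
   have "norm (itg a b (f N) - itg a b h) = \<bar>itg a b (\<lambda>x. f N x - h x)\<bar>"
    by (simp add: itg_diff L2_locint f h)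
   also have "\<dots> \<le> itg a b (\<lambda>x. \<bar>f N x - h x\<bar>)" by (rule itg_abs)
   also have "\<dots> \<le> itg a (a + L) (\<lambda>x. \<bar>f N x - h x\<bar>)" by (rule itg_subinterval_mono[OF la]) (use ab in auto)
   also have "\<dots> = itg 0 L (\<lambda>x. \<bar>f N x - h x\<bar>)"
    by (rule itg_period[OF la]) (use L2_periodic[OF d] in \<open>simp add: periodic_def\<close>)
   also have "\<dots> \<le> sqrt L * nrm (\<lambda>x. f N x - h x)" by (rule itg_abs_L2[OF d])
   finally show "norm (itg a b (f N) - itg a b h) \<le> sqrt L * norm (toL2 (f N) - toL2 h)" by (simp add: toL2_diff f h)
  qed
  have "(\<lambda>N. toL2 (f N) - toL2 h) \<longlonglongrightarrow> 0" using lim by (simp add: LIM_zero_iff)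
  then show "(\<lambda>N. sqrt L * norm (toL2 (f N) - toL2 h)) \<longlonglongrightarrow> 0" by (intro tendsto_mult_right_zero tendsto_norm_zero)
 qed
 then show ?thesis by (simp add: LIM_zero_iff)
qed

text \<open>The kernel arguments below treat short intervals only, which must not exceed a period or
  meet two singularities. The local estimate holds without error, so the comparison function is
  0.\<close>

lemma acd_of_short:
 assumes h: "locint h" and d: "d > 0" and s: "\<And>a b. a \<le> b ==> b \<le> a + d ==> f b - f a = itg a b h"
 shows "acd f h"
 unfolding acd_def
proof (intro conjI allI impI h)
 fix a b :: real assume ab: "a \<le> b"
 show "f b - f a = itg a b h"
 proof (rule itg_of_local_estimate[OF h locint_const[of 0] ab])
  fix e :: real
  show "\<exists>d>0. \<forall>x y. a \<le> x \<longrightarrow> x \<le> y \<longrightarrow> y \<le> b \<longrightarrow> y < x + d \<longrightarrow> \<bar>f y - f x - itg x y h\<bar> \<le> e * itg x y (\<lambda>x. 0)"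
   using d s by (intro exI[of _ d]) (auto simp: itg_const)
 qed
qed

lemma Lam1_diff: assumes "f \<in> \<L>2" "g \<in> \<L>2" shows "Lam1 (\<lambda>x. f x - g x) z = Lam1 f z - Lam1 g z"
 unfolding Lam1_def using L2_mult_locint[OF L2_reflect(1)[OF lam_L2] assms(1), of z] L2_mult_locint[OF L2_reflect(1)[OF lam_L2] assms(2), of z]
 by (simp add: right_diff_distrib itg_diff)

lemma itg_reflect: assumes h: "locint h" "periodic L h" shows "itg 0 L (\<lambda>y. h (z - y)) = itg 0 L h"
proof -
 have i0: "indicator {z-L..z} (z - x) = (indicator {0..L} x :: real)" for x by (auto simp: indicator_def)
 have "itg 0 L (\<lambda>y. h (z - y)) = itg (z - L) ((z - L) + L) h"
  unfolding itg_def set_lebesgue_integral_def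
  by (subst (2) lborel_integral_real_affine[where c="-1" and t=z]) (auto intro!: Bochner_Integration.integral_cong simp: i0)
 then show ?thesis using itg_period[OF h, of "z - L"] by simp
qed

section \<open>Completeness of the trigonometric system\<close>

definition trg :: "int => real => real => real" where "trg k \<theta> x = cos (2 * mu * of_int k * x + \<theta>)"

lemma trg_cont: "continuous_on UNIV (trg k \<theta>)"
 unfolding trg_def[abs_def] by (intro continuous_intros)

lemma trg_periodic: "periodic L (trg k \<theta>)"
 by (simp add: periodic_def trg_def cos_add two_pi_int)

lemma trg_L2: "trg k \<theta> \<in> \<L>2"
 by (rule L2_intro_cont[OF trg_cont trg_periodic])

text \<open>One family with a free phase replaces the pair of sine and cosine: differentiation adds
  \<open>pi / 2\<close> to the phase, multiplication by a cosine shifts frequency and phase, and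
  frequency 0 supplies the constants.\<close>

lemma trg_deriv: "(trg k \<theta> has_real_derivative (2 * mu * of_int k) * trg k (\<theta> + pi / 2) x) (at x)"
proof -
 have "trg k (\<theta> + pi / 2) x = - sin (2 * mu * of_int k * x + \<theta>)"
  unfolding trg_def add.assoc[symmetric] by (simp add: cos_add)
 then show ?thesis unfolding trg_def[of k \<theta>, abs_def] by (auto intro!: derivative_eq_intros)
qed

lemma trg_dvt: "dvt (trg k \<theta>) (\<lambda>x. (2 * mu * of_int k) * trg k (\<theta> + pi / 2) x)"
 by (rule dvt_of_deriv[OF trg_deriv]) (intro continuous_on_mult continuous_on_const trg_cont, rule trg_periodic)

text \<open>If a continuous function orthogonal to all trigonometric functions were nonzero at \<open>x0\<close>, testing it
 with high powers of \<open>(1 + cos (2 mu (x - x0))) / 2\<close>, which concentrate at \<open>x0\<close>, would give a contradiction.\<close>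

lemma trig_complete_cont:
 assumes G: "continuous_on UNIV G" "periodic L G" and z: "\<And>k \<theta>. itg 0 L (\<lambda>x. G x * trg k \<theta> x) = 0"
 shows "G x0 = 0"
proof (rule ccontr)
 assume nz: "G x0 \<noteq> 0"
 define P where "P x = (1 + cos (2 * mu * (x - x0))) / 2" for x
 have Pc: "continuous_on UNIV P" unfolding P_def[abs_def] by (intro continuous_intros) auto
 have Pp: "periodic L P" using two_pi_int(2)[of 1] by (simp add: periodic_def P_def cos_add right_diff_distrib cos_diff two_pi_int[of 1, simplified])
 have P2: "P x = (cos (mu * (x - x0)))\<^sup>2" for x
  using cos_double_cos[of "mu * (x - x0)"] by (simp add: P_def mult.assoc)
 have pc: "continuous_on UNIV (\<lambda>x. G x * P x ^ m)" for m by (intro continuous_intros G Pc)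
 \<comment> \<open>A factor \<open>P\<close> turns a trigonometric function of frequency
   \<open>k\<close> into a combination of those with frequencies \<open>k - 1\<close>,
   \<open>k\<close> and \<open>k + 1\<close>, so orthogonality survives every power of
   \<open>P\<close>.\<close>
 have "itg 0 L (\<lambda>x. (G x * P x ^ m) * trg k \<theta> x) = 0" for m k \<theta>
 proof (induction m arbitrary: k \<theta>)
  case (Suc m)
  let ?h = "\<lambda>k \<theta> x. (G x * P x ^ m) * trg k \<theta> x"
  have l: "locint (?h k \<theta>)" for k \<theta> by (rule locint_continuous) (intro continuous_on_mult pc trg_cont)
  have "P x * trg k \<theta> x = 1/2 * trg k \<theta> x + (1/4 * trg (k + 1) (\<theta> - 2 * mu * x0) x + 1/4 * trg (k - 1) (\<theta> + 2 * mu * x0) x)" for x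
  proof -
   have "cos (2 * mu * (x - x0)) * trg k \<theta> x = (trg (k - 1) (\<theta> + 2 * mu * x0) x + trg (k + 1) (\<theta> - 2 * mu * x0) x) / 2"
    unfolding trg_def cos_times_cos
    using cos_minus[of "2 * mu * (x - x0) - (2 * mu * of_int k * x + \<theta>)"] by (simp add: algebra_simps)
   then show ?thesis by (simp add: P_def field_simps)
  qed
  then have "(\<lambda>x. (G x * P x ^ Suc m) * trg k \<theta> x) =
    (\<lambda>x. 1/2 * ?h k \<theta> x + (1/4 * ?h (k + 1) (\<theta> - 2 * mu * x0) x + 1/4 * ?h (k - 1) (\<theta> + 2 * mu * x0) x))"
  proof (intro ext)
   fix x
   assume a: "\<And>x. P x * trg k \<theta> x = 1/2 * trg k \<theta> x + (1/4 * trg (k + 1) (\<theta> - 2 * mu * x0) x + 1/4 * trg (k - 1) (\<theta> + 2 * mu * x0) x)"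
   have "(G x * P x ^ Suc m) * trg k \<theta> x = (G x * P x ^ m) * (P x * trg k \<theta> x)" by simp
   then show "(G x * P x ^ Suc m) * trg k \<theta> x = 1/2 * ?h k \<theta> x + (1/4 * ?h (k + 1) (\<theta> - 2 * mu * x0) x + 1/4 * ?h (k - 1) (\<theta> + 2 * mu * x0) x)"
    unfolding a by (simp only: distrib_left mult_ac)
  qed
  then show ?case by (simp only: itg_add locint_add locint_cmult l itg_cmult Suc.IH)
 qed (simp add: z)
 from this[of _ 0 0] have GP: "itg 0 L (\<lambda>x. G x * P x ^ m) = 0" for m by (simp add: trg_def)
 define c where "c = (G x0)\<^sup>2 / 2"
 have c: "c > 0" using nz by (simp add: c_def)
 obtain d0 where d0: "d0 > 0" "\<And>x. \<bar>x - x0\<bar> < d0 ==> \<bar>G x - G x0\<bar> < \<bar>G x0\<bar> / 2"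
  using G(1) nz unfolding continuous_on_iff dist_real_def by (metis UNIV_I half_gt_zero zero_less_abs_iff)
 define d where "d = min (d0 / 2) (L / 2)"
 have d: "0 < d" "d \<le> L / 2" "d < d0" using d0 L_pos by (auto simp: d_def)
 have near: "c \<le> G x0 * G x" if "\<bar>x - x0\<bar> \<le> d" for x
 proof -
  have "\<bar>G x0 * (G x - G x0)\<bar> \<le> \<bar>G x0\<bar> * (\<bar>G x0\<bar> / 2)"
   unfolding abs_mult using d0(2)[of x] that d by (intro mult_left_mono) auto
  then have "- ((G x0)\<^sup>2 / 2) \<le> G x0 * (G x - G x0)" by (simp add: abs_le_iff power2_eq_square abs_mult_self_eq)
  then show ?thesis by (simp add: c_def algebra_simps power2_eq_square)
 qed
 have "bounded (G ` {x0 - L/2..x0 + L/2})"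
  by (intro compact_imp_bounded compact_continuous_image continuous_on_subset[OF G(1)]) auto
 then obtain B where B: "B > 0" "\<And>x. x0 - L/2 \<le> x ==> x \<le> x0 + L/2 ==> \<bar>G x\<bar> \<le> B"
  unfolding bounded_pos by auto
 define a b where "a = P (x0 + d / 2)" and "b = P (x0 + d)"
 have Pmono: "P y \<le> P x" if "\<bar>x - x0\<bar> \<le> \<bar>y - x0\<bar>" "\<bar>y - x0\<bar> \<le> L / 2" for x y
 proof -
  have e: "P x = (1 + cos (2 * mu * \<bar>x - x0\<bar>)) / 2" for x
   unfolding P_def using cos_abs_real[of "2 * mu * (x - x0)"] mu_pos by (simp add: abs_mult)
  have "2 * mu * \<bar>y - x0\<bar> \<le> 2 * mu * (L / 2)" using that mu_pos by (intro mult_left_mono) auto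
  then have "cos (2 * mu * \<bar>y - x0\<bar>) \<le> cos (2 * mu * \<bar>x - x0\<bar>)"
   using that mu_pos mu_L by (intro cos_monotone_0_pi_le) (auto intro!: mult_left_mono)
  then show ?thesis unfolding e by simp
 qed
 have P0: "0 \<le> P x" for x by (simp add: P2)
 have ab: "b < a" "0 \<le> b"
 proof -
  have "2 * mu * d \<le> 2 * mu * (L / 2)" using d mu_pos by (intro mult_left_mono) auto
  then have "cos (2 * mu * d) < cos (2 * mu * (d / 2))" using d mu_pos mu_L by (intro cos_monotone_0_pi) auto
  then show "b < a" by (simp add: a_def b_def P_def)
 qed (simp add: b_def P0)
 \<comment> \<open>The integral of \<open>?h\<close> over the period around \<open>x0\<close> is 0.
   Within \<open>d / 2\<close> of \<open>x0\<close> the integrand is at least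
   \<open>c * a ^ m\<close>. Elsewhere it is at least \<open>- E\<close>: up to distance
   \<open>d\<close> because \<open>G x0 * G x\<close> is positive, beyond \<open>d\<close> because
   \<open>P x \<le> b\<close>. As \<open>b < a\<close>, this fails for large
   \<open>m\<close>.\<close>
 have key: "d * c * a ^ m \<le> L * (\<bar>G x0\<bar> * B) * b ^ m" for m
 proof -
  let ?h = "\<lambda>x. G x0 * (G x * P x ^ m)"
  define E where "E = (\<bar>G x0\<bar> * B) * b ^ m"
  have E: "0 \<le> E" using B ab by (simp add: E_def)
  have l: "locint ?h" by (intro locint_cmult locint_continuous pc)
  have far: "- E \<le> ?h x" if "x0 - L/2 \<le> x" "x \<le> x0 + L/2" for x
  proof (cases "\<bar>x - x0\<bar> \<le> d")
   case True
   have "0 \<le> G x0 * G x" using near[OF True] c by linarith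
   then have "0 \<le> (G x0 * G x) * P x ^ m" by (rule mult_nonneg_nonneg[OF _ zero_le_power[OF P0]])
   then show ?thesis using E by (simp add: mult.assoc)
  next
   case False
   have "\<bar>x - x0\<bar> \<le> L / 2" using that by linarith
   then have "P x \<le> b" unfolding b_def using False d(1) by (intro Pmono) linarith+
   then have "P x ^ m \<le> b ^ m" by (rule power_mono[OF _ P0])
   then have "\<bar>?h x\<bar> \<le> \<bar>G x0\<bar> * (B * b ^ m)"
    unfolding abs_mult power_abs abs_of_nonneg[OF P0] using B(2)[OF that] B(1) P0 by (intro mult_left_mono mult_mono zero_le_power abs_ge_zero) auto
   then show ?thesis by (simp add: E_def mult.assoc)
  qed
  have nr: "c * a ^ m \<le> ?h x" if "x0 - d/2 \<le> x" "x \<le> x0 + d/2" for x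
  proof -
   have xd: "\<bar>x - x0\<bar> \<le> d / 2" using that by linarith
   then have "a \<le> P x" unfolding a_def using d by (intro Pmono) linarith+
   then have am: "a ^ m \<le> P x ^ m" using ab by (intro power_mono) auto
   have n: "c \<le> G x0 * G x" using xd d(1) by (intro near) linarith
   have "c * a ^ m \<le> (G x0 * G x) * P x ^ m"
    by (rule mult_mono[OF n am]) (use n c ab in auto)
   then show ?thesis by (simp add: mult.assoc)
  qed
  have pe: "x0 - L/2 + L = x0 + L/2" by simp
  have p: "periodic L ?h" using G(2) Pp by (simp add: periodic_def)
  have "itg (x0 - L/2) (x0 - d/2) (\<lambda>x. - E) + (itg (x0 - d/2) (x0 + d/2) (\<lambda>x. c * a ^ m) + itg (x0 + d/2) (x0 + L/2) (\<lambda>x. - E))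
   \<le> itg (x0 - L/2) (x0 - d/2) ?h + (itg (x0 - d/2) (x0 + d/2) ?h + itg (x0 + d/2) (x0 + L/2) ?h)"
   using d by (intro add_mono itg_mono l locint_const far nr) auto
  also have "\<dots> = itg (x0 - L/2) (x0 + L/2) ?h"
   using d itg_combine[OF l, of "x0 - L/2" "x0 - d/2" "x0 + L/2"] itg_combine[OF l, of "x0 - d/2" "x0 + d/2" "x0 + L/2"] by simp
  also have "\<dots> = 0" using itg_period[OF l p, of "x0 - L/2", unfolded pe] GP[of m] by (simp add: itg_cmult)
  finally have "d * (c * a ^ m) \<le> (L - d) * E" using d by (simp add: itg_const algebra_simps)
  also have "\<dots> \<le> L * E" using d E by (intro mult_right_mono) auto
  finally show ?thesis by (simp add: E_def mult.assoc)
 qed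
 have a0: "a > 0" using ab by simp
 have "(\<lambda>m. L * (\<bar>G x0\<bar> * B) * (b / a) ^ m) \<longlonglongrightarrow> L * (\<bar>G x0\<bar> * B) * 0"
  by (intro tendsto_mult tendsto_const LIMSEQ_power_zero) (use ab a0 in auto)
 moreover have "d * c \<le> L * (\<bar>G x0\<bar> * B) * (b / a) ^ m" for m
  using key[of m] a0 by (simp add: power_divide pos_le_divide_eq)
 ultimately have "d * c \<le> 0" using LIMSEQ_le_const by fastforce
 then show False using d(1) c by (simp add: mult_le_0_iff)
qed

text \<open>The primitive is continuous, and integration by parts expresses its coefficients at
  nonzero frequencies by those of \<open>h\<close>. Frequency 0 is settled by the normalisation of
  \<open>prim\<close>.\<close>

lemma trig_complete:
 assumes h: "h \<in> \<L>2" and z: "\<And>k \<theta>. itg 0 L (\<lambda>x. h x * trg k \<theta> x) = 0"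
 shows "AE x in lborel. h x = 0"
proof -
 have "mean L h = 0" using z[of 0 0] by (simp add: trg_def mean_itg)
 then have G: "dvt (prim h) h" using prim(1)[OF h] by simp
 have "itg 0 L (\<lambda>x. prim h x * trg k \<theta> x) = 0" for k \<theta>
 proof (cases "k = 0")
  case True
  then have "(\<lambda>x. prim h x * trg k \<theta> x) = (\<lambda>x. cos \<theta> * prim h x)" by (auto simp: trg_def)
  then show ?thesis by (simp add: itg_cmult prim(2)[OF h])
 next
  case False
  have "itg 0 L (\<lambda>x. prim h x * ((2 * mu * of_int k) * trg k (\<theta> - pi / 2 + pi / 2) x)) = 0"
   using itg_parts[OF G trg_dvt[of k "\<theta> - pi / 2"]] z[of k "\<theta> - pi / 2"] by simp
  moreover have "(\<lambda>x. prim h x * ((2 * mu * of_int k) * trg k (\<theta> - pi / 2 + pi / 2) x)) = (\<lambda>x. (2 * mu * of_int k) * (prim h x * trg k \<theta> x))" by auto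
  ultimately show ?thesis using False mu_pos by (simp only: itg_cmult) simp
 qed
 then have "prim h x = 0" for x by (rule trig_complete_cont[OF dvtD(4)[OF G] dvtD(1)[OF G]])
 then have "prim h = (\<lambda>x. 0)" by auto
 then show ?thesis using dvt_unique[OF G] dvt_const[of 0] by simp
qed

lemma bounded_linear_toL2_ofL2: "bounded_linear (\<lambda>x. toL2 (ofL2 x))"
 by (rule bounded_linear_intro[where K=1]) (use norm_toL2_ofL2 in \<open>auto simp: linear_add[OF linear_toL2_ofL2] linear_scale[OF linear_toL2_ofL2]\<close>)

lemma l2_zeroI:
 assumes x: "toL2 (ofL2 x) = x" and z: "\<And>k \<theta>. inner x (toL2 (trg k \<theta>)) = 0"
 shows "x = 0"
proof -
 have "itg 0 L (\<lambda>y. ofL2 x y * trg k \<theta> y) = 0" for k \<theta>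
  using inner_toL2[OF ofL2_L2 trg_L2, of x k \<theta>] z[of k \<theta>] x by simp
 then have "AE y in lborel. ofL2 x y = 0" by (rule trig_complete[OF ofL2_L2])
 then have "toL2 (ofL2 x) = toL2 (\<lambda>y. 0)" by (intro toL2_cong_AE ofL2_L2 L2_const)
 then show ?thesis using x toL2_zero by simp
qed

text \<open>The series converges by Bessel's inequality. The remainder \<open>y\<close> is
  orthogonal to all trigonometric functions and vanishes by completeness;
  \<open>toL2 (ofL2 y) = y\<close> has to be checked for this, because an element of
  \<open>l2\<close> may live outside \<open>{0..L}\<close>.\<close>

lemma four_expansion:
 assumes f: "f \<in> \<L>2"
 shows "(\<lambda>N. toL2 (\<lambda>x. mean L f) + (\<Sum>n<N. four_term f n)) \<longlonglongrightarrow> toL2 f"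
proof -
 have "summable (\<lambda>n. (norm (four_term f n))\<^sup>2)"
  unfolding four_norm(1) four_norm(2)[symmetric]
  by (rule bounded_imp_summable[where B="(nrm f)\<^sup>2"])
   (use Bessel[OF f, of "Suc _"] in \<open>auto simp: lessThan_Suc_atMost\<close>)
 then have s: "summable (four_term f)" by (rule orthogonal_summable[rotated]) (rule four_orth)
 define y where "y = toL2 f - (toL2 (\<lambda>x. mean L f) + suminf (four_term f))"
 interpret p: bounded_linear "\<lambda>x. toL2 (ofL2 x)" by (rule bounded_linear_toL2_ofL2)
 have pt: "toL2 (ofL2 (four_term f n)) = four_term f n" for n
  unfolding four_term_def by (simp only: p.scaleR p.add toL2_ofL2_toL2 CS_L2)
 have "toL2 (ofL2 (suminf (four_term f))) = suminf (four_term f)" unfolding p.suminf[OF s] pt ..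
 then have py: "toL2 (ofL2 y) = y" unfolding y_def by (simp only: p.diff p.add toL2_ofL2_toL2 f L2_const)
 have i: "inner (suminf (four_term f)) u = (\<Sum>n. inner (four_term f n) u)" for u
  by (rule bounded_linear.suminf[OF bounded_linear_inner_left s])
 have one: "inner (toL2 (Cn (Suc n))) (toL2 (\<lambda>x. 1)) = 0" "inner (toL2 (Sn (Suc n))) (toL2 (\<lambda>x. 1)) = 0" for n
  using itg_trig[of "int (Suc n)"] by (auto simp: inner_toL2 CS_L2 L2_const Cn_def Sn_def)
 have c1: "toL2 (\<lambda>x. c) = c *\<^sub>R toL2 (\<lambda>x. 1)" for c using toL2_cmult[OF L2_const, of c 1] by simp
 have y1: "inner y (toL2 (\<lambda>x. 1)) = 0"
 proof -
  have "inner (toL2 f) (toL2 (\<lambda>x. 1)) = itg 0 L f" "inner (toL2 (\<lambda>x. mean L f)) (toL2 (\<lambda>x. 1)) = itg 0 L f"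
   using L_pos by (auto simp: inner_toL2 f L2_const itg_const mean_itg)
  then show ?thesis unfolding y_def by (simp add: inner_diff_left inner_add_left i four_term_def one)
 qed
 have yC: "inner y (toL2 (Cn (Suc j))) = 0" "inner y (toL2 (Sn (Suc j))) = 0" for j
 proof -
  have a: "inner (four_term f n) (toL2 (Cn (Suc j))) = (if n = j then fa f (Suc j) else 0)"
   "inner (four_term f n) (toL2 (Sn (Suc j))) = (if n = j then fb f (Suc j) else 0)" for n
   using L_pos by (auto simp: four_term_def inner_add_left inner_trig inner_trig_CS)
  have "inner (toL2 (\<lambda>x. mean L f)) (toL2 (Cn (Suc j))) = 0" "inner (toL2 (\<lambda>x. mean L f)) (toL2 (Sn (Suc j))) = 0"
   using one[of j] by (simp_all add: c1[of "mean L f"] inner_commute)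
  moreover have "(\<Sum>n. inner (four_term f n) (toL2 (Cn (Suc j)))) = fa f (Suc j)" "(\<Sum>n. inner (four_term f n) (toL2 (Sn (Suc j)))) = fb f (Suc j)"
   unfolding a using sums_single[of j "\<lambda>n. fa f (Suc j)"] sums_single[of j "\<lambda>n. fb f (Suc j)"] by (auto simp: sums_iff)
  ultimately show "inner y (toL2 (Cn (Suc j))) = 0" "inner y (toL2 (Sn (Suc j))) = 0"
   unfolding y_def by (simp_all add: inner_diff_left inner_add_left i inner_toL2 f CS_L2 fa_def fb_def mult.commute)
 qed
 have "inner y (toL2 (trg k \<theta>)) = 0" for k \<theta>
 proof (cases "k = 0")
  case True
  then have "toL2 (trg k \<theta>) = cos \<theta> *\<^sub>R toL2 (\<lambda>x. 1)" using c1[of "cos \<theta>"] by (simp add: trg_def[abs_def])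
  then show ?thesis using y1 by simp
 next
  case False
  then obtain j where j: "nat \<bar>k\<bar> = Suc j" by (cases "nat \<bar>k\<bar>") auto
  define s where "s = real_of_int (sgn k)"
  have "\<bar>k\<bar> = int (Suc j)" using j by linarith
  then have "k = sgn k * int (Suc j)" by (metis mult.commute abs_mult_sgn)
  then have "of_int k = s * real (Suc j)" unfolding s_def by (metis of_int_mult of_int_of_nat_eq)
  then have k: "2 * mu * of_int k * x = s * (2 * mu * real (Suc j) * x)" for x by simp
  have s: "s = 1 \<or> s = -1" using False by (auto simp: s_def sgn_if)
  have "trg k \<theta> = (\<lambda>x. cos \<theta> * Cn (Suc j) x - (s * sin \<theta>) * Sn (Suc j) x)"
   unfolding trg_def[abs_def] Cn_def Sn_def k using s by (auto simp: cos_add fun_eq_iff)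
  then have "toL2 (trg k \<theta>) = cos \<theta> *\<^sub>R toL2 (Cn (Suc j)) - (s * sin \<theta>) *\<^sub>R toL2 (Sn (Suc j))"
   by (simp only: toL2_diff toL2_cmult L2_cmult CS_L2)
  then show ?thesis using yC by (simp add: inner_diff_right)
 qed
 then have "y = 0" by (rule l2_zeroI[OF py])
 then show ?thesis unfolding y_def using tendsto_add[OF tendsto_const summable_LIMSEQ[OF s]] by simp
qed

text \<open>The Fourier coefficients of the logarithmic kernel come from integrating the derivative of
 \<open>lam x * sin (2 mu n x)\<close>, which vanishes at both ends of the period.\<close>

lemma cot_sin_multiple:
 "\<exists>D. continuous_on UNIV D \<and> (\<forall>x. sin (mu * x) \<noteq> 0 \<longrightarrow> cot (mu * x) * sin (2 * mu * real (Suc n) * x) = D x) \<and> itg 0 L D = L"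
proof (induction n)
 case 0
 have l: "locint (\<lambda>x. cos (2 * mu * x))" by (intro locint_continuous continuous_intros)
 have "itg 0 L (\<lambda>x. 1 + cos (2 * mu * x)) = L"
  using itg_trig(1)[of 1] L_pos by (simp add: itg_add[OF locint_const l] itg_const)
 moreover have "cot (mu * x) * sin (2 * mu * x) = 1 + cos (2 * mu * x)" if "sin (mu * x) \<noteq> 0" for x
  using that cos_double_cos[of "mu * x"] sin_double[of "mu * x"] by (simp add: cot_def power2_eq_square mult.assoc)
 ultimately show ?case by (intro exI[of _ "\<lambda>x. 1 + cos (2 * mu * x)"]) (auto intro!: continuous_intros)
next
 case (Suc n)
 then obtain D where D: "continuous_on UNIV D" "\<And>x. sin (mu * x) \<noteq> 0 ==> cot (mu * x) * sin (2 * mu * real (Suc n) * x) = D x" "itg 0 L D = L" by blast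
 let ?a = "\<lambda>k x. cos (2 * mu * of_int (int k) * x)"
 \<comment> \<open>By \<open>sin (\<alpha> + 2 * t) = sin \<alpha> + 2 * sin t * cos (\<alpha> +
   t)\<close> the next function arises by adding two cosines of nonzero frequency, which leave the
   integral unchanged.\<close>
 let ?E = "\<lambda>x. D x + (?a (Suc (Suc n)) x + ?a (Suc n) x)"
 have l: "locint D" "locint (?a k)" for k by (intro locint_continuous continuous_intros D)+
 have "itg 0 L ?E = L"
  unfolding itg_add[OF l(1) locint_add[OF l(2) l(2)]] itg_add[OF l(2) l(2)] using D(3) itg_trig(1)[of "int (Suc (Suc n))"] itg_trig(1)[of "int (Suc n)"] by simp
 moreover have "cot (mu * x) * sin (2 * mu * real (Suc (Suc n)) * x) = ?E x" if s: "sin (mu * x) \<noteq> 0" for x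
 proof -
  define \<alpha> where "\<alpha> = 2 * mu * real (Suc n) * x"
  have e: "2 * mu * real (Suc (Suc n)) * x = \<alpha> + 2 * (mu * x)" by (simp add: \<alpha>_def algebra_simps)
  have "sin (\<alpha> + 2 * (mu * x)) = sin \<alpha> + 2 * sin (mu * x) * cos (\<alpha> + mu * x)"
   using sin_add[of "\<alpha> + mu * x" "mu * x"] sin_diff[of "\<alpha> + mu * x" "mu * x"] by (simp add: algebra_simps)
  then have "cot (mu * x) * sin (\<alpha> + 2 * (mu * x)) = D x + 2 * (cos (\<alpha> + mu * x) * cos (mu * x))"
   using D(2)[OF s, folded \<alpha>_def] s by (simp add: cot_def distrib_left)
  also have "2 * (cos (\<alpha> + mu * x) * cos (mu * x)) = cos \<alpha> + cos (\<alpha> + 2 * (mu * x))"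
   unfolding cos_times_cos by (simp add: algebra_simps)
  finally show ?thesis unfolding of_int_of_nat_eq e \<alpha>_def[symmetric] by (simp only: add_ac)
 qed
 ultimately show ?case using D(1) by (intro exI[of _ ?E]) (auto intro!: continuous_intros)
qed

lemma lam_coefficient: "itg 0 L (\<lambda>x. lam x * Cn (Suc n) x) = - (1 / (2 * mu * real (Suc n)))"
proof -
 define c where "c = 2 * mu * real (Suc n)"
 have c: "c > 0" using mu_pos by (simp add: c_def)
 obtain D where D: "continuous_on UNIV D" "\<And>x. sin (mu * x) \<noteq> 0 ==> cot (mu * x) * sin (c * x) = D x" "itg 0 L D = L"
  using cot_sin_multiple[of n] unfolding c_def by blast
 define \<Psi> where "\<Psi> x = lam x * sin (c * x)" for x
 \<comment> \<open>\<open>K\<close> combines \<open>lam_sq_le\<close> with the bound of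
   \<open>\<bar>sin (c * x)\<bar>\<close> by
   \<open>2 * real (Suc n) * \<bar>sin (mu * x)\<bar>\<close>. The zero of the sine beats the
   logarithm, so \<open>\<Psi>\<close> is continuous up to both ends of the period.\<close>
 define K where "K = (16 / pi\<^sup>2) * (2 * real (Suc n))\<^sup>2"
 have bound: "\<bar>\<Psi> x\<bar> \<le> sqrt (K * \<bar>sin (mu * x)\<bar>)" for x
 proof (rule real_le_rsqrt)
  define s where "s = \<bar>sin (mu * x)\<bar>"
  have s: "0 \<le> s" "s \<le> 1" by (simp_all add: s_def)
  have "\<bar>sin (c * x)\<bar> \<le> 2 * real (Suc n) * s"
   using abs_sin_nat_le[of "2 * Suc n" "mu * x"] by (simp add: c_def s_def mult_ac)
  then have "(sin (c * x))\<^sup>2 \<le> (2 * real (Suc n) * s)\<^sup>2" using s by (intro abs_le_square_iff[THEN iffD1]) simp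
  then have "(\<Psi> x)\<^sup>2 \<le> ((16 / pi\<^sup>2) * wgt x) * (2 * real (Suc n) * s)\<^sup>2"
   unfolding \<Psi>_def power_mult_distrib[of "lam x"] by (intro mult_mono lam_sq_le) (auto simp: wgt_nonneg)
  also have "\<dots> = K * (s\<^sup>2 * (1 / sqrt s))" by (simp add: K_def wgt_def s_def power_mult_distrib)
  also have "s\<^sup>2 * (1 / sqrt s) \<le> s"
  proof (cases "s = 0")
   case False
   have "s\<^sup>2 = s * sqrt s * sqrt s" using s by (simp add: power2_eq_square)
   then have "s\<^sup>2 * (1 / sqrt s) = s * sqrt s" using False by simp
   also have "\<dots> \<le> s * 1" using s by (intro mult_left_mono) auto
   finally show ?thesis by simp
  qed simp
  then have "K * (s\<^sup>2 * (1 / sqrt s)) \<le> K * s" by (intro mult_left_mono) (auto simp: K_def)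
  finally show "\<bar>\<Psi> x\<bar>\<^sup>2 \<le> K * \<bar>sin (mu * x)\<bar>" by (simp add: s_def)
 qed
 have d: "(\<Psi> has_real_derivative (1 / L) * D x + c * (lam x * cos (c * x))) (at x)" if "0 < x" "x < L" for x
 proof -
  have s: "sin (mu * x) \<noteq> 0" using sin_mu_pos[OF that] by simp
  have "((\<lambda>x. sin (c * x)) has_real_derivative c * cos (c * x)) (at x)" by (auto intro!: derivative_eq_intros)
  from DERIV_mult[OF lam_deriv[OF that] this] show ?thesis unfolding \<Psi>_def[abs_def] D(2)[OF s, symmetric] by (simp add: mult_ac)
 qed
 have "continuous_on {0..L} \<Psi>"
  unfolding continuous_on_def
 proof
  fix x assume x: "x \<in> {0..L}"
  show "(\<Psi> \<longlongrightarrow> \<Psi> x) (at x within {0..L})"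
  proof (cases "0 < x \<and> x < L")
   case True
   then show ?thesis using DERIV_isCont[OF d] by (auto simp: isCont_def intro: tendsto_within_subset)
  next
   case False
   then have z: "sin (mu * x) = 0" using x mu_L by (cases "x = 0") auto
   have "((\<lambda>y. sqrt (K * \<bar>sin (mu * y)\<bar>)) \<longlongrightarrow> sqrt (K * \<bar>sin (mu * x)\<bar>)) (at x within {0..L})" by (intro tendsto_intros)
   then have "((\<lambda>y. sqrt (K * \<bar>sin (mu * y)\<bar>)) \<longlongrightarrow> 0) (at x within {0..L})" by (simp add: z)
   then have "(\<Psi> \<longlongrightarrow> 0) (at x within {0..L})" by (rule Lim_null_comparison[rotated]) (simp add: bound)
   moreover have "\<Psi> x = 0" using bound[of x] z by simp
   ultimately show ?thesis by simp
  qed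
 qed
 then have hi: "((\<lambda>x. (1 / L) * D x + c * (lam x * cos (c * x))) has_integral \<Psi> L - \<Psi> 0) {0..L}"
  using d L_pos by (intro fundamental_theorem_of_calculus_interior) (auto simp: has_real_derivative_iff_has_vector_derivative)
 have l: "locint D" "locint (\<lambda>x. lam x * cos (c * x))"
  using locint_continuous[OF D(1)] L2_mult_locint[OF lam_L2 CS_L2(1)[of "Suc n"]] by (simp_all add: Cn_def c_def)
 have "\<Psi> L = 0" "\<Psi> 0 = 0" using bound[of L] bound[of 0] mu_L by simp_all
 then have "itg 0 L (\<lambda>x. (1 / L) * D x + c * (lam x * cos (c * x))) = 0"
  unfolding itg_eq_integral[OF locint_add[OF locint_cmult locint_cmult, OF l]] integral_unique[OF hi] by simp
 then have 1: "1 + c * itg 0 L (\<lambda>x. lam x * cos (c * x)) = 0"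
  using L_pos by (simp only: itg_add[OF locint_cmult locint_cmult, OF l] itg_cmult D(3)) simp
 have "y = - (1 / c)" if "1 + c * y = 0" for y using that c by (simp add: field_simps)
 from this[OF 1] show ?thesis by (simp add: Cn_def c_def)
qed

lemma Lam1_reflect: assumes h: "h \<in> \<L>2" shows "Lam1 h z = itg 0 L (\<lambda>x. lam x * h (z - x))"
proof -
 have l: "(\<lambda>x. h (z - x)) \<in> \<L>2" by (rule L2_reflect(1)[OF h])
 from itg_reflect[OF L2_mult_locint[OF lam_L2 l] periodic_mult[OF L2_periodic[OF lam_L2] L2_periodic[OF l]], of z]
 show ?thesis by (simp add: Lam1_def)
qed

text \<open>By the addition theorem, convolution with an even kernel has the trigonometric functions
  as eigenfunctions: the coefficient against the sine vanishes by symmetry, and the one against the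
  cosine is the eigenvalue.\<close>

lemma Lam1_trig:
 defines "c \<equiv> \<lambda>n. - (1 / (2 * mu * real (Suc n)))"
 shows "Lam1 (Cn (Suc n)) z = c n * Cn (Suc n) z" "Lam1 (Sn (Suc n)) z = c n * Sn (Suc n) z"
proof -
 let ?C = "Cn (Suc n)" and ?S = "Sn (Suc n)"
 have l: "locint (\<lambda>x. lam x * ?C x)" "locint (\<lambda>x. lam x * ?S x)" by (intro L2_mult_locint lam_L2 CS_L2)+
 have "periodic L (\<lambda>x. lam x * ?S x)" by (intro periodic_mult L2_periodic lam_L2 CS_L2)
 from itg_reflect[OF l(2) this, of 0] have "itg 0 L (\<lambda>x. - (lam x * ?S x)) = itg 0 L (\<lambda>x. lam x * ?S x)"
  by (simp add: lam_even Sn_def)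
 then have 0: "itg 0 L (\<lambda>x. lam x * ?S x) = 0" unfolding itg_minus by simp
 have 1: "lam x * ?C (z - x) = ?C z * (lam x * ?C x) + ?S z * (lam x * ?S x)"
  "lam x * ?S (z - x) = ?S z * (lam x * ?C x) - ?C z * (lam x * ?S x)" for x
  by (simp_all add: Cn_def Sn_def right_diff_distrib cos_diff sin_diff algebra_simps)
 show "Lam1 ?C z = c n * ?C z" "Lam1 ?S z = c n * ?S z"
  unfolding Lam1_reflect[OF CS_L2(1)] Lam1_reflect[OF CS_L2(2)] 1 c_def
  by (simp_all only: itg_add itg_diff locint_cmult l itg_cmult lam_coefficient 0) simp_all
qed

lemma Lam1_add: assumes "f \<in> \<L>2" "g \<in> \<L>2" shows "Lam1 (\<lambda>x. f x + g x) z = Lam1 f z + Lam1 g z"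
 unfolding Lam1_def using L2_mult_locint[OF L2_reflect(1)[OF lam_L2] assms(1), of z] L2_mult_locint[OF L2_reflect(1)[OF lam_L2] assms(2), of z]
 by (simp add: distrib_left itg_add)

lemma Lam1_cmult: "Lam1 (\<lambda>x. a * g x) z = a * Lam1 g z"
 unfolding Lam1_def itg_cmult[symmetric] by (simp add: mult_ac)

text \<open>One induction carries along what is needed of a partial sum: it lies in H^1, and the
  derivative of its potential is the conjugate partial sum. For the latter, the eigenvalue
  \<open>- (1 / w)\<close> of \<open>Lam1\<close> cancels the factor \<open>- w\<close> produced by
  differentiating the next term.\<close>

lemma four_approx:
 "\<exists>s s' c. dvt s s' \<and> toL2 s = toL2 (\<lambda>x. mean L f) + (\<Sum>n<N. four_term f n) \<and>
  c \<in> \<L>2 \<and> toL2 c = (\<Sum>n<N. conj_term f n) \<and> acd (Lam1 s) c"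
proof (induction N)
 case 0
 have "Lam1 (\<lambda>x. mean L f) = (\<lambda>z. itg 0 L (\<lambda>x. lam x * mean L f))" using Lam1_reflect[OF L2_const] by auto
 then show ?case using dvt_const[of "mean L f"] acd_const L2_const[of 0] toL2_zero
  by (intro exI[of _ "\<lambda>x. mean L f"] exI[of _ "\<lambda>x. 0"]) simp
next
 case (Suc N)
 then obtain s s' c where s: "dvt s s'" "toL2 s = toL2 (\<lambda>x. mean L f) + (\<Sum>n<N. four_term f n)"
  "c \<in> \<L>2" "toL2 c = (\<Sum>n<N. conj_term f n)" "acd (Lam1 s) c" by blast
 let ?n = "Suc N" 
 define w where "w = 2 * mu * real (Suc N)"
 let ?h = "\<lambda>x. (2 / L) * (fa f ?n * Cn ?n x + fb f ?n * Sn ?n x)" and ?k = "\<lambda>x. (2 / L) * (fa f ?n * Sn ?n x - fb f ?n * Cn ?n x)"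
 have w: "w \<noteq> 0" using mu_pos by (simp add: w_def)
 have hL: "?h \<in> \<L>2" "?k \<in> \<L>2" by (intro L2_cmult L2_add L2_diff CS_L2)+
 have CSd: "(Cn ?n has_real_derivative - (w * Sn ?n x)) (at x)" "(Sn ?n has_real_derivative w * Cn ?n x) (at x)" for x
  unfolding Cn_def[abs_def] Sn_def[abs_def] w_def by (auto intro!: derivative_eq_intros)
 have kc: "continuous_on UNIV ?k" unfolding Cn_def Sn_def by (intro continuous_intros)
 have hd: "(?h has_real_derivative (- w) * ?k x) (at x)" for x
  by (rule DERIV_cong[OF DERIV_cmult[OF DERIV_add[OF DERIV_cmult[OF CSd(1)] DERIV_cmult[OF CSd(2)]]]]) (simp add: algebra_simps)
 have hk: "((\<lambda>x. - (1 / w) * ?h x) has_real_derivative ?k x) (at x)" for x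
 proof (rule DERIV_cong[OF DERIV_cmult[OF hd]])
  show "- (1 / w) * ((- w) * y) = y" for y using w by simp
 qed
 from hd have h: "dvt ?h (\<lambda>x. (- w) * ?k x)" by (rule dvt_of_deriv) (intro continuous_on_mult continuous_on_const kc, rule L2_periodic[OF hL(1)])
 have "Lam1 ?h = (\<lambda>x. - (1 / w) * ?h x)"
  by (rule ext) (simp only: Lam1_cmult Lam1_add L2_cmult CS_L2 Lam1_trig w_def[symmetric], simp add: algebra_simps)
 then have "acd (Lam1 ?h) ?k" using acd_of_deriv[OF hk kc] by simp
 moreover have "Lam1 (\<lambda>x. s x + ?h x) = (\<lambda>z. Lam1 s z + Lam1 ?h z)" by (rule ext) (rule Lam1_add[OF dvtD(5)[OF s(1)] hL(1)])
 ultimately have "acd (Lam1 (\<lambda>x. s x + ?h x)) (\<lambda>x. c x + ?k x)" using acd_add[OF s(5)] by simp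
 moreover have "toL2 ?h = four_term f N" "toL2 ?k = conj_term f N"
  by (simp_all only: four_term_def conj_term_def toL2_cmult toL2_add toL2_diff L2_add L2_diff L2_cmult CS_L2)
 then have "toL2 (\<lambda>x. s x + ?h x) = toL2 (\<lambda>x. mean L f) + (\<Sum>n<Suc N. four_term f n)" "toL2 (\<lambda>x. c x + ?k x) = (\<Sum>n<Suc N. conj_term f n)"
  by (simp_all only: toL2_add[OF dvtD(5)[OF s(1)] hL(1)] toL2_add[OF s(3) hL(2)] s sum.lessThan_Suc add.assoc)
 ultimately show ?case using dvt_add[OF s(1) h] L2_add[OF s(3) hL(2)] by blast
qed

lemma H1_dense:
 assumes f: "f \<in> \<L>2" and e: "e > 0"
 shows "\<exists>g g'. dvt g g' \<and> norm (toL2 f - toL2 g) < e"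
proof -
 obtain N where N: "norm (toL2 (\<lambda>x. mean L f) + (\<Sum>n<N. four_term f n) - toL2 f) < e"
  using LIMSEQ_D[OF four_expansion[OF f] e] by blast
 obtain s s' where "dvt s s'" "toL2 s = toL2 (\<lambda>x. mean L f) + (\<Sum>n<N. four_term f n)" using four_approx[of f N] by blast
 then show ?thesis using N by (metis norm_minus_commute)
qed

text \<open>The periodic Hilbert transform, as the conjugate Fourier series; it is the derivative of the
 logarithmic potential \<open>Lam1 g\<close>.\<close>

definition Hil :: "(real => real) => real => real" where "Hil g = ofL2 (suminf (conj_term g))"

lemma toL2_Hil: assumes g: "g \<in> \<L>2" shows "toL2 (Hil g) = suminf (conj_term g)"
proof -
 interpret p: bounded_linear "\<lambda>x. toL2 (ofL2 x)" by (rule bounded_linear_toL2_ofL2)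
 have "toL2 (ofL2 (conj_term g n)) = conj_term g n" for n
  unfolding conj_term_def by (simp only: p.scaleR p.diff toL2_ofL2_toL2 CS_L2)
 then show ?thesis unfolding Hil_def p.suminf[OF conj_summable(1)[OF g]] by simp
qed

text \<open>Each conjugate term is orthogonal to \<open>g\<close>, because its two contributions are
  the same product of \<open>fa\<close> and \<open>fb\<close> with opposite signs. This skew
  symmetry preserves the mean of the vorticity.\<close>

lemma Hil_orthogonal: assumes g: "g \<in> \<L>2" shows "itg 0 L (\<lambda>x. Hil g x * g x) = 0"
proof -
 have "inner (conj_term g n) (toL2 g) = 0" for n
  by (simp add: conj_term_def inner_diff_left inner_toL2 CS_L2 g fa_def fb_def)
 then have "inner (suminf (conj_term g)) (toL2 g) = 0"
  using bounded_linear.suminf[OF bounded_linear_inner_left conj_summable(1)[OF g], of "toL2 g"] by simp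
 then show ?thesis using inner_toL2[OF _ g, of "Hil g"] by (simp add: toL2_Hil[OF g, symmetric]) (simp add: Hil_def ofL2_L2)
qed

text \<open>For partial sums this is \<open>four_approx\<close>. The potentials converge pointwise
  because \<open>lam\<close> is in L^2, the conjugate sums converge in L^2, and both limits pass
  through the formula for increments over at most one period.\<close>

theorem Lam1_dvt: assumes g: "g \<in> \<L>2" shows "dvt (Lam1 g) (Hil g)" and "nrm (Hil g) \<le> nrm g"
proof -
 have H: "Hil g \<in> \<L>2" by (simp add: Hil_def ofL2_L2)
 show "nrm (Hil g) \<le> nrm g" unfolding toL2_Hil[OF g] by (rule conj_summable(2)[OF g])
 obtain s c where s: "\<And>N. s N \<in> \<L>2" "\<And>N. toL2 (s N) = toL2 (\<lambda>x. mean L g) + (\<Sum>n<N. four_term g n)"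
  and c: "\<And>N. c N \<in> \<L>2" "\<And>N. toL2 (c N) = (\<Sum>n<N. conj_term g n)" "\<And>N. acd (Lam1 (s N)) (c N)"
  using four_approx[of g] dvtD(5) by metis
 have sl: "(\<lambda>N. toL2 (s N)) \<longlonglongrightarrow> toL2 g" unfolding s(2) by (rule four_expansion[OF g])
 have cl: "(\<lambda>N. toL2 (c N)) \<longlonglongrightarrow> toL2 (Hil g)" unfolding c(2) toL2_Hil[OF g] by (rule summable_LIMSEQ[OF conj_summable(1)[OF g]])
 have L: "(\<lambda>N. Lam1 (s N) z) \<longlonglongrightarrow> Lam1 g z" for z
 proof -
  have "(\<lambda>N. Lam1 (s N) z - Lam1 g z) \<longlonglongrightarrow> 0"
  proof (rule Lim_null_comparison)
   show "\<forall>\<^sub>F N in sequentially. norm (Lam1 (s N) z - Lam1 g z) \<le> nrm lam * norm (toL2 (s N) - toL2 g)"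
    using Lam1_sup[OF L2_diff[OF s(1) g]] by (simp add: Lam1_diff[OF s(1) g] toL2_diff[OF s(1) g])
   have "(\<lambda>N. toL2 (s N) - toL2 g) \<longlonglongrightarrow> 0" using sl by (simp add: LIM_zero_iff)
   then show "(\<lambda>N. nrm lam * norm (toL2 (s N) - toL2 g)) \<longlonglongrightarrow> 0" by (intro tendsto_mult_right_zero tendsto_norm_zero)
  qed
  then show ?thesis by (simp add: LIM_zero_iff)
 qed
 have "Lam1 g b - Lam1 g a = itg a b (Hil g)" if ab: "a \<le> b" "b \<le> a + L" for a b
  using LIMSEQ_unique[OF tendsto_diff[OF L L], of b a] itg_tendsto_L2[OF c(1) H cl ab] by (simp add: acdD[OF c(3) ab(1)])
 then have "acd (Lam1 g) (Hil g)" by (rule acd_of_short[OF L2_locint[OF H] L_pos])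
 then show "dvt (Lam1 g) (Hil g)" using Lam1_periodic H by (simp add: dvt_def)
qed

end

section \<open>Bounds for the cotangent and its regular part\<close>

definition kap :: real where "kap = (1 + cos (3 * pi / 4)) / 2"

lemma kap_pos: "kap > 0"
proof -
 have "cos (3 * pi / 4) = cos (pi - pi / 4)" by (rule arg_cong[where f=cos]) simp
 also have "\<dots> = - (sqrt 2 / 2)" unfolding cos_diff by (simp add: cos_45)
 finally show ?thesis using sqrt2_less_2 by (simp add: kap_def)
qed

text \<open>\<open>kap\<close> is the factor of \<open>sin_ge_linear\<close> at the right end point.
  Arguments reach \<open>3 * pi / 4\<close> because a circle diffeomorphism with derivative at least
  1/2 sends points at distance at most \<open>L / 2\<close> to points at distance at most
  \<open>3 * L / 4\<close>.\<close>

lemma sin_ge_kap: assumes "0 \<le> x" "x \<le> 3 * pi / 4" shows "kap * x \<le> sin x"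
proof -
 have "cos (3 * pi / 4) \<le> cos x" using assms by (intro cos_monotone_0_pi_le) auto
 then have "x * kap \<le> x * ((1 + cos x) / 2)" using assms by (intro mult_left_mono) (auto simp: kap_def)
 then show ?thesis using sin_ge_linear[of x] assms by (simp add: mult.commute)
qed

text \<open>The cotangent without its pole at 0. It is bounded and Lipschitz on
  \<open>{0<..3 * pi / 4}\<close>, so that only the term \<open>1 / x\<close> requires a
  cancellation.\<close>

definition gam :: "real => real" where "gam x = cot x - 1 / x"

lemma gam_minus: "gam (- x) = - gam x"
 by (simp add: gam_def cot_def)

lemma one_minus_cos_le: "1 - cos x \<le> x\<^sup>2 / 2" for x :: real
proof -
 have "1 - cos x = 2 * (sin (x/2))\<^sup>2" using cos_double_sin[of "x/2"] by simp
 also have "(sin (x/2))\<^sup>2 \<le> (x/2)\<^sup>2"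
  using power_mono[OF abs_sin_x_le_abs_x[of "x/2"] abs_ge_zero, of 2] by (simp only: power2_abs)
 finally show ?thesis by (simp add: power_divide)
qed

lemma gam_bound: assumes "0 < x" "x \<le> 3 * pi / 4" shows "\<bar>gam x\<bar> \<le> pi / kap"
proof -
 have s: "kap * x \<le> sin x" "0 < kap * x" using sin_ge_kap[of x] assms kap_pos by auto
 have 1: "0 \<le> sin x - x * cos x" using sin_ge_cos[of x] assms by simp
 have "sin x - x * cos x \<le> x * (1 - cos x)" using sin_x_le_x[of x] assms by (simp add: right_diff_distrib)
 also have "\<dots> \<le> x * (x\<^sup>2 / 2)" using one_minus_cos_le[of x] assms by (intro mult_left_mono) auto
 finally have 2: "sin x - x * cos x \<le> x * (x\<^sup>2 / 2)" .
 have "gam x = - ((sin x - x * cos x) / (x * sin x))" using assms s by (simp add: gam_def cot_def field_simps)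
 then have "\<bar>gam x\<bar> = (sin x - x * cos x) / (x * sin x)" using 1 s assms by simp
 also have "\<dots> \<le> (x * (x\<^sup>2 / 2)) / (x * (kap * x))" using 1 2 s assms by (intro frac_le mult_left_mono) auto
 also have "\<dots> = x / (2 * kap)" using assms by (simp add: power2_eq_square)
 also have "\<dots> \<le> pi / kap" using assms kap_pos by (simp add: field_simps)
 finally show ?thesis .
qed

lemma gam_deriv: assumes "0 < x" "x \<le> 3 * pi / 4"
 shows "(gam has_real_derivative 1 / x\<^sup>2 - 1 / (sin x)\<^sup>2) (at x)" "\<bar>1 / x\<^sup>2 - 1 / (sin x)\<^sup>2\<bar> \<le> 1 / kap\<^sup>2"
proof -
 have s: "kap * x \<le> sin x" "0 < kap * x" using sin_ge_kap[of x] assms kap_pos by auto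
 have c: "(cot has_real_derivative - 1 / (sin x)\<^sup>2) (at x)"
  using DERIV_cot[of x] s by (simp add: divide_inverse)
 show "(gam has_real_derivative 1 / x\<^sup>2 - 1 / (sin x)\<^sup>2) (at x)"
  unfolding gam_def[abs_def] using assms by (auto intro!: derivative_eq_intros c simp: power2_eq_square)
 have 1: "x - sin x \<le> x\<^sup>2 / 2 * x" "0 \<le> x - sin x"
 proof -
  have "x - sin x \<le> x * (1 - cos x)" using sin_ge_cos[of x] assms by (simp add: right_diff_distrib)
  also have "\<dots> \<le> x * (x\<^sup>2 / 2)" using one_minus_cos_le[of x] assms by (intro mult_left_mono) auto
  finally show "x - sin x \<le> x\<^sup>2 / 2 * x" by (simp add: mult.commute)
 qed (use sin_x_le_x[of x] assms in simp)
 have "1 / x\<^sup>2 - 1 / (sin x)\<^sup>2 = - ((x - sin x) * (x + sin x) / (x\<^sup>2 * (sin x)\<^sup>2))"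
  using s assms by (simp add: field_simps power2_eq_square)
 then have "\<bar>1 / x\<^sup>2 - 1 / (sin x)\<^sup>2\<bar> = (x - sin x) * (x + sin x) / (x\<^sup>2 * (sin x)\<^sup>2)"
  using 1 s assms by simp
 also have "\<dots> \<le> (x\<^sup>2 / 2 * x) * (2 * x) / (x\<^sup>2 * (kap * x)\<^sup>2)"
  using 1 s assms mult_pos_pos[OF zero_less_power[OF assms(1), of 2] zero_less_power[OF s(2), of 2]] by (intro frac_le mult_mono mult_left_mono power_mono) auto
 also have "\<dots> = 1 / kap\<^sup>2" using assms by (simp add: power2_eq_square)
 finally show "\<bar>1 / x\<^sup>2 - 1 / (sin x)\<^sup>2\<bar> \<le> 1 / kap\<^sup>2" .
qed

lemma gam_lip: assumes "0 < x" "x \<le> 3 * pi / 4" "0 < y" "y \<le> 3 * pi / 4"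
 shows "\<bar>gam x - gam y\<bar> \<le> (1 / kap\<^sup>2) * \<bar>x - y\<bar>"
proof -
 have "norm (gam x - gam y) \<le> (1 / kap\<^sup>2) * norm (x - y)"
  by (rule field_differentiable_bound[where S="{0<..3 * pi / 4}" and f'="\<lambda>x. 1 / x\<^sup>2 - 1 / (sin x)\<^sup>2"])
   (use assms gam_deriv in \<open>auto intro: DERIV_subset\<close>)
 then show ?thesis by simp
qed

text \<open>A difference quotient of \<open>F\<close> is an average of \<open>f\<close> between the
  two points. Both orders of \<open>y\<close> and \<open>z\<close> occur, and the quotient is
  symmetric in them.\<close>

lemma acd_quotient_near:
 assumes F: "acd F f" and n: "z \<noteq> y" and B: "\<And>s. min y z \<le> s ==> s \<le> max y z ==> \<bar>c - f s\<bar> \<le> B"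
 shows "\<bar>c - (F z - F y) / (z - y)\<bar> \<le> B"
proof -
 have *: "\<bar>c - (F q - F p) / (q - p)\<bar> \<le> B" if pq: "p < q" "\<And>s. p \<le> s ==> s \<le> q ==> \<bar>c - f s\<bar> \<le> B" for p q
 proof -
  have "c * (q - p) - (F q - F p) = itg p q (\<lambda>s. c - f s)"
   using acdD[OF F, of p q] pq(1) by (simp add: itg_diff locint_const acd_locint[OF F] itg_const mult.commute)
  then have "\<bar>c * (q - p) - (F q - F p)\<bar> \<le> (q - p) * B"
   using itg_abs_bound[of "\<lambda>s. c - f s" p q B] pq by (simp add: locint_diff locint_const acd_locint[OF F])
  then have "\<bar>c * (q - p) - (F q - F p)\<bar> / (q - p) \<le> B" using pq(1) by (simp add: field_simps)
  moreover have "c - (F q - F p) / (q - p) = (c * (q - p) - (F q - F p)) / (q - p)" using pq(1) by (simp add: field_simps)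
  ultimately show ?thesis using pq(1) by simp
 qed
 show ?thesis
 proof (cases "y < z")
  case True
  then show ?thesis using *[of y z] B by (simp add: min_def max_def)
 next
  case False
  then have "(F z - F y) / (z - y) = (F y - F z) / (y - z)" using n by (simp add: field_simps)
  then show ?thesis using *[of z y] B False n by (simp add: min_def max_def)
 qed
qed

context circle
begin

section \<open>Integral operators with weakly singular kernels\<close>

lemma wgt_even: "wgt (- x) = wgt x" by (simp add: wgt_def)

definition Wt :: real where "Wt = itg 0 L wgt"

lemma Wt_nonneg: "Wt \<ge> 0" unfolding Wt_def by (intro itg_nonneg wgt_nonneg)

lemma wgt_ge: assumes "sin (mu * h) \<noteq> 0" shows "1 \<le> wgt h" "h \<noteq> 0 ==> 1 / sqrt \<bar>h\<bar> \<le> sqrt mu * wgt h"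
proof -
 have s: "0 < \<bar>sin (mu * h)\<bar>" using assms by simp
 have "sqrt \<bar>sin (mu * h)\<bar> \<le> 1" by simp
 then show "1 \<le> wgt h" using s by (simp add: wgt_def)
 assume h: "h \<noteq> 0"
 have "sqrt \<bar>sin (mu * h)\<bar> \<le> sqrt (mu * \<bar>h\<bar>)"
  using abs_sin_x_le_abs_x[of "mu * h"] mu_pos by (simp add: abs_mult)
 then have "1 / sqrt (mu * \<bar>h\<bar>) \<le> 1 / sqrt \<bar>sin (mu * h)\<bar>" using s h mu_pos by (intro divide_left_mono) auto
 then show "1 / sqrt \<bar>h\<bar> \<le> sqrt mu * wgt h" using mu_pos h by (simp add: wgt_def real_sqrt_mult field_simps)
qed

lemma nn_periodic:
 assumes G: "locint G" "periodic L G" "\<And>x. 0 \<le> G x" and ab: "a \<le> b" "b \<le> a + L"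
 shows "(\<integral>\<^sup>+x. ennreal (G (x - y)) * indicator {a..b} x \<partial>lborel) \<le> ennreal (itg 0 L G)"
proof -
 have l: "locint (\<lambda>x. G (x - y))"
  unfolding locint_def
 proof (intro conjI allI)
  show "(\<lambda>x. G (x - y)) \<in> borel_measurable borel" using locint_measurable[OF G(1)] by measurable
  show "set_integrable lborel {a..b} (\<lambda>x. G (x - y))" for a b
   using locint_set_integrable[OF G(1), of "a - y" "b - y"] set_integrable_shift[of a "-y" b G] by simp
 qed
 have "(\<integral>\<^sup>+x. ennreal (G (x - y)) * indicator {a..b} x \<partial>lborel) = (\<integral>\<^sup>+x. ennreal (indicator {a..b} x *\<^sub>R G (x - y)) \<partial>lborel)"
  by (rule nn_integral_cong) (auto simp: indicator_def)
 also have "\<dots> = ennreal (itg a b (\<lambda>x. G (x - y)))"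
  unfolding itg_def set_lebesgue_integral_def
  by (rule nn_integral_eq_integral) (use l G(3) in \<open>auto simp: locint_def set_integrable_def\<close>)
 also have "itg a b (\<lambda>x. G (x - y)) \<le> itg a (a + L) (\<lambda>x. G (x - y))"
  by (rule itg_subinterval_mono[OF l]) (use ab G(3) in auto)
 also have "\<dots> = itg (a - y) ((a - y) + L) G" using itg_shift[of a "-y" "a + L" G] by (simp add: algebra_simps)
 also have "\<dots> = itg 0 L G" by (rule itg_period[OF G(1,2)])
 finally show ?thesis by (simp add: ennreal_leI)
qed

lemma nn_wgt:
 assumes "a \<le> b" "b \<le> a + L"
 shows "(\<integral>\<^sup>+x. ennreal (wgt (x - y)) * indicator {a..b} x \<partial>lborel) \<le> ennreal Wt"
 unfolding Wt_def by (rule nn_periodic[OF wgt_locint wgt_periodic wgt_nonneg assms])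

text \<open>Fubini under domination by a convolution kernel: integrating \<open>G (x - y)\<close> in
  \<open>x\<close> first costs a constant, and the integral of \<open>\<bar>g\<bar>\<close> remains.
  \<open>G\<close> is left general since it is \<open>wgt\<close> for the Lagrangian kernels and the
  modulus of a derivative in \<open>Lam1_H1\<close>.\<close>

lemma kernel_swap:
 assumes m: "(\<lambda>(x, y). f x y) \<in> borel_measurable (borel \<Otimes>\<^sub>M borel)"
  and b: "\<And>x y. \<bar>f x y\<bar> \<le> C * (G (x - y) * \<bar>g y\<bar>)" and C: "C \<ge> 0" and g: "locint g"
  and G: "locint G" "periodic L G" "\<And>x. 0 \<le> G x" and ab: "a \<le> b" "b \<le> a + L"
 shows "itg 0 L (\<lambda>y. itg a b (\<lambda>x. f x y)) = itg a b (\<lambda>x. itg 0 L (\<lambda>y. f x y))"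
  and "set_integrable lborel {a..b} (\<lambda>x. itg 0 L (\<lambda>y. f x y))"
proof -
 define F where "F = (\<lambda>x y. indicator {a..b} x *\<^sub>R (indicator {0..L} y *\<^sub>R f x y))"
 have gm: "g \<in> borel_measurable borel" by (rule locint_measurable[OF g])
 have Fm: "(\<lambda>p. F (fst p) (snd p)) \<in> borel_measurable (lborel \<Otimes>\<^sub>M lborel)"
  using m unfolding F_def split_beta' by measurable
 have i: "integrable (lborel \<Otimes>\<^sub>M lborel) (case_prod F)"
 proof (rule integrableI_bounded)
  show "case_prod F \<in> borel_measurable (lborel \<Otimes>\<^sub>M lborel)" using Fm by (simp add: split_beta')
  have "(\<integral>\<^sup>+p. ennreal (norm (case_prod F p)) \<partial>(lborel \<Otimes>\<^sub>M lborel)) = (\<integral>\<^sup>+y. \<integral>\<^sup>+x. ennreal (norm (F x y)) \<partial>lborel \<partial>lborel)"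
   using Fm by (subst lborel_pair.nn_integral_snd[symmetric]) (auto simp: split_beta')
  also have "\<dots> \<le> (\<integral>\<^sup>+y. ennreal (C * \<bar>indicator {0..L} y *\<^sub>R g y\<bar>) * ennreal (itg 0 L G) \<partial>lborel)"
  proof (rule nn_integral_mono)
   fix y
   have "(\<integral>\<^sup>+x. ennreal (norm (F x y)) \<partial>lborel) \<le> (\<integral>\<^sup>+x. ennreal (C * \<bar>indicator {0..L} y *\<^sub>R g y\<bar>) * (ennreal (G (x - y)) * indicator {a..b} x) \<partial>lborel)"
   proof (rule nn_integral_mono)
    fix x
    have "norm (F x y) \<le> C * \<bar>indicator {0..L} y *\<^sub>R g y\<bar> * (G (x - y) * indicator {a..b} x)"
     using b[of x y] C G(3) by (simp add: F_def indicator_def mult_ac)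
    then show "ennreal (norm (F x y)) \<le> ennreal (C * \<bar>indicator {0..L} y *\<^sub>R g y\<bar>) * (ennreal (G (x - y)) * indicator {a..b} x)"
     using C G(3) by (subst ennreal_indicator[symmetric], subst ennreal_mult[symmetric], simp, simp, subst ennreal_mult[symmetric]) (auto intro: ennreal_leI)
   qed
   also have "\<dots> = ennreal (C * \<bar>indicator {0..L} y *\<^sub>R g y\<bar>) * (\<integral>\<^sup>+x. ennreal (G (x - y)) * indicator {a..b} x \<partial>lborel)"
    by (rule nn_integral_cmult) (use locint_measurable[OF G(1)] in measurable)
   also have "\<dots> \<le> ennreal (C * \<bar>indicator {0..L} y *\<^sub>R g y\<bar>) * ennreal (itg 0 L G)" by (intro mult_left_mono nn_periodic[OF G ab]) simp
   finally show "(\<integral>\<^sup>+x. ennreal (norm (F x y)) \<partial>lborel) \<le> ennreal (C * \<bar>indicator {0..L} y *\<^sub>R g y\<bar>) * ennreal (itg 0 L G)" .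
  qed
  also have "\<dots> = (\<integral>\<^sup>+y. ennreal (C * \<bar>indicator {0..L} y *\<^sub>R g y\<bar>) \<partial>lborel) * ennreal (itg 0 L G)"
   by (rule nn_integral_multc) (use gm in measurable)
  also have "(\<integral>\<^sup>+y. ennreal (C * \<bar>indicator {0..L} y *\<^sub>R g y\<bar>) \<partial>lborel) = ennreal (LINT y|lborel. C * \<bar>indicator {0..L} y *\<^sub>R g y\<bar>)"
   by (rule nn_integral_eq_integral) (use g C in \<open>auto simp: locint_def set_integrable_def\<close>)
  also have "\<dots> * ennreal (itg 0 L G) < \<infinity>" by (simp add: ennreal_mult_less_top)
  finally show "(\<integral>\<^sup>+p. ennreal (norm (case_prod F p)) \<partial>(lborel \<Otimes>\<^sub>M lborel)) < \<infinity>" .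
 qed
 have e: "itg a b (\<lambda>x. itg 0 L (f x)) = (LINT x|lborel. LINT y|lborel. F x y)"
  "itg 0 L (\<lambda>y. itg a b (\<lambda>x. f x y)) = (LINT y|lborel. LINT x|lborel. F x y)"
  unfolding itg_def set_lebesgue_integral_def F_def
  by (auto intro!: Bochner_Integration.integral_cong simp flip: integral_scaleR_right simp: indicator_def)
 show "itg 0 L (\<lambda>y. itg a b (\<lambda>x. f x y)) = itg a b (\<lambda>x. itg 0 L (\<lambda>y. f x y))"
  unfolding e by (rule lborel_pair.Fubini_integral[OF i])
 have "integrable lborel (\<lambda>x. LINT y|lborel. F x y)" using lborel_pair.integrable_fst[OF i] by simp
 moreover have "(LINT y|lborel. F x y) = indicator {a..b} x *\<^sub>R itg 0 L (\<lambda>y. f x y)" for x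
  unfolding itg_def set_lebesgue_integral_def F_def by simp
 ultimately show "set_integrable lborel {a..b} (\<lambda>x. itg 0 L (\<lambda>y. f x y))" by (simp add: set_integrable_def)
qed

lemma kernel_measurable:
 assumes m: "(\<lambda>(x, y). f x y) \<in> borel_measurable (borel \<Otimes>\<^sub>M borel)"
 shows "(\<lambda>x. itg a b (\<lambda>y. f x y)) \<in> borel_measurable borel"
proof -
 have "(\<lambda>x. LINT y|lborel. indicator {a..b} y *\<^sub>R f x y) \<in> borel_measurable borel"
  by (rule sigma_finite_measure.borel_measurable_lebesgue_integral[OF sigma_finite_lborel]) (use m in \<open>simp add: split_beta'\<close>)
 then show ?thesis by (simp add: itg_def set_lebesgue_integral_def)
qed

text \<open>The weight is split into two square roots and Cauchy-Schwarz is applied for fixed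
  \<open>z\<close>. One factor integrates to \<open>Wt\<close>; the other is the convolution of
  \<open>wgt\<close> with the square of \<open>g\<close>, whose integral in \<open>z\<close> gives
  the second \<open>Wt\<close>. Nonnegative integrals are used throughout, so square integrability
  is a result.\<close>

lemma Schur:
 assumes m: "(\<lambda>(z, y). k z y) \<in> borel_measurable (borel \<Otimes>\<^sub>M borel)"
  and b: "\<And>z y. \<bar>k z y\<bar> \<le> C * wgt (z - y)" and C: "C \<ge> 0" and p: "\<And>z y. k (z + L) y = k z y" and g: "g \<in> \<L>2"
 shows "(\<lambda>z. itg 0 L (\<lambda>y. k z y * g y)) \<in> \<L>2"
  "nrm (\<lambda>z. itg 0 L (\<lambda>y. k z y * g y)) \<le> C * Wt * nrm g"
proof -
 define K where "K z = itg 0 L (\<lambda>y. k z y * g y)" for z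
 have gm: "g \<in> borel_measurable borel" by (rule L2_measurable[OF g])
 have "(\<lambda>(z, y). k z y * g y) \<in> borel_measurable (borel \<Otimes>\<^sub>M borel)"
  using m gm unfolding split_beta' by measurable
 then have Km: "K \<in> borel_measurable borel" unfolding K_def by (rule kernel_measurable)
 have Kp: "periodic L K" by (simp add: periodic_def K_def p)
 define I :: "real => ennreal" where "I = indicator {0..L}"
 have wm: "(\<lambda>y. wgt (z - y)) \<in> borel_measurable borel" for z using wgt_measurable by measurable
 have pt: "ennreal ((K z)\<^sup>2) \<le> ennreal (C\<^sup>2 * Wt) * (\<integral>\<^sup>+y. ennreal (wgt (z - y) * (g y)\<^sup>2) * I y \<partial>lborel)" for z
 proof -
  have "ennreal \<bar>K z\<bar> \<le> (\<integral>\<^sup>+y. ennreal (norm (indicator {0..L} y *\<^sub>R (k z y * g y))) \<partial>lborel)"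
   using integral_norm_bound_ennreal[of lborel "\<lambda>y. indicator {0..L} y *\<^sub>R (k z y * g y)"]
   by (cases "integrable lborel (\<lambda>y. indicator {0..L} y *\<^sub>R (k z y * g y))")
    (simp_all add: K_def itg_def set_lebesgue_integral_def not_integrable_integral_eq)
  also have "\<dots> \<le> (\<integral>\<^sup>+y. ennreal C * ((ennreal (sqrt (wgt (z - y))) * I y) * (ennreal (sqrt (wgt (z - y)) * \<bar>g y\<bar>) * I y)) \<partial>lborel)"
  proof (rule nn_integral_mono)
   fix y
   have "\<bar>k z y * g y\<bar> \<le> C * (sqrt (wgt (z - y)) * (sqrt (wgt (z - y)) * \<bar>g y\<bar>))"
    using mult_right_mono[OF b[of z y], of "\<bar>g y\<bar>"] wgt_nonneg[of "z - y"] by (simp add: abs_mult mult.assoc[symmetric])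
   then show "ennreal (norm (indicator {0..L} y *\<^sub>R (k z y * g y))) \<le> ennreal C * ((ennreal (sqrt (wgt (z - y))) * I y) * (ennreal (sqrt (wgt (z - y)) * \<bar>g y\<bar>) * I y))"
    using C wgt_nonneg[of "z - y"] by (auto simp: I_def indicator_def ennreal_mult[symmetric] intro!: ennreal_leI)
  qed
  also have "\<dots> = ennreal C * (\<integral>\<^sup>+y. (ennreal (sqrt (wgt (z - y))) * I y) * (ennreal (sqrt (wgt (z - y)) * \<bar>g y\<bar>) * I y) \<partial>lborel)"
   by (rule nn_integral_cmult) (use gm wm in \<open>simp add: I_def\<close>)
  finally have "(ennreal \<bar>K z\<bar>)\<^sup>2 \<le> (ennreal C * (\<integral>\<^sup>+y. (ennreal (sqrt (wgt (z - y))) * I y) * (ennreal (sqrt (wgt (z - y)) * \<bar>g y\<bar>) * I y) \<partial>lborel))\<^sup>2"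
   by (rule power_mono) simp
  also have "\<dots> = (ennreal C)\<^sup>2 * (\<integral>\<^sup>+y. (ennreal (sqrt (wgt (z - y))) * I y) * (ennreal (sqrt (wgt (z - y)) * \<bar>g y\<bar>) * I y) \<partial>lborel)\<^sup>2"
   by (rule power_mult_distrib)
  also have "\<dots> \<le> (ennreal C)\<^sup>2 * ((\<integral>\<^sup>+y. (ennreal (sqrt (wgt (z - y))) * I y)\<^sup>2 \<partial>lborel) * (\<integral>\<^sup>+y. (ennreal (sqrt (wgt (z - y)) * \<bar>g y\<bar>) * I y)\<^sup>2 \<partial>lborel))"
   by (intro mult_left_mono Cauchy_Schwarz_nn_integral) (use gm wm in \<open>auto simp: I_def\<close>)
  also have "(\<integral>\<^sup>+y. (ennreal (sqrt (wgt (z - y))) * I y)\<^sup>2 \<partial>lborel) = (\<integral>\<^sup>+y. ennreal (wgt (y - z)) * indicator {0..0+L} y \<partial>lborel)"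
   using wgt_nonneg wgt_even[of "z - _"] by (intro nn_integral_cong) (auto simp: I_def indicator_def power_mult_distrib ennreal_power)
  also have "(\<integral>\<^sup>+y. (ennreal (sqrt (wgt (z - y)) * \<bar>g y\<bar>) * I y)\<^sup>2 \<partial>lborel) = (\<integral>\<^sup>+y. ennreal (wgt (z - y) * (g y)\<^sup>2) * I y \<partial>lborel)"
   using wgt_nonneg by (intro nn_integral_cong) (auto simp: I_def indicator_def power_mult_distrib ennreal_power)
  also have "(ennreal C)\<^sup>2 * ((\<integral>\<^sup>+y. ennreal (wgt (y - z)) * indicator {0..0+L} y \<partial>lborel) * (\<integral>\<^sup>+y. ennreal (wgt (z - y) * (g y)\<^sup>2) * I y \<partial>lborel))
   \<le> (ennreal C)\<^sup>2 * (ennreal Wt * (\<integral>\<^sup>+y. ennreal (wgt (z - y) * (g y)\<^sup>2) * I y \<partial>lborel))"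
   by (intro mult_left_mono mult_right_mono nn_wgt) (use L_pos in auto)
  also have "\<dots> = ennreal (C\<^sup>2 * Wt) * (\<integral>\<^sup>+y. ennreal (wgt (z - y) * (g y)\<^sup>2) * I y \<partial>lborel)"
   using C Wt_nonneg by (simp add: ennreal_mult ennreal_power mult.assoc)
  finally show ?thesis by (simp add: ennreal_power)
 qed
 have wm2: "(\<lambda>p. wgt (fst p - snd p)) \<in> borel_measurable (borel \<Otimes>\<^sub>M borel)" using wgt_measurable by measurable
 have "(\<integral>\<^sup>+z. ennreal ((K z)\<^sup>2) * I z \<partial>lborel) \<le> (\<integral>\<^sup>+z. ennreal (C\<^sup>2 * Wt) * (\<integral>\<^sup>+y. ennreal (wgt (z - y) * (g y)\<^sup>2) * I y * I z \<partial>lborel) \<partial>lborel)"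
 proof (rule nn_integral_mono)
  fix z
  show "ennreal ((K z)\<^sup>2) * I z \<le> ennreal (C\<^sup>2 * Wt) * (\<integral>\<^sup>+y. ennreal (wgt (z - y) * (g y)\<^sup>2) * I y * I z \<partial>lborel)"
   using pt[of z] by (auto simp: I_def indicator_def)
 qed
 also have "\<dots> = ennreal (C\<^sup>2 * Wt) * (\<integral>\<^sup>+z. (\<integral>\<^sup>+y. ennreal (wgt (z - y) * (g y)\<^sup>2) * I y * I z \<partial>lborel) \<partial>lborel)"
  by (rule nn_integral_cmult) (use gm wm2 in \<open>measurable; simp add: I_def split_beta'\<close>)
 also have "(\<integral>\<^sup>+z. (\<integral>\<^sup>+y. ennreal (wgt (z - y) * (g y)\<^sup>2) * I y * I z \<partial>lborel) \<partial>lborel) = (\<integral>\<^sup>+y. (\<integral>\<^sup>+z. ennreal (wgt (z - y) * (g y)\<^sup>2) * I y * I z \<partial>lborel) \<partial>lborel)"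
  by (rule lborel_pair.Fubini'[symmetric]) (use gm wm2 in \<open>simp add: I_def split_beta'\<close>)
 also have "\<dots> \<le> (\<integral>\<^sup>+y. ennreal Wt * (ennreal ((g y)\<^sup>2) * I y) \<partial>lborel)"
 proof (rule nn_integral_mono)
  fix y
  have "(\<integral>\<^sup>+z. ennreal (wgt (z - y) * (g y)\<^sup>2) * I y * I z \<partial>lborel) = (\<integral>\<^sup>+z. (ennreal ((g y)\<^sup>2) * I y) * (ennreal (wgt (z - y)) * indicator {0..0+L} z) \<partial>lborel)"
   using wgt_nonneg by (intro nn_integral_cong) (simp add: I_def ennreal_mult mult_ac)
  also have "\<dots> = (ennreal ((g y)\<^sup>2) * I y) * (\<integral>\<^sup>+z. ennreal (wgt (z - y)) * indicator {0..0+L} z \<partial>lborel)"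
   by (rule nn_integral_cmult) (use wgt_measurable in measurable)
  also have "\<dots> \<le> (ennreal ((g y)\<^sup>2) * I y) * ennreal Wt" by (intro mult_left_mono nn_wgt) (use L_pos in auto)
  finally show "(\<integral>\<^sup>+z. ennreal (wgt (z - y) * (g y)\<^sup>2) * I y * I z \<partial>lborel) \<le> ennreal Wt * (ennreal ((g y)\<^sup>2) * I y)"
   by (simp add: mult.commute)
 qed
 also have "\<dots> = ennreal Wt * (\<integral>\<^sup>+y. ennreal ((g y)\<^sup>2) * I y \<partial>lborel)"
  by (rule nn_integral_cmult) (use gm in \<open>simp add: I_def\<close>)
 also have "(\<integral>\<^sup>+y. ennreal ((g y)\<^sup>2) * I y \<partial>lborel) = ennreal ((nrm g)\<^sup>2)"
 proof -
  have "(\<integral>\<^sup>+y. ennreal ((g y)\<^sup>2) * I y \<partial>lborel) = (\<integral>\<^sup>+y. ennreal (indicator {0..L} y *\<^sub>R (g y)\<^sup>2) \<partial>lborel)"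
   by (rule nn_integral_cong) (auto simp: I_def indicator_def)
  also have "\<dots> = ennreal (itg 0 L (\<lambda>y. (g y)\<^sup>2))"
   unfolding itg_def set_lebesgue_integral_def by (rule nn_integral_eq_integral) (use g in \<open>auto simp: L2_circle_def set_integrable_def\<close>)
  finally show ?thesis by (simp add: norm_toL2_sq[OF g])
 qed
 also have "ennreal (C\<^sup>2 * Wt) * (ennreal Wt * ennreal ((nrm g)\<^sup>2)) = ennreal ((C * Wt * nrm g)\<^sup>2)"
  using Wt_nonneg C by (subst ennreal_mult[symmetric], simp, simp, subst ennreal_mult[symmetric]) (auto simp: power2_eq_square mult_ac)
 finally have le: "(\<integral>\<^sup>+z. ennreal (indicator {0..L} z *\<^sub>R (K z)\<^sup>2) \<partial>lborel) \<le> ennreal ((C * Wt * nrm g)\<^sup>2)"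
  by (rule order_trans[rotated]) (auto intro!: nn_integral_mono mult_left_mono simp: I_def indicator_def)
 have "integrable lborel (\<lambda>z. indicator {0..L} z *\<^sub>R (K z)\<^sup>2)"
  by (rule integrableI_bounded) (use Km le in \<open>auto intro: le_less_trans\<close>)
 then have KL: "K \<in> \<L>2" and i: "set_integrable lborel {0..L} (\<lambda>z. (K z)\<^sup>2)"
  using Km Kp by (auto simp: L2_circle_def set_integrable_def)
 have "ennreal (itg 0 L (\<lambda>z. (K z)\<^sup>2)) = (\<integral>\<^sup>+z. ennreal (indicator {0..L} z *\<^sub>R (K z)\<^sup>2) \<partial>lborel)"
  unfolding itg_def set_lebesgue_integral_def
  by (rule nn_integral_eq_integral[symmetric]) (use i in \<open>auto simp: set_integrable_def\<close>)
 then have "ennreal ((nrm K)\<^sup>2) \<le> ennreal ((C * Wt * nrm g)\<^sup>2)" using le norm_toL2_sq[OF KL] by simp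
 then have "(nrm K)\<^sup>2 \<le> (C * Wt * nrm g)\<^sup>2" by (subst (asm) ennreal_le_iff) auto
 then have "nrm K \<le> C * Wt * nrm g" by (rule power2_le_imp_le) (use C Wt_nonneg in auto)
 then show "nrm (\<lambda>z. itg 0 L (\<lambda>y. k z y * g y)) \<le> C * Wt * nrm g" "(\<lambda>z. itg 0 L (\<lambda>y. k z y * g y)) \<in> \<L>2"
  using KL by (simp_all add: K_def[abs_def])
qed


section \<open>The potential in Lagrangian coordinates\<close>

text \<open>\<open>adm \<rho> r\<close>: \<open>\<rho>\<close> is the derivative of a bi-Lipschitz diffeomorphism \<open>eta \<rho>\<close> of the circle, with weak
 derivative \<open>r\<close>. \<open>Lam \<rho> g\<close> is the logarithmic potential in the corresponding Lagrangian coordinate.\<close>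

definition adm :: "(real => real) => (real => real) => bool" where
 "adm \<rho> r \<longleftrightarrow> dvt \<rho> r \<and> (\<forall>x. 1/2 \<le> \<rho> x) \<and> itg 0 L \<rho> = L"

definition eta :: "(real => real) => real => real" where
 "eta \<rho> z = (if 0 \<le> z then itg 0 z \<rho> else - itg z 0 \<rho>)"

definition Lam :: "(real => real) => (real => real) => real => real" where
 "Lam \<rho> g z = itg 0 L (\<lambda>y. lam (eta \<rho> z - eta \<rho> y) * g y)"

text \<open>The derivative in \<open>z\<close> of
  \<open>lam (eta \<rho> z - eta \<rho> y) - lam (z - y)\<close> away from the singular points. The
  chain rule gives the factor \<open>\<rho> z\<close>, and subtracting the flat kernel removes the
  pole.\<close>

definition kern :: "(real => real) => real => real => real" where
 "kern \<rho> z y = (1 / L) * (\<rho> z * cot (mu * (eta \<rho> z - eta \<rho> y)) - cot (mu * (z - y)))"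

lemma adm_one: "adm (\<lambda>x. 1) (\<lambda>x. 0)"
 using dvt_const[of 1] L_pos by (simp add: adm_def itg_const)

lemma eta_one: "eta (\<lambda>x. 1) = (\<lambda>z. z)"
 by (rule ext) (simp add: eta_def itg_const)

lemma Lam_one: "Lam (\<lambda>x. 1) g = Lam1 g"
 by (rule ext) (simp add: Lam_def Lam1_def eta_one)

lemma kern_one: "kern (\<lambda>x. 1) z y = 0"
 by (simp add: kern_def eta_one)

context
 fixes \<rho> r assumes a: "adm \<rho> r"
begin

lemma adm_dvt: "dvt \<rho> r" using a by (simp add: adm_def)
lemma adm_ge: "1/2 \<le> \<rho> x" using a by (simp add: adm_def)
lemma adm_pos: "0 < \<rho> x" using adm_ge[of x] by linarith
lemma adm_cont: "continuous_on UNIV \<rho>" by (rule dvtD(4)[OF adm_dvt])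
lemma adm_r: "r \<in> \<L>2" by (rule dvtD(2)[OF adm_dvt])
lemma adm_locint: "locint \<rho>" by (rule locint_continuous[OF adm_cont])

lemma eta_acd: "acd (eta \<rho>) \<rho>"
 unfolding eta_def[abs_def] by (rule acd_indefinite[OF adm_locint])

lemma eta_deriv: "(eta \<rho> has_real_derivative \<rho> x) (at x)"
 by (rule acd_has_deriv[OF eta_acd adm_cont])

lemma eta_cont: "continuous_on UNIV (eta \<rho>)" by (rule acd_continuous[OF eta_acd])

lemma eta_shift: "eta \<rho> (z + L) = eta \<rho> z + L"
 using acdD[OF eta_acd, of z "z + L"] L_pos itg_period[OF adm_locint dvtD(1)[OF adm_dvt], of z] a by (simp add: adm_def)

lemma eta_lower: "y \<le> z ==> (z - y) / 2 \<le> eta \<rho> z - eta \<rho> y"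
 using acdD[OF eta_acd, of y z] itg_mono[OF locint_const[of "1/2"] adm_locint, of y z] adm_ge by (simp add: itg_const)

lemma adm_dev: "\<bar>\<rho> x - 1\<bar> \<le> sqrt L * nrm r"
proof -
 have "dvt (\<lambda>x. \<rho> x - 1) (\<lambda>x. r x - 0)" by (rule dvt_diff[OF adm_dvt dvt_const])
 moreover have "itg 0 L (\<lambda>x. \<rho> x - 1) = 0" using a L_pos by (simp add: adm_def itg_diff adm_locint locint_const itg_const)
 ultimately show ?thesis using dvt_mean_zero_sup by simp
qed

text \<open>\<open>t\<close> is the mean slope of \<open>eta \<rho>\<close> between the points: at
  least 1/2, and near \<open>\<rho> z\<close> by the Hoelder bound for \<open>\<rho>\<close>. The
  distance of the images is bounded above by means of the complementary arc.\<close>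

lemma eta_quotient:
 assumes n: "z \<noteq> y" and h: "\<bar>z - y\<bar> \<le> L / 2"
 defines "t \<equiv> (eta \<rho> z - eta \<rho> y) / (z - y)"
 shows "1/2 \<le> t" "\<bar>z - y\<bar> * t \<le> 3 * L / 4" "\<bar>\<rho> z - t\<bar> \<le> nrm r * sqrt \<bar>z - y\<bar>"
  "eta \<rho> z - eta \<rho> y = (z - y) * t"
proof -
 show e: "eta \<rho> z - eta \<rho> y = (z - y) * t" using n by (simp add: t_def)
 have *: "1/2 \<le> (eta \<rho> q - eta \<rho> p) / (q - p) \<and> (eta \<rho> q - eta \<rho> p) \<le> 3 * L / 4" if "p < q" "q - p \<le> L / 2" for p q
 proof -
  \<comment> \<open>The complementary arc has length at least \<open>L / 2\<close>, so its image has
    length at least \<open>L / 4\<close>, and \<open>3 * L / 4\<close> is left for the other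
    arc.\<close>
  have "(p + L - q) / 2 \<le> eta \<rho> (p + L) - eta \<rho> q" using that L_pos by (intro eta_lower) simp
  then have "eta \<rho> q - eta \<rho> p \<le> 3 * L / 4" using that unfolding eta_shift by (simp add: field_simps)
  moreover have "(q - p) / 2 \<le> eta \<rho> q - eta \<rho> p" using that by (intro eta_lower) simp
  then have "1/2 \<le> (eta \<rho> q - eta \<rho> p) / (q - p)" using that by (simp add: field_simps)
  ultimately show ?thesis by simp
 qed
 have "1/2 \<le> t \<and> \<bar>z - y\<bar> * t \<le> 3 * L / 4"
 proof (cases "y < z")
  case True
  then have "\<bar>z - y\<bar> * t = eta \<rho> z - eta \<rho> y" using e by simp
  then show ?thesis using *[of y z, folded t_def] h True by simp
 next
  case False
  have t: "(eta \<rho> y - eta \<rho> z) / (y - z) = t"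
   unfolding t_def using minus_divide_divide[of "eta \<rho> z - eta \<rho> y" "z - y"] by simp
  have "\<bar>z - y\<bar> * t = eta \<rho> y - eta \<rho> z" using e False by (simp add: abs_if left_diff_distrib)
  then show ?thesis using *[of z y, unfolded t] h n False by simp
 qed
 then show "1/2 \<le> t" "\<bar>z - y\<bar> * t \<le> 3 * L / 4" by auto
 show "\<bar>\<rho> z - t\<bar> \<le> nrm r * sqrt \<bar>z - y\<bar>"
  unfolding t_def
 proof (rule acd_quotient_near[OF eta_acd n])
  fix s assume s: "min y z \<le> s" "s \<le> max y z"
  then have d: "\<bar>z - s\<bar> \<le> \<bar>z - y\<bar>" by (auto simp: min_def max_def split: if_splits)
  have "\<bar>\<rho> z - \<rho> s\<bar> \<le> nrm r * sqrt \<bar>z - s\<bar>" using d h L_pos by (intro dvt_Hoelder[OF adm_dvt]) linarith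
  also have "\<dots> \<le> nrm r * sqrt \<bar>z - y\<bar>" using d by (intro mult_left_mono) auto
  finally show "\<bar>\<rho> z - \<rho> s\<bar> \<le> nrm r * sqrt \<bar>z - y\<bar>" .
 qed
qed

lemma lam_eta_shift: "lam (eta \<rho> z - eta \<rho> (y + L)) = lam (eta \<rho> z - eta \<rho> y)"
 "lam (eta \<rho> (z + L) - eta \<rho> y) = lam (eta \<rho> z - eta \<rho> y)"
proof -
 have p: "lam (x + L) = lam x" for x using lam_periodic by (simp add: periodic_def)
 have "eta \<rho> z - eta \<rho> (y + L) + L = eta \<rho> z - eta \<rho> y" by (simp add: eta_shift)
 then show "lam (eta \<rho> z - eta \<rho> (y + L)) = lam (eta \<rho> z - eta \<rho> y)" using p by metis
 show "lam (eta \<rho> (z + L) - eta \<rho> y) = lam (eta \<rho> z - eta \<rho> y)"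
  using p[of "eta \<rho> z - eta \<rho> y"] unfolding eta_shift by (simp add: algebra_simps)
qed

lemma cot_shift: "cot (x - pi) = cot x" "cot (x + pi) = cot x" for x :: real
 by (simp_all add: cot_def)

lemma kern_shift: "kern \<rho> z (y + L) = kern \<rho> z y" "kern \<rho> (z + L) y = kern \<rho> z y"
proof -
 have "mu * (eta \<rho> z - eta \<rho> (y + L)) = mu * (eta \<rho> z - eta \<rho> y) - pi" "mu * (z - (y + L)) = mu * (z - y) - pi"
  "mu * (eta \<rho> (z + L) - eta \<rho> y) = mu * (eta \<rho> z - eta \<rho> y) + pi" "mu * (z + L - y) = mu * (z - y) + pi"
  unfolding eta_shift mu_L[symmetric] by (simp_all add: algebra_simps)
 then show "kern \<rho> z (y + L) = kern \<rho> z y" "kern \<rho> (z + L) y = kern \<rho> z y"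
  using dvtD(1)[OF adm_dvt] by (simp_all add: kern_def cot_shift periodic_def)
qed

lemma kern_measurable: "(\<lambda>(z, y). kern \<rho> z y) \<in> borel_measurable (borel \<Otimes>\<^sub>M borel)"
proof -
 have [measurable]: "\<rho> \<in> borel_measurable borel" "eta \<rho> \<in> borel_measurable borel"
  using adm_cont eta_cont borel_measurable_continuous_onI by auto
 show ?thesis unfolding kern_def cot_def split_beta' by measurable
qed

end

lemma near_rep: obtains k :: int where "\<bar>z - (y + of_int k * L)\<bar> \<le> L / 2"
proof -
 have "\<bar>of_int (round ((z - y) / L)) - (z - y) / L\<bar> \<le> 1 / 2" by (rule of_int_round_abs_le)
 then have "\<bar>of_int (round ((z - y) / L)) - (z - y) / L\<bar> * L \<le> (1 / 2) * L" using L_pos by (intro mult_right_mono) auto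
 moreover have "\<bar>of_int (round ((z - y) / L)) - (z - y) / L\<bar> * L = \<bar>z - (y + of_int (round ((z - y) / L)) * L)\<bar>"
 proof -
  have "\<bar>of_int (round ((z - y) / L)) - (z - y) / L\<bar> * L = \<bar>(of_int (round ((z - y) / L)) - (z - y) / L) * L\<bar>" using L_pos by (simp add: abs_mult)
  also have "(of_int (round ((z - y) / L)) - (z - y) / L) * L = - (z - (y + of_int (round ((z - y) / L)) * L))"
   unfolding left_diff_distrib[of "of_int _"] using L_pos by simp
  finally show ?thesis by simp
 qed
 ultimately show ?thesis using that by simp
qed

lemma mu_quarter: "mu * (3 * L / 4) = 3 * pi / 4"
proof -
 have "mu * (3 * L / 4) = (mu * L) * (3 / 4)" by simp
 then show ?thesis unfolding mu_L by simp
qed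

text \<open>The mean value theorem: on the interval \<open>\<bar>cot (mu * x)\<bar> / L\<close> is
  at most \<open>1 / (L * kap * mu * m)\<close>, and \<open>mu * L = pi\<close>.\<close>

lemma lam_lip:
 assumes m: "0 < m" "m \<le> s" "m \<le> t" "s \<le> 3 * L / 4" "t \<le> 3 * L / 4"
 shows "\<bar>lam s - lam t\<bar> \<le> \<bar>s - t\<bar> / (pi * kap * m)"
proof -
 have "norm (lam s - lam t) \<le> (1 / (pi * kap * m)) * norm (s - t)"
 proof (rule field_differentiable_bound[where S="{m..3 * L / 4}" and f'="\<lambda>x. (1 / L) * cot (mu * x)"])
  fix x assume x: "x \<in> {m..3 * L / 4}"
  then have xl: "0 < x" "x < L" using m L_pos by auto
  then show "(lam has_field_derivative (1 / L) * cot (mu * x)) (at x within {m..3 * L / 4})"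
   by (intro DERIV_subset[OF lam_deriv]) auto
  have "mu * x \<le> mu * (3 * L / 4)" using x mu_pos by (intro mult_left_mono) auto
  then have b: "0 \<le> mu * x" "mu * x \<le> 3 * pi / 4" using mu_pos xl unfolding mu_quarter by simp_all
  have "kap * (mu * m) \<le> kap * (mu * x)" using x mu_pos kap_pos by (intro mult_left_mono) auto
  then have k: "kap * (mu * m) \<le> sin (mu * x)" using sin_ge_kap[OF b] by linarith
  have p: "0 < kap * (mu * m)" using kap_pos mu_pos m by simp
  have "\<bar>cot (mu * x)\<bar> = \<bar>cos (mu * x)\<bar> / sin (mu * x)" using k p by (simp add: cot_def)
  also have "\<dots> \<le> 1 / (kap * (mu * m))" using k p by (intro frac_le) auto
  finally have "(1 / L) * \<bar>cot (mu * x)\<bar> \<le> (1 / L) * (1 / (kap * (mu * m)))" using L_pos by (intro mult_left_mono) auto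
  also have "\<dots> = 1 / (pi * kap * m)" using L_pos by (simp add: mu_def)
  finally show "norm ((1 / L) * cot (mu * x)) \<le> 1 / (pi * kap * m)" using L_pos by (simp add: abs_mult)
 qed (use m in auto)
 then show ?thesis by simp
qed

text \<open>The summands belong to the three parts of the estimate in \<open>kern_diff\<close>: the
  poles, the change of the factor in front of \<open>gam\<close>, and the change of the argument of
  \<open>gam\<close>.\<close>

definition KC :: "real => real" where
 "KC M = (1 / L) * ((2 + 4 * sqrt L * M) / mu * sqrt mu + sqrt L * (pi / kap) + (1 + sqrt L * M) * ((1 / kap\<^sup>2) * (mu * (L / 2) * sqrt L)))"

context
 fixes \<rho>1 r1 \<rho>2 r2 and M d :: real
 assumes a1: "adm \<rho>1 r1" and a2: "adm \<rho>2 r2" and M2: "nrm r2 \<le> M" and d: "norm (toL2 r1 - toL2 r2) \<le> d"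
begin

lemma d_nonneg: "0 \<le> d" using d norm_ge_zero order_trans by blast
lemma M_nonneg: "0 \<le> M" using M2 norm_ge_zero order_trans by blast

lemma dvt_rho_diff: "dvt (\<lambda>x. \<rho>1 x - \<rho>2 x) (\<lambda>x. r1 x - r2 x)" by (rule dvt_diff[OF adm_dvt[OF a1] adm_dvt[OF a2]])

lemma norm_r_diff: "nrm (\<lambda>x. r1 x - r2 x) \<le> d" using d by (simp add: toL2_diff adm_r[OF a1] adm_r[OF a2])

lemma rho_diff: "\<bar>\<rho>1 x - \<rho>2 x\<bar> \<le> sqrt L * d"
proof -
 have "itg 0 L (\<lambda>x. \<rho>1 x - \<rho>2 x) = 0" using a1 a2 by (simp add: adm_def itg_diff adm_locint[OF a1] adm_locint[OF a2])
 from dvt_mean_zero_sup[OF dvt_rho_diff this] have "\<bar>\<rho>1 x - \<rho>2 x\<bar> \<le> sqrt L * nrm (\<lambda>x. r1 x - r2 x)" .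
 also have "\<dots> \<le> sqrt L * d" using norm_r_diff L_pos by (intro mult_left_mono) auto
 finally show ?thesis .
qed

text \<open>Both bounds come from averaging \<open>\<rho>1 - \<rho>2\<close>. The second is the
  decisive one: it is small in \<open>d\<close> and in the distance at once, so a factor
  \<open>sqrt \<bar>z - y\<bar>\<close> can be set against the pole without losing the Lipschitz
  dependence.\<close>

lemma eta_diff_quotient:
 assumes n: "z \<noteq> y" and h: "\<bar>z - y\<bar> \<le> L / 2"
 defines "t1 \<equiv> (eta \<rho>1 z - eta \<rho>1 y) / (z - y)" and "t2 \<equiv> (eta \<rho>2 z - eta \<rho>2 y) / (z - y)"
 shows "\<bar>t1 - t2\<bar> \<le> sqrt L * d" "\<bar>(\<rho>1 z - t1) - (\<rho>2 z - t2)\<bar> \<le> d * sqrt \<bar>z - y\<bar>"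
proof -
 let ?E = "\<lambda>x. eta \<rho>1 x - eta \<rho>2 x"
 have E: "acd ?E (\<lambda>x. \<rho>1 x - \<rho>2 x)" by (rule acd_diff[OF eta_acd[OF a1] eta_acd[OF a2]])
 have q: "(?E z - ?E y) / (z - y) = t1 - t2" by (simp add: t1_def t2_def diff_divide_distrib[symmetric])
 have "\<bar>0 - (?E z - ?E y) / (z - y)\<bar> \<le> sqrt L * d"
  by (rule acd_quotient_near[OF E n]) (use rho_diff in \<open>simp add: abs_minus_commute\<close>)
 then show "\<bar>t1 - t2\<bar> \<le> sqrt L * d" unfolding q by simp
 have "\<bar>(\<rho>1 z - \<rho>2 z) - (?E z - ?E y) / (z - y)\<bar> \<le> d * sqrt \<bar>z - y\<bar>"
 proof (rule acd_quotient_near[OF E n])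
  fix s assume s: "min y z \<le> s" "s \<le> max y z"
  then have ds: "\<bar>z - s\<bar> \<le> \<bar>z - y\<bar>" by (auto simp: min_def max_def split: if_splits)
  have "\<bar>(\<rho>1 z - \<rho>2 z) - (\<rho>1 s - \<rho>2 s)\<bar> \<le> nrm (\<lambda>x. r1 x - r2 x) * sqrt \<bar>z - s\<bar>"
   using ds h L_pos by (intro dvt_Hoelder[OF dvt_rho_diff]) linarith
  also have "\<dots> \<le> d * sqrt \<bar>z - y\<bar>" using ds norm_r_diff d_nonneg by (intro mult_mono) auto
  finally show "\<bar>(\<rho>1 z - \<rho>2 z) - (\<rho>1 s - \<rho>2 s)\<bar> \<le> d * sqrt \<bar>z - y\<bar>" .
 qed
 then show "\<bar>(\<rho>1 z - t1) - (\<rho>2 z - t2)\<bar> \<le> d * sqrt \<bar>z - y\<bar>" unfolding q by (simp add: algebra_simps)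
qed

lemma lam_abs: "lam \<bar>x\<bar> = lam x" using lam_even[of x] by (cases "x \<ge> 0") auto

text \<open>Both arguments are the distance of the points times a slope that is at least 1/2. The
  Lipschitz constant of \<open>lam\<close> there is inversely proportional to the distance, and this
  cancels the distance in front of the difference of the slopes: the singularity disappears.\<close>

lemma lam_eta_diff: "\<bar>lam (eta \<rho>1 z - eta \<rho>1 y) - lam (eta \<rho>2 z - eta \<rho>2 y)\<bar> \<le> 2 * sqrt L / (pi * kap) * d"
proof -
 obtain k :: int where k: "\<bar>z - (y + of_int k * L)\<bar> \<le> L / 2" using near_rep .
 define y' where "y' = y + of_int k * L"
 have p: "lam (eta \<rho>i z - eta \<rho>i y') = lam (eta \<rho>i z - eta \<rho>i y)" if "adm \<rho>i ri" for \<rho>i ri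
  unfolding y'_def
 proof (rule periodic_int[of "\<lambda>y. lam (eta \<rho>i z - eta \<rho>i y)"])
  show "periodic L (\<lambda>y. lam (eta \<rho>i z - eta \<rho>i y))" using lam_eta_shift(1)[OF that] by (simp add: periodic_def)
 qed
 have "\<bar>lam (eta \<rho>1 z - eta \<rho>1 y') - lam (eta \<rho>2 z - eta \<rho>2 y')\<bar> \<le> 2 * sqrt L / (pi * kap) * d"
 proof (cases "z = y'")
  case True
  then show ?thesis using L_pos kap_pos d_nonneg by simp
 next
  case False
  have h: "\<bar>z - y'\<bar> \<le> L / 2" using k by (simp add: y'_def)
  define t1 t2 where "t1 = (eta \<rho>1 z - eta \<rho>1 y') / (z - y')" and "t2 = (eta \<rho>2 z - eta \<rho>2 y') / (z - y')"
  note q1 = eta_quotient[OF a1 False h, folded t1_def] and q2 = eta_quotient[OF a2 False h, folded t2_def]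
  define m where "m = \<bar>z - y'\<bar> / 2"
  have m: "0 < m" using False by (simp add: m_def)
  have "\<bar>lam (\<bar>z - y'\<bar> * t1) - lam (\<bar>z - y'\<bar> * t2)\<bar> \<le> \<bar>\<bar>z - y'\<bar> * t1 - \<bar>z - y'\<bar> * t2\<bar> / (pi * kap * m)"
   using mult_left_mono[OF q1(1), of "\<bar>z - y'\<bar>"] mult_left_mono[OF q2(1), of "\<bar>z - y'\<bar>"] q1(2) q2(2)
   by (intro lam_lip m) (auto simp: m_def)
  also have "\<bar>\<bar>z - y'\<bar> * t1 - \<bar>z - y'\<bar> * t2\<bar> = \<bar>z - y'\<bar> * \<bar>t1 - t2\<bar>" by (simp add: right_diff_distrib[symmetric] abs_mult)
  also have "\<dots> / (pi * kap * m) = (2 / (pi * kap)) * \<bar>t1 - t2\<bar>" using False by (simp add: m_def)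
  also have "\<dots> \<le> (2 / (pi * kap)) * (sqrt L * d)"
   using eta_diff_quotient(1)[OF False h] kap_pos by (intro mult_left_mono) (auto simp: t1_def t2_def)
  finally have "\<bar>lam (\<bar>z - y'\<bar> * t1) - lam (\<bar>z - y'\<bar> * t2)\<bar> \<le> 2 * sqrt L / (pi * kap) * d" by simp
  moreover have "lam (\<bar>z - y'\<bar> * t1) = lam (eta \<rho>1 z - eta \<rho>1 y')" "lam (\<bar>z - y'\<bar> * t2) = lam (eta \<rho>2 z - eta \<rho>2 y')"
   unfolding q1(4) q2(4) using lam_abs[of "(z - y') * t1"] lam_abs[of "(z - y') * t2"] q1(1) q2(1) by (simp_all add: abs_mult)
  ultimately show ?thesis by simp
 qed
 then show ?thesis unfolding p[OF a1] p[OF a2] .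
qed

lemma cot_gam: "x \<noteq> 0 ==> cot x = 1 / x + gam x" by (simp add: gam_def)

lemma KC_nonneg: "0 \<le> KC M"
 unfolding KC_def using L_pos M_nonneg mu_pos kap_pos by (intro mult_nonneg_nonneg add_nonneg_nonneg) auto

text \<open>The flat kernel drops out of the difference, and each remaining cotangent is split into
  its pole and \<open>gam\<close>. A pole part is \<open>1 / (mu * h)\<close> times the quotient of
  \<open>\<rho> z\<close> by the mean slope, which differs from 1 by the order
  \<open>sqrt \<bar>h\<bar>\<close>; the difference of two such quotients keeps this order and gains
  the factor \<open>d\<close>.\<close>

lemma kern_diff: "\<bar>kern \<rho>1 z y - kern \<rho>2 z y\<bar> \<le> (KC M * d) * wgt (z - y)"
proof -
 obtain k :: int where k: "\<bar>z - (y + of_int k * L)\<bar> \<le> L / 2" using near_rep .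
 define y' where "y' = y + of_int k * L"
 have p: "kern \<rho>i z y' = kern \<rho>i z y" if "adm \<rho>i ri" for \<rho>i ri
  unfolding y'_def
  by (rule periodic_int[of "\<lambda>y. kern \<rho>i z y"]) (use kern_shift(1)[OF that] in \<open>simp add: periodic_def\<close>)
 have w: "wgt (z - y') = wgt (z - y)"
  using periodic_int[OF wgt_periodic, of "z - y" "- k"] by (simp add: y'_def algebra_simps)
 have "\<bar>kern \<rho>1 z y' - kern \<rho>2 z y'\<bar> \<le> (KC M * d) * wgt (z - y')"
 proof (cases "z = y'")
  case True
  \<comment> \<open>On the diagonal both sides are 0, as \<open>sin 0 = 0\<close> and division by
    zero gives zero.\<close>
  then show ?thesis by (simp add: kern_def cot_def wgt_def)
 next
  case False
  have h: "\<bar>z - y'\<bar> \<le> L / 2" using k by (simp add: y'_def)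
  define h where "h = z - y'"
  have h0: "h \<noteq> 0" "\<bar>h\<bar> \<le> L / 2" using False h by (auto simp: h_def)
  define t1 t2 where "t1 = (eta \<rho>1 z - eta \<rho>1 y') / (z - y')" and "t2 = (eta \<rho>2 z - eta \<rho>2 y') / (z - y')"
  note q1 = eta_quotient[OF a1 False h, folded t1_def h_def] and q2 = eta_quotient[OF a2 False h, folded t2_def h_def]
  note e = eta_diff_quotient[OF False h, folded t1_def t2_def h_def]
  have mh: "0 < mu * \<bar>h\<bar> / 2" using mu_pos h0 by simp
  have "mu * \<bar>h\<bar> / 2 \<le> \<bar>sin (mu * h)\<bar>" by (rule abs_sin_mu_ge[OF h0(2)])
  then have snz: "sin (mu * h) \<noteq> 0" using mh by auto
  have w1: "1 \<le> wgt h" "1 / sqrt \<bar>h\<bar> \<le> sqrt mu * wgt h" using wgt_ge[OF snz] h0 by auto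
  define X1 X2 where "X1 = mu * (h * t1)" and "X2 = mu * (h * t2)"
  have X: "X1 \<noteq> 0" "X2 \<noteq> 0" using q1(1) q2(1) mu_pos h0 by (auto simp: X1_def X2_def)
  have aX: "\<bar>X1\<bar> = mu * (\<bar>h\<bar> * t1)" "\<bar>X2\<bar> = mu * (\<bar>h\<bar> * t2)" using q1(1) q2(1) mu_pos by (simp_all add: X1_def X2_def abs_mult)
  have Xb: "0 < \<bar>X1\<bar>" "\<bar>X1\<bar> \<le> 3 * pi / 4" "0 < \<bar>X2\<bar>" "\<bar>X2\<bar> \<le> 3 * pi / 4"
   using X mult_left_mono[OF q1(2), of mu] mult_left_mono[OF q2(2), of mu] mu_pos
   unfolding aX(1)[symmetric] aX(2)[symmetric] mu_quarter by simp_all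
  have gs: "\<bar>gam X1 - gam X2\<bar> = \<bar>gam \<bar>X1\<bar> - gam \<bar>X2\<bar>\<bar>" "\<bar>gam X1\<bar> = \<bar>gam \<bar>X1\<bar>\<bar>"
  proof -
   have "(0 < X1 \<and> 0 < X2) \<or> (X1 < 0 \<and> X2 < 0)"
    using q1(1) q2(1) mu_pos h0 by (simp add: X1_def X2_def zero_less_mult_iff mult_less_0_iff) linarith
   then show "\<bar>gam X1 - gam X2\<bar> = \<bar>gam \<bar>X1\<bar> - gam \<bar>X2\<bar>\<bar>" by (auto simp: gam_minus)
   show "\<bar>gam X1\<bar> = \<bar>gam \<bar>X1\<bar>\<bar>" using gam_minus[of X1] by (cases "X1 \<ge> 0") auto
  qed
  have main1: "\<bar>\<rho>1 z / X1 - \<rho>2 z / X2\<bar> \<le> (2 + 4 * sqrt L * M) / mu * sqrt mu * d * wgt h"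
  proof -
   have "\<rho>1 z / X1 - \<rho>2 z / X2 = (\<rho>1 z / t1 - \<rho>2 z / t2) / (mu * h)" using mu_pos h0 by (simp add: X1_def X2_def diff_divide_distrib mult_ac)
   \<comment> \<open>Subtracting 1 from both quotients exposes the small quantities
     \<open>\<rho>1 z - t1\<close> and \<open>\<rho>2 z - t2\<close>. The slopes are at least 1/2,
     whence the factors 2 and 4 in the bound.\<close>
   also have "\<rho>1 z / t1 - \<rho>2 z / t2 = ((\<rho>1 z - t1) - (\<rho>2 z - t2)) / t1 + (\<rho>2 z - t2) * (t2 - t1) / (t1 * t2)"
    using q1(1) q2(1) by (simp add: field_simps)
   finally have "\<bar>\<rho>1 z / X1 - \<rho>2 z / X2\<bar> = \<bar>((\<rho>1 z - t1) - (\<rho>2 z - t2)) / t1 + (\<rho>2 z - t2) * (t2 - t1) / (t1 * t2)\<bar> / (mu * \<bar>h\<bar>)"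
    using mu_pos by (simp add: abs_mult)
   also have "\<dots> \<le> (2 * (d * sqrt \<bar>h\<bar>) + 4 * (M * sqrt \<bar>h\<bar> * (sqrt L * d))) / (mu * \<bar>h\<bar>)"
   proof (rule divide_right_mono)
    have "\<bar>((\<rho>1 z - t1) - (\<rho>2 z - t2)) / t1\<bar> \<le> (d * sqrt \<bar>h\<bar>) / (1/2)"
     unfolding abs_divide using e(2) q1(1) by (intro frac_le) auto
    moreover have "\<bar>(\<rho>2 z - t2) * (t2 - t1) / (t1 * t2)\<bar> \<le> (M * sqrt \<bar>h\<bar> * (sqrt L * d)) / ((1/2) * (1/2))"
    proof -
     have "\<bar>\<rho>2 z - t2\<bar> \<le> M * sqrt \<bar>h\<bar>" using q2(3) mult_right_mono[OF M2, of "sqrt \<bar>h\<bar>"] by simp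
     then have 1: "\<bar>(\<rho>2 z - t2) * (t2 - t1)\<bar> \<le> M * sqrt \<bar>h\<bar> * (sqrt L * d)"
      unfolding abs_mult using e(1) M_nonneg by (intro mult_mono) (auto simp: abs_minus_commute)
     have "(1/2) * (1/2) \<le> \<bar>t1 * t2\<bar>" unfolding abs_mult using q1(1) q2(1) by (intro mult_mono) auto
     then show ?thesis unfolding abs_divide using 1 by (intro frac_le) auto
    qed
    ultimately show "\<bar>((\<rho>1 z - t1) - (\<rho>2 z - t2)) / t1 + (\<rho>2 z - t2) * (t2 - t1) / (t1 * t2)\<bar> \<le> 2 * (d * sqrt \<bar>h\<bar>) + 4 * (M * sqrt \<bar>h\<bar> * (sqrt L * d))"
     using abs_triangle_ineq[of "((\<rho>1 z - t1) - (\<rho>2 z - t2)) / t1" "(\<rho>2 z - t2) * (t2 - t1) / (t1 * t2)"] by simp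
   qed (use mu_pos in simp)
   also have "\<dots> = (2 + 4 * sqrt L * M) / mu * d * (sqrt \<bar>h\<bar> / \<bar>h\<bar>)" using mu_pos h0 by (simp add: field_simps)
   also have "sqrt \<bar>h\<bar> / \<bar>h\<bar> = 1 / sqrt \<bar>h\<bar>" using h0 real_sqrt_mult_self[of "\<bar>h\<bar>"] by (simp add: field_simps)
   also have "(2 + 4 * sqrt L * M) / mu * d * (1 / sqrt \<bar>h\<bar>) \<le> (2 + 4 * sqrt L * M) / mu * d * (sqrt mu * wgt h)"
    using w1 L_pos M_nonneg mu_pos d_nonneg by (intro mult_left_mono) auto
   finally show ?thesis by (simp add: mult_ac)
  qed
  have main2: "\<bar>\<rho>1 z * gam X1 - \<rho>2 z * gam X2\<bar> \<le> (sqrt L * (pi / kap) + (1 + sqrt L * M) * ((1 / kap\<^sup>2) * (mu * (L / 2) * sqrt L))) * d * wgt h"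
  proof -
   have r2: "\<bar>\<rho>2 z\<bar> \<le> 1 + sqrt L * M"
   proof -
    have "sqrt L * nrm r2 \<le> sqrt L * M" using M2 L_pos by (intro mult_left_mono) auto
    then show ?thesis using adm_dev[OF a2, of z] by linarith
   qed
   have "\<rho>1 z * gam X1 - \<rho>2 z * gam X2 = (\<rho>1 z - \<rho>2 z) * gam X1 - \<rho>2 z * (gam X2 - gam X1)" by (simp add: algebra_simps)
   also have "\<bar>\<dots>\<bar> \<le> \<bar>\<rho>1 z - \<rho>2 z\<bar> * \<bar>gam X1\<bar> + \<bar>\<rho>2 z\<bar> * \<bar>gam X2 - gam X1\<bar>" by (rule abs_diff_mult_le)
   also have "\<dots> \<le> (sqrt L * d) * (pi / kap) + (1 + sqrt L * M) * ((1 / kap\<^sup>2) * (mu * (L / 2) * (sqrt L * d)))"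
   proof (intro add_mono mult_mono rho_diff r2)
    show "\<bar>gam X1\<bar> \<le> pi / kap" unfolding gs(2) by (rule gam_bound[OF Xb(1,2)])
    have "\<bar>gam X2 - gam X1\<bar> \<le> (1 / kap\<^sup>2) * \<bar>\<bar>X1\<bar> - \<bar>X2\<bar>\<bar>"
     unfolding abs_minus_commute[of "gam X2"] gs(1) by (rule gam_lip[OF Xb])
    also have "\<bar>\<bar>X1\<bar> - \<bar>X2\<bar>\<bar> = mu * \<bar>h\<bar> * \<bar>t1 - t2\<bar>"
     using mu_pos unfolding aX by (simp add: right_diff_distrib[symmetric] abs_mult mult.assoc)
    also have "mu * \<bar>h\<bar> * \<bar>t1 - t2\<bar> \<le> mu * (L / 2) * (sqrt L * d)"
     using h0 e(1) mu_pos L_pos by (intro mult_mono) auto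
    finally show "\<bar>gam X2 - gam X1\<bar> \<le> (1 / kap\<^sup>2) * (mu * (L / 2) * (sqrt L * d))"
     by (simp add: divide_right_mono)
   qed (use L_pos M_nonneg d_nonneg kap_pos in auto)
   also have "\<dots> = (sqrt L * (pi / kap) + (1 + sqrt L * M) * ((1 / kap\<^sup>2) * (mu * (L / 2) * sqrt L))) * d * 1" by (simp add: algebra_simps)
   also have "\<dots> \<le> (sqrt L * (pi / kap) + (1 + sqrt L * M) * ((1 / kap\<^sup>2) * (mu * (L / 2) * sqrt L))) * d * wgt h"
    using w1(1) L_pos M_nonneg d_nonneg kap_pos mu_pos by (intro mult_left_mono mult_nonneg_nonneg add_nonneg_nonneg) auto
   finally show ?thesis .
  qed
  have "kern \<rho>1 z y' - kern \<rho>2 z y' = (1 / L) * (\<rho>1 z * cot X1 - \<rho>2 z * cot X2)"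
   unfolding kern_def X1_def X2_def q1(4)[symmetric] q2(4)[symmetric] by (simp add: algebra_simps)
  also have "\<dots> = (1 / L) * ((\<rho>1 z / X1 - \<rho>2 z / X2) + (\<rho>1 z * gam X1 - \<rho>2 z * gam X2))"
   unfolding cot_gam[OF X(1)] cot_gam[OF X(2)] by (simp add: algebra_simps)
  finally have "\<bar>kern \<rho>1 z y' - kern \<rho>2 z y'\<bar> = (1 / L) * \<bar>(\<rho>1 z / X1 - \<rho>2 z / X2) + (\<rho>1 z * gam X1 - \<rho>2 z * gam X2)\<bar>"
   using L_pos by (simp add: abs_mult)
  also have "\<dots> \<le> (1 / L) * ((2 + 4 * sqrt L * M) / mu * sqrt mu * d * wgt h
    + (sqrt L * (pi / kap) + (1 + sqrt L * M) * ((1 / kap\<^sup>2) * (mu * (L / 2) * sqrt L))) * d * wgt h)"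
   using main1 main2 L_pos by (intro mult_left_mono order_trans[OF abs_triangle_ineq add_mono]) auto
  also have "\<dots> = (KC M * d) * wgt h" unfolding KC_def by (simp add: algebra_simps)
  finally show ?thesis by (simp add: h_def)
 qed
 then show ?thesis unfolding p[OF a1] p[OF a2] w .
qed

end


section \<open>The derivative of a difference of pulled back potentials\<close>

lemma sin_mu_zeroD: assumes "sin (mu * x) = 0" obtains k :: int where "x = of_int k * L"
proof -
 obtain k :: int where "mu * x = of_int k * pi" using assms sin_zero_iff_int2 by blast
 then have "mu * x = mu * (of_int k * L)" using mu_L by (simp add: mult.left_commute)
 then have "x = of_int k * L" using mu_pos by simp
 then show ?thesis by (rule that)
qed

lemma sin_mu_zeroI: "sin (mu * (of_int k * L)) = 0"
 unfolding sin_zero_iff_int2 using mu_L by (intro exI[of _ k]) (simp add: mult.left_commute)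

text \<open>\<open>lam_deriv\<close> covers one period. Writing the logarithm through the square of
  the sine treats all nonsingular points and both signs at once.\<close>

lemma lam_deriv_all: assumes "sin (mu * x) \<noteq> 0" shows "(lam has_real_derivative (1 / L) * cot (mu * x)) (at x)"
proof -
 have l: "lam x = (1 / (2 * pi)) * ln ((sin (mu * x))\<^sup>2)" for x
 proof (cases "sin (mu * x) = 0")
  case False
  have "ln ((sin (mu * x))\<^sup>2) = ln (\<bar>sin (mu * x)\<bar>\<^sup>2)" by simp
  also have "\<dots> = 2 * ln \<bar>sin (mu * x)\<bar>" using False by (subst ln_realpow) auto
  finally show ?thesis by (simp add: lam_def)
 qed (simp add: lam_def)
 have p: "0 < (sin (mu * x))\<^sup>2" using assms by simp
 show ?thesis unfolding l[abs_def]
  using assms p L_pos by (auto intro!: derivative_eq_intros simp: cot_def mu_def power2_eq_square field_simps)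
qed

context
 fixes \<rho> r assumes a: "adm \<rho> r"
begin

lemma eta_mono: "strict_mono (eta \<rho>)"
 by (rule strict_monoI, rule DERIV_pos_imp_increasing) (use eta_deriv[OF a] adm_pos[OF a] in auto)

lemma eta_shift_int: "eta \<rho> (z + of_int k * L) = eta \<rho> z + of_int k * L"
proof -
 have "periodic L (\<lambda>z. eta \<rho> z - z)" using eta_shift[OF a] by (simp add: periodic_def)
 from periodic_int[OF this, of z k] show ?thesis by simp
qed

lemma sin_eta_nz: assumes "sin (mu * (z - y)) \<noteq> 0" shows "sin (mu * (eta \<rho> z - eta \<rho> y)) \<noteq> 0"
proof
 assume "sin (mu * (eta \<rho> z - eta \<rho> y)) = 0"
 then obtain k :: int where "eta \<rho> z - eta \<rho> y = of_int k * L" by (rule sin_mu_zeroD)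
 then have "eta \<rho> z = eta \<rho> (y + of_int k * L)" by (simp add: eta_shift_int)
 then have "z - y = of_int k * L" using eta_mono by (simp add: strict_mono_eq)
 then show False using assms sin_mu_zeroI by simp
qed

text \<open>A comparison with the constant 1, for which \<open>kern\<close> vanishes and the weak
  derivative is 0; hence the constant \<open>KC 0\<close>.\<close>

lemma kern_bound: "\<bar>kern \<rho> z y\<bar> \<le> (KC 0 * nrm r) * wgt (z - y)"
 using kern_diff[OF a adm_one, of 0 "nrm r" z y] by (simp add: toL2_zero kern_one)

lemma kern_locint: "locint (\<lambda>z. kern \<rho> z y)"
proof (rule locint_periodic)
 show m: "(\<lambda>z. kern \<rho> z y) \<in> borel_measurable borel"
 proof -
  have [measurable]: "\<rho> \<in> borel_measurable borel" "eta \<rho> \<in> borel_measurable borel"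
   using adm_cont[OF a] eta_cont[OF a] borel_measurable_continuous_onI by auto
  show ?thesis unfolding kern_def cot_def by measurable
 qed
 show "periodic L (\<lambda>z. kern \<rho> z y)" using kern_shift(2)[OF a] by (simp add: periodic_def)
 have "set_integrable lborel {0..L} (\<lambda>z. (KC 0 * nrm r) * wgt (z - y))"
  using locint_set_integrable[OF locint_cmult[OF wgt_locint, of "KC 0 * nrm r"], of "0 - y" "L - y"]
   set_integrable_shift[of 0 "-y" L "\<lambda>z. (KC 0 * nrm r) * wgt z"] by simp
 then show "set_integrable lborel {0..L} (\<lambda>z. kern \<rho> z y)"
  unfolding set_integrable_def
  by (rule Bochner_Integration.integrable_bound)
   (use m kern_bound in \<open>auto intro!: AE_I2 simp: indicator_def intro: order_trans[OF _ abs_ge_self]\<close>)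
qed

definition Dl :: "real => real => real" where "Dl z y = lam (eta \<rho> z - eta \<rho> y) - lam (z - y)"

lemma Dl_deriv: assumes "sin (mu * (z - y)) \<noteq> 0" shows "((\<lambda>z. Dl z y) has_real_derivative kern \<rho> z y) (at z)"
proof -
 have "((\<lambda>z. lam (eta \<rho> z - eta \<rho> y)) has_real_derivative (1 / L) * cot (mu * (eta \<rho> z - eta \<rho> y)) * \<rho> z) (at z)"
  by (rule DERIV_chain2[where f=lam and g="\<lambda>z. eta \<rho> z - eta \<rho> y", OF lam_deriv_all[OF sin_eta_nz[OF assms]]]) (auto intro!: derivative_eq_intros eta_deriv[OF a])
 moreover have "((\<lambda>z. lam (z - y)) has_real_derivative (1 / L) * cot (mu * (z - y)) * 1) (at z)"
  by (rule DERIV_chain2[where f=lam and g="\<lambda>z. z - y", OF lam_deriv_all[OF assms]]) (auto intro!: derivative_eq_intros)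
 ultimately show ?thesis unfolding Dl_def kern_def
  by (rule DERIV_cong[OF DERIV_diff]) (simp add: algebra_simps)
qed

lemma Dl_regular:
 assumes pq: "p \<le> q" and n: "\<And>z. p \<le> z ==> z \<le> q ==> sin (mu * (z - y)) \<noteq> 0"
 shows "Dl q y - Dl p y = itg p q (\<lambda>z. kern \<rho> z y)"
proof -
 have "((\<lambda>z. kern \<rho> z y) has_integral Dl q y - Dl p y) {p..q}"
  by (rule fundamental_theorem_of_calculus[OF pq])
   (use n Dl_deriv in \<open>auto simp: has_real_derivative_iff_has_vector_derivative[symmetric] intro: DERIV_subset\<close>)
 then show ?thesis by (simp add: itg_eq_integral[OF kern_locint] integral_unique)
qed

text \<open>At the singular point itself the value of \<open>Dl\<close> is a convention, so the
  values on both sides are compared. At equal distance \<open>e\<close> the flat terms agree by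
  evenness, and the pulled back ones differ only through two mean slopes, both within
  \<open>nrm r * sqrt e\<close> of \<open>\<rho> z0\<close>.\<close>

lemma Dl_symmetric_bound:
 assumes z0: "z0 = y + of_int k * L" and e: "0 < e" "e \<le> L / 2"
 shows "\<bar>Dl (z0 + e) y - Dl (z0 - e) y\<bar> \<le> 4 / (pi * kap) * nrm r * sqrt e"
proof -
 define tp tm where "tp = (eta \<rho> z0 - eta \<rho> (z0 + e)) / (z0 - (z0 + e))" and "tm = (eta \<rho> z0 - eta \<rho> (z0 - e)) / (z0 - (z0 - e))"
 have nz: "z0 \<noteq> z0 + e" "z0 \<noteq> z0 - e" "\<bar>z0 - (z0 + e)\<bar> \<le> L / 2" "\<bar>z0 - (z0 - e)\<bar> \<le> L / 2" using e by auto
 note qp = eta_quotient[OF a nz(1,3), folded tp_def] and qm = eta_quotient[OF a nz(2,4), folded tm_def]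
 have lp: "lam (x + of_int j * L) = lam x" for x and j :: int by (rule periodic_int[OF lam_periodic])
 have sgl: "eta \<rho> z0 = eta \<rho> y + of_int k * L" unfolding z0 by (rule eta_shift_int)
 have 1: "lam (eta \<rho> w - eta \<rho> y) = lam (eta \<rho> w - eta \<rho> z0)" for w
  using lp[of "eta \<rho> w - eta \<rho> z0" k] unfolding sgl by simp
 have 2: "lam (w - y) = lam (w - z0)" for w using lp[of "w - z0" k] unfolding z0 by simp
 have 3: "lam (eta \<rho> (z0 + e) - eta \<rho> z0) = lam (e * tp)" "lam (eta \<rho> (z0 - e) - eta \<rho> z0) = lam (e * tm)"
 proof -
  have A: "eta \<rho> (z0 + e) - eta \<rho> z0 = e * tp" using qp(4) by (simp add: algebra_simps)
  have B: "eta \<rho> (z0 - e) - eta \<rho> z0 = - (e * tm)" using qm(4) by (simp add: algebra_simps)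
  show "lam (eta \<rho> (z0 + e) - eta \<rho> z0) = lam (e * tp)" "lam (eta \<rho> (z0 - e) - eta \<rho> z0) = lam (e * tm)"
   unfolding A B lam_even by simp_all
 qed
 have "Dl (z0 + e) y - Dl (z0 - e) y = lam (e * tp) - lam (e * tm)"
  unfolding Dl_def 1 2 3 using lam_even[of e] by simp
 also have "\<bar>\<dots>\<bar> \<le> \<bar>e * tp - e * tm\<bar> / (pi * kap * (e / 2))"
  using qp(1,2) qm(1,2) e mult_left_mono[OF qp(1), of e] mult_left_mono[OF qm(1), of e] by (intro lam_lip) auto
 also have "\<bar>e * tp - e * tm\<bar> = e * \<bar>tp - tm\<bar>" using e by (simp add: right_diff_distrib[symmetric] abs_mult)
 also have "e * \<bar>tp - tm\<bar> / (pi * kap * (e / 2)) = 2 / (pi * kap) * \<bar>tp - tm\<bar>" using e by simp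
 also have "\<dots> \<le> 2 / (pi * kap) * (2 * (nrm r * sqrt e))"
 proof (rule mult_left_mono)
  show "\<bar>tp - tm\<bar> \<le> 2 * (nrm r * sqrt e)" using qp(3) qm(3) e by simp
 qed (use kap_pos in simp)
 finally show ?thesis by simp
qed

text \<open>The fundamental theorem across a singularity. The length is at most
  \<open>L / 2\<close>, so at most one singular point lies in the interval. After a symmetric
  neighbourhood of radius \<open>e\<close> is cut out, the defect \<open>c\<close> equals a
  difference of increments over that neighbourhood; it does not depend on \<open>e\<close>, and the
  increments tend to 0.\<close>

lemma Dl_diff:
 assumes ab: "a' \<le> b'" "b' \<le> a' + L / 2" and n: "sin (mu * (a' - y)) \<noteq> 0" "sin (mu * (b' - y)) \<noteq> 0"
 shows "Dl b' y - Dl a' y = itg a' b' (\<lambda>z. kern \<rho> z y)"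
proof (cases "\<exists>z0. a' \<le> z0 \<and> z0 \<le> b' \<and> sin (mu * (z0 - y)) = 0")
 case False
 then show ?thesis by (intro Dl_regular ab) blast
next
 case True
 then obtain z0 where z: "a' \<le> z0" "z0 \<le> b'" "sin (mu * (z0 - y)) = 0" by blast
 then have z': "a' < z0" "z0 < b'" using n by (auto simp: less_le)
 obtain k :: int where "z0 - y = of_int k * L" using z(3) by (rule sin_mu_zeroD)
 then have k: "z0 = y + of_int k * L" by simp
 have uniq: "w = z0" if w: "a' \<le> w" "w \<le> b'" "sin (mu * (w - y)) = 0" for w
 proof -
  obtain j :: int where j: "w - y = of_int j * L" using w(3) by (rule sin_mu_zeroD)
  have e: "w - z0 = of_int (j - k) * L" using j k by (simp add: algebra_simps)
  have "\<bar>w - z0\<bar> < L" using w z ab L_pos by (simp add: abs_if)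
  then have "\<bar>of_int (j - k)\<bar> * L < 1 * L" using L_pos unfolding e by (simp add: abs_mult)
  then have "j = k" using L_pos by simp
  then show ?thesis using e by simp
 qed
 let ?k = "\<lambda>z. kern \<rho> z y"
 define P where "P = (\<lambda>x. if 0 \<le> x then itg 0 x ?k else - itg x 0 ?k)"
 have P: "acd P ?k" unfolding P_def by (rule acd_indefinite[OF kern_locint])
 define c where "c = Dl b' y - Dl a' y - itg a' b' ?k"
 define e0 where "e0 = min (z0 - a') (b' - z0)"
 have "e0 \<le> z0 - a'" by (simp add: e0_def)
 then have "e0 \<le> L / 2" using z' ab by linarith
 moreover have "0 < e0" using z' by (simp add: e0_def)
 ultimately have e0: "0 < e0" "e0 \<le> L / 2" by auto
 have ceq: "c = (Dl (z0 + e) y - Dl (z0 - e) y) - (P (z0 + e) - P (z0 - e))" if e: "0 < e" "e < e0" for e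
 proof -
  have le: "a' \<le> z0 - e" "z0 + e \<le> b'" using e by (auto simp: e0_def)
  have "Dl (z0 - e) y - Dl a' y = itg a' (z0 - e) ?k"
  proof (rule Dl_regular[OF le(1)])
   fix w assume w: "a' \<le> w" "w \<le> z0 - e"
   then have "w \<noteq> z0" "w \<le> b'" using e z' by auto
   then show "sin (mu * (w - y)) \<noteq> 0" using uniq w(1) by blast
  qed
  moreover have "Dl b' y - Dl (z0 + e) y = itg (z0 + e) b' ?k"
  proof (rule Dl_regular[OF le(2)])
   fix w assume w: "z0 + e \<le> w" "w \<le> b'"
   then have "w \<noteq> z0" "a' \<le> w" using e z' by auto
   then show "sin (mu * (w - y)) \<noteq> 0" using uniq w(2) by blast
  qed
  moreover have "itg a' b' ?k = itg a' (z0 - e) ?k + (itg (z0 - e) (z0 + e) ?k + itg (z0 + e) b' ?k)"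
   using itg_combine[OF kern_locint, of a' "z0 - e" b'] itg_combine[OF kern_locint, of "z0 - e" "z0 + e" b'] le e by simp
  moreover have "P (z0 + e) - P (z0 - e) = itg (z0 - e) (z0 + e) ?k" using acdD[OF P, of "z0 - e" "z0 + e"] e by simp
  ultimately show ?thesis by (simp add: c_def)
 qed
 have "((\<lambda>e::real. c) \<longlongrightarrow> 0) (at_right 0)"
 proof (rule Lim_null_comparison)
  have "\<bar>c\<bar> \<le> 4 / (pi * kap) * nrm r * sqrt e + \<bar>P (z0 + e) - P (z0 - e)\<bar>" if e: "0 < e" "e < e0" for e
   using Dl_symmetric_bound[OF k, of e] ceq[OF e] e e0 by linarith
  then show "\<forall>\<^sub>F e in at_right 0. norm c \<le> 4 / (pi * kap) * nrm r * sqrt e + \<bar>P (z0 + e) - P (z0 - e)\<bar>"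
   using eventually_at_right_less[of 0] eventually_at_right[OF zero_less_one] e0
   by (auto simp: eventually_at_right_field intro!: exI[of _ e0])
  have cP: "isCont P x" for x using acd_continuous[OF P] by (simp add: continuous_on_eq_continuous_at)
  have t: "((\<lambda>e. P (z0 + e) - P (z0 - e)) \<longlongrightarrow> P (z0 + 0) - P (z0 - 0)) (at_right 0)"
   by (intro tendsto_diff isCont_tendsto_compose[OF cP] tendsto_intros)
  have "((\<lambda>e. 4 / (pi * kap) * nrm r * sqrt e + \<bar>P (z0 + e) - P (z0 - e)\<bar>) \<longlongrightarrow> 4 / (pi * kap) * nrm r * sqrt 0 + \<bar>P (z0 + 0) - P (z0 - 0)\<bar>) (at_right 0)"
   by (intro tendsto_intros t)
  then show "((\<lambda>e. 4 / (pi * kap) * nrm r * sqrt e + \<bar>P (z0 + e) - P (z0 - e)\<bar>) \<longlongrightarrow> 0) (at_right 0)" by simp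
 qed
 then have "c = 0" using tendsto_unique[OF trivial_limit_at_right_real[of "0::real"] tendsto_const] by blast
 then show ?thesis by (simp add: c_def)
qed

lemma lam_eta_L2: "(\<lambda>y. lam (eta \<rho> z - eta \<rho> y)) \<in> \<L>2"
proof -
 have m: "(\<lambda>y. lam (eta \<rho> z - eta \<rho> y)) \<in> borel_measurable borel"
  using borel_measurable_continuous_onI[OF eta_cont[OF a]] lam_measurable by measurable
 have "(\<lambda>y. lam (eta \<rho> z - eta \<rho> y) - lam (z - y)) \<in> \<L>2"
 proof -
  have "(\<lambda>y. (lam (eta \<rho> z - eta \<rho> y) - lam (z - y)) * 1) \<in> \<L>2"
  proof (rule L2_bounded_mult[OF _ _ _ L2_const])
   show "(\<lambda>y. lam (eta \<rho> z - eta \<rho> y) - lam (z - y)) \<in> borel_measurable borel" using m lam_measurable by measurable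
   show "periodic L (\<lambda>y. lam (eta \<rho> z - eta \<rho> y) - lam (z - y))"
    using lam_eta_shift(1)[OF a, of z] L2_periodic[OF L2_reflect(1)[OF lam_L2, of z]] by (simp add: periodic_def)
   show "\<bar>lam (eta \<rho> z - eta \<rho> y) - lam (z - y)\<bar> \<le> 2 * sqrt L / (pi * kap) * nrm r" for y
    using lam_eta_diff[OF a adm_one, of 0 "nrm r" z y] by (simp add: toL2_zero eta_one)
  qed
  then show ?thesis by simp
 qed
 from L2_add[OF this L2_reflect(1)[OF lam_L2, of z]] show ?thesis by simp
qed

lemma Lam_diff: "f \<in> \<L>2 ==> g \<in> \<L>2 ==> Lam \<rho> (\<lambda>x. f x - g x) z = Lam \<rho> f z - Lam \<rho> g z"
 unfolding Lam_def using L2_mult_locint[OF lam_eta_L2, of f z] L2_mult_locint[OF lam_eta_L2, of g z]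
 by (simp add: right_diff_distrib itg_diff)

lemma Lam_periodic: "periodic L (Lam \<rho> g)"
 by (simp add: periodic_def Lam_def lam_eta_shift(2)[OF a])

end

text \<open>The derivative of the difference is the integral operator with kernel
  \<open>kern \<rho>1 z y - kern \<rho>2 z y\<close>. For almost every \<open>y\<close> both end
  points are nonsingular and \<open>Dl_diff\<close> applies, where the flat parts cancel. Fubini
  exchanges the integrals, and Schur's test bounds the operator.\<close>

theorem Lam_pair:
 assumes a1: "adm \<rho>1 r1" and a2: "adm \<rho>2 r2" and M: "nrm r2 \<le> M" and d: "norm (toL2 r1 - toL2 r2) \<le> d" and g: "g \<in> \<L>2"
 shows "\<exists>k. dvt (\<lambda>z. Lam \<rho>1 g z - Lam \<rho>2 g z) k \<and> nrm k \<le> KC M * d * Wt * nrm g"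
  "\<bar>Lam \<rho>1 g z - Lam \<rho>2 g z\<bar> \<le> 2 * sqrt L / (pi * kap) * d * (sqrt L * nrm g)"
proof -
 define kk where "kk z y = kern \<rho>1 z y - kern \<rho>2 z y" for z y
 define K where "K = (\<lambda>z. itg 0 L (\<lambda>y. kk z y * g y))"
 have d0: "0 \<le> d" by (rule d_nonneg[OF a1 a2 M d])
 have KC0: "0 \<le> KC M" by (rule KC_nonneg[OF a1 a2 M d])
 have gm: "g \<in> borel_measurable borel" by (rule L2_measurable[OF g])
 have kb: "\<bar>kk z y\<bar> \<le> (KC M * d) * wgt (z - y)" for z y unfolding kk_def by (rule kern_diff[OF a1 a2 M d])
 have km: "(\<lambda>(z, y). kk z y) \<in> borel_measurable (borel \<Otimes>\<^sub>M borel)"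
  using kern_measurable[OF a1] kern_measurable[OF a2] unfolding kk_def split_beta' by measurable
 have kgm: "(\<lambda>(z, y). kk z y * g y) \<in> borel_measurable (borel \<Otimes>\<^sub>M borel)"
  using km gm unfolding split_beta' by measurable
 have KL: "K \<in> \<L>2" "nrm K \<le> (KC M * d) * Wt * nrm g"
  unfolding K_def using Schur[OF km kb _ _ g] KC0 d0 kern_shift(2)[OF a1] kern_shift(2)[OF a2] by (auto simp: kk_def)
 have lg: "locint (\<lambda>y. lam (eta \<rho>1 z - eta \<rho>1 y) * g y)" "locint (\<lambda>y. lam (eta \<rho>2 z - eta \<rho>2 y) * g y)" for z
  using L2_mult_locint[OF lam_eta_L2[OF a1] g] L2_mult_locint[OF lam_eta_L2[OF a2] g] by auto
 define D where "D z y = lam (eta \<rho>1 z - eta \<rho>1 y) - lam (eta \<rho>2 z - eta \<rho>2 y)" for z y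
 have Dg: "Lam \<rho>1 g z - Lam \<rho>2 g z = itg 0 L (\<lambda>y. D z y * g y)" "locint (\<lambda>y. D z y * g y)" for z
  using itg_diff[OF lg(1) lg(2), of 0 L z z] locint_diff[OF lg(1) lg(2), of z z] by (simp_all add: Lam_def D_def left_diff_distrib)
 have "(Lam \<rho>1 g b - Lam \<rho>2 g b) - (Lam \<rho>1 g a - Lam \<rho>2 g a) = itg a b K" if ab: "a \<le> b" "b \<le> a + L / 2" for a b
 proof -
  have "(Lam \<rho>1 g b - Lam \<rho>2 g b) - (Lam \<rho>1 g a - Lam \<rho>2 g a) = itg 0 L (\<lambda>y. D b y * g y - D a y * g y)"
   unfolding Dg by (rule itg_diff[symmetric]) (rule Dg)+
  also have "\<dots> = itg 0 L (\<lambda>y. itg a b (\<lambda>z. kk z y * g y))"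
  proof (rule itg_cong_AE)
   show "(\<lambda>y. D b y * g y - D a y * g y) \<in> borel_measurable borel" by (intro locint_measurable locint_diff Dg)
   have "(\<lambda>(y, z). kk z y * g y) \<in> borel_measurable (borel \<Otimes>\<^sub>M borel)"
    using measurable_compose[OF measurable_pair_swap' kgm] by (simp add: split_beta')
   then show "(\<lambda>y. itg a b (\<lambda>z. kk z y * g y)) \<in> borel_measurable borel" by (rule kernel_measurable)
   show "AE y in lborel. D b y * g y - D a y * g y = itg a b (\<lambda>z. kk z y * g y)"
    using AE_sin_nz[of a] AE_sin_nz[of b]
   proof eventually_elim
    case (elim y)
    have "D b y - D a y = (Dl \<rho>1 b y - Dl \<rho>1 a y) - (Dl \<rho>2 b y - Dl \<rho>2 a y)" by (simp add: D_def Dl_def[OF a1] Dl_def[OF a2])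
    also have "\<dots> = itg a b (\<lambda>z. kern \<rho>1 z y) - itg a b (\<lambda>z. kern \<rho>2 z y)"
     using Dl_diff[OF a1 ab elim] Dl_diff[OF a2 ab elim] by simp
    also have "\<dots> = itg a b (\<lambda>z. kk z y)" unfolding kk_def by (rule itg_diff[symmetric]) (rule kern_locint[OF a1] kern_locint[OF a2])+
    finally have e: "D b y - D a y = itg a b (\<lambda>z. kk z y)" .
    have "D b y * g y - D a y * g y = g y * (D b y - D a y)" by (simp add: algebra_simps)
    also have "\<dots> = itg a b (\<lambda>z. g y * kk z y)" unfolding e itg_cmult ..
    finally show ?case by (simp only: mult.commute)
   qed
  qed
  also have "\<dots> = itg a b K"
   unfolding K_def
  proof (rule kernel_swap(1)[OF kgm _ _ L2_locint[OF g] wgt_locint wgt_periodic wgt_nonneg])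
   show "\<bar>kk x y * g y\<bar> \<le> (KC M * d) * (wgt (x - y) * \<bar>g y\<bar>)" for x y
    using mult_right_mono[OF kb[of x y], of "\<bar>g y\<bar>"] by (simp add: abs_mult mult.assoc)
  qed (use KC0 d0 ab L_pos in auto)
  finally show ?thesis .
 qed
 then have "acd (\<lambda>z. Lam \<rho>1 g z - Lam \<rho>2 g z) K" using L_pos by (intro acd_of_short[of _ "L/2"] L2_locint KL) auto
 then have "dvt (\<lambda>z. Lam \<rho>1 g z - Lam \<rho>2 g z) K"
  using Lam_periodic[OF a1] Lam_periodic[OF a2] KL by (simp add: dvt_def periodic_def)
 then show "\<exists>k. dvt (\<lambda>z. Lam \<rho>1 g z - Lam \<rho>2 g z) k \<and> nrm k \<le> KC M * d * Wt * nrm g" using KL by blast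
 have "\<bar>Lam \<rho>1 g z - Lam \<rho>2 g z\<bar> \<le> itg 0 L (\<lambda>y. \<bar>D z y * g y\<bar>)" unfolding Dg by (rule itg_abs)
 also have "\<dots> \<le> itg 0 L (\<lambda>y. 2 * sqrt L / (pi * kap) * d * \<bar>g y\<bar>)"
  unfolding abs_mult D_def
  by (intro itg_mono mult_right_mono lam_eta_diff[OF a1 a2 M d] locint_cmult locint_abs L2_locint[OF g])
   (use locint_abs[OF Dg(2), of z] in \<open>simp_all add: abs_mult D_def\<close>)
 also have "\<dots> \<le> 2 * sqrt L / (pi * kap) * d * (sqrt L * nrm g)"
  unfolding itg_cmult using itg_abs_L2[OF g] L_pos d0 kap_pos by (intro mult_left_mono) auto
 finally show "\<bar>Lam \<rho>1 g z - Lam \<rho>2 g z\<bar> \<le> 2 * sqrt L / (pi * kap) * d * (sqrt L * nrm g)" .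
qed

text \<open>The flat potential \<open>Lam1\<close>, bounded by Fourier series, plus the perturbation
  from the constant 1 to \<open>\<rho>\<close>, bounded by \<open>Lam_pair\<close>.\<close>

lemma Lam_dvt:
 assumes a: "adm \<rho> r" and g: "g \<in> \<L>2"
 shows "\<exists>s. dvt (Lam \<rho> g) s \<and> nrm s \<le> (1 + KC 0 * nrm r * Wt) * nrm g"
  "\<bar>Lam \<rho> g z\<bar> \<le> (nrm lam + 2 * sqrt L / (pi * kap) * nrm r * sqrt L) * nrm g"
proof -
 have n: "nrm (\<lambda>x. 0) \<le> 0" "norm (toL2 r - toL2 (\<lambda>x. 0)) \<le> nrm r" by (simp_all add: toL2_zero)
 obtain k where k: "dvt (\<lambda>z. Lam \<rho> g z - Lam1 g z) k" "nrm k \<le> KC 0 * nrm r * Wt * nrm g"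
  using Lam_pair(1)[OF a adm_one n g] by (auto simp: Lam_one)
 have H: "dvt (Lam1 g) (Hil g)" "nrm (Hil g) \<le> nrm g" using Lam1_dvt[OF g] by auto
 have "dvt (Lam \<rho> g) (\<lambda>x. k x + Hil g x)" using dvt_add[OF k(1) H(1)] by simp
 moreover have "nrm (\<lambda>x. k x + Hil g x) \<le> (1 + KC 0 * nrm r * Wt) * nrm g"
  using norm_triangle_ineq[of "toL2 k" "toL2 (Hil g)"] k(2) H(2) dvtD(2)[OF k(1)] dvtD(2)[OF H(1)]
  by (simp add: toL2_add distrib_right)
 ultimately show "\<exists>s. dvt (Lam \<rho> g) s \<and> nrm s \<le> (1 + KC 0 * nrm r * Wt) * nrm g" by blast
 show "\<bar>Lam \<rho> g z\<bar> \<le> (nrm lam + 2 * sqrt L / (pi * kap) * nrm r * sqrt L) * nrm g"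
  using Lam_pair(2)[OF a adm_one n g, of z] Lam1_sup[OF g, of z] by (simp add: Lam_one distrib_right mult.assoc)
qed

section \<open>Substitution by the inverse diffeomorphism\<close>

definition xi :: "(real => real) => real => real" where "xi \<rho> = inv (eta \<rho>)"

context
 fixes \<rho> r assumes a: "adm \<rho> r"
begin

lemma eta_surj: "surj (eta \<rho>)"
proof -
 have "\<exists>z. eta \<rho> z = x" for x
 proof -
  define k where "k = \<lfloor>x / L\<rfloor>"
  have kx: "of_int k * L \<le> x" "x \<le> of_int k * L + L" using wrap_bounds[of x] by (auto simp: wrap_def k_def)
  have e0: "eta \<rho> 0 = 0" by (simp add: eta_def itg_refl)
  have "\<exists>z\<ge>of_int k * L. z \<le> of_int k * L + L \<and> eta \<rho> z = x"
  proof (rule IVT')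
   show "eta \<rho> (of_int k * L) \<le> x" using eta_shift_int[OF a, of 0 k] e0 kx by simp
   show "x \<le> eta \<rho> (of_int k * L + L)" using eta_shift[OF a, of "of_int k * L"] eta_shift_int[OF a, of 0 k] e0 kx by simp
  qed (use L_pos eta_cont[OF a] in \<open>auto intro: continuous_on_subset\<close>)
  then show ?thesis by blast
 qed
 then show ?thesis by (auto simp: surj_def intro: sym) 
qed

lemma eta_xi: "eta \<rho> (xi \<rho> x) = x" unfolding xi_def by (rule surj_f_inv_f[OF eta_surj])

lemma xi_eta: "xi \<rho> (eta \<rho> z) = z"
 unfolding xi_def by (rule inv_f_f) (rule strict_mono_imp_inj_on[OF eta_mono[OF a]])

lemma xi_shift: "xi \<rho> (x + L) = xi \<rho> x + L"
 using xi_eta[of "xi \<rho> x + L"] by (simp add: eta_shift[OF a] eta_xi)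

lemma xi_cont: "continuous_on UNIV (xi \<rho>)"
proof -
 have "isCont (xi \<rho>) (eta \<rho> x)" for x
  by (rule isCont_inverse_function[where d=1]) (use xi_eta eta_cont[OF a] in \<open>auto simp: continuous_on_eq_continuous_at\<close>)
 then have "isCont (xi \<rho>) x" for x using eta_xi by metis
 then show ?thesis by (simp add: continuous_at_imp_continuous_on)
qed

lemma xi_deriv: "(xi \<rho> has_real_derivative 1 / \<rho> (xi \<rho> x)) (at x)"
proof -
 have "(xi \<rho> has_real_derivative inverse (\<rho> (xi \<rho> x))) (at x)"
 proof (rule DERIV_inverse_function[where a="x - 1" and b="x + 1"])
  show "(eta \<rho> has_real_derivative \<rho> (xi \<rho> x)) (at (xi \<rho> x))" by (rule eta_deriv[OF a])
  show "\<rho> (xi \<rho> x) \<noteq> 0" using adm_pos[OF a, of "xi \<rho> x"] by simp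
  show "isCont (xi \<rho>) x" using xi_cont by (simp add: continuous_on_eq_continuous_at)
 qed (simp_all add: eta_xi)
 then show ?thesis by (simp add: inverse_eq_divide)
qed

lemma inv_rho_xi_cont: "continuous_on UNIV (\<lambda>x. 1 / \<rho> (xi \<rho> x))"
 by (intro continuous_intros continuous_on_compose2[OF adm_cont[OF a] xi_cont]) (use adm_pos[OF a] in \<open>auto simp: less_le\<close>)

lemma xi_measurable: "xi \<rho> \<in> borel_measurable borel" by (rule borel_measurable_continuous_onI[OF xi_cont])

lemma periodic_comp_xi: "periodic L f ==> periodic L (\<lambda>x. f (xi \<rho> x))"
 by (simp add: periodic_def xi_shift)

lemma itg_comp_eta:
 assumes h: "locint h" "periodic L h" shows "itg 0 L (\<lambda>y. h (eta \<rho> y) * \<rho> y) = itg 0 L h"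
proof -
 have "itg 0 L (\<lambda>y. h (eta \<rho> y) * \<rho> y) = itg (eta \<rho> 0) (eta \<rho> L) h"
  by (rule locint_change_of_variables(2)[OF eta_deriv[OF a] adm_cont[OF a] adm_pos[OF a] h(1), symmetric]) (use L_pos in simp)
 also have "\<dots> = itg 0 L h" using itg_period[OF h, of "eta \<rho> 0"] eta_shift[OF a, of 0] by simp
 finally show ?thesis .
qed

lemma locint_comp_xi: assumes "locint h" shows "locint (\<lambda>x. h (xi \<rho> x))"
proof -
 have "locint (\<lambda>z. \<rho> z * h z)" by (rule locint_mult_cont[OF adm_cont[OF a] assms])
 from locint_change_of_variables(1)[OF xi_deriv inv_rho_xi_cont _ this]
 have "locint (\<lambda>x. \<rho> (xi \<rho> x) * h (xi \<rho> x) * (1 / \<rho> (xi \<rho> x)))" using adm_pos[OF a] by simp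
 moreover have "\<rho> (xi \<rho> x) * h (xi \<rho> x) * (1 / \<rho> (xi \<rho> x)) = h (xi \<rho> x)" for x using adm_pos[OF a, of "xi \<rho> x"] by simp
 ultimately show ?thesis by simp
qed

lemma itg_comp_xi: assumes "locint h" "periodic L h" shows "itg 0 L (\<lambda>x. h (xi \<rho> x)) = itg 0 L (\<lambda>y. h y * \<rho> y)"
 using itg_comp_eta[OF locint_comp_xi[OF assms(1)] periodic_comp_xi[OF assms(2)]] by (simp add: xi_eta)

lemma L2_comp_xi: assumes f: "f \<in> \<L>2" shows "(\<lambda>x. f (xi \<rho> x)) \<in> \<L>2"
proof -
 have "locint (\<lambda>x. (f x)\<^sup>2)" using L2_mult_locint[OF f f] by (simp add: power2_eq_square)
 from locint_comp_xi[OF this] have "set_integrable lborel {0..L} (\<lambda>x. (f (xi \<rho> x))\<^sup>2)" by (rule locint_set_integrable)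
 moreover have "(\<lambda>x. f (xi \<rho> x)) \<in> borel_measurable borel" using L2_measurable[OF f] xi_measurable by measurable
 ultimately show ?thesis using periodic_comp_xi[OF L2_periodic[OF f]] by (simp add: L2_circle_def)
qed

lemma dvt_comp_xi: assumes f: "dvt f f'" shows "dvt (\<lambda>x. f (xi \<rho> x)) (\<lambda>x. f' (xi \<rho> x) / \<rho> (xi \<rho> x))"
proof -
 have p: "0 < 1 / \<rho> (xi \<rho> x)" for x using adm_pos[OF a] by simp
 note cv = locint_change_of_variables[OF xi_deriv inv_rho_xi_cont p L2_locint[OF dvtD(2)[OF f]]]
 have "acd (\<lambda>x. f (xi \<rho> x)) (\<lambda>x. f' (xi \<rho> x) * (1 / \<rho> (xi \<rho> x)))"
  unfolding acd_def
 proof (intro conjI allI impI cv(1))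
  fix p q :: real assume pq: "p \<le> q"
  have "strict_mono (xi \<rho>)" by (rule strict_monoI, rule DERIV_pos_imp_increasing) (use xi_deriv p in blast)+
  then have "xi \<rho> p \<le> xi \<rho> q" using pq by (simp add: strict_mono_less_eq)
  then show "f (xi \<rho> q) - f (xi \<rho> p) = itg p q (\<lambda>x. f' (xi \<rho> x) * (1 / \<rho> (xi \<rho> x)))"
   using acdD[OF dvtD(3)[OF f]] cv(2)[OF pq] by simp
 qed
 moreover have "(\<lambda>x. (1 / \<rho> (xi \<rho> x)) * f' (xi \<rho> x)) \<in> \<L>2"
  by (rule L2_cont_mult[OF inv_rho_xi_cont _ L2_comp_xi[OF dvtD(2)[OF f]]])
   (use dvtD(1)[OF adm_dvt[OF a]] in \<open>simp add: periodic_def xi_shift\<close>)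
 ultimately show ?thesis using periodic_comp_xi[OF dvtD(1)[OF f]] by (simp add: dvt_def)
qed

text \<open>The substitution \<open>x = eta \<rho> y\<close>. Its Jacobian is the factor
  \<open>\<rho>\<close> that accompanies the source whenever a Lagrangian potential represents an
  Eulerian one.\<close>

lemma Lam_eq_Lam1:
 assumes f: "f \<in> \<L>2" shows "Lam \<rho> (\<lambda>y. \<rho> y * f y) z = Lam1 (\<lambda>x. f (xi \<rho> x)) (eta \<rho> z)"
proof -
 have "Lam1 (\<lambda>x. f (xi \<rho> x)) (eta \<rho> z) = itg 0 L (\<lambda>y. (lam (eta \<rho> z - eta \<rho> y) * f (xi \<rho> (eta \<rho> y))) * \<rho> y)"
  unfolding Lam1_def
  by (rule itg_comp_eta[symmetric]) (use L2_mult_locint[OF L2_reflect(1)[OF lam_L2] L2_comp_xi[OF f], of "eta \<rho> z"]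
   periodic_mult[OF L2_periodic[OF L2_reflect(1)[OF lam_L2]] L2_periodic[OF L2_comp_xi[OF f]], of "eta \<rho> z"] in simp_all)
 then show ?thesis by (simp add: Lam_def xi_eta mult_ac)
qed

end

text \<open>After reflecting the convolution the kernel no longer depends on \<open>z\<close>, so
  increments can be taken on \<open>F\<close>; Fubini then moves the integral over
  \<open>{a..b}\<close> outside.\<close>

lemma Lam1_H1: assumes F: "dvt F F'" shows "dvt (Lam1 F) (Lam1 F')"
proof -
 note FL = dvtD[OF F]
 have "Lam1 F b - Lam1 F a = itg a b (Lam1 F')" if ab: "a \<le> b" "b \<le> a + L" for a b
 proof -
  have l: "locint (\<lambda>x. lam x * F (z - x))" for z by (intro L2_mult_locint lam_L2 L2_reflect FL)
  have "Lam1 F b - Lam1 F a = itg 0 L (\<lambda>x. lam x * F (b - x) - lam x * F (a - x))"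
   unfolding Lam1_reflect[OF FL(5)] by (rule itg_diff[symmetric]) (rule l)+
  also have "\<dots> = itg 0 L (\<lambda>x. itg a b (\<lambda>z. lam x * F' (z - x)))"
  proof (rule itg_cong)
   fix x
   have "F (b - x) - F (a - x) = itg (a + - x) (b + - x) F'" using acdD[OF FL(3), of "a - x" "b - x"] ab by simp
   then show "lam x * F (b - x) - lam x * F (a - x) = itg a b (\<lambda>z. lam x * F' (z - x))"
    unfolding itg_shift itg_cmult by (simp add: right_diff_distrib[symmetric])
  qed
  also have "\<dots> = itg a b (\<lambda>z. itg 0 L (\<lambda>x. lam x * F' (z - x)))"
  proof (rule kernel_swap(1)[where C=1 and g=lam and G="\<lambda>x. \<bar>F' x\<bar>"])
   show "(\<lambda>(x, y). lam y * F' (x - y)) \<in> borel_measurable (borel \<Otimes>\<^sub>M borel)"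
    using lam_measurable L2_measurable[OF FL(2)] unfolding split_beta' by measurable
   show "periodic L (\<lambda>x. \<bar>F' x\<bar>)" using L2_periodic[OF FL(2)] by (simp add: periodic_def)
  qed (use ab in \<open>auto simp: abs_mult intro: locint_abs L2_locint lam_L2 FL\<close>)
  also have "\<dots> = itg a b (Lam1 F')" by (rule itg_cong) (rule Lam1_reflect[OF FL(2), symmetric])
  finally show ?thesis .
 qed
 moreover have c: "Lam1 F' \<in> \<L>2" using Lam1_dvt(1)[OF FL(2)] by (rule dvtD)
 ultimately have "acd (Lam1 F) (Lam1 F')" by (intro acd_of_short[OF L2_locint L_pos])
 then show ?thesis using c Lam1_periodic by (simp add: dvt_def)
qed

text \<open>In Eulerian variables the derivative falls on the source. There it produces
  \<open>f' / \<rho>\<close>, and this quotient absorbs the Jacobian of the substitution. No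
  derivative of \<open>\<rho>\<close> appears, which is why \<open>Lam\<close> can gain a derivative
  although \<open>\<rho>\<close> is no smoother than the sources.\<close>

theorem Lam_key:
 assumes a: "adm \<rho> r" and f: "dvt f f'"
 shows "dvt (Lam \<rho> (\<lambda>y. \<rho> y * f y)) (\<lambda>z. \<rho> z * Lam \<rho> f' z)"
proof -
 let ?F = "\<lambda>x. f (xi \<rho> x)" and ?G = "\<lambda>x. f' (xi \<rho> x) / \<rho> (xi \<rho> x)"
 have F: "dvt ?F ?G" by (rule dvt_comp_xi[OF a f])
 have LF: "dvt (Lam1 ?F) (Lam1 ?G)" by (rule Lam1_H1[OF F])
 have cG: "continuous_on UNIV (Lam1 ?G)" by (rule dvtD(4)[OF Lam1_dvt(1)[OF dvtD(2)[OF F]]])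
 have q: "(\<lambda>z. (1 / \<rho> z) * f' z) \<in> \<L>2"
  by (rule L2_cont_mult[OF _ _ dvtD(2)[OF f]])
   (use adm_cont[OF a] adm_pos[OF a] dvtD(1)[OF adm_dvt[OF a]] in \<open>auto intro!: continuous_intros simp: less_le periodic_def\<close>)
 have nz: "\<rho> y \<noteq> 0" for y using adm_pos[OF a, of y] by simp
 have G: "Lam1 ?G (eta \<rho> z) = Lam \<rho> f' z" for z
  using Lam_eq_Lam1[OF a q, of z] nz by simp
 have e: "Lam \<rho> (\<lambda>y. \<rho> y * f y) = (\<lambda>z. Lam1 ?F (eta \<rho> z))" by (rule ext) (rule Lam_eq_Lam1[OF a dvtD(5)[OF f]])
 show ?thesis
 proof (rule dvt_of_deriv)
  show "(Lam \<rho> (\<lambda>y. \<rho> y * f y) has_real_derivative \<rho> z * Lam \<rho> f' z) (at z)" for z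
   unfolding e using DERIV_chain2[OF acd_has_deriv[OF dvtD(3)[OF LF] cG] eta_deriv[OF a], of z] by (simp add: G mult.commute)
  show "continuous_on UNIV (\<lambda>z. \<rho> z * Lam \<rho> f' z)"
   unfolding G[symmetric] by (intro continuous_intros adm_cont[OF a] continuous_on_compose2[OF cG eta_cont[OF a]]) auto
  show "periodic L (Lam \<rho> (\<lambda>y. \<rho> y * f y))" by (rule Lam_periodic[OF a])
 qed
qed


section \<open>Lipschitz families\<close>

text \<open>Families \<open>f\<close> of periodic functions over a parameter set \<open>B\<close>: \<open>fam Q B k f\<close> says that each \<open>f p\<close> has
 \<open>k\<close> weak derivatives and that these satisfy \<open>Q B\<close>. With \<open>Q = lip0\<close> this is Lipschitz dependence on \<open>p\<close>
 in \<open>H\<^sup>k\<close>, with bounds; with \<open>Q = con0\<close> it is continuous dependence.\<close>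

primrec fam :: "('p set => ('p => real => real) => bool) => 'p set => nat => ('p => real => real) => bool" where
 "fam Q B 0 f = Q B f"
| "fam Q B (Suc k) f = (Q B f \<and> (\<exists>g. (\<forall>p\<in>B. dvt (f p) (g p)) \<and> fam Q B k g))"

definition lip0 :: "'p::metric_space set => ('p => real => real) => bool" where
 "lip0 B f \<longleftrightarrow> (\<forall>p\<in>B. f p \<in> \<L>2) \<and> (\<exists>C\<ge>0. \<forall>p\<in>B. nrm (f p) \<le> C \<and>
  (\<forall>q\<in>B. norm (toL2 (f p) - toL2 (f q)) \<le> C * dist p q))"

definition lips :: "'p::metric_space set => ('p => real => real) => bool" where
 "lips B f \<longleftrightarrow> (\<exists>C\<ge>0. \<forall>p\<in>B. \<forall>z. \<bar>f p z\<bar> \<le> C \<and> (\<forall>q\<in>B. \<bar>f p z - f q z\<bar> \<le> C * dist p q))"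

abbreviation "lip \<equiv> fam lip0"

lemma fam_0: "fam Q B k f ==> Q B f" by (cases k) auto

lemma fam_Suc: "fam Q B (Suc k) f ==> fam Q B k f"
 by (induction k arbitrary: f) auto

lemma fam_le: "k \<le> n ==> fam Q B n f ==> fam Q B k f"
 by (induction n) (simp, metis le_Suc_eq fam_Suc)

lemma famE: assumes "fam Q B (Suc k) f" obtains g where "\<And>p. p \<in> B ==> dvt (f p) (g p)" "fam Q B k g"
 using assms by auto

lemma fam_SucI: "Q B f ==> fam Q B k g ==> (\<And>p. p \<in> B ==> dvt (f p) (g p)) ==> fam Q B (Suc k) f"
 by auto

lemma lip0_L2: "lip0 B f ==> p \<in> B ==> f p \<in> \<L>2" by (simp add: lip0_def)

lemma lip0I:
 assumes "\<And>p. p \<in> B ==> f p \<in> \<L>2" "\<And>p. p \<in> B ==> nrm (f p) \<le> C"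
  "\<And>p q. p \<in> B ==> q \<in> B ==> norm (toL2 (f p) - toL2 (f q)) \<le> D * dist p q"
 shows "lip0 B f"
 unfolding lip0_def
proof (intro conjI exI[of _ "max 0 (max C D)"] ballI)
 fix p q assume "p \<in> B" "q \<in> B"
 then have "norm (toL2 (f p) - toL2 (f q)) \<le> D * dist p q" by (rule assms)
 also have "\<dots> \<le> max 0 (max C D) * dist p q" by (intro mult_right_mono) auto
 finally show "norm (toL2 (f p) - toL2 (f q)) \<le> max 0 (max C D) * dist p q" .
qed (use assms in \<open>auto simp: le_max_iff_disj\<close>)

lemma lip0E:
 assumes "lip0 B f" obtains C where "C \<ge> 0" "\<And>p. p \<in> B ==> nrm (f p) \<le> C"
  "\<And>p q. p \<in> B ==> q \<in> B ==> norm (toL2 (f p) - toL2 (f q)) \<le> C * dist p q"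
 using assms unfolding lip0_def by blast

lemma lipsI:
 assumes "\<And>p z. p \<in> B ==> \<bar>f p z\<bar> \<le> C" "\<And>p q z. p \<in> B ==> q \<in> B ==> \<bar>f p z - f q z\<bar> \<le> D * dist p q"
 shows "lips B f"
 unfolding lips_def
proof (intro conjI exI[of _ "max 0 (max C D)"] ballI allI)
 fix p q z assume "p \<in> B" "q \<in> B"
 then have "\<bar>f p z - f q z\<bar> \<le> D * dist p q" by (rule assms)
 also have "\<dots> \<le> max 0 (max C D) * dist p q" by (intro mult_right_mono) auto
 finally show "\<bar>f p z - f q z\<bar> \<le> max 0 (max C D) * dist p q" .
qed (use assms in \<open>auto simp: le_max_iff_disj\<close>)

lemma lipsE:
 assumes "lips B f" obtains C where "C \<ge> 0" "\<And>p z. p \<in> B ==> \<bar>f p z\<bar> \<le> C"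
  "\<And>p q z. p \<in> B ==> q \<in> B ==> \<bar>f p z - f q z\<bar> \<le> C * dist p q"
 using assms unfolding lips_def by blast

lemma lips_lip0: assumes "lips B f" "\<And>p. p \<in> B ==> f p \<in> \<L>2" shows "lip0 B f"
proof -
 obtain C where C: "C \<ge> 0" "\<And>p z. p \<in> B ==> \<bar>f p z\<bar> \<le> C" "\<And>p q z. p \<in> B ==> q \<in> B ==> \<bar>f p z - f q z\<bar> \<le> C * dist p q"
  by (rule lipsE[OF assms(1)]) blast
 show ?thesis
 proof (rule lip0I[where C="C * sqrt L" and D="C * sqrt L"])
  fix p q assume pq: "p \<in> B" "q \<in> B"
  have "nrm (\<lambda>z. f p z - f q z) \<le> (C * dist p q) * sqrt L"
   by (rule norm_toL2_le_sup) (use C pq assms(2) L2_diff in auto)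
  then show "norm (toL2 (f p) - toL2 (f q)) \<le> C * sqrt L * dist p q" using assms(2) pq by (simp add: toL2_diff mult_ac)
 qed (use norm_toL2_le_sup C assms(2) in auto)
qed

lemma lip_Suc_sup: assumes "lip B (Suc k) f" shows "lips B f"
proof -
 obtain g where g: "\<And>p. p \<in> B ==> dvt (f p) (g p)" "lip0 B g" using famE[OF assms] fam_0 by metis
 obtain C where C: "C \<ge> 0" "\<And>p. p \<in> B ==> nrm (f p) \<le> C"
  "\<And>p q. p \<in> B ==> q \<in> B ==> norm (toL2 (f p) - toL2 (f q)) \<le> C * dist p q"
  by (rule lip0E[OF fam_0[OF assms]]) blast
 obtain D where D: "D \<ge> 0" "\<And>p. p \<in> B ==> nrm (g p) \<le> D"
  "\<And>p q. p \<in> B ==> q \<in> B ==> norm (toL2 (g p) - toL2 (g q)) \<le> D * dist p q"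
  by (rule lip0E[OF g(2)]) blast
 define A where "A = sqrt L + 1 / sqrt L"
 have A: "A \<ge> 0" using L_pos by (simp add: A_def)
 show ?thesis
 proof (rule lipsI[where C="A * (C + D)" and D="A * (C + D)"])
  fix p z assume "p \<in> B"
  then show "\<bar>f p z\<bar> \<le> A * (C + D)"
   using dvt_sup[OF g(1), of p z] C D A unfolding A_def[symmetric] by (meson add_mono mult_left_mono order_trans)
 next
  fix p q z assume pq: "p \<in> B" "q \<in> B"
  have "\<bar>f p z - f q z\<bar> \<le> A * (nrm (\<lambda>z. f p z - f q z) + nrm (\<lambda>z. g p z - g q z))"
   unfolding A_def by (rule dvt_sup[OF dvt_diff[OF g(1)[OF pq(1)] g(1)[OF pq(2)]]])
  also have "\<dots> \<le> A * (C * dist p q + D * dist p q)"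
   using C(3)[OF pq] D(3)[OF pq] dvtD[OF g(1)[OF pq(1)]] dvtD[OF g(1)[OF pq(2)]] A
   by (intro mult_left_mono add_mono) (simp_all add: toL2_diff)
  finally show "\<bar>f p z - f q z\<bar> \<le> A * (C + D) * dist p q" by (simp add: algebra_simps)
 qed
qed

lemma lip0_mult:
 assumes f: "lips B f" "\<And>p. p \<in> B ==> f p \<in> \<L>2" and g: "lip0 B g"
 shows "lip0 B (\<lambda>p z. f p z * g p z)"
proof -
 obtain C where C: "C \<ge> 0" "\<And>p z. p \<in> B ==> \<bar>f p z\<bar> \<le> C" "\<And>p q z. p \<in> B ==> q \<in> B ==> \<bar>f p z - f q z\<bar> \<le> C * dist p q"
  by (rule lipsE[OF f(1)]) blast
 obtain D where D: "D \<ge> 0" "\<And>p. p \<in> B ==> nrm (g p) \<le> D"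
  "\<And>p q. p \<in> B ==> q \<in> B ==> norm (toL2 (g p) - toL2 (g q)) \<le> D * dist p q"
  by (rule lip0E[OF g]) blast
 note gL = lip0_L2[OF g]
 have fg: "(\<lambda>z. f p z * g q z) \<in> \<L>2" "nrm (\<lambda>z. f p z * g q z) \<le> C * nrm (g q)" if "p \<in> B" "q \<in> B" for p q
  using L2_bounded_mult[OF L2_measurable L2_periodic C(2) gL] norm_toL2_mult_le[OF L2_measurable L2_periodic C(2) gL] f(2) that by auto
 show ?thesis
 proof (rule lip0I[where C="C * D" and D="C * D + C * D"])
  fix p assume p: "p \<in> B"
  show "nrm (\<lambda>z. f p z * g p z) \<le> C * D" using fg(2)[OF p p] D(2)[OF p] C(1) by (meson mult_left_mono order_trans)
  fix q assume q: "q \<in> B"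
  have gd: "(\<lambda>z. g p z - g q z) \<in> \<L>2" by (rule L2_diff[OF gL[OF p] gL[OF q]])
  have fd: "(\<lambda>z. f p z - f q z) \<in> \<L>2" by (rule L2_diff[OF f(2)[OF p] f(2)[OF q]])
  note L2_bounded_mult[OF L2_measurable L2_periodic C(2), OF f(2) f(2), OF p p p gd]
   norm_toL2_mult_le[OF L2_measurable L2_periodic C(2), OF f(2) f(2), OF p p p gd]
  then have d1: "(\<lambda>z. f p z * (g p z - g q z)) \<in> \<L>2 \<and> nrm (\<lambda>z. f p z * (g p z - g q z)) \<le> C * nrm (\<lambda>z. g p z - g q z)" by blast
  note L2_bounded_mult[OF L2_measurable[OF fd] L2_periodic[OF fd] C(3)[OF p q] gL[OF q]]
   norm_toL2_mult_le[OF L2_measurable[OF fd] L2_periodic[OF fd] C(3)[OF p q] gL[OF q]]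
  then have d2: "(\<lambda>z. (f p z - f q z) * g q z) \<in> \<L>2 \<and> nrm (\<lambda>z. (f p z - f q z) * g q z) \<le> (C * dist p q) * nrm (g q)" by blast
  have "(\<lambda>z. f p z * g p z - f q z * g q z) = (\<lambda>z. f p z * (g p z - g q z) + (f p z - f q z) * g q z)" by (auto simp: algebra_simps)
  then have "norm (toL2 (\<lambda>z. f p z * g p z) - toL2 (\<lambda>z. f q z * g q z)) \<le> nrm (\<lambda>z. f p z * (g p z - g q z)) + nrm (\<lambda>z. (f p z - f q z) * g q z)"
  proof -
   assume e: "(\<lambda>z. f p z * g p z - f q z * g q z) = (\<lambda>z. f p z * (g p z - g q z) + (f p z - f q z) * g q z)"
   have "toL2 (\<lambda>z. f p z * g p z) - toL2 (\<lambda>z. f q z * g q z) = toL2 (\<lambda>z. f p z * (g p z - g q z)) + toL2 (\<lambda>z. (f p z - f q z) * g q z)"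
    using d1 d2 toL2_diff[OF fg(1)[OF p p] fg(1)[OF q q]] unfolding e by (simp add: toL2_add)
   then show ?thesis by (simp only: norm_triangle_ineq)
  qed
  also have "\<dots> \<le> C * nrm (\<lambda>z. g p z - g q z) + (C * dist p q) * nrm (g q)" using d1 d2 by simp
  also have "\<dots> \<le> C * (D * dist p q) + (C * dist p q) * D"
   using D(2)[OF q] D(3)[OF p q] C(1) gL p q by (intro add_mono mult_left_mono) (auto simp: toL2_diff)
  finally show "norm (toL2 (\<lambda>z. f p z * g p z) - toL2 (\<lambda>z. f q z * g q z)) \<le> (C * D + C * D) * dist p q" by (simp add: algebra_simps)
 qed (use fg in auto)
qed

lemma lip0_add: assumes "lip0 B f" "lip0 B g" shows "lip0 B (\<lambda>p z. f p z + g p z)"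
proof -
 obtain C where C: "C \<ge> 0" "\<And>p. p \<in> B ==> nrm (f p) \<le> C" "\<And>p q. p \<in> B ==> q \<in> B ==> norm (toL2 (f p) - toL2 (f q)) \<le> C * dist p q"
  by (rule lip0E[OF assms(1)]) blast
 obtain D where D: "D \<ge> 0" "\<And>p. p \<in> B ==> nrm (g p) \<le> D" "\<And>p q. p \<in> B ==> q \<in> B ==> norm (toL2 (g p) - toL2 (g q)) \<le> D * dist p q"
  by (rule lip0E[OF assms(2)]) blast
 note L = lip0_L2[OF assms(1)] lip0_L2[OF assms(2)]
 show ?thesis
 proof (rule lip0I[where C="C + D" and D="C + D"])
  fix p assume p: "p \<in> B"
  show "(\<lambda>z. f p z + g p z) \<in> \<L>2" using L p L2_add by blast
  show "nrm (\<lambda>z. f p z + g p z) \<le> C + D"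
   using L p C(2)[OF p] D(2)[OF p] norm_triangle_ineq[of "toL2 (f p)" "toL2 (g p)"] by (simp add: toL2_add)
  fix q assume q: "q \<in> B"
  have "toL2 (\<lambda>z. f p z + g p z) - toL2 (\<lambda>z. f q z + g q z) = (toL2 (f p) - toL2 (f q)) + (toL2 (g p) - toL2 (g q))"
   using L p q by (simp add: toL2_add)
  then show "norm (toL2 (\<lambda>z. f p z + g p z) - toL2 (\<lambda>z. f q z + g q z)) \<le> (C + D) * dist p q"
   using norm_triangle_ineq[of "toL2 (f p) - toL2 (f q)" "toL2 (g p) - toL2 (g q)"] C(3)[OF p q] D(3)[OF p q] by (simp add: distrib_right)
 qed
qed

lemma lip_add: "lip B k f ==> lip B k g ==> lip B k (\<lambda>p z. f p z + g p z)"
proof (induction k arbitrary: f g)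
 case (Suc k)
 obtain f' where f': "\<And>p. p \<in> B ==> dvt (f p) (f' p)" "lip B k f'" by (rule famE[OF Suc.prems(1)]) blast
 obtain g' where g': "\<And>p. p \<in> B ==> dvt (g p) (g' p)" "lip B k g'" by (rule famE[OF Suc.prems(2)]) blast
 show ?case
  by (rule fam_SucI[OF lip0_add[OF fam_0[OF Suc.prems(1)] fam_0[OF Suc.prems(2)]] Suc.IH[OF f'(2) g'(2)]])
   (rule dvt_add[OF f'(1) g'(1)])
qed (simp add: lip0_add)

lemma lip_bounded_const:
 assumes "\<And>p. p \<in> B ==> \<bar>c p\<bar> \<le> C" "\<And>p q. p \<in> B ==> q \<in> B ==> \<bar>c p - c q\<bar> \<le> D * dist p q"
 shows "lip B k (\<lambda>p z. c p)"
proof -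
 have z: "lip B k (\<lambda>p z. 0)" for k
 proof (induction k)
  case 0
  then show ?case by (simp, intro lip0I[where C=0 and D=0]) (auto simp: L2_const toL2_zero)
 next
  case (Suc k)
  then show ?case using fam_0[OF Suc] dvt_const[of 0] by (auto intro!: exI[of _ "\<lambda>p z. 0"])
 qed
 have "lip0 B (\<lambda>p z. c p)" by (rule lips_lip0) (use assms L2_const in \<open>auto intro: lipsI\<close>)
 then show ?thesis using z dvt_const by (cases k) (auto intro!: exI[of _ "\<lambda>p z. 0"])
qed

lemma lip_const: "lip B k (\<lambda>p z. c)"
 by (rule lip_bounded_const[where C="\<bar>c\<bar>" and D=0]) auto

text \<open>In the product rule the term with \<open>f'\<close> is handled by exchanging roles:
  \<open>g\<close> now has \<open>k + 1\<close> derivatives and acts as the multiplier of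
  \<open>f'\<close> at level \<open>k\<close>. For this reason \<open>n\<close>, \<open>f\<close>
  and \<open>g\<close> vary in the induction.\<close>

lemma lip_mult:
 "k \<le> n ==> lip B (Suc n) f ==> lip B k g ==> lip B k (\<lambda>p z. f p z * g p z)"
proof (induction k arbitrary: n f g)
 case 0
 show ?case using lip0_mult[OF lip_Suc_sup[OF 0(2)] lip0_L2[OF fam_0[OF 0(2)]] fam_0[OF 0(3)]] by simp
next
 case (Suc k)
 obtain f' where f': "\<And>p. p \<in> B ==> dvt (f p) (f' p)" "lip B n f'" by (rule famE[OF Suc.prems(2)]) blast
 obtain g' where g': "\<And>p. p \<in> B ==> dvt (g p) (g' p)" "lip B k g'" by (rule famE[OF Suc.prems(3)]) blast
 have 1: "lip B k (\<lambda>p z. g p z * f' p z)"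
  by (rule Suc.IH[OF order_refl Suc.prems(3) fam_le[OF _ f'(2)]]) (use Suc.prems(1) in simp)
 have 2: "lip B k (\<lambda>p z. f p z * g' p z)" by (rule Suc.IH[OF _ Suc.prems(2) g'(2)]) (use Suc.prems(1) in simp)
 have 3: "lip B k (\<lambda>p z. f' p z * g p z + f p z * g' p z)" using lip_add[OF 1 2] by (simp add: mult.commute)
 have "lip0 B (\<lambda>p z. f p z * g p z)"
  by (rule lip0_mult[OF lip_Suc_sup[OF Suc.prems(2)] lip0_L2[OF fam_0[OF Suc.prems(2)]] fam_0[OF Suc.prems(3)]])
 then show ?case by (rule fam_SucI[OF _ 3 dvt_mult[OF f'(1) g'(1)]])
qed

lemma lip_mult_same: "lip B (Suc n) f ==> lip B (Suc n) g ==> lip B (Suc n) (\<lambda>p z. f p z * g p z)"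
proof -
 assume f: "lip B (Suc n) f" and g: "lip B (Suc n) g"
 obtain f' where f': "\<And>p. p \<in> B ==> dvt (f p) (f' p)" "lip B n f'" by (rule famE[OF f]) blast
 obtain g' where g': "\<And>p. p \<in> B ==> dvt (g p) (g' p)" "lip B n g'" by (rule famE[OF g]) blast
 have 3: "lip B n (\<lambda>p z. f' p z * g p z + f p z * g' p z)"
  using lip_add[OF lip_mult[OF order_refl g f'(2)] lip_mult[OF order_refl f g'(2)]] by (simp add: mult.commute)
 have "lip0 B (\<lambda>p z. f p z * g p z)"
  by (rule lip0_mult[OF lip_Suc_sup[OF f] lip0_L2[OF fam_0[OF f]] fam_0[OF g]])
 then show ?thesis by (rule fam_SucI[OF _ 3 dvt_mult[OF f'(1) g'(1)]])
qed

lemma lip_mult_le: "k \<le> Suc n ==> lip B (Suc n) f ==> lip B k g ==> lip B k (\<lambda>p z. f p z * g p z)"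
 using lip_mult[of k n B f g] lip_mult_same[of B n f g] by (cases "k = Suc n") auto

lemma lip_cmult: "lip B k f ==> lip B k (\<lambda>p z. c * f p z)"
 using lip_mult[OF order_refl lip_const] by blast

lemma lip_minus: "lip B k f ==> lip B k (\<lambda>p z. - f p z)"
 using lip_cmult[of B k f "-1"] by simp

text \<open>The derivative is \<open>f'\<close> times \<open>1 / f\<close> twice, up to sign. An
  induction step therefore needs that multiplication by \<open>1 / f\<close> acts one level below:
  at the bottom by sup bounds, later by the multiplication rule applied to the level already
  reached.\<close>

lemma lip_inverse:
 assumes c: "c > 0" "\<And>p z. p \<in> B ==> c \<le> f p z"
 shows "lip B (Suc n) f ==> lip B (Suc n) (\<lambda>p z. 1 / f p z)"
proof (induction n)
 have base: "lip0 B (\<lambda>p z. 1 / f p z)" "lips B (\<lambda>p z. 1 / f p z)" if f: "lip B (Suc n) f" for n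
 proof -
  have nz: "f p z > 0" if "p \<in> B" for p z using c(1) c(2)[OF that, of z] by linarith
  obtain C where C: "C \<ge> 0" "\<And>p z. p \<in> B ==> \<bar>f p z\<bar> \<le> C" "\<And>p q z. p \<in> B ==> q \<in> B ==> \<bar>f p z - f q z\<bar> \<le> C * dist p q"
   by (rule lipsE[OF lip_Suc_sup[OF f]]) blast
  show s: "lips B (\<lambda>p z. 1 / f p z)"
  proof (rule lipsI[where C="1/c" and D="C / (c * c)"])
   fix p z assume p: "p \<in> B"
   show "\<bar>1 / f p z\<bar> \<le> 1 / c" using c(2)[OF p, of z] c(1) nz[OF p, of z] by (simp add: frac_le)
   fix q assume q: "q \<in> B"
   have "1 / f p z - 1 / f q z = (f q z - f p z) / (f p z * f q z)" using nz[OF p, of z] nz[OF q, of z] by (simp add: field_simps)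
   also have "\<bar>\<dots>\<bar> = \<bar>f p z - f q z\<bar> / (f p z * f q z)" using nz[OF p, of z] nz[OF q, of z] by (simp add: abs_minus_commute)
   also have "\<dots> \<le> (C * dist p q) / (c * c)"
    using C(3)[OF p q] c(2)[OF p, of z] c(2)[OF q, of z] c(1) C(1) by (intro frac_le mult_mono mult_pos_pos) auto
   finally show "\<bar>1 / f p z - 1 / f q z\<bar> \<le> C / (c * c) * dist p q" by simp
  qed
  obtain f' where "\<And>p. p \<in> B ==> dvt (f p) (f' p)" "lip B n f'" by (rule famE[OF f]) blast
  note this(1)
  then show "lip0 B (\<lambda>p z. 1 / f p z)" by (intro lips_lip0[OF s] dvtD(5)[OF dvt_inverse[OF _ c(1) c(2)]])
 qed
 have step: "lip B (Suc k) (\<lambda>p z. 1 / f p z)" if f: "lip B (Suc k) f" and r: "\<And>g. lip B k g ==> lip B k (\<lambda>p z. (1 / f p z) * g p z)" for k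
 proof -
  obtain f' where f': "\<And>p. p \<in> B ==> dvt (f p) (f' p)" "lip B k f'" by (rule famE[OF f]) blast
  have "lip B k (\<lambda>p z. - ((1 / f p z) * ((1 / f p z) * f' p z)))" by (intro lip_minus r f')
  then have "lip B k (\<lambda>p z. - (f' p z * (1 / f p z) * (1 / f p z)))" by (simp add: mult_ac)
  from base(1)[OF f] this show ?thesis by (rule fam_SucI) (rule dvt_inverse[OF f'(1) c(1) c(2)])
 qed
 {
  case 0
  show ?case
  proof (rule step[OF 0])
   fix g assume "lip B 0 g"
   then show "lip B 0 (\<lambda>p z. (1 / f p z) * g p z)" using lip0_mult[OF base(2)[OF 0] lip0_L2[OF base(1)[OF 0]]] by simp
  qed
 next
  case (Suc n)
  show ?case
   by (rule step[OF Suc.prems]) (rule lip_mult_le[OF order_refl Suc.IH[OF fam_Suc[OF Suc.prems]]])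
 }
qed

lemma mean_bound: assumes "h \<in> \<L>2" shows "\<bar>mean L h\<bar> \<le> nrm h / sqrt L"
proof -
 have "\<bar>itg 0 L h\<bar> \<le> sqrt L * nrm h" using itg_abs[of 0 L h] itg_abs_L2[OF assms] by linarith
 then have "\<bar>mean L h\<bar> \<le> sqrt L * nrm h / L" unfolding mean_itg using L_pos by (simp add: divide_right_mono)
 also have "\<dots> = nrm h / sqrt L" using L_pos by (simp add: field_simps)
 finally show ?thesis .
qed

lemma mean_diff: "f \<in> \<L>2 ==> g \<in> \<L>2 ==> mean L (\<lambda>z. f z - g z) = mean L f - mean L g"
 unfolding mean_itg by (simp add: itg_diff L2_locint diff_divide_distrib)

lemma lip_prim: assumes g: "lip B k g" shows "lip B (Suc k) (\<lambda>p. prim (g p))"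
proof -
 obtain C where C: "C \<ge> 0" "\<And>p. p \<in> B ==> nrm (g p) \<le> C" "\<And>p q. p \<in> B ==> q \<in> B ==> norm (toL2 (g p) - toL2 (g q)) \<le> C * dist p q"
  by (rule lip0E[OF fam_0[OF g]]) blast
 note gL = lip0_L2[OF fam_0[OF g]]
 note mb = mean_bound
 have "lip B k (\<lambda>p z. mean L (g p))"
 proof (rule lip_bounded_const[where C="C / sqrt L" and D="C / sqrt L"])
  fix p assume p: "p \<in> B"
  show "\<bar>mean L (g p)\<bar> \<le> C / sqrt L" using mb[OF gL[OF p]] C(2)[OF p] L_pos by (meson divide_right_mono order_trans real_sqrt_ge_zero less_imp_le)
  fix q assume q: "q \<in> B"
  have "mean L (g p) - mean L (g q) = mean L (\<lambda>z. g p z - g q z)"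
   unfolding mean_itg using gL p q by (simp add: itg_diff L2_locint diff_divide_distrib)
  also have "\<bar>\<dots>\<bar> \<le> norm (toL2 (g p) - toL2 (g q)) / sqrt L" using mb[OF L2_diff[OF gL[OF p] gL[OF q]]] gL p q by (simp add: toL2_diff)
  also have "\<dots> \<le> (C * dist p q) / sqrt L" using C(3)[OF p q] L_pos by (intro divide_right_mono) auto
  finally show "\<bar>mean L (g p) - mean L (g q)\<bar> \<le> C / sqrt L * dist p q" by simp
 qed
 from lip_add[OF g lip_minus[OF this]] have 1: "lip B k (\<lambda>p z. g p z - mean L (g p))" by simp
 have "lips B (\<lambda>p. prim (g p))"
 proof (rule lipsI[where C="sqrt L * C" and D="sqrt L * C"])
  fix p z assume p: "p \<in> B"
  show "\<bar>prim (g p) z\<bar> \<le> sqrt L * C" using prim_sup[OF gL[OF p], of z] C(2)[OF p] L_pos by (meson mult_left_mono order_trans real_sqrt_ge_zero less_imp_le)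
  fix q assume q: "q \<in> B"
  have "prim (g p) z - prim (g q) z = prim (\<lambda>z. g p z - g q z) z" using prim_diff[OF gL[OF p] gL[OF q]] by simp
  also have "\<bar>\<dots>\<bar> \<le> sqrt L * norm (toL2 (g p) - toL2 (g q))" using prim_sup[OF L2_diff[OF gL[OF p] gL[OF q]], of z] gL p q by (simp add: toL2_diff)
  also have "\<dots> \<le> sqrt L * (C * dist p q)" using C(3)[OF p q] L_pos by (intro mult_left_mono) auto
  finally show "\<bar>prim (g p) z - prim (g q) z\<bar> \<le> sqrt L * C * dist p q" by simp
 qed
 then have "lip0 B (\<lambda>p. prim (g p))" by (rule lips_lip0) (use gL prim(1) dvtD(5) in blast)
 from this 1 show ?thesis by (rule fam_SucI) (rule prim(1)[OF gL])
qed

lemma lip_compose: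
 assumes phi: "\<And>t. t \<in> A ==> phi t \<in> B" "\<And>s t. s \<in> A ==> t \<in> A ==> dist (phi s) (phi t) \<le> K * dist s t"
 shows "lip B k f ==> lip A k (\<lambda>t. f (phi t))"
proof (induction k arbitrary: f)
 have base: "lip0 A (\<lambda>t. f (phi t))" if f: "lip0 B f" for f
 proof -
  obtain C where C: "C \<ge> 0" "\<And>p. p \<in> B ==> nrm (f p) \<le> C" "\<And>p q. p \<in> B ==> q \<in> B ==> norm (toL2 (f p) - toL2 (f q)) \<le> C * dist p q"
   using f unfolding lip0_def by blast
  show ?thesis
  proof (rule lip0I[where C=C and D="C * K"])
   fix s t assume "s \<in> A" "t \<in> A"
   then show "norm (toL2 (f (phi s)) - toL2 (f (phi t))) \<le> C * K * dist s t"
    using C(3)[OF phi(1) phi(1), of s t] mult_left_mono[OF phi(2) C(1), of s t] by (simp add: mult.assoc)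
  qed (use C phi lip0_L2[OF f] in auto)
 qed
 {
  case 0
  then show ?case using base by simp
 next
  case (Suc k)
  obtain g where g: "\<And>p. p \<in> B ==> dvt (f p) (g p)" "lip B k g" by (rule famE[OF Suc.prems]) blast
  show ?case by (rule fam_SucI[OF base[OF fam_0[OF Suc.prems]] Suc.IH[OF g(2)]]) (rule g(1)[OF phi(1)])
 }
qed

text \<open>On functions of mean zero this inverts the n-fold derivative. It lets a
  square-integrable function stand for one with \<open>n\<close> more derivatives.\<close>

primrec pw :: "nat => (real => real) => real => real" where
 "pw 0 f = f"
| "pw (Suc n) f = prim (pw n f)"

lemma lip_pw: "lip B k f ==> lip B (n + k) (\<lambda>p. pw n (f p))"
 by (induction n) (auto dest: lip_prim simp del: fam.simps)

text \<open>The derivative of a periodic function has mean zero, so only the mean of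
  \<open>f p\<close> itself is lost when passing to the top derivative. At \<open>n = 0\<close>
  nothing has been differentiated and no mean is split off.\<close>

lemma lip_top:
 "lip B n f ==> \<exists>g. lip0 B g \<and> (\<forall>p\<in>B. f p = (\<lambda>z. (if n = 0 then 0 else mean L (f p)) + pw n (g p) z))"
proof (induction n arbitrary: f)
 case 0
 then show ?case by auto
next
 case (Suc n)
 obtain f' where f': "\<And>p. p \<in> B ==> dvt (f p) (f' p)" "lip B n f'" by (rule famE[OF Suc.prems]) blast
 obtain g where g: "lip0 B g" "\<And>p. p \<in> B ==> f' p = (\<lambda>z. (if n = 0 then 0 else mean L (f' p)) + pw n (g p) z)"
  using Suc.IH[OF f'(2)] by blast
 have "f p = (\<lambda>z. mean L (f p) + pw (Suc n) (g p) z)" if p: "p \<in> B" for p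
 proof -
  have "mean L (f' p) = 0" using dvt_mean_zero[OF f'(1)[OF p]] by (simp add: mean_itg)
  then have "f' p = pw n (g p)" using g(2)[OF p] by (auto split: if_splits)
  then show ?thesis using dvt_prim[OF f'(1)[OF p]] by auto
 qed
 then show ?case using g(1) by (intro exI[of _ g]) simp
qed

text \<open>A change of the source costs the norm of one operator, a change of the coordinate the
  norm of a difference of operators, given by \<open>Lam_pair\<close>. The derivatives
  \<open>s p\<close> are arbitrary choices; uniqueness almost everywhere transfers the norm bounds
  to them.\<close>

lemma lip_Lam0:
 assumes a: "\<And>p. p \<in> B ==> adm (\<rho> p) (r p)" and r: "lip0 B r" and g: "lip0 B g"
 shows "lip B 1 (\<lambda>p. Lam (\<rho> p) (g p))"
proof -
 obtain C where C: "C \<ge> 0" "\<And>p. p \<in> B ==> nrm (r p) \<le> C" "\<And>p q. p \<in> B ==> q \<in> B ==> norm (toL2 (r p) - toL2 (r q)) \<le> C * dist p q"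
  by (rule lip0E[OF r]) blast
 obtain D where D: "D \<ge> 0" "\<And>p. p \<in> B ==> nrm (g p) \<le> D" "\<And>p q. p \<in> B ==> q \<in> B ==> norm (toL2 (g p) - toL2 (g q)) \<le> D * dist p q"
  by (rule lip0E[OF g]) blast
 note gL = lip0_L2[OF g]
 define c1 where "c1 = 2 * sqrt L / (pi * kap)"
 define A where "A = nrm lam + c1 * C * sqrt L"
 define A' where "A' = 1 + KC 0 * C * Wt"
 have c1: "c1 \<ge> 0" using L_pos kap_pos by (simp add: c1_def)
 have KC: "KC M \<ge> 0" if "M \<ge> 0" for M
  unfolding KC_def using L_pos that mu_pos kap_pos by (intro mult_nonneg_nonneg add_nonneg_nonneg) auto
 have A: "\<bar>Lam (\<rho> p) h z\<bar> \<le> A * nrm h" if "p \<in> B" "h \<in> \<L>2" for p h z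
 proof -
  have "nrm lam + c1 * nrm (r p) * sqrt L \<le> A"
   unfolding A_def using C(2)[OF that(1)] c1 L_pos by (intro add_left_mono mult_right_mono mult_left_mono) auto
  then show ?thesis using Lam_dvt(2)[OF a[OF that(1)] that(2), of z, folded c1_def] by (meson mult_right_mono norm_ge_zero order_trans)
 qed
 have A': "\<exists>s. dvt (Lam (\<rho> p) h) s \<and> nrm s \<le> A' * nrm h" if "p \<in> B" "h \<in> \<L>2" for p h
 proof -
  have "1 + KC 0 * nrm (r p) * Wt \<le> A'"
   unfolding A'_def using C(2)[OF that(1)] KC[of 0] Wt_nonneg by (intro add_left_mono mult_right_mono mult_left_mono) auto
  then show ?thesis using Lam_dvt(1)[OF a[OF that(1)] that(2)] by (meson mult_right_mono norm_ge_zero order_trans)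
 qed
 have A0: "A \<ge> 0" "A' \<ge> 0" unfolding A_def A'_def using c1 C(1) KC[of 0] Wt_nonneg L_pos by auto
 have AD: "A * nrm (g p) \<le> A * D" "A' * nrm (g p) \<le> A' * D" if "p \<in> B" for p
  using D(2)[OF that] A0 by (auto intro: mult_left_mono)
 define s where "s p = (SOME s. dvt (Lam (\<rho> p) (g p)) s)" for p
 have s: "dvt (Lam (\<rho> p) (g p)) (s p)" if "p \<in> B" for p
  unfolding s_def using someI_ex[of "\<lambda>s. dvt (Lam (\<rho> p) (g p)) s"] A'[OF that gL[OF that]] by blast
 have split: "Lam (\<rho> p) (g p) z - Lam (\<rho> q) (g q) z = Lam (\<rho> p) (\<lambda>z. g p z - g q z) z + (Lam (\<rho> p) (g q) z - Lam (\<rho> q) (g q) z)"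
  if "p \<in> B" "q \<in> B" for p q z using Lam_diff[OF a[OF that(1)] gL[OF that(1)] gL[OF that(2)]] by simp
 have gd: "nrm (\<lambda>z. g p z - g q z) \<le> D * dist p q" if "p \<in> B" "q \<in> B" for p q
  using D(3)[OF that] gL that by (simp add: toL2_diff)
 have "lips B (\<lambda>p. Lam (\<rho> p) (g p))"
 proof (rule lipsI[where C="A * D" and D="A * D + c1 * C * (sqrt L * D)"])
  fix p z assume p: "p \<in> B"
  show "\<bar>Lam (\<rho> p) (g p) z\<bar> \<le> A * D" using A[OF p gL[OF p], of z] AD(1)[OF p] by linarith
  fix q assume q: "q \<in> B"
  have "\<bar>Lam (\<rho> p) (g q) z - Lam (\<rho> q) (g q) z\<bar> \<le> c1 * (C * dist p q) * (sqrt L * nrm (g q))"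
   unfolding c1_def by (rule Lam_pair(2)[OF a[OF p] a[OF q] C(2)[OF q] C(3)[OF p q] gL[OF q]])
  also have "\<dots> \<le> c1 * (C * dist p q) * (sqrt L * D)" using D(2)[OF q] c1 C(1) L_pos by (intro mult_left_mono) auto
  finally have 1: "\<bar>Lam (\<rho> p) (g q) z - Lam (\<rho> q) (g q) z\<bar> \<le> c1 * (C * dist p q) * (sqrt L * D)" .
  have 2: "\<bar>Lam (\<rho> p) (\<lambda>z. g p z - g q z) z\<bar> \<le> A * (D * dist p q)"
   using A[OF p L2_diff[OF gL[OF p] gL[OF q]], of z] mult_left_mono[OF gd[OF p q] A0(1)] by linarith
  show "\<bar>Lam (\<rho> p) (g p) z - Lam (\<rho> q) (g q) z\<bar> \<le> (A * D + c1 * C * (sqrt L * D)) * dist p q"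
   unfolding split[OF p q] using 1 2 abs_triangle_ineq[of "Lam (\<rho> p) (\<lambda>z. g p z - g q z) z" "Lam (\<rho> p) (g q) z - Lam (\<rho> q) (g q) z"]
   by (simp add: algebra_simps)
 qed
 then have l: "lip0 B (\<lambda>p. Lam (\<rho> p) (g p))" using lips_lip0 dvtD(5)[OF s] by blast
 have "lip0 B s"
 proof (rule lip0I[where C="A' * D" and D="A' * D + KC C * C * Wt * D"])
  fix p assume p: "p \<in> B"
  show sp: "s p \<in> \<L>2" by (rule dvtD(2)[OF s[OF p]])
  have n: "nrm (s p) \<le> A' * nrm (g p)"
   using A'[OF p gL[OF p]] dvt_unique[OF s[OF p]] toL2_cong_AE[OF sp] dvtD(2) by metis
  show "nrm (s p) \<le> A' * D" using n AD(2)[OF p] by linarith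
  fix q assume q: "q \<in> B"
  obtain s1 where s1: "dvt (Lam (\<rho> p) (\<lambda>z. g p z - g q z)) s1" "nrm s1 \<le> A' * nrm (\<lambda>z. g p z - g q z)"
   using A'[OF p L2_diff[OF gL[OF p] gL[OF q]]] by blast
  obtain k where k: "dvt (\<lambda>z. Lam (\<rho> p) (g q) z - Lam (\<rho> q) (g q) z) k" "nrm k \<le> KC C * (C * dist p q) * Wt * nrm (g q)"
   using Lam_pair(1)[OF a[OF p] a[OF q] C(2)[OF q] C(3)[OF p q] gL[OF q]] by blast
  have "dvt (\<lambda>z. Lam (\<rho> p) (g p) z - Lam (\<rho> q) (g q) z) (\<lambda>z. s1 z + k z)"
   unfolding split[OF p q] by (rule dvt_add[OF s1(1) k(1)])
  from dvt_unique[OF dvt_diff[OF s[OF p] s[OF q]] this]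
  have "toL2 (s p) - toL2 (s q) = toL2 s1 + toL2 k"
   using toL2_cong_AE[OF L2_diff[OF dvtD(2)[OF s[OF p]] dvtD(2)[OF s[OF q]]] L2_add[OF dvtD(2)[OF s1(1)] dvtD(2)[OF k(1)]]]
    toL2_diff[OF dvtD(2)[OF s[OF p]] dvtD(2)[OF s[OF q]]] toL2_add[OF dvtD(2)[OF s1(1)] dvtD(2)[OF k(1)]] by simp
  then have "norm (toL2 (s p) - toL2 (s q)) \<le> nrm s1 + nrm k" by (simp add: norm_triangle_ineq)
  also have "\<dots> \<le> A' * (D * dist p q) + KC C * (C * dist p q) * Wt * D"
  proof (rule add_mono)
   show "nrm s1 \<le> A' * (D * dist p q)" using s1(2) mult_left_mono[OF gd[OF p q] A0(2)] by linarith
   have "KC C * (C * dist p q) * Wt * nrm (g q) \<le> KC C * (C * dist p q) * Wt * D"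
    using D(2)[OF q] KC[OF C(1)] C(1) Wt_nonneg by (intro mult_left_mono) auto
   then show "nrm k \<le> KC C * (C * dist p q) * Wt * D" using k(2) by linarith
  qed
  finally show "norm (toL2 (s p) - toL2 (s q)) \<le> (A' * D + KC C * C * Wt * D) * dist p q" by (simp add: algebra_simps)
 qed
 then show ?thesis using l s by auto
qed

text \<open>By \<open>Lam_key\<close> the operator \<open>Lam \<rho>\<close> gains one derivative at every level.\<close>

lemma lip_Lam:
 assumes rho: "lip B (Suc n) \<rho>" and lb: "\<And>p z. p \<in> B ==> 1/2 \<le> \<rho> p z" and m: "\<And>p. p \<in> B ==> itg 0 L (\<rho> p) = L"
 shows "k \<le> Suc n ==> lip B k g ==> lip B (Suc k) (\<lambda>p. Lam (\<rho> p) (g p))"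
proof (induction k arbitrary: g)
 obtain r where r: "\<And>p. p \<in> B ==> dvt (\<rho> p) (r p)" "lip0 B r" using famE[OF rho] fam_0 by metis
 have a: "adm (\<rho> p) (r p)" if "p \<in> B" for p using r(1)[OF that] lb[OF that] m[OF that] by (simp add: adm_def)
 {
  case 0
  then show ?case using lip_Lam0[OF a r(2)] by simp
 next
  case (Suc k)
  \<comment> \<open>Dividing by \<open>\<rho>\<close> brings the source into the form that
    \<open>Lam_key\<close> requires, at no cost in regularity.\<close>
  have "lip B (Suc k) (\<lambda>p z. (1 / \<rho> p z) * g p z)"
   by (rule lip_mult_le[OF Suc.prems(1) lip_inverse[OF _ lb rho] Suc.prems(2)]) auto
  then obtain f' where f': "\<And>p. p \<in> B ==> dvt (\<lambda>z. (1 / \<rho> p z) * g p z) (f' p)" "lip B k f'" by (rule famE) blast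
  have "lip B (Suc k) (\<lambda>p. Lam (\<rho> p) (f' p))" by (rule Suc.IH[OF _ f'(2)]) (use Suc.prems(1) in simp)
  then have 1: "lip B (Suc k) (\<lambda>p z. \<rho> p z * Lam (\<rho> p) (f' p) z)" by (rule lip_mult_le[OF Suc.prems(1) rho])
  have 2: "dvt (Lam (\<rho> p) (g p)) (\<lambda>z. \<rho> p z * Lam (\<rho> p) (f' p) z)" if p: "p \<in> B" for p
  proof -
   have "(\<lambda>y. \<rho> p y * ((1 / \<rho> p y) * g p y)) = g p" using adm_pos[OF a[OF p]] by (auto simp: less_le)
   then show ?thesis using Lam_key[OF a[OF p] f'(1)[OF p]] by simp
  qed
  have "lip0 B (\<lambda>p. Lam (\<rho> p) (g p))" using fam_0[OF lip_Lam0[OF a r(2) fam_0[OF Suc.prems(2)]]] .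
  then show ?case by (rule fam_SucI[OF _ 1 2])
 }
qed

end

section \<open>The Lagrangian system\<close>

text \<open>The field is Lipschitz on a ball only, so the iteration runs on curves in that ball:
  \<open>T * M \<le> r\<close> keeps them there and \<open>T * K \<le> 1/2\<close> gives a
  contraction. The Lipschitz bound in time is recorded because it turns Lipschitz families over the
  phase space into Lipschitz families over \<open>{0..T}\<close>.\<close>

lemma Picard:
 fixes F :: "'a::banach => 'a"
 assumes K: "\<And>x y. x \<in> cball x0 r ==> y \<in> cball x0 r ==> norm (F x - F y) \<le> K * norm (x - y)"
  and M: "\<And>x. x \<in> cball x0 r ==> norm (F x) \<le> M"
  and r: "0 < r" and K0: "0 \<le> K" and M0: "0 \<le> M" and T: "0 < T" "T * M \<le> r" "T * K \<le> 1/2"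
 shows "\<exists>x. x 0 = x0 \<and> (\<forall>t\<in>{0..T}. x t \<in> cball x0 r \<and> (x has_vector_derivative F (x t)) (at t within {0..T}))
  \<and> (\<forall>s\<in>{0..T}. \<forall>t\<in>{0..T}. dist (x s) (x t) \<le> M * dist s t)"
proof -
 define S where "S = (PiC UNIV (\<lambda>_. cball x0 r) :: (real \<Rightarrow>\<^sub>C 'a) set)"
 \<comment> \<open>Bounded continuous functions are defined on the whole line, so time is clamped to
   \<open>{0..T}\<close>.\<close>
 define cl where "cl t = max 0 (min T t)" for t
 have cl: "0 \<le> cl t" "cl t \<le> T" for t using T by (auto simp: cl_def)
 have clid: "t \<in> {0..T} ==> cl t = t" for t by (auto simp: cl_def)
 have fS: "apply_bcontfun f t \<in> cball x0 r" if "f \<in> S" for f t using that by (auto simp: S_def mem_PiC_iff)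
 have Fc: "continuous_on (cball x0 r) F"
 proof (rule lipschitz_on_continuous_on[where L=K])
  show "K-lipschitz_on (cball x0 r) F" using K K0 by (intro lipschitz_onI) (auto simp: dist_norm)
 qed
 define g where "g f s = F (apply_bcontfun f s)" for f :: "real \<Rightarrow>\<^sub>C 'a" and s
 have gc: "continuous_on A (g f)" if "f \<in> S" for f A
  unfolding g_def[abs_def]
  by (rule continuous_on_compose2[OF Fc]) (use fS[OF that] continuous_on_apply_bcontfun in auto)
 have gi: "g f integrable_on {a..b}" if "f \<in> S" for f a b by (rule integrable_continuous_interval[OF gc[OF that]])
 have gM: "norm (g f s) \<le> M" if "f \<in> S" for f s using M[OF fS[OF that]] by (simp add: g_def)
 define G where "G f t = x0 + integral {0..cl t} (g f)" for f :: "real \<Rightarrow>\<^sub>C 'a" and t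
 have Gi: "norm (integral {a..b} (g f)) \<le> M * (b - a)" if "f \<in> S" "a \<le> b" for f a b
  by (rule integral_bound[OF that(2) gc[OF that(1)]]) (rule gM[OF that(1)])
 have Gball: "G f t \<in> cball x0 r" if "f \<in> S" for f t
 proof -
  have "norm (integral {0..cl t} (g f)) \<le> M * (cl t - 0)" by (rule Gi[OF that cl(1)])
  also have "\<dots> \<le> M * T" using cl(2) M0 by (intro mult_left_mono) auto
  finally show ?thesis using T by (simp add: G_def dist_norm mult.commute)
 qed
 have Gbc: "G f \<in> bcontfun" if "f \<in> S" for f
  unfolding bcontfun_def
 proof (intro CollectI conjI)
  have "continuous_on {0..T} (\<lambda>t. integral {0..t} (g f))" by (rule indefinite_integral_continuous_1[OF gi[OF that]])
  then show "continuous_on UNIV (G f)"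
   unfolding G_def[abs_def] using cl by (intro continuous_intros continuous_on_compose2[of "{0..T}" "\<lambda>t. integral {0..t} (g f)" UNIV cl])
    (auto simp: cl_def[abs_def] intro!: continuous_intros)
  show "bounded (range (G f))" by (rule bounded_subset[OF bounded_cball[of x0 r]]) (use Gball[OF that] in auto)
 qed
 define P where "P f = Bcontfun (G f)" for f
 have Pa: "apply_bcontfun (P f) = G f" if "f \<in> S" for f unfolding P_def using Gbc[OF that] by (rule Bcontfun_inverse)
 have PS: "P f \<in> S" if "f \<in> S" for f using Gball[OF that] Pa[OF that] by (auto simp: S_def mem_PiC_iff)
 have contr: "dist (P f) (P h) \<le> (1/2) * dist f h" if f: "f \<in> S" and h: "h \<in> S" for f h
 proof (rule dist_bound)
  fix t
  have "dist (apply_bcontfun (P f) t) (apply_bcontfun (P h) t) = norm (integral {0..cl t} (\<lambda>s. g f s - g h s))"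
   unfolding Pa[OF f] Pa[OF h] by (simp add: G_def dist_norm integral_diff[OF gi[OF f] gi[OF h]])
  also have "\<dots> \<le> (K * dist f h) * (cl t - 0)"
  proof (rule integral_bound[OF cl(1)])
   show "continuous_on {0..cl t} (\<lambda>s. g f s - g h s)" by (intro continuous_on_diff gc f h)
   fix s
   have "norm (g f s - g h s) \<le> K * dist (apply_bcontfun f s) (apply_bcontfun h s)"
    unfolding g_def dist_norm by (rule K[OF fS[OF f] fS[OF h]])
   also have "\<dots> \<le> K * dist f h" using K0 by (intro mult_left_mono dist_bounded)
   finally show "norm (g f s - g h s) \<le> K * dist f h" .
  qed
  also have "\<dots> \<le> (K * dist f h) * T" using cl(2)[of t] K0 by (intro mult_left_mono) auto
  also have "\<dots> = (T * K) * dist f h" by simp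
  also have "\<dots> \<le> (1/2) * dist f h" using T by (intro mult_right_mono) auto
  finally show "dist (apply_bcontfun (P f) t) (apply_bcontfun (P h) t) \<le> (1/2) * dist f h" .
 qed
 have "complete S" unfolding S_def complete_eq_closed by (rule closed_PiC) auto
 moreover have "const_bcontfun x0 \<in> S" using r by (simp add: S_def mem_PiC_iff)
 ultimately have "\<exists>!f. f \<in> S \<and> P f = f"
  using Banach_fix[of S "1/2" P] PS contr by auto
 then obtain f where f: "f \<in> S" "P f = f" by blast
 define x where "x = apply_bcontfun f"
 have xe: "x t = x0 + integral {0..t} (g f)" if "t \<in> {0..T}" for t
  using Pa[OF f(1)] f(2) clid[OF that] by (simp add: x_def G_def)
 have "(x has_vector_derivative F (x t)) (at t within {0..T})" if t: "t \<in> {0..T}" for t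
 proof -
  have "((\<lambda>u. x0 + integral {0..u} (g f)) has_vector_derivative 0 + g f t) (at t within {0..T})"
   by (intro has_vector_derivative_add has_vector_derivative_const integral_has_vector_derivative gc f t)
  then have "((\<lambda>u. x0 + integral {0..u} (g f)) has_vector_derivative F (x t)) (at t within {0..T})" by (simp add: g_def x_def)
  then show ?thesis by (rule has_vector_derivative_transform[OF t xe, rotated])
 qed
 moreover have "dist (x s) (x t) \<le> M * dist s t" if s: "s \<in> {0..T}" and t: "t \<in> {0..T}" for s t
 proof -
  have *: "dist (x s) (x t) \<le> M * dist s t" if "s \<le> t" "s \<in> {0..T}" "t \<in> {0..T}" for s t
  proof -
   have "integral {0..s} (g f) + integral {s..t} (g f) = integral {0..t} (g f)"
    by (rule Henstock_Kurzweil_Integration.integral_combine) (use that gi[OF f(1)] in auto)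
   then have "x t - x s = integral {s..t} (g f)" using xe that by (simp add: algebra_simps)
   then show ?thesis using Gi[OF f(1) that(1)] that(1) by (simp add: dist_norm norm_minus_commute[of "x s"] abs_minus_commute)
  qed
  show ?thesis using *[of s t] *[of t s] s t by (cases "s \<le> t") (auto simp: dist_commute)
 qed
 moreover have "x 0 = x0" using xe[of 0] T by simp
 ultimately show ?thesis using fS[OF f(1)] by (intro exI[of _ x]) (auto simp: x_def)
qed

context circle
begin

lemma pw_L2: "g \<in> \<L>2 ==> pw n g \<in> \<L>2"
 by (induction n) (auto dest: prim(1) dvtD(5))

lemma pw_bound: "\<exists>C\<ge>0. \<forall>g\<in>\<L>2. \<forall>z. \<bar>pw (Suc n) g z\<bar> \<le> C * nrm g"
proof (induction n)
 case 0
 show ?case using prim_sup L_pos by (intro exI[of _ "sqrt L"]) auto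
next
 case (Suc n)
 then obtain C where C: "C \<ge> 0" "\<And>g z. g \<in> \<L>2 ==> \<bar>pw (Suc n) g z\<bar> \<le> C * nrm g" by blast
 have "\<bar>pw (Suc (Suc n)) g z\<bar> \<le> (sqrt L * (C * sqrt L)) * nrm g" if g: "g \<in> \<L>2" for g z
 proof -
  have "\<bar>pw (Suc (Suc n)) g z\<bar> \<le> sqrt L * nrm (pw (Suc n) g)"
   using prim_sup[OF pw_L2[OF g, of "Suc n"]] by simp
  also have "\<dots> \<le> sqrt L * (C * nrm g * sqrt L)"
   using norm_toL2_le_sup[OF pw_L2[OF g, of "Suc n"] C(2)[OF g]] L_pos by (intro mult_left_mono) auto
  finally show ?thesis by (simp only: mult_ac)
 qed
 moreover have "0 \<le> sqrt L * (C * sqrt L)" using C(1) L_pos by (intro mult_nonneg_nonneg) auto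
 ultimately show ?case by (intro exI[of _ "sqrt L * (C * sqrt L)"] conjI ballI allI)
qed

lemma pw_cong_AE: "f \<in> \<L>2 ==> g \<in> \<L>2 ==> AE x in lborel. f x = g x ==> pw (Suc n) f = pw (Suc n) g"
proof (induction n)
 case 0
 then show ?case using prim_cong_AE[of f g] by (simp only: pw.simps)
next
 case (Suc n)
 then show ?case by (simp only: pw.simps)
qed

lemma pw_add: "f \<in> \<L>2 ==> g \<in> \<L>2 ==> pw n (\<lambda>x. f x + g x) = (\<lambda>x. pw n f x + pw n g x)"
 by (induction n) (simp_all add: prim_add pw_L2)

lemma pw_cmult: "f \<in> \<L>2 ==> pw n (\<lambda>x. c * f x) = (\<lambda>x. c * pw n f x)"
 by (induction n) (simp_all add: prim_cmult pw_L2)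

text \<open>After at least one integration, evaluation at a point is continuous on L^2. This allows
  a differential equation in \<open>l2\<close> to be read off at each \<open>z\<close>.\<close>

lemma bounded_linear_pw: "bounded_linear (\<lambda>x. pw (Suc n) (ofL2 x) z)"
proof -
 obtain C where C: "C \<ge> 0" "\<And>g z. g \<in> \<L>2 ==> \<bar>pw (Suc n) g z\<bar> \<le> C * nrm g" using pw_bound by blast
 show ?thesis
 proof (rule bounded_linear_intro[where K=C])
  fix x y :: l2 and c :: real
  show "pw (Suc n) (ofL2 (x + y)) z = pw (Suc n) (ofL2 x) z + pw (Suc n) (ofL2 y) z"
   using pw_cong_AE[OF ofL2_L2 L2_add[OF ofL2_L2 ofL2_L2] ofL2_add, of n x y] pw_add[OF ofL2_L2 ofL2_L2, of "Suc n" x y] by simp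
  show "pw (Suc n) (ofL2 (c *\<^sub>R x)) z = c *\<^sub>R pw (Suc n) (ofL2 x) z"
   using pw_cong_AE[OF ofL2_L2 L2_cmult[OF ofL2_L2] ofL2_scaleR, of n c x] pw_cmult[OF ofL2_L2, of "Suc n" c x] by simp
  have "\<bar>pw (Suc n) (ofL2 x) z\<bar> \<le> C * nrm (ofL2 x)" by (rule C(2)[OF ofL2_L2])
  also have "\<dots> \<le> C * norm x" using norm_toL2_ofL2 C(1) by (intro mult_left_mono)
  finally show "norm (pw (Suc n) (ofL2 x) z) \<le> norm x * C" by (simp add: mult.commute)
 qed
qed

lemma pw_mean_zero: "g \<in> \<L>2 ==> itg 0 L (pw (Suc n) g) = 0"
 by (simp add: prim(2) pw_L2)

lemma lip_ofL2:
 assumes "\<And>p. p \<in> B ==> norm (\<pi> p) \<le> C" "\<And>p q. p \<in> B ==> q \<in> B ==> dist (\<pi> p) (\<pi> q) \<le> dist p q"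
 shows "lip0 B (\<lambda>p. ofL2 (\<pi> p))"
proof (rule lip0I[where C=C and D=1])
 fix p q assume "p \<in> B" "q \<in> B"
 then show "norm (toL2 (ofL2 (\<pi> p)) - toL2 (ofL2 (\<pi> q))) \<le> 1 * dist p q" using dist_toL2_ofL2 assms(2) by (metis mult_1 order_trans)
next
 fix p assume "p \<in> B"
 then show "nrm (ofL2 (\<pi> p)) \<le> C" by (rule order_trans[OF norm_toL2_ofL2 assms(1)])
qed (rule ofL2_L2)

text \<open>The Lagrangian system \<open>\<rho>\<^sub>t = \<rho> Lam \<rho> W'\<close>, \<open>W\<^sub>t = u\<^sub>0' / \<rho>\<close> is an ordinary differential equation with
 locally Lipschitz right-hand side for the top derivatives of \<open>\<rho>\<close> and \<open>W\<close> in \<open>L\<^sup>2\<close> and the mean of \<open>W\<close>.\<close>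

theorem Lagrangian_solution:
 fixes n :: nat and R :: real
 assumes R: "0 \<le> R"
 shows "\<exists>T>0. \<forall>q\<in>\<L>2. \<forall>h\<in>\<L>2. nrm q \<le> R \<longrightarrow> nrm h \<le> R \<longrightarrow>
  (\<exists>\<rho> W W'. lip {0..T} (Suc n) \<rho> \<and> lip {0..T} (Suc n) W \<and> lip {0..T} n W' \<and>
   \<rho> 0 = (\<lambda>z. 1) \<and> W 0 = pw (Suc n) h \<and>
   (\<forall>t\<in>{0..T}. dvt (W t) (W' t) \<and> itg 0 L (\<rho> t) = L \<and> (\<forall>z. 1/2 \<le> \<rho> t z \<and>
    ((\<lambda>t. \<rho> t z) has_real_derivative \<rho> t z * Lam (\<rho> t) (W' t) z) (at t within {0..T}) \<and>
    ((\<lambda>t. W t z) has_real_derivative pw (Suc n) q z / \<rho> t z) (at t within {0..T}))))"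
proof -
 let ?m = "Suc n"
 obtain C0 where C0: "C0 \<ge> 0" "\<And>g z. g \<in> \<L>2 ==> \<bar>pw ?m g z\<bar> \<le> C0 * nrm g" using pw_bound by blast
 \<comment> \<open>\<open>C0 * r0 \<le> 1/2\<close> keeps \<open>\<rho>\<close> above 1/2, and
   \<open>r0 \<le> 1\<close> lets the other components move by at most 1.\<close>
 define r0 where "r0 = min 1 (1 / (2 * (C0 + 1)))"
 have r0: "0 < r0" "r0 \<le> 1" "C0 * r0 \<le> 1/2"
 proof -
  have "C0 * r0 \<le> C0 * (1 / (2 * (C0 + 1)))" using C0(1) by (intro mult_left_mono) (auto simp: r0_def)
  also have "\<dots> \<le> 1/2" using C0(1) by (simp add: field_simps)
  finally show "C0 * r0 \<le> 1/2" .
 qed (use C0(1) in \<open>auto simp: r0_def\<close>)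
 \<comment> \<open>The unknowns are the top derivative of \<open>\<rho>\<close>, the mean of
   \<open>W\<close> and the top derivative of \<open>W\<close>. The last component does not evolve:
   it is the top derivative of the datum for \<open>u\<close>. Treating it as part of the parameter
   makes all constants depend on \<open>R\<close> alone.\<close>
 define B :: "((l2 \<times> real \<times> l2) \<times> l2) set" where
  "B = {p. norm (fst (fst p)) \<le> r0 \<and> \<bar>fst (snd (fst p))\<bar> \<le> 1 \<and> norm (snd (snd (fst p))) \<le> R + 1 \<and> norm (snd p) \<le> R}"
 define \<rho> where "\<rho> p z = 1 + pw ?m (ofL2 (fst (fst p))) z" for p :: "(l2 \<times> real \<times> l2) \<times> l2" and z
 define W where "W p z = fst (snd (fst p)) + pw ?m (ofL2 (snd (snd (fst p)))) z" for p :: "(l2 \<times> real \<times> l2) \<times> l2" and z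
 define U where "U p = pw ?m (ofL2 (snd p))" for p :: "(l2 \<times> real \<times> l2) \<times> l2"
 have d: "dist (fst (fst p)) (fst (fst q)) \<le> dist p q" "dist (fst (snd (fst p))) (fst (snd (fst q))) \<le> dist p q"
  "dist (snd (snd (fst p))) (snd (snd (fst q))) \<le> dist p q" "dist (snd p) (snd q) \<le> dist p q" for p q :: "(l2 \<times> real \<times> l2) \<times> l2"
  by (meson dist_fst_le dist_snd_le order_trans)+
 have lp: "lip B ?m (\<lambda>p. pw ?m (ofL2 (\<pi> p)))" if "\<And>p. p \<in> B ==> norm (\<pi> p) \<le> C" "\<And>p q. dist (\<pi> p) (\<pi> q) \<le> dist p q" for \<pi> C
  using lip_pw[of B 0 "\<lambda>p. ofL2 (\<pi> p)" ?m] lip_ofL2[of B \<pi> C, OF that(1) that(2)] by simp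
 have lrho: "lip B ?m \<rho>"
  unfolding \<rho>_def[abs_def] by (rule lip_add[OF lip_const lp[of "\<lambda>p. fst (fst p)" r0]]) (simp_all add: B_def d)
 have lW: "lip B ?m W"
  unfolding W_def[abs_def]
  by (rule lip_add[OF lip_bounded_const[of B "\<lambda>p. fst (snd (fst p))" 1 1] lp[of "\<lambda>p. snd (snd (fst p))" "R + 1"]])
   (simp_all add: B_def d dist_real_def[symmetric])
 have lU: "lip B ?m U" unfolding U_def[abs_def] by (rule lp[of snd R]) (simp_all add: B_def d)
 have rlb: "1/2 \<le> \<rho> p z" if "p \<in> B" for p z
 proof -
  have "\<bar>pw ?m (ofL2 (fst (fst p))) z\<bar> \<le> C0 * nrm (ofL2 (fst (fst p)))" by (rule C0(2)[OF ofL2_L2])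
  also have "\<dots> \<le> C0 * r0" using that norm_toL2_ofL2[of "fst (fst p)"] C0(1) by (intro mult_left_mono) (auto simp: B_def)
  finally show ?thesis using r0(3) by (simp add: \<rho>_def abs_le_iff)
 qed
 have rm: "itg 0 L (\<rho> p) = L" for p
  unfolding \<rho>_def[abs_def] using pw_mean_zero[OF ofL2_L2, of n "fst (fst p)"] L_pos
  by (simp add: itg_add locint_const L2_locint pw_L2 ofL2_L2 itg_const del: pw.simps)
 obtain W' where W': "\<And>p. p \<in> B ==> dvt (W p) (W' p)" "lip B n W'" by (rule famE[OF lW]) blast
 define N1 where "N1 p z = \<rho> p z * Lam (\<rho> p) (W' p) z" for p z
 define N2 where "N2 p z = (1 / \<rho> p z) * U p z" for p z
 have lLam: "lip B ?m (\<lambda>p. Lam (\<rho> p) (W' p))" by (rule lip_Lam[OF lrho rlb rm _ W'(2)]) auto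
 have lN1: "lip B ?m N1" unfolding N1_def[abs_def] by (rule lip_mult_same[OF lrho lLam])
 have lN2: "lip B ?m N2" unfolding N2_def[abs_def] by (rule lip_mult_same[OF lip_inverse[OF _ rlb lrho] lU]) auto
 \<comment> \<open>By \<open>Lam_key\<close> the function \<open>N1 p\<close> is the derivative of a
   periodic potential. So \<open>\<rho>\<close> keeps the mean 1 and needs no coordinate for
   it.\<close>
 have N1m: "mean L (N1 p) = 0" if p: "p \<in> B" for p
 proof -
  obtain r where "\<And>p. p \<in> B ==> dvt (\<rho> p) (r p)" "lip B n r" by (rule famE[OF lrho]) blast
  then have a: "adm (\<rho> p) (r p)" using p rlb rm by (simp add: adm_def)
  have "itg 0 L (N1 p) = 0" unfolding N1_def[abs_def] by (rule dvt_mean_zero[OF Lam_key[OF a W'(1)[OF p]]])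
  then show ?thesis by (simp add: mean_itg)
 qed
 obtain g1 where g1: "lip0 B g1" "\<And>p. p \<in> B ==> N1 p = (\<lambda>z. mean L (N1 p) + pw ?m (g1 p) z)" using lip_top[OF lN1] by auto
 obtain g2 where g2: "lip0 B g2" "\<And>p. p \<in> B ==> N2 p = (\<lambda>z. mean L (N2 p) + pw ?m (g2 p) z)" using lip_top[OF lN2] by auto
 obtain C1 where C1: "C1 \<ge> 0" "\<And>p. p \<in> B ==> nrm (g1 p) \<le> C1" "\<And>p q. p \<in> B ==> q \<in> B ==> norm (toL2 (g1 p) - toL2 (g1 q)) \<le> C1 * dist p q"
  by (rule lip0E[OF g1(1)]) blast
 obtain C2 where C2: "C2 \<ge> 0" "\<And>p. p \<in> B ==> nrm (g2 p) \<le> C2" "\<And>p q. p \<in> B ==> q \<in> B ==> norm (toL2 (g2 p) - toL2 (g2 q)) \<le> C2 * dist p q"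
  by (rule lip0E[OF g2(1)]) blast
 obtain C3 where C3: "C3 \<ge> 0" "\<And>p. p \<in> B ==> nrm (N2 p) \<le> C3" "\<And>p q. p \<in> B ==> q \<in> B ==> norm (toL2 (N2 p) - toL2 (N2 q)) \<le> C3 * dist p q"
  by (rule lip0E[OF fam_0[OF lN2]]) blast
 note N2L = lip0_L2[OF fam_0[OF lN2]]
 define F where "F q x = (toL2 (g1 (x, q)), mean L (N2 (x, q)), toL2 (g2 (x, q)))" for q x
 define M where "M = C1 + (C3 / sqrt L + C2)"
 have M0: "M \<ge> 0" using C1 C2 C3 L_pos by (simp add: M_def)
 have tri: "norm (a, b, c) \<le> norm a + (norm b + norm c)" for a :: l2 and b :: real and c :: l2
  using norm_Pair_le[of a "(b, c)"] norm_Pair_le[of b c] by linarith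
 have FM: "norm (F q x) \<le> M" if p: "(x, q) \<in> B" for x q
 proof -
  have "\<bar>mean L (N2 (x, q))\<bar> \<le> C3 / sqrt L"
   using mean_bound[OF N2L[OF p]] divide_right_mono[OF C3(2)[OF p], of "sqrt L"] L_pos by (meson less_imp_le order_trans real_sqrt_ge_0_iff)
  then show ?thesis unfolding F_def M_def using tri[of "toL2 (g1 (x, q))" "mean L (N2 (x, q))" "toL2 (g2 (x, q))"] C1(2)[OF p] C2(2)[OF p] by simp
 qed
 have FK: "norm (F q x - F q y) \<le> M * norm (x - y)" if p: "(x, q) \<in> B" "(y, q) \<in> B" for x y q
 proof -
  have dd: "dist (x, q) (y, q) = norm (x - y)" by (simp add: dist_Pair_Pair dist_norm)
  have "\<bar>mean L (N2 (x, q)) - mean L (N2 (y, q))\<bar> \<le> norm (toL2 (N2 (x, q)) - toL2 (N2 (y, q))) / sqrt L"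
   using mean_bound[OF L2_diff[OF N2L[OF p(1)] N2L[OF p(2)]]] mean_diff[OF N2L[OF p(1)] N2L[OF p(2)]] toL2_diff[OF N2L[OF p(1)] N2L[OF p(2)]] by simp
  also have "\<dots> \<le> C3 * norm (x - y) / sqrt L" using C3(3)[OF p] L_pos unfolding dd by (intro divide_right_mono) auto
  finally have 3: "\<bar>mean L (N2 (x, q)) - mean L (N2 (y, q))\<bar> \<le> C3 / sqrt L * norm (x - y)" by simp
  have "F q x - F q y = (toL2 (g1 (x, q)) - toL2 (g1 (y, q)), mean L (N2 (x, q)) - mean L (N2 (y, q)), toL2 (g2 (x, q)) - toL2 (g2 (y, q)))"
   by (simp add: F_def)
  then have "norm (F q x - F q y) \<le> norm (toL2 (g1 (x, q)) - toL2 (g1 (y, q))) + (\<bar>mean L (N2 (x, q)) - mean L (N2 (y, q))\<bar> + norm (toL2 (g2 (x, q)) - toL2 (g2 (y, q))))"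
   using tri by (metis real_norm_def)
  also have "\<dots> \<le> C1 * norm (x - y) + (C3 / sqrt L * norm (x - y) + C2 * norm (x - y))"
   using C1(3)[OF p] C2(3)[OF p] 3 unfolding dd by (intro add_mono)
  also have "\<dots> = M * norm (x - y)" by (simp add: M_def algebra_simps)
  finally show ?thesis .
 qed
 \<comment> \<open>\<open>M\<close> serves as bound and as Lipschitz constant of \<open>F\<close>.
   Since \<open>T * M \<le> r0 / 2\<close> and \<open>r0 \<le> 1\<close>, both conditions of
   \<open>Picard\<close> are met.\<close>
 define T where "T = r0 / (2 * (M + 1))"
 have T: "0 < T" "T * M \<le> r0" "T * M \<le> 1/2"
 proof -
  show "0 < T" using r0 M0 by (simp add: T_def)
  have "T * M \<le> T * (M + 1)" using \<open>0 < T\<close> by simp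
  also have "\<dots> = r0 / 2" using M0 by (simp add: T_def field_simps)
  finally show "T * M \<le> r0" "T * M \<le> 1/2" using r0 by auto
 qed
 show ?thesis
 proof (intro exI[of _ T] conjI T(1) ballI impI)
  fix q h assume q: "q \<in> \<L>2" and h: "h \<in> \<L>2" and qR: "nrm q \<le> R" and hR: "nrm h \<le> R"
  define x0 :: "l2 \<times> real \<times> l2" where "x0 = (0, 0, toL2 h)"
  have inB: "(x, toL2 q) \<in> B" if "x \<in> cball x0 r0" for x
  proof -
   have nx: "norm (x - x0) \<le> r0" using that by (simp add: dist_norm norm_minus_commute)
   have e: "fst (x - x0) = fst x" "fst (snd (x - x0)) = fst (snd x)" "snd (snd (x - x0)) = snd (snd x) - toL2 h" by (simp_all add: x0_def)
   have nf: "norm (fst y) \<le> norm y" "norm (snd y) \<le> norm y" for y :: "'u::real_normed_vector \<times> 'v::real_normed_vector"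
    using norm_fst_le[of "fst y" "snd y"] norm_snd_le[of "snd y" "fst y"] by simp_all
   have "norm (fst x) \<le> r0" using order_trans[OF nf(1) nx] unfolding e(1) .
   moreover have s: "norm (snd (x - x0)) \<le> r0" by (rule order_trans[OF nf(2) nx])
   moreover have "\<bar>fst (snd x)\<bar> \<le> 1" using order_trans[OF nf(1) s] r0 unfolding e(2) by simp
   moreover have "norm (snd (snd x) - toL2 h) \<le> 1" using order_trans[OF nf(2) s] r0 unfolding e(3) by simp
   then have "norm (snd (snd x)) \<le> R + 1" using hR norm_triangle_sub[of "snd (snd x)" "toL2 h"] by linarith
   ultimately show ?thesis using qR by (simp add: B_def)
  qed
  obtain x where x: "x 0 = x0" "\<And>t. t \<in> {0..T} ==> x t \<in> cball x0 r0"
   "\<And>t. t \<in> {0..T} ==> (x has_vector_derivative F (toL2 q) (x t)) (at t within {0..T})"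
   "\<And>s t. s \<in> {0..T} ==> t \<in> {0..T} ==> dist (x s) (x t) \<le> M * dist s t"
   using Picard[of x0 r0 "F (toL2 q)" M M T, OF FK[OF inB inB] FM[OF inB] r0(1) M0 M0 T] by blast
  define p where "p t = (x t, toL2 q)" for t
  have pB: "p t \<in> B" if "t \<in> {0..T}" for t using inB[OF x(2)[OF that]] by (simp add: p_def)
  have pL: "dist (p s) (p t) \<le> M * dist s t" if "s \<in> {0..T}" "t \<in> {0..T}" for s t
   using x(4)[OF that] by (simp add: p_def dist_Pair_Pair)
  have lc: "lip {0..T} k (\<lambda>t. f (p t))" if "lip B k f" for k and f :: "(l2 \<times> real \<times> l2) \<times> l2 => real => real"
   by (rule lip_compose[of "{0..T}" p B M, OF _ _ that]) (use pB pL in auto)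
  have der: "((\<lambda>t. \<rho> (p t) z) has_real_derivative N1 (p t) z) (at t within {0..T})"
   "((\<lambda>t. W (p t) z) has_real_derivative pw ?m q z / \<rho> (p t) z) (at t within {0..T})" if t: "t \<in> {0..T}" for t z
  proof -
   note xd = x(3)[OF t]
   have bl1: "bounded_linear (\<lambda>x::l2 \<times> real \<times> l2. pw ?m (ofL2 (fst x)) z)"
    using bounded_linear_compose[OF bounded_linear_pw bounded_linear_fst] by simp
   have bl2: "bounded_linear (\<lambda>x::l2 \<times> real \<times> l2. fst (snd x) + pw ?m (ofL2 (snd (snd x))) z)"
    by (intro bounded_linear_add bounded_linear_compose[OF bounded_linear_fst bounded_linear_snd]
     bounded_linear_compose[OF bounded_linear_pw bounded_linear_compose[OF bounded_linear_snd bounded_linear_snd]])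
   have c: "pw ?m (ofL2 (toL2 g)) = pw ?m g" if "g \<in> \<L>2" for g by (rule pw_cong_AE[OF ofL2_L2 that ofL2_toL2[OF that]])
   have 1: "pw ?m (ofL2 (fst (F (toL2 q) (x t)))) z = N1 (p t) z"
    using g1(2)[OF pB[OF t]] N1m[OF pB[OF t]] c[OF lip0_L2[OF g1(1) pB[OF t]]] by (simp add: F_def p_def fun_eq_iff del: pw.simps)
   have 2: "fst (snd (F (toL2 q) (x t))) + pw ?m (ofL2 (snd (snd (F (toL2 q) (x t))))) z = pw ?m q z / \<rho> (p t) z"
   proof -
    have "mean L (N2 (p t)) + pw ?m (g2 (p t)) z = N2 (p t) z" using g2(2)[OF pB[OF t]] by metis
    moreover have "U (p t) = pw ?m q" unfolding U_def p_def using c[OF q] by (simp del: pw.simps)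
    ultimately show ?thesis using c[OF lip0_L2[OF g2(1) pB[OF t]]] by (simp add: F_def p_def N2_def del: pw.simps)
   qed
   have "((\<lambda>t. pw ?m (ofL2 (fst (x t))) z) has_real_derivative N1 (p t) z) (at t within {0..T})"
    using bounded_linear.has_vector_derivative[OF bl1 xd] unfolding 1 by (simp add: has_real_derivative_iff_has_vector_derivative)
   then show "((\<lambda>t. \<rho> (p t) z) has_real_derivative N1 (p t) z) (at t within {0..T})"
    unfolding \<rho>_def p_def by (auto intro!: derivative_eq_intros simp del: pw.simps)
   show "((\<lambda>t. W (p t) z) has_real_derivative pw ?m q z / \<rho> (p t) z) (at t within {0..T})"
    using bounded_linear.has_vector_derivative[OF bl2 xd] unfolding 2 by (simp add: has_real_derivative_iff_has_vector_derivative W_def p_def del: pw.simps)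
  qed
  have "\<rho> (p 0) = (\<lambda>z. 1)"
   using linear_0[OF bounded_linear.linear[OF bounded_linear_pw]] by (auto simp: \<rho>_def p_def x(1) x0_def simp del: pw.simps)
  moreover have "W (p 0) = pw ?m h"
   using pw_cong_AE[OF ofL2_L2 h ofL2_toL2[OF h], of n] by (auto simp: W_def p_def x(1) x0_def simp del: pw.simps)
  ultimately show "\<exists>\<rho> W W'. lip {0..T} (Suc n) \<rho> \<and> lip {0..T} (Suc n) W \<and> lip {0..T} n W' \<and>
   \<rho> 0 = (\<lambda>z. 1) \<and> W 0 = pw (Suc n) h \<and>
   (\<forall>t\<in>{0..T}. dvt (W t) (W' t) \<and> itg 0 L (\<rho> t) = L \<and> (\<forall>z. 1/2 \<le> \<rho> t z \<and>
    ((\<lambda>t. \<rho> t z) has_real_derivative \<rho> t z * Lam (\<rho> t) (W' t) z) (at t within {0..T}) \<and>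
    ((\<lambda>t. W t z) has_real_derivative pw (Suc n) q z / \<rho> t z) (at t within {0..T})))"
   using lc[OF lrho] lc[OF lW] lc[OF W'(2)] der W'(1)[OF pB] rm rlb[OF pB] unfolding N1_def
   by (intro exI[of _ "\<lambda>t. \<rho> (p t)"] exI[of _ "\<lambda>t. W (p t)"] exI[of _ "\<lambda>t. W' (p t)"]) (simp del: fam.simps pw.simps)
 qed
qed

end

section \<open>Strong time derivatives from weak ones\<close>

lemma real_derivative_transform:
 assumes "t \<in> S" "\<And>s. s \<in> S ==> f s = g s" "(g has_real_derivative D) (at t within S)"
 shows "(f has_real_derivative D) (at t within S)"
 using assms unfolding has_real_derivative_iff_has_vector_derivative by (metis has_vector_derivative_transform)

context circle
begin

text \<open>The integral \<open>Y\<close> of the continuous curve \<open>G\<close> has the desired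
  derivative. The difference of \<open>F\<close> and \<open>F 0 + Y\<close> has derivative 0 against
  every trigonometric function and starts at 0, so it vanishes by completeness.\<close>

lemma vector_derivative_of_weak:
 assumes F: "\<And>t. t \<in> {0..T} ==> F t \<in> \<L>2" and G: "\<And>t. t \<in> {0..T} ==> G t \<in> \<L>2"
  and c: "continuous_on {0..T} (\<lambda>t. toL2 (G t))" and T: "0 \<le> T"
  and weak: "\<And>k \<theta> t. t \<in> {0..T} ==> ((\<lambda>t. itg 0 L (\<lambda>x. F t x * trg k \<theta> x)) has_real_derivative itg 0 L (\<lambda>x. G t x * trg k \<theta> x)) (at t within {0..T})"
  and t: "t \<in> {0..T}"
 shows "((\<lambda>t. toL2 (F t)) has_vector_derivative toL2 (G t)) (at t within {0..T})"
proof -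
 define Y where "Y s = integral {0..s} (\<lambda>t. toL2 (G t))" for s
 have Yd: "(Y has_vector_derivative toL2 (G s)) (at s within {0..T})" if "s \<in> {0..T}" for s
  unfolding Y_def[abs_def] by (rule integral_has_vector_derivative[OF c that])
 interpret p: bounded_linear "\<lambda>x. toL2 (ofL2 x)" by (rule bounded_linear_toL2_ofL2)
 have pY: "toL2 (ofL2 (Y s)) = Y s" if "s \<in> {0..T}" for s
 proof -
  have i: "(\<lambda>t. toL2 (G t)) integrable_on {0..s}"
   by (rule integrable_continuous_interval[OF continuous_on_subset[OF c]]) (use that in auto)
  have "toL2 (ofL2 (Y s)) = integral {0..s} (\<lambda>t. toL2 (ofL2 (toL2 (G t))))"
   unfolding Y_def using integral_linear[OF i bounded_linear_toL2_ofL2] by (simp add: o_def)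
  also have "\<dots> = Y s" unfolding Y_def by (rule Henstock_Kurzweil_Integration.integral_cong) (use that G toL2_ofL2_toL2 in auto)
  finally show ?thesis .
 qed
 have e: "toL2 (F s) = toL2 (F 0) + Y s" if s: "s \<in> {0..T}" for s
 proof -
  have 0: "0 \<in> {0..T}" using T by auto
  define D where "D s = toL2 (F s) - toL2 (F 0) - Y s" for s
  have "inner (D s) (toL2 (trg k \<theta>)) = 0" for k \<theta>
  proof -
   have "((\<lambda>s. inner (D s) (toL2 (trg k \<theta>))) has_real_derivative 0) (at r within {0..T})" if r: "r \<in> {0..T}" for r
   proof -
    have "((\<lambda>s. inner (toL2 (F s)) (toL2 (trg k \<theta>))) has_real_derivative itg 0 L (\<lambda>x. G r x * trg k \<theta> x)) (at r within {0..T})"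
     by (rule real_derivative_transform[OF r _ weak[OF r]]) (simp add: inner_toL2 F trg_L2)
    moreover have "((\<lambda>s. inner (Y s) (toL2 (trg k \<theta>))) has_real_derivative itg 0 L (\<lambda>x. G r x * trg k \<theta> x)) (at r within {0..T})"
     using bounded_linear.has_vector_derivative[OF bounded_linear_inner_left Yd[OF r], of "toL2 (trg k \<theta>)"]
     by (simp add: has_real_derivative_iff_has_vector_derivative inner_toL2 G[OF r] trg_L2)
    ultimately show ?thesis unfolding D_def inner_diff_left by (auto intro!: derivative_eq_intros)
   qed
   then obtain C where C: "\<And>r. r \<in> {0..T} ==> inner (D r) (toL2 (trg k \<theta>)) = C"
    using has_field_derivative_zero_constant[of "{0..T}" "\<lambda>s. inner (D s) (toL2 (trg k \<theta>))"] by auto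
   have "D 0 = 0" by (simp add: D_def Y_def)
   then show ?thesis using C[OF s] C[OF 0] by simp
  qed
  moreover have "toL2 (ofL2 (D s)) = D s" unfolding D_def by (simp only: p.diff toL2_ofL2_toL2 F s 0 pY)
  ultimately have "D s = 0" by (intro l2_zeroI)
  then show ?thesis by (simp add: D_def algebra_simps)
 qed
 have "((\<lambda>s. toL2 (F 0) + Y s) has_vector_derivative 0 + toL2 (G t)) (at t within {0..T})"
  by (intro has_vector_derivative_add has_vector_derivative_const Yd t)
 then show ?thesis using has_vector_derivative_transform[OF t e] by simp
qed

text \<open>Testing moves the space derivative to the trigonometric function, where the time
  derivative is already known; continuity of \<open>G'\<close> turns the weak statement into a
  strong one.\<close>

lemma vector_derivative_dvt:
 assumes F: "\<And>t. t \<in> {0..T} ==> dvt (F t) (F' t)" and G: "\<And>t. t \<in> {0..T} ==> dvt (G t) (G' t)"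
  and c: "continuous_on {0..T} (\<lambda>t. toL2 (G' t))" and T: "0 \<le> T"
  and d: "\<And>t. t \<in> {0..T} ==> ((\<lambda>t. toL2 (F t)) has_vector_derivative toL2 (G t)) (at t within {0..T})"
  and t: "t \<in> {0..T}"
 shows "((\<lambda>t. toL2 (F' t)) has_vector_derivative toL2 (G' t)) (at t within {0..T})"
proof (rule vector_derivative_of_weak[OF dvtD(2)[OF F] dvtD(2)[OF G] c T _ t])
 fix k \<theta> t assume t: "t \<in> {0..T}"
 let ?c = "2 * mu * of_int k" and ?\<phi> = "trg k (\<theta> + pi / 2)"
 have p: "itg 0 L (\<lambda>x. f' x * trg k \<theta> x) = - (?c * inner (toL2 f) (toL2 ?\<phi>))" if "dvt f f'" for f f'
 proof -
  have "(\<lambda>x. f x * (?c * ?\<phi> x)) = (\<lambda>x. ?c * (f x * ?\<phi> x))" by auto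
  then show ?thesis using itg_parts[OF that trg_dvt] by (simp only: itg_cmult inner_toL2 dvtD(5)[OF that] trg_L2)
 qed
 have "((\<lambda>t. - (?c * inner (toL2 (F t)) (toL2 ?\<phi>))) has_real_derivative - (?c * inner (toL2 (G t)) (toL2 ?\<phi>))) (at t within {0..T})"
  using bounded_linear.has_vector_derivative[OF bounded_linear_inner_left d[OF t], of "toL2 ?\<phi>"]
  by (auto simp: has_real_derivative_iff_has_vector_derivative[symmetric] intro!: derivative_eq_intros)
 then have "((\<lambda>t. - (?c * inner (toL2 (F t)) (toL2 ?\<phi>))) has_real_derivative itg 0 L (\<lambda>x. G' t x * trg k \<theta> x)) (at t within {0..T})"
  by (simp only: p[OF G[OF t]])
 then show "((\<lambda>t. itg 0 L (\<lambda>x. F' t x * trg k \<theta> x)) has_real_derivative itg 0 L (\<lambda>x. G' t x * trg k \<theta> x)) (at t within {0..T})"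
  by (rule real_derivative_transform[OF t p[OF F], rotated])
qed

end

section \<open>The flow\<close>

lemma joint_continuous:
 fixes f :: "real => real => real"
 assumes l: "\<And>s t z. s \<in> S ==> t \<in> S ==> \<bar>f s z - f t z\<bar> \<le> C * \<bar>s - t\<bar>"
  and c: "\<And>t. t \<in> S ==> continuous_on UNIV (f t)"
 shows "continuous_on (S \<times> A) (\<lambda>(t, z). f t z)"
 unfolding continuous_on_def
proof (intro ballI)
 fix p assume p: "p \<in> S \<times> A"
 obtain s y where sy: "p = (s, y)" "s \<in> S" using p by auto
 have "((\<lambda>q. C * \<bar>fst q - s\<bar> + \<bar>f s (snd q) - f s y\<bar>) \<longlongrightarrow> C * \<bar>fst p - s\<bar> + \<bar>f s (snd p) - f s y\<bar>) (at p within S \<times> A)"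
  by (intro tendsto_intros continuous_on_tendsto_compose[OF c[OF sy(2)]]) auto
 then have "((\<lambda>q. C * \<bar>fst q - s\<bar> + \<bar>f s (snd q) - f s y\<bar>) \<longlongrightarrow> 0) (at p within S \<times> A)" by (simp add: sy)
 then have "((\<lambda>q. f (fst q) (snd q) - f s y) \<longlongrightarrow> 0) (at p within S \<times> A)"
 proof (rule Lim_null_comparison[rotated])
  show "\<forall>\<^sub>F q in at p within S \<times> A. norm (f (fst q) (snd q) - f s y) \<le> C * \<bar>fst q - s\<bar> + \<bar>f s (snd q) - f s y\<bar>"
   unfolding eventually_at_filter
  proof (intro always_eventually allI impI)
   fix q assume "q \<in> S \<times> A"
   then have "\<bar>f (fst q) (snd q) - f s (snd q)\<bar> \<le> C * \<bar>fst q - s\<bar>" using l sy by auto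
   then show "norm (f (fst q) (snd q) - f s y) \<le> C * \<bar>fst q - s\<bar> + \<bar>f s (snd q) - f s y\<bar>" by simp
  qed
 qed
 then show "((\<lambda>(t, z). f t z) \<longlongrightarrow> (case p of (t, z) => f t z)) (at p within S \<times> A)"
  using LIM_zero_cancel[of "\<lambda>q. f (fst q) (snd q)" "f s y"] by (simp add: sy case_prod_beta')
qed

lemma itg_Leibniz:
 assumes d: "\<And>t z. t \<in> {0..T} ==> a \<le> z ==> z \<le> b ==> ((\<lambda>t. f t z) has_real_derivative f' t z) (at t within {0..T})"
  and f: "\<And>t. t \<in> {0..T} ==> continuous_on UNIV (f t)" and f': "\<And>t. t \<in> {0..T} ==> continuous_on UNIV (f' t)"
  and c: "continuous_on ({0..T} \<times> {a..b}) (\<lambda>(t, z). f' t z)" and t: "t \<in> {0..T}"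
 shows "((\<lambda>t. itg a b (f t)) has_real_derivative itg a b (f' t)) (at t within {0..T})"
proof (rule real_derivative_transform[OF t])
 show "itg a b (f s) = integral (cbox a b) (f s)" if "s \<in> {0..T}" for s
  using itg_eq_integral[OF locint_continuous[OF f[OF that]]] by simp
 have "((\<lambda>t. integral (cbox a b) (f t)) has_real_derivative integral (cbox a b) (f' t)) (at t within {0..T})"
  by (rule leibniz_rule_field_derivative) (use d f c t in \<open>auto intro!: integrable_continuous_interval intro: continuous_on_subset\<close>)
 then show "((\<lambda>t. integral (cbox a b) (f t)) has_real_derivative itg a b (f' t)) (at t within {0..T})"
  using itg_eq_integral[OF locint_continuous[OF f'[OF t]]] by simp
qed

context circle
begin

lemma L2_shift: assumes "f \<in> \<L>2" shows "(\<lambda>x. f (x - a)) \<in> \<L>2"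
 using L2_reflect(1)[OF L2_reflect(1)[OF assms, of 0], of a] by simp

lemma dvt_shift: assumes "dvt f f'" shows "dvt (\<lambda>x. f (x - a)) (\<lambda>x. f' (x - a))"
proof -
 have "periodic L (\<lambda>x. f (x - a))" using L2_periodic[OF L2_shift[OF dvtD(5)[OF assms]]] .
 moreover have l: "(\<lambda>x. f' (x - a)) \<in> \<L>2" by (rule L2_shift[OF dvtD(2)[OF assms]])
 moreover have "f (c - a) - f (b - a) = itg b c (\<lambda>x. f' (x - a))" if "b \<le> c" for b c
  using acdD[OF dvtD(3)[OF assms], of "b - a" "c - a"] that itg_shift[of b "- a" c f'] by simp
 ultimately show ?thesis using L2_locint by (simp add: dvt_def acd_def)
qed

lemma Lam1_shift: assumes g: "g \<in> \<L>2" shows "Lam1 (\<lambda>x. g (x - a)) z = Lam1 g (z - a)"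
 unfolding Lam1_reflect[OF g] Lam1_reflect[OF L2_shift[OF g]] by (simp add: algebra_simps)

text \<open>Composition with a moving flow preserves continuity in time on L^2 but not a Lipschitz
  bound, so Eulerian families are only asked to be continuous.\<close>

definition con0 :: "real set => (real => real => real) => bool" where
 "con0 B f \<longleftrightarrow> (\<forall>t\<in>B. f t \<in> \<L>2) \<and> continuous_on B (\<lambda>t. toL2 (f t))"

lemma con0_lip0: assumes "lip0 B f" shows "con0 B f"
proof -
 obtain C where C: "C \<ge> 0" "\<And>p q. p \<in> B ==> q \<in> B ==> norm (toL2 (f p) - toL2 (f q)) \<le> C * dist p q"
  by (rule lip0E[OF assms]) blast
 have "C-lipschitz_on B (\<lambda>t. toL2 (f t))" using C by (intro lipschitz_onI) (auto simp: dist_norm)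
 then show ?thesis using lip0_L2[OF assms] lipschitz_on_continuous_on by (auto simp: con0_def)
qed

context
 fixes T :: real and n :: nat and \<rho> W W' :: "real => real => real"
 assumes T: "0 < T" and lr: "lip {0..T} (Suc n) \<rho>" and lW: "lip {0..T} (Suc n) W" and lW': "lip {0..T} n W'"
  and dW0: "\<forall>t\<in>{0..T}. dvt (W t) (W' t)" and m0: "\<forall>t\<in>{0..T}. itg 0 L (\<rho> t) = L"
  and lb0: "\<forall>t\<in>{0..T}. \<forall>z. 1/2 \<le> \<rho> t z"
  and rt0: "\<forall>t\<in>{0..T}. \<forall>z. ((\<lambda>t. \<rho> t z) has_real_derivative \<rho> t z * Lam (\<rho> t) (W' t) z) (at t within {0..T})"
begin

lemmas dW = dW0[rule_format] and m = m0[rule_format] and lb = lb0[rule_format] and rt = rt0[rule_format]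

lemma adm_t: assumes "t \<in> {0..T}" obtains r where "adm (\<rho> t) r"
 by (rule famE[OF lr]) (use assms m lb in \<open>auto simp: adm_def\<close>)

lemma rho_pos: "t \<in> {0..T} ==> 0 < \<rho> t z" using lb[of t z] by simp

lemma lip_cont: "lip {0..T} (Suc k) f ==> t \<in> {0..T} ==> continuous_on UNIV (f t)"
 by (auto dest: dvtD(4))

lemma lip_joint: assumes "lip {0..T} (Suc k) f" shows "continuous_on ({0..T} \<times> A) (\<lambda>(t, z). f t z)"
proof -
 obtain C where "\<And>p q z. p \<in> {0..T} ==> q \<in> {0..T} ==> \<bar>f p z - f q z\<bar> \<le> C * dist p q"
  by (rule lipsE[OF lip_Suc_sup[OF assms]]) blast
 then show ?thesis by (intro joint_continuous[of _ f C] lip_cont[OF assms]) (auto simp: dist_real_def)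
qed

text \<open>The velocity of the particle with a given label. Its label derivative \<open>Nl\<close>
  is also the time derivative of \<open>\<rho>\<close>, and this is what makes \<open>ef\<close> the
  flow of the velocity.\<close>

definition Vl :: "real => real => real" where "Vl t = Lam (\<rho> t) (\<lambda>z. \<rho> t z * W t z)"
definition Nl :: "real => real => real" where "Nl t z = \<rho> t z * Lam (\<rho> t) (W' t) z"

lemma Vl_dvt: assumes t: "t \<in> {0..T}" shows "dvt (Vl t) (Nl t)"
proof -
 obtain r where "adm (\<rho> t) r" by (rule adm_t[OF t])
 then show ?thesis unfolding Vl_def Nl_def[abs_def] by (rule Lam_key[OF _ dW[OF t]])
qed

lemma Vl_lip: "lip {0..T} (Suc (Suc n)) Vl"
 unfolding Vl_def[abs_def] by (rule lip_Lam[OF lr lb m le_refl lip_mult_same[OF lr lW]])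

lemma Nl_lip: "lip {0..T} (Suc n) Nl"
 unfolding Nl_def[abs_def] by (rule lip_mult_same[OF lr lip_Lam[OF lr lb m _ lW']]) auto

text \<open>\<open>eta\<close> fixes 0, and the potential sees only differences of
  \<open>eta\<close>, so the Lagrangian system does not record how the circle is rotated.
  \<open>sh\<close> restores the position of the particle with label 0.\<close>

definition sh :: "real => real" where "sh t = integral {0..t} (\<lambda>s. Vl s 0)"
definition ef :: "real => real => real" where "ef t z = sh t + eta (\<rho> t) z"
definition lab :: "real => real => real" where "lab t x = xi (\<rho> t) (x - sh t)"

lemma ef_deriv:
 assumes t: "t \<in> {0..T}" and z: "0 \<le> z"
 shows "((\<lambda>t. ef t z) has_real_derivative Vl t z) (at t within {0..T})"
proof -
 have "continuous_on {0..T} (\<lambda>s. case (s, 0) of (t, z) => Vl t z)"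
  by (rule continuous_on_compose2[OF lip_joint[OF Vl_lip, of UNIV]]) (auto intro!: continuous_intros)
 then have 1: "(sh has_real_derivative Vl t 0) (at t within {0..T})"
  unfolding sh_def[abs_def] by (intro integral_has_real_derivative t) simp
 have "((\<lambda>t. itg 0 z (\<rho> t)) has_real_derivative itg 0 z (Nl t)) (at t within {0..T})"
  by (rule itg_Leibniz[OF _ lip_cont[OF lr] lip_cont[OF Nl_lip] lip_joint[OF Nl_lip] t]) (use rt in \<open>auto simp: Nl_def\<close>)
 moreover have "itg 0 z (Nl t) = Vl t z - Vl t 0" using acdD[OF dvtD(3)[OF Vl_dvt[OF t]] z] by simp
 ultimately show ?thesis using DERIV_add[OF 1, of "\<lambda>t. itg 0 z (\<rho> t)" "Vl t z - Vl t 0"] z by (simp add: ef_def eta_def)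
qed

lemma ef_shift: assumes "t \<in> {0..T}" shows "ef t (z + L) = ef t z + L"
proof -
 obtain r where "adm (\<rho> t) r" by (rule adm_t[OF assms])
 then show ?thesis by (simp add: ef_def eta_shift)
qed

lemma ef_z_deriv: assumes "t \<in> {0..T}" shows "(ef t has_real_derivative \<rho> t z) (at z)"
proof -
 obtain r where "adm (\<rho> t) r" by (rule adm_t[OF assms])
 then show ?thesis unfolding ef_def[abs_def] by (auto intro!: derivative_eq_intros eta_deriv)
qed

lemma ef_cont: "t \<in> {0..T} ==> continuous_on UNIV (ef t)"
 using ef_z_deriv by (meson DERIV_isCont continuous_at_imp_continuous_on)

lemma ef_lip: "\<exists>C\<ge>0. \<forall>s\<in>{0..T}. \<forall>t\<in>{0..T}. \<forall>z. \<bar>ef s z - ef t z\<bar> \<le> C * \<bar>s - t\<bar>"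
proof -
 obtain C where C: "C \<ge> 0" "\<And>p z. p \<in> {0..T} ==> \<bar>Vl p z\<bar> \<le> C" by (rule lipsE[OF lip_Suc_sup[OF Vl_lip]]) blast
 have "\<bar>ef s z - ef t z\<bar> \<le> C * \<bar>s - t\<bar>" if st: "s \<in> {0..T}" "t \<in> {0..T}" for s t z
 proof -
  \<comment> \<open>\<open>ef_deriv\<close> speaks of labels \<open>z \<ge> 0\<close>; periodicity
    of the difference reduces every label to one period.\<close>
  have "periodic L (\<lambda>z. ef s z - ef t z)" using st by (simp add: periodic_def ef_shift)
  from periodic_wrap[OF this] have e: "ef s (wrap z) - ef t (wrap z) = ef s z - ef t z" .
  have "norm (ef s (wrap z) - ef t (wrap z)) \<le> C * norm (s - t)"
   by (rule field_differentiable_bound[of "{0..T}" "\<lambda>t. ef t (wrap z)" "\<lambda>t. Vl t (wrap z)"])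
    (use C st ef_deriv wrap_bounds in auto)
  then show ?thesis unfolding e by simp
 qed
 then show ?thesis using C(1) by blast
qed

lemma ef_X: "t \<in> {0..T} ==> ef t (lab t x) = x"
 by (erule adm_t) (simp add: ef_def lab_def eta_xi)

text \<open>The map \<open>ef s\<close> has slope at least 1/2, so the labels seen at one place
  differ by at most twice the distance travelled.\<close>

lemma X_lip: "\<exists>C\<ge>0. \<forall>s\<in>{0..T}. \<forall>t\<in>{0..T}. \<forall>x. \<bar>lab s x - lab t x\<bar> \<le> C * \<bar>s - t\<bar>"
proof -
 obtain C where C: "C \<ge> 0" "\<And>s t z. s \<in> {0..T} ==> t \<in> {0..T} ==> \<bar>ef s z - ef t z\<bar> \<le> C * \<bar>s - t\<bar>" using ef_lip by blast
 have "\<bar>lab s x - lab t x\<bar> \<le> 2 * C * \<bar>s - t\<bar>" if st: "s \<in> {0..T}" "t \<in> {0..T}" for s t x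
 proof -
  obtain r where a: "adm (\<rho> s) r" by (rule adm_t[OF st(1)])
  have lo: "\<bar>z - y\<bar> / 2 \<le> \<bar>ef s z - ef s y\<bar>" for y z
   using eta_lower[OF a, of y z] eta_lower[OF a, of z y] by (cases "y \<le> z") (auto simp: ef_def)
  have "\<bar>lab s x - lab t x\<bar> / 2 \<le> \<bar>ef t (lab t x) - ef s (lab t x)\<bar>" using lo[of "lab s x" "lab t x"] ef_X st by simp
  then show ?thesis using C(2)[OF st(2) st(1), of "lab t x"] by (simp add: abs_minus_commute)
 qed
 then show ?thesis using C(1) by (intro exI[of _ "2 * C"]) auto
qed

section \<open>Composition with the inverse flow\<close>

lemma L2_X: "f \<in> \<L>2 ==> t \<in> {0..T} ==> (\<lambda>x. f (lab t x)) \<in> \<L>2"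
 unfolding lab_def by (erule adm_t) (rule L2_shift[OF L2_comp_xi])

lemma dvt_X: assumes "dvt f f'" and t: "t \<in> {0..T}" shows "dvt (\<lambda>x. f (lab t x)) (\<lambda>x. (1 / \<rho> t (lab t x)) * f' (lab t x))"
proof -
 obtain r where a: "adm (\<rho> t) r" by (rule adm_t[OF t])
 show ?thesis using dvt_shift[OF dvt_comp_xi[OF a assms(1)], of "sh t"] by (simp add: lab_def)
qed

lemma itg_X: assumes h: "locint h" "periodic L h" and t: "t \<in> {0..T}" shows "itg 0 L (\<lambda>x. h (lab t x)) = itg 0 L (\<lambda>z. h z * \<rho> t z)"
proof -
 obtain r where a: "adm (\<rho> t) r" by (rule adm_t[OF t])
 have "itg 0 L (\<lambda>x. h (lab t x)) = itg (- sh t) (- sh t + L) (\<lambda>x. h (xi (\<rho> t) x))"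
  using itg_shift[of 0 "- sh t" L "\<lambda>x. h (xi (\<rho> t) x)"] by (simp add: lab_def)
 also have "\<dots> = itg 0 L (\<lambda>x. h (xi (\<rho> t) x))"
  by (rule itg_period[OF locint_comp_xi[OF a h(1)] periodic_comp_xi[OF a h(2)]])
 finally show ?thesis using itg_comp_xi[OF a h] by simp
qed

lemma norm_X: "\<exists>C>0. \<forall>t\<in>{0..T}. \<forall>f\<in>\<L>2. nrm (\<lambda>x. f (lab t x)) \<le> C * nrm f"
proof -
 obtain C0 where C0: "C0 \<ge> 0" "\<And>p z. p \<in> {0..T} ==> \<bar>\<rho> p z\<bar> \<le> C0" by (rule lipsE[OF lip_Suc_sup[OF lr]]) blast
 \<comment> \<open>The added 1 ensures \<open>C \<le> C\<^sup>2\<close>, so no square root of the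
   bound for \<open>\<rho>\<close> is needed.\<close>
 define C where "C = C0 + 1"
 have "nrm (\<lambda>x. f (lab t x)) \<le> C * nrm f" if t: "t \<in> {0..T}" and f: "f \<in> \<L>2" for t f
 proof (rule power2_le_imp_le)
  have l: "locint (\<lambda>z. (f z)\<^sup>2)" using L2_mult_locint[OF f f] by (simp add: power2_eq_square)
  have p: "periodic L (\<lambda>z. (f z)\<^sup>2)" using L2_periodic[OF f] by (simp add: periodic_def)
  have "(nrm (\<lambda>x. f (lab t x)))\<^sup>2 = itg 0 L (\<lambda>z. (f z)\<^sup>2 * \<rho> t z)"
   unfolding norm_toL2_sq[OF L2_X[OF f t]] by (rule itg_X[OF l p t])
  also have "\<dots> \<le> itg 0 L (\<lambda>z. C * (f z)\<^sup>2)"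
  proof (rule itg_mono)
   show "locint (\<lambda>z. (f z)\<^sup>2 * \<rho> t z)" using locint_mult_cont[OF lip_cont[OF lr t] l] by (simp add: mult.commute)
   show "(f z)\<^sup>2 * \<rho> t z \<le> C * (f z)\<^sup>2" for z
    using mult_left_mono[of "\<rho> t z" C "(f z)\<^sup>2"] C0(2)[OF t, of z] by (simp add: C_def mult.commute)
  qed (rule locint_cmult[OF l])
  also have "\<dots> \<le> C\<^sup>2 * (nrm f)\<^sup>2"
   unfolding itg_cmult norm_toL2_sq[OF f, symmetric] using C0(1) by (intro mult_right_mono) (auto simp: C_def power2_eq_square algebra_simps)
  finally show "(nrm (\<lambda>x. f (lab t x)))\<^sup>2 \<le> (C * nrm f)\<^sup>2" by (simp add: power_mult_distrib)
 qed (use C0 in \<open>simp add: C_def\<close>)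
 then show ?thesis using C0(1) by (intro exI[of _ C]) (auto simp: C_def)
qed

text \<open>The composition operators are uniformly bounded, and on the dense set H^1 the Hoelder
  bound makes them continuous in time. Density extends this to L^2, at the price of losing every
  rate.\<close>

lemma con0_X: assumes f: "con0 {0..T} f" shows "con0 {0..T} (\<lambda>t x. f t (lab t x))"
 unfolding con0_def
proof (intro conjI ballI)
 have fL: "f t \<in> \<L>2" if "t \<in> {0..T}" for t using f that by (simp add: con0_def)
 show "(\<lambda>x. f t (lab t x)) \<in> \<L>2" if "t \<in> {0..T}" for t by (rule L2_X[OF fL[OF that] that])
 obtain C where C: "C > 0" "\<And>t f. t \<in> {0..T} ==> f \<in> \<L>2 ==> nrm (\<lambda>x. f (lab t x)) \<le> C * nrm f" using norm_X by blast
 obtain D where D: "D \<ge> 0" "\<And>s t x. s \<in> {0..T} ==> t \<in> {0..T} ==> \<bar>lab s x - lab t x\<bar> \<le> D * \<bar>s - t\<bar>" using X_lip by blast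
 show "continuous_on {0..T} (\<lambda>t. toL2 (\<lambda>x. f t (lab t x)))"
  unfolding continuous_on_def
 proof (intro ballI tendstoI)
  fix s and e :: real assume s: "s \<in> {0..T}" and e: "0 < e"
  \<comment> \<open>\<open>g\<close> replaces \<open>f s\<close> at both times, which costs
    \<open>e / 4\<close> each. The remaining \<open>e / 2\<close> is for \<open>E\<close>, which
    collects the change of \<open>f\<close> in time and the change of the labels inside
    \<open>g\<close>.\<close>
  obtain g g' where g: "dvt g g'" and ge: "norm (toL2 (f s) - toL2 g) < e / (4 * C)"
   using H1_dense[OF fL[OF s], of "e / (4 * C)"] e C by auto
  note gL = dvtD(5)[OF g]
  define E where "E t = C * norm (toL2 (f t) - toL2 (f s)) + nrm g' * sqrt (D * \<bar>t - s\<bar>) * sqrt L" for t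
  have "(E \<longlongrightarrow> C * norm (toL2 (f s) - toL2 (f s)) + nrm g' * sqrt (D * \<bar>s - s\<bar>) * sqrt L) (at s within {0..T})"
   unfolding E_def[abs_def] using f s by (intro tendsto_intros) (auto simp: con0_def continuous_on_def)
  then have "(E \<longlongrightarrow> 0) (at s within {0..T})" by simp
  then have ev1: "\<forall>\<^sub>F t in at s within {0..T}. E t < e / 2" using e by (intro order_tendstoD(2)) auto
  have "((\<lambda>t. D * \<bar>t - s\<bar>) \<longlongrightarrow> D * \<bar>s - s\<bar>) (at s within {0..T})" by (intro tendsto_intros)
  then have ev2: "\<forall>\<^sub>F t in at s within {0..T}. D * \<bar>t - s\<bar> < L" using L_pos by (intro order_tendstoD(2)) auto
  have ev3: "\<forall>\<^sub>F t in at s within {0..T}. t \<in> {0..T}" by (simp add: eventually_at_filter)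
  show "\<forall>\<^sub>F t in at s within {0..T}. dist (toL2 (\<lambda>x. f t (lab t x))) (toL2 (\<lambda>x. f s (lab s x))) < e"
   using ev1 ev2 ev3
  proof eventually_elim
   case (elim t)
   note t = elim(3)
   have d: "norm (toL2 (\<lambda>x. h (lab r x)) - toL2 (\<lambda>x. k (lab r x))) \<le> C * norm (toL2 h - toL2 k)" if "h \<in> \<L>2" "k \<in> \<L>2" "r \<in> {0..T}" for h k r
    using C(2)[OF that(3) L2_diff[OF that(1,2)]] that by (simp add: toL2_diff L2_X)
   have ge': "C * norm (toL2 (f s) - toL2 g) < e / 4" "C * norm (toL2 g - toL2 (f s)) < e / 4"
    using ge C by (simp_all add: field_simps norm_minus_commute)
   have gg: "norm (toL2 (\<lambda>x. g (lab t x)) - toL2 (\<lambda>x. g (lab s x))) \<le> nrm g' * sqrt (D * \<bar>t - s\<bar>) * sqrt L"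
    unfolding toL2_diff[OF L2_X[OF gL t] L2_X[OF gL s], symmetric]
   proof (rule norm_toL2_le_sup[OF L2_diff[OF L2_X[OF gL t] L2_X[OF gL s]]])
    fix x
    have "\<bar>g (lab t x) - g (lab s x)\<bar> \<le> nrm g' * sqrt \<bar>lab t x - lab s x\<bar>"
     by (rule dvt_Hoelder[OF g]) (use D(2)[OF t s, of x] elim(2) in linarith)
    also have "\<dots> \<le> nrm g' * sqrt (D * \<bar>t - s\<bar>)" using D(2)[OF t s, of x] by (intro mult_left_mono) auto
    finally show "\<bar>g (lab t x) - g (lab s x)\<bar> \<le> nrm g' * sqrt (D * \<bar>t - s\<bar>)" .
   qed
   have tri: "norm (a1 - a5) \<le> norm (a1 - a2) + norm (a2 - a3) + norm (a3 - a4) + norm (a4 - a5)" for a1 a2 a3 a4 a5 :: l2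
    using norm_triangle_ineq[of "a1 - a2" "a2 - a5"] norm_triangle_ineq[of "a2 - a3" "a3 - a5"] norm_triangle_ineq[of "a3 - a4" "a4 - a5"] by simp
   have "norm (toL2 (\<lambda>x. f t (lab t x)) - toL2 (\<lambda>x. f s (lab s x))) < e"
    using tri[of "toL2 (\<lambda>x. f t (lab t x))" "toL2 (\<lambda>x. f s (lab s x))" "toL2 (\<lambda>x. f s (lab t x))" "toL2 (\<lambda>x. g (lab t x))" "toL2 (\<lambda>x. g (lab s x))"] gg
     d[OF fL[OF t] fL[OF s] t] d[OF fL[OF s] gL t] d[OF gL fL[OF s] s] ge' elim(1)
    unfolding E_def by linarith
   then show ?case unfolding dist_norm .
  qed
 qed
qed

text \<open>Each space derivative of a composite brings a factor \<open>1 / \<rho>\<close>. That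
  factor has \<open>n + 1\<close> derivatives and first enters after one differentiation, whence the
  limit \<open>n + 2\<close>.\<close>

lemma lip_con_X: "j \<le> Suc (Suc n) ==> lip {0..T} j f ==> fam con0 {0..T} j (\<lambda>t x. f t (lab t x))"
proof (induction j arbitrary: f)
 case 0
 then show ?case using con0_X[OF con0_lip0] by simp
next
 case (Suc j)
 obtain f' where f': "\<And>t. t \<in> {0..T} ==> dvt (f t) (f' t)" "lip {0..T} j f'" by (rule famE[OF Suc.prems(2)]) blast
 have "lip {0..T} j (\<lambda>t z. (1 / \<rho> t z) * f' t z)"
  by (rule lip_mult_le[OF _ lip_inverse[OF _ lb lr] f'(2)]) (use Suc.prems in auto)
 from Suc.IH[OF _ this] Suc.prems(1) have "fam con0 {0..T} j (\<lambda>t x. (1 / \<rho> t (lab t x)) * f' t (lab t x))" by simp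
 moreover have "con0 {0..T} (\<lambda>t x. f t (lab t x))" by (rule con0_X[OF con0_lip0[OF fam_0[OF Suc.prems(2)]]])
 moreover have "\<forall>t\<in>{0..T}. dvt (\<lambda>x. f t (lab t x)) (\<lambda>x. (1 / \<rho> t (lab t x)) * f' t (lab t x))" using dvt_X[OF f'(1)] by blast
 ultimately show ?case unfolding fam.simps by (intro conjI exI)
qed

text \<open>Written in labels, the test function moves with the flow and the integrand is
  differentiable in time at each fixed label. The derivatives of the test function and of the
  Jacobian \<open>\<rho>\<close> combine to the label derivative of \<open>Vl\<close> times the
  moving test function. Integration by parts shifts it to \<open>f\<close> and produces the
  transport term.\<close>

lemma transport_weak:
 assumes lf: "lip {0..T} (Suc i) f" and df: "\<And>t. t \<in> {0..T} ==> dvt (f t) (f' t)" and lk: "lip {0..T} (Suc j) k"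
  and fd: "\<And>t z. t \<in> {0..T} ==> ((\<lambda>t. f t z) has_real_derivative k t z) (at t within {0..T})" and t: "t \<in> {0..T}"
 shows "((\<lambda>t. itg 0 L (\<lambda>x. f t (lab t x) * trg \<kappa> \<theta> x)) has_real_derivative
  itg 0 L (\<lambda>x. (k t (lab t x) + - (Vl t (lab t x) * ((1 / \<rho> t (lab t x)) * f' t (lab t x)))) * trg \<kappa> \<theta> x)) (at t within {0..T})"
proof -
 let ?\<phi> = "trg \<kappa> \<theta>" and ?\<psi> = "\<lambda>x. (2 * mu * of_int \<kappa>) * trg \<kappa> (\<theta> + pi / 2) x"
 have pc: "continuous_on UNIV ?\<psi>" by (intro continuous_on_mult continuous_on_const trg_cont)
 have pp: "periodic L ?\<psi>" using trg_periodic by (simp add: periodic_def)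
 have ep: "h (ef t (z + L)) = h (ef t z)" if "periodic L h" "t \<in> {0..T}" for h :: "real => real" and t z
  using that by (simp add: periodic_def ef_shift)
 define D where "D t z = k t z * (?\<phi> (ef t z) * \<rho> t z) + f t z * (Nl t z * ?\<phi> (ef t z) + Vl t z * (?\<psi> (ef t z) * \<rho> t z))" for t z
 have cc: "continuous_on UNIV (\<lambda>z. h (ef t z))" if "continuous_on UNIV h" "t \<in> {0..T}" for h :: "real => real" and t
  by (rule continuous_on_compose2[OF that(1) ef_cont[OF that(2)]]) auto
 note cz = lip_cont[OF lf] lip_cont[OF lk] lip_cont[OF lr] lip_cont[OF Nl_lip] lip_cont[OF Vl_lip] cc[OF trg_cont] cc[OF pc]
 have ejc: "continuous_on ({0..T} \<times> {0..L}) (\<lambda>(t, z). h (ef t z))" if "continuous_on UNIV h" for h :: "real => real"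
 proof -
  obtain C where "\<And>s t z. s \<in> {0..T} ==> t \<in> {0..T} ==> \<bar>ef s z - ef t z\<bar> \<le> C * \<bar>s - t\<bar>" using ef_lip by blast
  then have "continuous_on ({0..T} \<times> {0..L}) (\<lambda>(t, z). ef t z)" by (intro joint_continuous[of _ ef C] ef_cont)
  then show ?thesis unfolding split_beta by (intro continuous_on_compose2[OF that]) auto
 qed
 have deriv: "((\<lambda>t. f t z * ?\<phi> (ef t z) * \<rho> t z) has_real_derivative D t z) (at t within {0..T})" if t: "t \<in> {0..T}" and z: "0 \<le> z" for t z
 proof -
  have "((\<lambda>t. ?\<phi> (ef t z)) has_real_derivative ?\<psi> (ef t z) * Vl t z) (at t within {0..T})"
   by (rule DERIV_chain2[OF trg_deriv ef_deriv[OF t z]])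
  from DERIV_mult[OF DERIV_mult[OF fd[OF t] this] rt[OF t]] show ?thesis
   by (rule DERIV_cong) (simp add: D_def Nl_def algebra_simps)
 qed
 have "((\<lambda>t. itg 0 L (\<lambda>z. f t z * ?\<phi> (ef t z) * \<rho> t z)) has_real_derivative itg 0 L (D t)) (at t within {0..T})"
 proof (rule itg_Leibniz[OF deriv _ _ _ t])
  show "continuous_on UNIV (\<lambda>z. f t z * ?\<phi> (ef t z) * \<rho> t z)" "continuous_on UNIV (D t)" if "t \<in> {0..T}" for t
   unfolding D_def[abs_def] by (intro continuous_intros cz that)+
  show "continuous_on ({0..T} \<times> {0..L}) (\<lambda>(t, z). D t z)"
   unfolding D_def[abs_def] split_beta
   by (intro continuous_on_mult continuous_on_add lip_joint[OF lf, unfolded split_beta] lip_joint[OF lk, unfolded split_beta] lip_joint[OF lr, unfolded split_beta]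
    lip_joint[OF Nl_lip, unfolded split_beta] lip_joint[OF Vl_lip, unfolded split_beta] ejc[OF trg_cont, unfolded split_beta] ejc[OF pc, unfolded split_beta])
 qed
 moreover have e: "itg 0 L (\<lambda>x. g (lab s x) * ?\<phi> x) = itg 0 L (\<lambda>z. g z * ?\<phi> (ef s z) * \<rho> s z)" if s: "s \<in> {0..T}" and g: "g \<in> \<L>2" for s g
 proof -
  have "locint (\<lambda>z. ?\<phi> (ef s z) * g z)" by (rule locint_mult_cont[OF cc[OF trg_cont s] L2_locint[OF g]])
  then have "locint (\<lambda>z. g z * ?\<phi> (ef s z))" by (simp add: mult.commute)
  from itg_X[OF this _ s] L2_periodic[OF g] show ?thesis
   by (simp add: periodic_def ep[OF trg_periodic s] ef_X[OF s])
 qed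
 moreover have "itg 0 L (D t) = itg 0 L (\<lambda>x. (k t (lab t x) + - (Vl t (lab t x) * ((1 / \<rho> t (lab t x)) * f' t (lab t x)))) * ?\<phi> x)"
 proof -
  have dP: "dvt (\<lambda>z. ?\<phi> (ef t z)) (\<lambda>z. ?\<psi> (ef t z) * \<rho> t z)"
   by (rule dvt_of_deriv[OF DERIV_chain2[OF trg_deriv ef_z_deriv[OF t]]])
    (intro continuous_on_mult cz t, simp add: periodic_def ep[OF trg_periodic t])
  note dVP = dvt_mult[OF Vl_dvt[OF t] dP]
  note par = itg_parts[OF df[OF t] dVP]
  have f'L: "f' t \<in> \<L>2" by (rule dvtD(2)[OF df[OF t]])
  have pr: "periodic L (f t)" "periodic L (k t)" "periodic L (\<rho> t)" "periodic L (Vl t)"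
   using lf lk lr dvtD(1)[OF Vl_dvt[OF t]] t by (auto dest!: dvtD(1))
  have kL: "k t \<in> \<L>2" by (rule L2_intro_cont[OF cz(2)[OF t] pr(2)])
  have "(\<lambda>z. (- (Vl t z * (1 / \<rho> t z))) * f' t z) \<in> \<L>2"
   by (rule L2_cont_mult[OF _ _ f'L]) (intro continuous_intros cz t, use rho_pos[OF t] pr in \<open>auto simp: periodic_def less_imp_neq[symmetric]\<close>)
  then have gL: "(\<lambda>z. k t z + - (Vl t z * ((1 / \<rho> t z) * f' t z))) \<in> \<L>2" using L2_add[OF kL, of "\<lambda>z. (- (Vl t z * (1 / \<rho> t z))) * f' t z"] by (simp add: mult.assoc)
  have l1: "locint (\<lambda>z. k t z * (?\<phi> (ef t z) * \<rho> t z))" by (intro locint_continuous continuous_on_mult cz t)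
  have l2: "locint (\<lambda>z. f' t z * (Vl t z * ?\<phi> (ef t z)))" by (rule L2_mult_locint[OF f'L dvtD(5)[OF dVP]])
  have l3: "locint (\<lambda>z. f t z * (Nl t z * ?\<phi> (ef t z) + Vl t z * (?\<psi> (ef t z) * \<rho> t z)))"
   by (rule L2_mult_locint[OF dvtD(5)[OF df[OF t]] dvtD(2)[OF dVP]])
  have "itg 0 L (\<lambda>x. (k t (lab t x) + - (Vl t (lab t x) * ((1 / \<rho> t (lab t x)) * f' t (lab t x)))) * ?\<phi> x)
   = itg 0 L (\<lambda>z. (k t z + - (Vl t z * ((1 / \<rho> t z) * f' t z))) * ?\<phi> (ef t z) * \<rho> t z)" by (rule e[OF t gL])
  also have "\<dots> = itg 0 L (\<lambda>z. k t z * (?\<phi> (ef t z) * \<rho> t z) - f' t z * (Vl t z * ?\<phi> (ef t z)))"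
   by (rule itg_cong) (use rho_pos[OF t] in \<open>simp add: field_simps less_imp_neq[symmetric]\<close>)
  also have "\<dots> = itg 0 L (D t)" unfolding itg_diff[OF l1 l2] par D_def[abs_def] itg_add[OF l1 l3] by simp
  finally show ?thesis ..
 qed
 ultimately show ?thesis
  using real_derivative_transform[OF t e[OF _ dvtD(5)[OF df]]] by simp
qed

text \<open>Used with \<open>i = Suc n\<close> and \<open>k = 0\<close> for \<open>u\<close>, and
  with \<open>i = n\<close> and the source \<open>U / \<rho>\<close> for the vorticity. The
  transport term contains \<open>f'\<close>, so \<open>G\<close> has one derivative less than
  \<open>F\<close>.\<close>

lemma transport:
 assumes lf: "lip {0..T} (Suc i) f" and df: "\<forall>t\<in>{0..T}. dvt (f t) (f' t)" and lf': "lip {0..T} i f'" and i: "i \<le> Suc n"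
  and lk: "lip {0..T} (Suc n) k"
  and fd: "\<forall>t\<in>{0..T}. \<forall>z. ((\<lambda>t. f t z) has_real_derivative k t z) (at t within {0..T})"
 defines "F \<equiv> \<lambda>t x. f t (lab t x)" and "G \<equiv> \<lambda>t x. k t (lab t x) + - (Vl t (lab t x) * ((1 / \<rho> t (lab t x)) * f' t (lab t x)))"
 shows "fam con0 {0..T} (Suc i) F" "fam con0 {0..T} i G"
  "\<And>t. t \<in> {0..T} ==> ((\<lambda>t. toL2 (F t)) has_vector_derivative toL2 (G t)) (at t within {0..T})"
  "\<And>t. t \<in> {0..T} ==> ((\<lambda>t. itg 0 L (F t)) has_real_derivative itg 0 L (G t)) (at t within {0..T})"
proof -
 show F: "fam con0 {0..T} (Suc i) F" unfolding F_def using lip_con_X[OF _ lf] i by simp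
 have "lip {0..T} i (\<lambda>t z. k t z + - (Vl t z * ((1 / \<rho> t z) * f' t z)))"
  by (intro lip_add lip_minus lip_mult_le[OF _ fam_Suc[OF Vl_lip]] lip_mult_le[OF _ lip_inverse[OF _ lb lr]] lf' i fam_le[OF i lk]) auto
 then show G: "fam con0 {0..T} i G" unfolding G_def using lip_con_X[of i] i by simp
 have w: "((\<lambda>t. itg 0 L (\<lambda>x. F t x * trg \<kappa> \<theta> x)) has_real_derivative itg 0 L (\<lambda>x. G t x * trg \<kappa> \<theta> x)) (at t within {0..T})"
  if "t \<in> {0..T}" for t \<kappa> \<theta> unfolding F_def G_def by (rule transport_weak[OF lf df[rule_format] lk fd[rule_format] that])
 show "((\<lambda>t. toL2 (F t)) has_vector_derivative toL2 (G t)) (at t within {0..T})" if t: "t \<in> {0..T}" for t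
  by (rule vector_derivative_of_weak[OF _ _ _ less_imp_le[OF T] _ t])
   (use fam_0[OF F] fam_0[OF G] w in \<open>auto simp: con0_def\<close>)
 \<comment> \<open>At frequency 0 and phase 0 the test function is the constant 1.\<close>
 show "((\<lambda>t. itg 0 L (F t)) has_real_derivative itg 0 L (G t)) (at t within {0..T})" if t: "t \<in> {0..T}" for t
  using w[OF t, of 0 0] by (simp add: trg_def)
qed

lemma Lam1_Euler: assumes t: "t \<in> {0..T}" shows "Lam1 (\<lambda>x. W t (lab t x)) x = Vl t (lab t x)"
proof -
 obtain r where a: "adm (\<rho> t) r" by (rule adm_t[OF t])
 have WL: "W t \<in> \<L>2" by (rule dvtD(5)[OF dW[OF t]])
 have "Lam1 (\<lambda>x. W t (lab t x)) x = Lam1 (\<lambda>x. W t (xi (\<rho> t) x)) (x - sh t)"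
  unfolding lab_def by (rule Lam1_shift[OF L2_comp_xi[OF a WL]])
 also have "\<dots> = Lam1 (\<lambda>x. W t (xi (\<rho> t) x)) (eta (\<rho> t) (lab t x))" by (simp add: lab_def eta_xi[OF a])
 also have "\<dots> = Vl t (lab t x)" unfolding Vl_def by (rule Lam_eq_Lam1[OF a WL, symmetric])
 finally show ?thesis .
qed

lemma X_0: assumes "\<rho> 0 = (\<lambda>z. 1)" shows "lab 0 x = x"
 using assms by (simp add: lab_def sh_def xi_def eta_one inv_id[unfolded id_def])

end


text \<open>\<open>q\<close> and \<open>h\<close> stand for the top derivatives of the data, and
  \<open>c\<close> for the initial mean of \<open>u\<close>. No bound on \<open>c\<close> appears,
  because \<open>u\<close> enters the equations through its derivative alone.\<close>

theorem Euler_solution: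
 fixes n :: nat and R :: real
 assumes R: "0 \<le> R"
 shows "\<exists>T>0. \<forall>q\<in>\<L>2. \<forall>h\<in>\<L>2. \<forall>c. nrm q \<le> R \<longrightarrow> nrm h \<le> R \<longrightarrow>
  (\<exists>u ut ux w wt wx. fam con0 {0..T} (Suc (Suc n)) u \<and> fam con0 {0..T} (Suc n) ut \<and> fam con0 {0..T} (Suc n) w \<and> fam con0 {0..T} n wt \<and>
   u 0 = (\<lambda>x. c + pw (Suc (Suc n)) q x) \<and> w 0 = pw (Suc n) h \<and>
   (\<forall>t\<in>{0..T}. dvt (u t) (ux t) \<and> dvt (w t) (wx t) \<and> itg 0 L (w t) = 0 \<and> itg 0 L (wt t) = 0 \<and>
    ((\<lambda>t. toL2 (u t)) has_vector_derivative toL2 (ut t)) (at t within {0..T}) \<and>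
    ((\<lambda>t. toL2 (w t)) has_vector_derivative toL2 (wt t)) (at t within {0..T}) \<and>
    (\<forall>x. ut t x = - (Lam1 (w t) x * ux t x) \<and> wt t x = ux t x - Lam1 (w t) x * wx t x)))"
proof -
 let ?m = "Suc n"
 obtain T where T: "0 < T" and sol: "\<forall>q\<in>\<L>2. \<forall>h\<in>\<L>2. nrm q \<le> R \<longrightarrow> nrm h \<le> R \<longrightarrow>
  (\<exists>\<rho> W W'. lip {0..T} ?m \<rho> \<and> lip {0..T} ?m W \<and> lip {0..T} n W' \<and> \<rho> 0 = (\<lambda>z. 1) \<and> W 0 = pw ?m h \<and>
   (\<forall>t\<in>{0..T}. dvt (W t) (W' t) \<and> itg 0 L (\<rho> t) = L \<and> (\<forall>z. 1/2 \<le> \<rho> t z \<and>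
    ((\<lambda>t. \<rho> t z) has_real_derivative \<rho> t z * Lam (\<rho> t) (W' t) z) (at t within {0..T}) \<and>
    ((\<lambda>t. W t z) has_real_derivative pw ?m q z / \<rho> t z) (at t within {0..T}))))"
  using Lagrangian_solution[OF R, of n] by (elim exE conjE) (rule that)
 show ?thesis
 proof (intro exI[of _ T] conjI T ballI allI impI)
  fix q h c assume q: "q \<in> \<L>2" and h: "h \<in> \<L>2" and nq: "nrm q \<le> R" and nh: "nrm h \<le> R"
  obtain \<rho> W W' where lr: "lip {0..T} ?m \<rho>" and lW: "lip {0..T} ?m W" and lW': "lip {0..T} n W'" and i0: "\<rho> 0 = (\<lambda>z. 1)" "W 0 = pw ?m h"
   and A: "\<forall>t\<in>{0..T}. dvt (W t) (W' t) \<and> itg 0 L (\<rho> t) = L \<and> (\<forall>z. 1/2 \<le> \<rho> t z \<and>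
    ((\<lambda>t. \<rho> t z) has_real_derivative \<rho> t z * Lam (\<rho> t) (W' t) z) (at t within {0..T}) \<and>
    ((\<lambda>t. W t z) has_real_derivative pw ?m q z / \<rho> t z) (at t within {0..T}))"
   using sol[THEN bspec, OF q, THEN bspec, OF h, THEN mp, OF nq, THEN mp, OF nh] by (elim exE conjE) (rule that)
  have dW: "\<forall>t\<in>{0..T}. dvt (W t) (W' t)" and m: "\<forall>t\<in>{0..T}. itg 0 L (\<rho> t) = L"
   and lb: "\<forall>t\<in>{0..T}. \<forall>z. 1/2 \<le> \<rho> t z"
   and rt: "\<forall>t\<in>{0..T}. \<forall>z. ((\<lambda>t. \<rho> t z) has_real_derivative \<rho> t z * Lam (\<rho> t) (W' t) z) (at t within {0..T})"
   and Wt: "\<And>t z. t \<in> {0..T} ==> ((\<lambda>t. W t z) has_real_derivative pw ?m q z / \<rho> t z) (at t within {0..T})"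
   using A by blast+
  note flow = T lr lW lW' dW m lb rt
  define U where "U = pw ?m q"
  define Y where "Y = lab \<rho> W"
  define V where "V t x = Lam1 (\<lambda>x. W t (Y t x)) x" for t x
  have Ve: "Vl \<rho> W t (Y t x) = V t x" if "t \<in> {0..T}" for t x
   unfolding V_def Y_def by (rule Lam1_Euler[OF flow that, symmetric])
  define u ux w wx where "u t x = c + pw (Suc ?m) q (Y t x)" and "ux t x = (1 / \<rho> t (Y t x)) * U (Y t x)"
   and "w t x = W t (Y t x)" and "wx t x = (1 / \<rho> t (Y t x)) * W' t (Y t x)" for t x
  have cst: "lip {0..T} k (\<lambda>t. pw k q)" for k
   using lip_pw[of "{0..T}" 0 "\<lambda>t. q" k] lip0I[of "{0..T}" "\<lambda>t. q" R 0] q nq by simp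
  have lu: "lip {0..T} (Suc ?m) (\<lambda>t x. c + pw (Suc ?m) q x)" by (intro lip_add lip_const cst)
  have lU: "lip {0..T} ?m (\<lambda>t. U)" unfolding U_def by (rule cst)
  have "mean L U = 0" using pw_mean_zero[OF q, of n] by (simp add: mean_itg U_def del: pw.simps)
  then have du: "dvt (\<lambda>x. c + pw (Suc ?m) q x) U"
   using dvt_add[OF dvt_const prim(1)[OF pw_L2[OF q, of ?m]], of c] by (simp add: U_def)
  have lk: "lip {0..T} ?m (\<lambda>t z. (1 / \<rho> t z) * U z)" by (rule lip_mult_same[OF lip_inverse[OF _ lb[rule_format] lr] lU]) auto
  have Wt': "\<forall>t\<in>{0..T}. \<forall>z. ((\<lambda>t. W t z) has_real_derivative (1 / \<rho> t z) * U z) (at t within {0..T})"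
   using Wt by (simp add: U_def)
  \<comment> \<open>The summand 0 is the source term of \<open>u\<close>; it is written so that both
    definitions have the shape of \<open>G\<close> in \<open>transport\<close>.\<close>
  define ut wt where "ut t x = 0 + - (Vl \<rho> W t (Y t x) * ux t x)" and "wt t x = ux t x + - (Vl \<rho> W t (Y t x) * wx t x)" for t x
  note tu = transport[OF flow lu ballI[OF du] lU le_refl lip_const[of "{0..T}" "Suc n" 0] ballI[OF allI[OF DERIV_const]], folded Y_def, folded ux_def, folded u_def ut_def]
  note tw = transport[OF flow lW dW lW' le_SucI[OF le_refl] lk Wt', folded Y_def, folded ux_def wx_def, folded w_def wt_def]
  have dux: "dvt (u t) (ux t)" if "t \<in> {0..T}" for t
   using dvt_X[OF flow du that] unfolding u_def[abs_def] ux_def[abs_def] Y_def .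
  have dwx: "dvt (w t) (wx t)" if "t \<in> {0..T}" for t
   using dvt_X[OF flow dW[rule_format, OF that] that] unfolding w_def[abs_def] wx_def[abs_def] Y_def .
  have Vw: "V t = Lam1 (w t)" for t unfolding V_def[abs_def] w_def[abs_def] ..
  have e: "ut t x = - (Lam1 (w t) x * ux t x)" "wt t x = ux t x - Lam1 (w t) x * wx t x" if "t \<in> {0..T}" for t x
   using Ve[OF that] by (simp_all add: ut_def wt_def Vw)
  \<comment> \<open>By parts, the mean of the transport term becomes minus the mean of
    \<open>Hil (w t) x * w t x\<close>, which vanishes; the source \<open>ux t\<close> is a
    derivative of a periodic function. So the vorticity keeps mean zero.\<close>
  have zt: "itg 0 L (wt t) = 0" if t: "t \<in> {0..T}" for t
  proof -
   note wL = dvtD(5)[OF dwx[OF t]]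
   have "itg 0 L (\<lambda>x. Lam1 (w t) x * wx t x) = - itg 0 L (\<lambda>x. Hil (w t) x * w t x)"
    using itg_parts[OF dwx[OF t] Lam1_dvt(1)[OF wL]] by (simp add: mult.commute)
   then have "itg 0 L (\<lambda>x. Lam1 (w t) x * wx t x) = 0" using Hil_orthogonal[OF wL] by simp
   moreover have "locint (\<lambda>x. Lam1 (w t) x * wx t x)"
    by (rule L2_mult_locint[OF dvtD(5)[OF Lam1_dvt(1)[OF wL]] dvtD(2)[OF dwx[OF t]]])
   moreover have "wt t = (\<lambda>x. ux t x - Lam1 (w t) x * wx t x)" using e(2)[OF t] by auto
   ultimately show ?thesis
    by (simp add: itg_diff L2_locint dvtD(2)[OF dux[OF t]] dvt_mean_zero[OF dux[OF t]])
  qed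
  have id: "Y 0 x = x" for x unfolding Y_def by (rule X_0[OF flow i0(1)])
  have z: "itg 0 L (w t) = 0" if t: "t \<in> {0..T}" for t
  proof -
   have "((\<lambda>t. itg 0 L (w t)) has_real_derivative 0) (at t within {0..T})" if "t \<in> {0..T}" for t
    using tw(4)[OF that] zt[OF that] by simp
   then obtain C where C: "\<And>t. t \<in> {0..T} ==> itg 0 L (w t) = C"
    using has_field_derivative_zero_constant[of "{0..T}" "\<lambda>t. itg 0 L (w t)"] by auto
   have "itg 0 L (w 0) = 0" unfolding w_def[abs_def] id i0(2) using pw_mean_zero[OF h] by simp
   then show ?thesis using C[OF t] C[of 0] T by simp
  qed
  show "\<exists>u ut ux w wt wx. fam con0 {0..T} (Suc ?m) u \<and> fam con0 {0..T} ?m ut \<and> fam con0 {0..T} ?m w \<and> fam con0 {0..T} n wt \<and>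
   u 0 = (\<lambda>x. c + pw (Suc ?m) q x) \<and> w 0 = pw ?m h \<and>
   (\<forall>t\<in>{0..T}. dvt (u t) (ux t) \<and> dvt (w t) (wx t) \<and> itg 0 L (w t) = 0 \<and> itg 0 L (wt t) = 0 \<and>
    ((\<lambda>t. toL2 (u t)) has_vector_derivative toL2 (ut t)) (at t within {0..T}) \<and>
    ((\<lambda>t. toL2 (w t)) has_vector_derivative toL2 (wt t)) (at t within {0..T}) \<and>
    (\<forall>x. ut t x = - (Lam1 (w t) x * ux t x) \<and> wt t x = ux t x - Lam1 (w t) x * wx t x))"
  proof (intro exI conjI ballI allI)
   show "fam con0 {0..T} (Suc ?m) u" by (rule tu(1))
   show "fam con0 {0..T} ?m ut" by (rule tu(2))
   show "fam con0 {0..T} ?m w" by (rule tw(1))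
   show "fam con0 {0..T} n wt" by (rule tw(2))
   show "u 0 = (\<lambda>x. c + pw (Suc ?m) q x)" "w 0 = pw ?m h" using id i0 by (auto simp: u_def w_def simp del: pw.simps)
   fix t assume t: "t \<in> {0..T}"
   show "dvt (u t) (ux t)" "dvt (w t) (wx t)" "itg 0 L (w t) = 0" "itg 0 L (wt t) = 0"
    by (rule dux[OF t] dwx[OF t] z[OF t] zt[OF t])+
   show "((\<lambda>t. toL2 (u t)) has_vector_derivative toL2 (ut t)) (at t within {0..T})" by (rule tu(3)[OF t])
   show "((\<lambda>t. toL2 (w t)) has_vector_derivative toL2 (wt t)) (at t within {0..T})" by (rule tw(3)[OF t])
   show "ut t x = - (Lam1 (w t) x * ux t x)" "wt t x = ux t x - Lam1 (w t) x * wx t x" for x by (rule e[OF t])+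
  qed
 qed
qed

section \<open>The velocity\<close>

lemma lam_sqrt_tendsto: "((\<lambda>e. lam e * sqrt e) \<longlongrightarrow> 0) (at_right 0)"
proof -
 have "((\<lambda>e::real. (1 / pi) * ln \<bar>sin (mu * e)\<bar> * sqrt e) \<longlongrightarrow> 0) (at_right 0)" using mu_pos by real_asymp
 then show ?thesis by (simp add: lam_def)
qed

lemma off_lattice_closed: "closed {y::real. \<forall>k::int. e \<le> \<bar>z - y - of_int k * L\<bar>}"
 by (intro closed_Collect_all closed_Collect_le continuous_intros)

text \<open>The truncated kernel is bounded and periodic, so the window \<open>{0..L}\<close> may be
  replaced by the period that starts at \<open>z\<close>. In that period the truncation removes
  exactly the pieces of length \<open>e\<close> at both ends.\<close>

lemma hilbert_truncated:
 assumes w: "w \<in> \<L>2" and e: "0 < e" "e < L / 2"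
 shows "(LINT y:{y\<in>{0..L}. \<forall>k::int. e \<le> \<bar>z - y - of_int k * L\<bar>}|lborel. w y * cot (pi / L * (z - y)))
  = itg (z + e) (z + L - e) (\<lambda>y. w y * cot (mu * (z - y)))"
proof -
 define P where "P = {y::real. \<forall>k::int. e \<le> \<bar>z - y - of_int k * L\<bar>}"
 define c where "c y = indicator P y * cot (mu * (z - y))" for y
 have Pb: "P \<in> sets borel" unfolding P_def by (rule borel_closed[OF off_lattice_closed])
 have Pp: "y + L \<in> P \<longleftrightarrow> y \<in> P" for y
 proof -
  have a: "z - (y + L) - of_int k * L = z - y - of_int (k + 1) * L" "z - y - of_int k * L = z - (y + L) - of_int (k - 1) * L" for k :: int
   by (simp_all add: algebra_simps)
  show ?thesis unfolding P_def mem_Collect_eq by (metis a)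
 qed
 have cp: "cot (mu * (z - (y + L))) = cot (mu * (z - y))" for y
  using cot_shift(1)[OF adm_one, of "mu * (z - y)"] mu_L by (simp add: algebra_simps)
 have cb: "\<bar>c y\<bar> \<le> 2 / (mu * e)" for y
 proof (cases "y \<in> P")
  case True
  obtain k :: int where k: "\<bar>z - (y + of_int k * L)\<bar> \<le> L / 2" by (rule near_rep)
  have "e \<le> \<bar>z - y - of_int k * L\<bar>" using True by (simp add: P_def)
  then have "mu * e / 2 \<le> mu * \<bar>z - (y + of_int k * L)\<bar> / 2" using mu_pos by (simp add: algebra_simps)
  also have "\<dots> \<le> \<bar>sin (mu * (z - (y + of_int k * L)))\<bar>" by (rule abs_sin_mu_ge[OF k])
  also have "\<dots> = \<bar>sin (mu * (z - y))\<bar>"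
   using periodic_int[OF abs_sin_periodic[of "\<lambda>x. x"], of "z - y" "- k"] by (simp add: algebra_simps)
  finally have s: "mu * e / 2 \<le> \<bar>sin (mu * (z - y))\<bar>" .
  have "\<bar>cos (mu * (z - y))\<bar> / \<bar>sin (mu * (z - y))\<bar> \<le> 1 / (mu * e / 2)"
   by (rule frac_le) (use s mu_pos e in auto)
  then show ?thesis using True by (simp add: c_def cot_def)
 qed (use mu_pos e in \<open>simp add: c_def\<close>)
 have "(\<lambda>y. c y * w y) \<in> \<L>2"
  by (rule L2_bounded_mult[OF _ _ cb w]) (use Pb Pp cp in \<open>auto simp: c_def[abs_def] periodic_def indicator_def cot_def\<close>)
 then have l: "locint (\<lambda>y. c y * w y)" and p: "periodic L (\<lambda>y. c y * w y)" using L2_locint L2_periodic by auto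
 have m: "pi / L = mu" by (simp add: mu_def)
 have "(LINT y:{y\<in>{0..L}. \<forall>k::int. e \<le> \<bar>z - y - of_int k * L\<bar>}|lborel. w y * cot (pi / L * (z - y))) = itg 0 L (\<lambda>y. c y * w y)"
  unfolding itg_def set_lebesgue_integral_def m
  by (rule Bochner_Integration.integral_cong) (auto simp: c_def P_def indicator_def)
 also have "\<dots> = itg z (z + L) (\<lambda>y. c y * w y)" by (rule itg_period[OF l p, symmetric])
 also have "\<dots> = itg (z + e) (z + L - e) (\<lambda>y. w y * cot (mu * (z - y)))"
 proof -
  have "y \<in> {z..z + L} \<and> y \<in> P \<longleftrightarrow> y \<in> {z + e..z + L - e}" for y
  proof
   assume a: "y \<in> {z..z + L} \<and> y \<in> P"
   then have "e \<le> \<bar>z - y - of_int 0 * L\<bar>" "e \<le> \<bar>z - y - of_int (- 1) * L\<bar>" unfolding P_def by blast+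
   then show "y \<in> {z + e..z + L - e}" using a by auto
  next
   assume a: "y \<in> {z + e..z + L - e}"
   then have a': "z + e \<le> y" "y \<le> z + L - e" by auto
   have "e \<le> \<bar>z - y - of_int k * L\<bar>" for k :: int
   proof (cases "0 \<le> k")
    case True
    then have "0 \<le> of_int k * L" using L_pos by simp
    then show ?thesis using a' by linarith
   next
    case False
    then have "of_int k * L \<le> (- 1) * L" using L_pos by (intro mult_right_mono) auto
    then show ?thesis using a' by linarith
   qed
   then show "y \<in> {z..z + L} \<and> y \<in> P" using a e by (auto simp: P_def)
  qed
  then show ?thesis unfolding itg_def set_lebesgue_integral_def
   by (intro Bochner_Integration.integral_cong) (auto simp: c_def indicator_def)
 qed
 finally show ?thesis .
qed

text \<open>Integration by parts, with boundary terms at the two cut points, where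
  \<open>lam\<close> takes the common value \<open>lam e\<close>. The clamp \<open>cl\<close>
  freezes the cotangent outside the interval; it thereby becomes continuous on the line, and
  \<open>acd_mult\<close> applies.\<close>

lemma truncated_parts:
 assumes w: "dvt w w'" and e: "0 < e" "e < L / 2"
 shows "(1 / L) * itg (z + e) (z + L - e) (\<lambda>y. w y * cot (mu * (z - y)))
  = itg (z + e) (z + L - e) (\<lambda>y. lam (z - y) * w' y) + lam e * (w (z + e) - w (z - e))"
proof -
 let ?a = "z + e" and ?b = "z + L - e"
 have ab: "?a \<le> ?b" using e by simp
 define cl where "cl y = max ?a (min ?b y)" for y
 define \<kappa> where "\<kappa> y = - ((1 / L) * cot (mu * (z - cl y)))" for y
 have sn: "sin (mu * (z - y)) \<noteq> 0" if "?a \<le> y" "y \<le> ?b" for y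
  using sin_mu_pos[of "y - z"] that e sin_minus[of "mu * (y - z)"] by (auto simp: algebra_simps)
 have clb: "?a \<le> cl y" "cl y \<le> ?b" for y using ab by (auto simp: cl_def)
 have cli: "cl y = y" if "?a \<le> y" "y \<le> ?b" for y using that by (simp add: cl_def)
 have kc: "continuous_on UNIV \<kappa>"
  unfolding \<kappa>_def[abs_def] cot_def using sn[OF clb] by (intro continuous_intros) (auto simp: cl_def[abs_def] intro!: continuous_intros)
 define Q where "Q = (\<lambda>x. if 0 \<le> x then itg 0 x \<kappa> else - itg x 0 \<kappa>)"
 define K where "K y = Q y + (lam (z - ?a) - Q ?a)" for y
 have K: "acd K \<kappa>"
  unfolding K_def[abs_def] using acd_add[OF acd_indefinite[OF locint_continuous[OF kc]] acd_const] by (simp add: Q_def)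
 have Ke: "K y = lam (z - y)" if y: "?a \<le> y" "y \<le> ?b" for y
 proof -
  have "(\<kappa> has_integral lam (z - y) - lam (z - ?a)) {?a..y}"
  proof (rule fundamental_theorem_of_calculus[OF y(1)])
   fix s assume s: "s \<in> {?a..y}"
   then have s': "?a \<le> s" "s \<le> ?b" using y by auto
   have "((\<lambda>s. lam (z - s)) has_real_derivative (1 / L) * cot (mu * (z - s)) * (0 - 1)) (at s)"
    by (rule DERIV_chain2[where f=lam and g="\<lambda>s. z - s", OF lam_deriv_all[OF sn[OF s']]]) (intro derivative_intros)
   then show "((\<lambda>s. lam (z - s)) has_vector_derivative \<kappa> s) (at s within {?a..y})"
    by (simp add: \<kappa>_def cli[OF s'] has_real_derivative_iff_has_vector_derivative has_vector_derivative_at_within)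
  qed
  then have "itg ?a y \<kappa> = lam (z - y) - lam (z - ?a)" using itg_eq_integral[OF locint_continuous[OF kc]] by (simp add: integral_unique)
  then show ?thesis using acdD[OF K y(1)] by (simp add: K_def)
 qed
 note aw = dvtD(3)[OF w]
 have l: "locint (\<lambda>y. \<kappa> y * w y)" "locint (\<lambda>y. K y * w' y)"
  by (rule locint_mult_cont[OF kc acd_locint1[OF aw]] locint_mult_cont[OF acd_continuous[OF K] acd_locint[OF aw]])+
 have "K ?b * w ?b - K ?a * w ?a = itg ?a ?b (\<lambda>y. \<kappa> y * w y) + itg ?a ?b (\<lambda>y. K y * w' y)"
  using acdD[OF acd_mult[OF K aw] ab] by (simp add: itg_add l)
 also have "itg ?a ?b (\<lambda>y. \<kappa> y * w y) = itg ?a ?b (\<lambda>y. (- (1 / L)) * (w y * cot (mu * (z - y))))"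
  by (rule itg_cong) (simp add: \<kappa>_def cli)
 also have "itg ?a ?b (\<lambda>y. K y * w' y) = itg ?a ?b (\<lambda>y. lam (z - y) * w' y)" by (rule itg_cong) (simp add: Ke)
 also have "K ?b = lam e" using Ke[OF ab order_refl] lam_periodic lam_even[of e] by (simp add: periodic_def) (metis add.commute diff_add_cancel minus_diff_eq uminus_add_conv_diff)
 also have "K ?a = lam e" using Ke[OF order_refl ab] lam_even[of e] by simp
 also have "w ?b = w (z - e)" using dvtD(1)[OF w] unfolding periodic_def by (metis diff_add_eq)
 finally show ?thesis unfolding itg_cmult by (simp add: algebra_simps)
qed

text \<open>The boundary term is \<open>lam e\<close> times an increment of \<open>w\<close> of
  order \<open>sqrt e\<close>, hence tends to 0, and the principal value exists at every point. This
  is where \<open>w\<close> has to lie in H^1, as \<open>m \<ge> 1\<close> ensures.\<close>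

lemma hilbert_Lam1:
 assumes w: "dvt w w'" shows "hilbert L w z = Lam1 w' z"
proof -
 define g where "g y = lam (z - y) * w' y" for y
 have g: "locint g" unfolding g_def[abs_def] by (rule L2_mult_locint[OF L2_reflect(1)[OF lam_L2] dvtD(2)[OF w]])
 have gp: "periodic L g"
  unfolding g_def[abs_def] by (intro periodic_mult L2_periodic L2_reflect(1) lam_L2 dvtD(2)[OF w])
 define G where "G = (\<lambda>x. if 0 \<le> x then itg 0 x g else - itg x 0 g)"
 have G: "acd G g" unfolding G_def by (rule acd_indefinite[OF g])
 have Gl: "G (z + L) - G z = Lam1 w' z"
  using acdD[OF G, of z "z + L"] itg_period[OF g gp, of z] L_pos by (simp add: Lam1_def g_def[abs_def])
 have Gi: "isCont G x" for x using acd_continuous[OF G] by (simp add: continuous_on_eq_continuous_at)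
 have "((\<lambda>e. G (z + L - e) - G (z + e)) \<longlongrightarrow> G (z + L - 0) - G (z + 0)) (at_right 0)"
  by (intro tendsto_intros isCont_tendsto_compose[OF Gi])
 moreover have "((\<lambda>e. lam e * (w (z + e) - w (z - e))) \<longlongrightarrow> 0) (at_right 0)"
 proof (rule Lim_null_comparison)
  have "((\<lambda>e. \<bar>lam e * sqrt e\<bar> * (nrm w' * sqrt 2)) \<longlongrightarrow> \<bar>0\<bar> * (nrm w' * sqrt 2)) (at_right 0)"
   by (intro tendsto_mult tendsto_rabs tendsto_const lam_sqrt_tendsto)
  then show "((\<lambda>e. \<bar>lam e * sqrt e\<bar> * (nrm w' * sqrt 2)) \<longlongrightarrow> 0) (at_right 0)" by simp
  have "\<forall>\<^sub>F e in at_right 0. 0 < e \<and> e < L / 2" using eventually_at_right_real[of 0 "L / 2"] L_pos by simp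
  then show "\<forall>\<^sub>F e in at_right 0. norm (lam e * (w (z + e) - w (z - e))) \<le> \<bar>lam e * sqrt e\<bar> * (nrm w' * sqrt 2)"
  proof eventually_elim
   case (elim e)
   have "\<bar>w (z + e) - w (z - e)\<bar> \<le> nrm w' * sqrt \<bar>(z + e) - (z - e)\<bar>"
    by (rule dvt_Hoelder[OF w]) (use elim in simp)
   also have "\<dots> = nrm w' * sqrt 2 * sqrt e" using elim by (simp add: real_sqrt_mult)
   finally have "\<bar>lam e\<bar> * \<bar>w (z + e) - w (z - e)\<bar> \<le> \<bar>lam e\<bar> * (nrm w' * sqrt 2 * sqrt e)"
    by (rule mult_left_mono) simp
   then show ?case using elim by (simp add: abs_mult mult_ac)
  qed
 qed
 ultimately have "((\<lambda>e. L * ((G (z + L - e) - G (z + e)) + lam e * (w (z + e) - w (z - e)))) \<longlongrightarrow> L * (Lam1 w' z + 0)) (at_right 0)"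
  using Gl by (intro tendsto_intros) auto
 then have lim: "((\<lambda>e. L * ((G (z + L - e) - G (z + e)) + lam e * (w (z + e) - w (z - e)))) \<longlongrightarrow> L * Lam1 w' z) (at_right 0)" by simp
 have "((\<lambda>e. LINT y:{y\<in>{0..L}. \<forall>k::int. e \<le> \<bar>z - y - of_int k * L\<bar>}|lborel. w y * cot (pi / L * (z - y))) \<longlongrightarrow> L * Lam1 w' z) (at_right 0)"
 proof (rule Lim_transform_eventually[OF lim])
  have "\<forall>\<^sub>F e in at_right 0. 0 < e \<and> e < L / 2" using eventually_at_right_real[of 0 "L / 2"] L_pos by simp
  then show "\<forall>\<^sub>F e in at_right 0. L * ((G (z + L - e) - G (z + e)) + lam e * (w (z + e) - w (z - e)))
   = (LINT y:{y\<in>{0..L}. \<forall>k::int. e \<le> \<bar>z - y - of_int k * L\<bar>}|lborel. w y * cot (pi / L * (z - y)))"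
  proof eventually_elim
   case (elim e)
   have 1: "itg (z + e) (z + L - e) g = G (z + L - e) - G (z + e)" using acdD[OF G, of "z + e" "z + L - e"] elim by simp
   have 2: "(1 / L) * itg (z + e) (z + L - e) (\<lambda>y. w y * cot (mu * (z - y))) = itg (z + e) (z + L - e) g + lam e * (w (z + e) - w (z - e))"
    using truncated_parts[OF w, of e z] elim unfolding g_def[abs_def] by blast
   show ?case unfolding hilbert_truncated[OF dvtD(5)[OF w] conjunct1[OF elim] conjunct2[OF elim]] 1[symmetric] 2[symmetric]
    using L_pos by simp
  qed
 qed
 then show ?thesis unfolding hilbert_def using tendsto_Lim[OF trivial_limit_at_right_real] L_pos by force
qed

lemma hilbert_cong_AE:
 assumes f: "f \<in> \<L>2" and g: "g \<in> \<L>2" and e: "AE x in lborel. f x = g x" shows "hilbert L f z = hilbert L g z"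
proof -
 have "(LINT y:{y\<in>{0..L}. \<forall>k::int. \<epsilon> \<le> \<bar>z - y - of_int k * L\<bar>}|lborel. f y * cot (pi / L * (z - y)))
  = (LINT y:{y\<in>{0..L}. \<forall>k::int. \<epsilon> \<le> \<bar>z - y - of_int k * L\<bar>}|lborel. g y * cot (pi / L * (z - y)))" for \<epsilon>
 proof -
  have S: "{y\<in>{0..L}. \<forall>k::int. \<epsilon> \<le> \<bar>z - y - of_int k * L\<bar>} \<in> sets borel"
   using sets.Int[OF _ borel_closed[OF off_lattice_closed[of \<epsilon> z]], of "{0..L}"] by (simp add: Int_def)
  have c: "(\<lambda>y. cot (pi / L * (z - y))) \<in> borel_measurable borel" unfolding cot_def by measurable
  show ?thesis unfolding set_lebesgue_integral_def
   by (rule integral_cong_AE) (use S c L2_measurable[OF f] L2_measurable[OF g] e in auto)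
 qed
 then show ?thesis by (simp add: hilbert_def)
qed

lemma Lam1_deriv: assumes "dvt w w'" shows "(Lam1 w has_real_derivative Lam1 w' x) (at x)"
 by (rule acd_has_deriv[OF dvtD(3)[OF Lam1_H1[OF assms]] dvtD(4)[OF Lam1_dvt(1)[OF dvtD(2)[OF assms]]]])

lemma Lam1_mean_zero: assumes w: "w \<in> \<L>2" and z: "itg 0 L w = 0" shows "itg 0 L (Lam1 w) = 0"
proof -
 have "dvt (prim w) w" using prim(1)[OF w] z by (simp add: mean_itg)
 then show ?thesis by (intro dvt_mean_zero[OF Lam1_H1])
qed

text \<open>\<open>Lam1 w\<close> has derivative \<open>Lam1 w'\<close>, the Hilbert transform of
  \<open>w\<close>, and it has mean zero, being itself the derivative of the potential of
  \<open>prim w\<close>. Any other velocity differs from it by a constant of mean zero.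
  \<open>f\<close> is an arbitrary representative, as \<open>hilbert\<close> ignores null
  sets.\<close>

lemma is_velocity_iff:
 assumes w: "dvt w w'" and z: "itg 0 L w = 0" and f: "f \<in> \<L>2" "AE x in lborel. f x = w x"
 shows "is_velocity L f v \<longleftrightarrow> v = Lam1 w"
proof -
 have h: "hilbert L f z = Lam1 w' z" for z using hilbert_cong_AE[OF f(1) dvtD(5)[OF w] f(2)] hilbert_Lam1[OF w] by simp
 have l: "is_velocity L f (Lam1 w)"
  unfolding is_velocity_def h using Lam1_deriv[OF w] Lam1_mean_zero[OF dvtD(5)[OF w] z] Lam1_periodic by (simp add: mean_itg)
 have "v = Lam1 w" if v: "is_velocity L f v"
 proof -
  have "((\<lambda>x. v x - Lam1 w x) has_real_derivative Lam1 w' x - Lam1 w' x) (at x)" for x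
   using v Lam1_deriv[OF w] unfolding is_velocity_def h by (intro DERIV_diff) auto
  then have c: "v x - Lam1 w x = v 0 - Lam1 w 0" for x by (intro DERIV_isconst_all) simp
  have vc: "locint v" using v unfolding is_velocity_def
   by (intro locint_continuous continuous_at_imp_continuous_on) (auto intro: DERIV_isCont)
  have "itg 0 L (\<lambda>x. v x - Lam1 w x) = 0"
   unfolding itg_diff[OF vc L2_locint[OF dvtD(5)[OF Lam1_H1[OF w]]]]
   using v Lam1_mean_zero[OF dvtD(5)[OF w] z] L_pos by (simp add: is_velocity_def mean_itg)
  moreover have "(\<lambda>x. v x - Lam1 w x) = (\<lambda>x. v 0 - Lam1 w 0)" using c by (intro ext)
  ultimately have "v 0 - Lam1 w 0 = 0" using L_pos by (simp add: itg_const)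
  then have "v x = Lam1 w x" for x using c[of x] by simp
  then show ?thesis by (intro ext)
 qed
 then show ?thesis using l by blast
qed

end

section \<open>Sobolev spaces\<close>

text \<open>The quotient is spelled out as a linear combination of \<open>f s\<close> and
  \<open>f t\<close>, the shape in which \<open>sobolev_linear\<close> evaluates weak
  derivatives.\<close>

lemma has_vector_derivative_iff_quotient:
 fixes f :: "real => 'a::real_normed_vector"
 shows "(f has_vector_derivative D) (at t within S) \<longleftrightarrow> ((\<lambda>s. (1 / (s - t)) *\<^sub>R f s + (- 1 / (s - t)) *\<^sub>R f t - D) \<longlongrightarrow> 0) (at t within S)"
proof -
 have e: "norm ((1 / norm (s - t)) *\<^sub>R (f s - (f t + (s - t) *\<^sub>R D))) = norm ((1 / (s - t)) *\<^sub>R f s + (- 1 / (s - t)) *\<^sub>R f t - D)" if "s \<noteq> t" for s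
 proof -
  have "(1 / (s - t)) *\<^sub>R f s + (- 1 / (s - t)) *\<^sub>R f t - D = (1 / (s - t)) *\<^sub>R (f s - (f t + (s - t) *\<^sub>R D))"
   using that by (simp add: scaleR_diff_right scaleR_add_right)
  then show ?thesis by simp
 qed
 have "((\<lambda>s. (1 / norm (s - t)) *\<^sub>R (f s - (f t + (s - t) *\<^sub>R D))) \<longlongrightarrow> 0) (at t within S) \<longleftrightarrow>
  ((\<lambda>s. norm ((1 / norm (s - t)) *\<^sub>R (f s - (f t + (s - t) *\<^sub>R D)))) \<longlongrightarrow> 0) (at t within S)" by (rule tendsto_norm_zero_iff[symmetric])
 also have "\<dots> \<longleftrightarrow> ((\<lambda>s. norm ((1 / (s - t)) *\<^sub>R f s + (- 1 / (s - t)) *\<^sub>R f t - D)) \<longlongrightarrow> 0) (at t within S)"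
  by (rule Lim_cong_within) (use e in auto)
 finally show ?thesis unfolding tendsto_norm_zero_iff
  by (simp add: has_vector_derivative_def has_derivative_within bounded_linear_scaleR_left)
qed

context circle
begin

lemma is_weak_deriv_itg: "is_weak_deriv L j f g \<longleftrightarrow>
 (\<forall>\<phi>\<in>smooth_circle L. itg 0 L (\<lambda>z. f z * (deriv ^^ j) \<phi> z) = (-1) ^ j * itg 0 L (\<lambda>z. g z * \<phi> z))"
 by (simp add: is_weak_deriv_def itg_def)

lemma deriv_trg: "(deriv ^^ m) (trg k \<theta>) = (\<lambda>x. (2 * mu * of_int k) ^ m * trg k (\<theta> + real m * (pi / 2)) x)"
proof -
 define c where "c = 2 * mu * of_int k"
 have "(deriv ^^ m) (trg k \<theta>) = (\<lambda>x. c ^ m * trg k (\<theta> + real m * (pi / 2)) x)"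
 proof (induction m)
  case (Suc m)
  have a: "\<theta> + real (Suc m) * (pi / 2) = \<theta> + real m * (pi / 2) + pi / 2" by (simp add: field_simps)
  have "((\<lambda>x. c ^ m * trg k (\<theta> + real m * (pi / 2)) x) has_real_derivative c ^ Suc m * trg k (\<theta> + real (Suc m) * (pi / 2)) x) (at x)" for x
   using DERIV_cmult[OF trg_deriv[of k "\<theta> + real m * (pi / 2)" x], of "c ^ m"] unfolding a c_def[symmetric] by (simp add: mult_ac)
  then have "deriv (\<lambda>x. c ^ m * trg k (\<theta> + real m * (pi / 2)) x) = (\<lambda>x. c ^ Suc m * trg k (\<theta> + real (Suc m) * (pi / 2)) x)"
   by (intro ext DERIV_imp_deriv)
  then show ?case by (simp only: funpow.simps o_apply Suc.IH)
 qed simp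
 then show ?thesis by (simp only: c_def)
qed

lemma trg_smooth: "trg k \<theta> \<in> smooth_circle L"
proof -
 have "(\<lambda>x. c * trg k \<alpha> x) field_differentiable at z" for c \<alpha> z
  using DERIV_cmult[OF trg_deriv] field_differentiable_def by blast
 then show ?thesis by (simp add: smooth_circle_def deriv_trg trg_periodic)
qed

lemma smooth_dvt: assumes "\<phi> \<in> smooth_circle L" shows "dvt \<phi> (deriv \<phi>)"
proof -
 have d: "(deriv ^^ n) \<phi> field_differentiable at z" for n z using assms by (simp add: smooth_circle_def)
 have "(\<phi> has_real_derivative deriv \<phi> x) (at x)" for x
  using d[of 0 x] DERIV_deriv_iff_field_differentiable by auto
 moreover have "continuous_on UNIV (deriv \<phi>)"
  using d[of 1] by (auto intro!: continuous_at_imp_continuous_on field_differentiable_imp_continuous_at)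
 ultimately show ?thesis using assms by (intro dvt_of_deriv) (auto simp: smooth_circle_def)
qed

lemma smooth_deriv: assumes "\<phi> \<in> smooth_circle L" shows "deriv \<phi> \<in> smooth_circle L"
proof -
 have d: "(deriv ^^ n) \<phi> field_differentiable at z" for n z using assms by (simp add: smooth_circle_def)
 have "deriv \<phi> (z + L) = deriv \<phi> z" for z
 proof -
  have "(\<phi> has_real_derivative deriv \<phi> (z + L)) (at (z + L))" using d[of 0] DERIV_deriv_iff_field_differentiable by auto
  then have "((\<lambda>x. \<phi> (x + L)) has_real_derivative deriv \<phi> (z + L)) (at z)" by (simp add: DERIV_shift)
  moreover have "(\<lambda>x. \<phi> (x + L)) = \<phi>" using assms by (auto simp: smooth_circle_def periodic_def)
  ultimately show ?thesis using DERIV_imp_deriv by fastforce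
 qed
 then show ?thesis using d[of "Suc _"] by (simp add: smooth_circle_def periodic_def funpow_swap1)
qed

lemma weak_deriv_unique:
 assumes g: "g \<in> \<L>2" "h \<in> \<L>2" and w: "is_weak_deriv L j f g" "is_weak_deriv L j f h"
 shows "toL2 g = toL2 h"
proof -
 have "itg 0 L (\<lambda>x. (g x - h x) * trg k \<theta> x) = 0" for k \<theta>
 proof -
  have "itg 0 L (\<lambda>x. g x * trg k \<theta> x) = itg 0 L (\<lambda>x. h x * trg k \<theta> x)"
   using w trg_smooth[of k \<theta>] by (auto simp: is_weak_deriv_itg)
  then show ?thesis by (simp add: left_diff_distrib itg_diff L2_mult_locint g trg_L2)
 qed
 from trig_complete[OF L2_diff[OF g] this] show ?thesis by (intro toL2_cong_AE g) simp
qed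

definition wd :: "nat => (real => real) => l2" where "wd j f = toL2 (weak_deriv L j f)"

lemma weak_deriv_sobolev:
 assumes "f \<in> sobolev L k" "j \<le> k" shows "weak_deriv L j f \<in> \<L>2" "is_weak_deriv L j f (weak_deriv L j f)"
proof -
 have "\<exists>g. g \<in> \<L>2 \<and> is_weak_deriv L j f g" using assms by (auto simp: sobolev_def)
 from someI_ex[OF this] show "weak_deriv L j f \<in> \<L>2" "is_weak_deriv L j f (weak_deriv L j f)" by (simp_all add: weak_deriv_def)
qed

text \<open>Concrete representatives of all derivatives: the terms below the top are continuous, and
  only the last one is a mere L^2 function.\<close>

definition chain :: "nat => (nat => real => real) => bool" where
 "chain k D \<longleftrightarrow> (\<forall>i\<le>k. D i \<in> \<L>2) \<and> (\<forall>i<k. dvt (D i) (D (Suc i)))"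

lemma chain_weak_deriv:
 assumes D: "chain k D" and f: "f \<in> \<L>2" "AE x in lborel. f x = D 0 x"
 shows "j \<le> k ==> is_weak_deriv L j f (D j)"
proof (induction j)
 case 0
 have "itg 0 L (\<lambda>x. f x * \<phi> x) = itg 0 L (\<lambda>x. D 0 x * \<phi> x)" if "\<phi> \<in> smooth_circle L" for \<phi>
 proof (rule itg_cong_AE)
  note p = L2_measurable[OF dvtD(5)[OF smooth_dvt[OF that]]]
  show "(\<lambda>x. f x * \<phi> x) \<in> borel_measurable borel" using p L2_measurable[OF f(1)] by measurable
  show "(\<lambda>x. D 0 x * \<phi> x) \<in> borel_measurable borel" using p L2_measurable[of "D 0"] D by (auto simp: chain_def intro!: borel_measurable_times)
  show "AE x in lborel. f x * \<phi> x = D 0 x * \<phi> x" using f(2) by eventually_elim simp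
 qed
 then show ?case by (simp add: is_weak_deriv_itg)
next
 case (Suc j)
 have "itg 0 L (\<lambda>x. f x * (deriv ^^ Suc j) \<phi> x) = (-1) ^ Suc j * itg 0 L (\<lambda>x. D (Suc j) x * \<phi> x)" if p: "\<phi> \<in> smooth_circle L" for \<phi>
 proof -
  have "itg 0 L (\<lambda>x. f x * (deriv ^^ j) (deriv \<phi>) x) = (-1) ^ j * itg 0 L (\<lambda>x. D j x * deriv \<phi> x)"
   using Suc smooth_deriv[OF p] by (auto simp: is_weak_deriv_itg)
  moreover have "dvt (D j) (D (Suc j))" using D Suc.prems by (simp add: chain_def)
  from itg_parts[OF this smooth_dvt[OF p]] have "itg 0 L (\<lambda>x. D j x * deriv \<phi> x) = - itg 0 L (\<lambda>x. D (Suc j) x * \<phi> x)" by simp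
  ultimately show ?thesis by (simp add: funpow_swap1)
 qed
 then show ?case by (simp add: is_weak_deriv_itg)
qed

lemma chain_sobolev:
 assumes D: "chain k D" and f: "f \<in> \<L>2" "AE x in lborel. f x = D 0 x"
 shows "f \<in> sobolev L k" "j \<le> k ==> wd j f = toL2 (D j)"
proof -
 have DL: "D i \<in> \<L>2" if "i \<le> k" for i using D that by (simp add: chain_def)
 show s: "f \<in> sobolev L k" using chain_weak_deriv[OF D f] DL f(1) by (auto simp: sobolev_def)
 show "wd j f = toL2 (D j)" if "j \<le> k" unfolding wd_def
  using weak_deriv_unique[OF weak_deriv_sobolev(1)[OF s that] DL[OF that] weak_deriv_sobolev(2)[OF s that] chain_weak_deriv[OF D f that]] .
qed

lemma weak_deriv_1:
 assumes f: "dvt f f'" and g: "g \<in> \<L>2" "AE x in lborel. g x = f x" shows "AE x in lborel. weak_deriv L 1 g x = f' x"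
proof -
 have c: "chain 1 (\<lambda>i. if i = 0 then f else f')" using dvtD[OF f] f by (auto simp: chain_def le_Suc_eq)
 have "toL2 (weak_deriv L 1 g) = toL2 f'" using chain_sobolev(2)[OF c g(1), of 1] g(2) by (simp add: wd_def)
 then show ?thesis
  using toL2_eq_iff[OF weak_deriv_sobolev(1)[OF chain_sobolev(1)[OF c g(1)]] dvtD(2)[OF f]] g(2) by simp
qed

text \<open>The candidate has the same mean and the same top weak derivative as \<open>f\<close>.
  Against a trigonometric function of nonzero frequency, the top derivative multiplies the
  coefficient by a nonzero number, so all coefficients agree and completeness applies.\<close>

lemma sobolev_repr:
 assumes f: "f \<in> sobolev L (Suc k)"
 defines "q \<equiv> weak_deriv L (Suc k) f"
 shows "q \<in> \<L>2" "mean L q = 0" "AE x in lborel. f x = mean L f + pw (Suc k) q x"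
  "chain (Suc k) (\<lambda>i. if i = 0 then \<lambda>x. mean L f + pw (Suc k) q x else pw (Suc k - i) q)"
proof -
 show q: "q \<in> \<L>2" unfolding q_def by (rule weak_deriv_sobolev(1)[OF f order_refl])
 have qw: "is_weak_deriv L (Suc k) f q" unfolding q_def by (rule weak_deriv_sobolev(2)[OF f order_refl])
 have fL: "f \<in> \<L>2" using f by (simp add: sobolev_def)
 have "itg 0 L (\<lambda>x. f x * 0) = (-1) ^ Suc k * itg 0 L (\<lambda>x. q x)"
  using bspec[OF qw[unfolded is_weak_deriv_itg] trg_smooth[of 0 0]] unfolding deriv_trg by (simp add: trg_def)
 then show mq: "mean L q = 0" by (simp add: mean_itg itg_def)
 let ?D = "\<lambda>i. if i = 0 then \<lambda>x. mean L f + pw (Suc k) q x else pw (Suc k - i) q"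
 have pd: "dvt (pw (Suc j) q) (pw j q)" for j
 proof -
  have "mean L (pw j q) = 0" using mq pw_mean_zero[OF q, of "j - 1"] by (cases j) (auto simp: mean_itg simp del: pw.simps(2))
  then show ?thesis using prim(1)[OF pw_L2[OF q, of j]] by simp
 qed
 show D: "chain (Suc k) ?D"
  unfolding chain_def
 proof (intro conjI allI impI)
  show "?D i \<in> \<L>2" for i using pw_L2[OF q] by (auto intro!: L2_add L2_const simp del: pw.simps)
  fix i assume i: "i < Suc k"
  show "dvt (?D i) (?D (Suc i))"
  proof (cases i)
   case 0
   then show ?thesis using dvt_add[OF dvt_const pd[of k], of "mean L f"] by simp
  next
   case (Suc l)
   then have "Suc k - i = Suc (k - i)" using i by simp
   then show ?thesis using pd[of "k - i"] Suc by (simp del: pw.simps)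
  qed
 qed
 have DL: "?D 0 \<in> \<L>2" by (rule conjunct1[OF D[unfolded chain_def], rule_format]) simp
 have w0: "is_weak_deriv L (Suc k) (?D 0) q" using chain_weak_deriv[OF D DL _ order_refl] by simp
 have "itg 0 L (\<lambda>x. (f x - ?D 0 x) * trg l \<theta> x) = 0" for l \<theta>
 proof (cases "l = 0")
  case True
  have "itg 0 L (\<lambda>x. f x - ?D 0 x) = 0"
   using L_pos pw_mean_zero[OF q, of k]
   by (simp add: itg_diff itg_add L2_locint fL L2_add L2_const pw_L2[OF q] itg_const mean_itg del: pw.simps)
  then show ?thesis using True itg_cmult[of 0 L "cos \<theta>" "\<lambda>x. f x - ?D 0 x"] by (simp add: trg_def mult.commute)
 next
  case False
  \<comment> \<open>The phase is moved back by \<open>pi / 2\<close> for each derivative, so that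
    the differentiated test function has the phase \<theta>.\<close>
  let ?c = "(2 * mu * of_int l) ^ Suc k" and ?\<alpha> = "\<theta> - real (Suc k) * (pi / 2)"
  have e: "(deriv ^^ Suc k) (trg l ?\<alpha>) = (\<lambda>x. ?c * trg l \<theta> x)" unfolding deriv_trg by simp
  have i: "itg 0 L (\<lambda>x. h x * (?c * trg l \<theta> x)) = ?c * itg 0 L (\<lambda>x. h x * trg l \<theta> x)" for h
   using itg_cmult[of 0 L ?c "\<lambda>x. h x * trg l \<theta> x"] by (simp only: mult.left_commute)
  have "?c * itg 0 L (\<lambda>x. f x * trg l \<theta> x) = ?c * itg 0 L (\<lambda>x. ?D 0 x * trg l \<theta> x)"
   using bspec[OF qw[unfolded is_weak_deriv_itg] trg_smooth[of l ?\<alpha>]] bspec[OF w0[unfolded is_weak_deriv_itg] trg_smooth[of l ?\<alpha>]]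
   unfolding e i by simp
  then have "itg 0 L (\<lambda>x. f x * trg l \<theta> x) = itg 0 L (\<lambda>x. ?D 0 x * trg l \<theta> x)" using False mu_pos by simp
  then show ?thesis
   unfolding left_diff_distrib itg_diff[OF L2_mult_locint[OF fL trg_L2] L2_mult_locint[OF DL trg_L2]] by simp
 qed
 from trig_complete[OF L2_diff[OF fL DL] this] show "AE x in lborel. f x = mean L f + pw (Suc k) q x" by simp
qed

lemma sobolev_chain:
 assumes f: "f \<in> sobolev L k" obtains D where "chain k D" "AE x in lborel. f x = D 0 x"
proof (cases k)
 case 0
 then show ?thesis using f that[of "\<lambda>i. f"] by (simp add: chain_def sobolev_def)
next
 case (Suc l)
 have "f \<in> sobolev L (Suc l)" using f Suc by simp
 from sobolev_repr(3,4)[OF this] show ?thesis using that Suc by simp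
qed

lemma sobolev_L2: "f \<in> sobolev L k ==> f \<in> \<L>2" by (simp add: sobolev_def)

lemma sobolev_linear:
 assumes f: "f \<in> sobolev L k" and g: "g \<in> sobolev L k"
 shows "(\<lambda>x. a * f x + b * g x) \<in> sobolev L k"
  "j \<le> k ==> wd j (\<lambda>x. a * f x + b * g x) = a *\<^sub>R wd j f + b *\<^sub>R wd j g"
proof -
 obtain D where D: "chain k D" "AE x in lborel. f x = D 0 x" by (rule sobolev_chain[OF f])
 obtain E where E: "chain k E" "AE x in lborel. g x = E 0 x" by (rule sobolev_chain[OF g])
 have fL: "f \<in> \<L>2" "g \<in> \<L>2" using f g sobolev_L2 by auto
 have c: "chain k (\<lambda>i x. a * D i x + b * E i x)"
  using D(1) E(1) by (auto simp: chain_def intro!: L2_add L2_cmult dvt_add dvt_cmult)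
 have l: "(\<lambda>x. a * f x + b * g x) \<in> \<L>2" by (intro L2_add L2_cmult fL)
 have e: "AE x in lborel. a * f x + b * g x = a * D 0 x + b * E 0 x" using D(2) E(2) by eventually_elim simp
 show "(\<lambda>x. a * f x + b * g x) \<in> sobolev L k" by (rule chain_sobolev(1)[OF c l e])
 have DE: "D i \<in> \<L>2" "E i \<in> \<L>2" if "i \<le> k" for i using D(1) E(1) that by (auto simp: chain_def)
 show "wd j (\<lambda>x. a * f x + b * g x) = a *\<^sub>R wd j f + b *\<^sub>R wd j g" if "j \<le> k"
  unfolding chain_sobolev(2)[OF c l e that] chain_sobolev(2)[OF D(1) fL(1) D(2) that] chain_sobolev(2)[OF E(1) fL(2) E(2) that]
  by (simp only: toL2_add toL2_cmult L2_cmult DE that)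
qed

section \<open>Norms and path spaces\<close>

lemma sobolev_norm_wd: "f \<in> sobolev L k ==> sobolev_norm L k f = L2_set (\<lambda>j. norm (wd j f)) {..k}"
 unfolding sobolev_norm_def L2_set_def wd_def itg_def[symmetric]
 by (intro arg_cong[of _ _ sqrt] sum.cong refl) (simp add: norm_toL2_sq weak_deriv_sobolev(1))

lemma V_norm_wd: "f \<in> sobolev L k ==> V_norm L k f = norm (wd k f)"
 unfolding V_norm_def wd_def itg_def[symmetric] by (simp add: norm_toL2 weak_deriv_sobolev(1))

text \<open>Every function below the top of the chain has mean zero: the first by hypothesis, the
  others as derivatives of periodic functions. So each norm is at most \<open>L\<close> times the
  next one; the base \<open>1 + L\<close> makes the powers monotone, which gives one constant for
  all \<open>j\<close>.\<close>

lemma Poincare: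
 assumes D: "chain k D" and z: "itg 0 L (D 0) = 0"
 shows "j \<le> k ==> nrm (D j) \<le> (1 + L) ^ k * nrm (D k)"
proof -
 have s: "nrm (D i) \<le> (1 + L) * nrm (D (Suc i))" if i: "i < k" for i
 proof -
  have d: "dvt (D i) (D (Suc i))" using D i by (simp add: chain_def)
  have "itg 0 L (D i) = 0"
  proof (cases i)
   case (Suc l)
   then have "dvt (D l) (D i)" using D i by (simp add: chain_def)
   then show ?thesis by (rule dvt_mean_zero)
  qed (use z in simp)
  note norm_toL2_le_sup[OF dvtD(5)[OF d] dvt_mean_zero_sup[OF d this]]
  moreover have "sqrt L * sqrt L = L" using L_pos by simp
  then have "sqrt L * nrm (D (Suc i)) * sqrt L = L * nrm (D (Suc i))" by (metis mult.assoc mult.commute)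
  ultimately have "nrm (D i) \<le> L * nrm (D (Suc i))" by simp
  then show ?thesis by (simp add: distrib_right add_increasing)
 qed
 assume jk: "j \<le> k"
 have "nrm (D j) \<le> (1 + L) ^ (k - j) * nrm (D k)"
  using jk
 proof (induction rule: inc_induct)
  case (step i)
  have "nrm (D i) \<le> (1 + L) * ((1 + L) ^ (k - Suc i) * nrm (D k))"
   using s[OF step.hyps(2)] mult_left_mono[OF step.IH, of "1 + L"] L_pos by linarith
  also have "\<dots> = (1 + L) ^ (k - i) * nrm (D k)"
   using step.hyps by (simp add: Suc_diff_Suc[symmetric])
  finally show ?case .
 qed simp
 also have "\<dots> \<le> (1 + L) ^ k * nrm (D k)" using L_pos by (intro mult_right_mono power_increasing) auto
 finally show ?thesis .
qed

text \<open>It allows the full Sobolev norm and the top-order norm on mean zero functions to be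
  treated together: convergence in \<open>N\<close> amounts to convergence of all weak derivatives
  in L^2.\<close>

definition good :: "(real => real) set => ((real => real) => real) => nat => bool" where
 "good X N k \<longleftrightarrow> X \<subseteq> sobolev L k \<and> (\<forall>f\<in>X. \<forall>g\<in>X. \<forall>a b. (\<lambda>z. a * f z + b * g z) \<in> X) \<and>
  (\<exists>C. \<forall>f\<in>X. 0 \<le> N f \<and> N f \<le> C * (\<Sum>j\<le>k. norm (wd j f)) \<and> (\<forall>j\<le>k. norm (wd j f) \<le> C * N f))"

lemma good_sobolev: "good (sobolev L k) (sobolev_norm L k) k"
 unfolding good_def
proof (intro conjI exI[of _ 1] ballI allI impI)
 fix f assume f: "f \<in> sobolev L k"
 show "0 \<le> sobolev_norm L k f" by (simp add: sobolev_norm_wd[OF f])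
 show "sobolev_norm L k f \<le> 1 * (\<Sum>j\<le>k. norm (wd j f))" using L2_set_le_sum[of "{..k}" "\<lambda>j. norm (wd j f)"] by (simp add: sobolev_norm_wd[OF f])
 show "norm (wd j f) \<le> 1 * sobolev_norm L k f" if "j \<le> k" for j
  using member_le_L2_set[of "{..k}" j "\<lambda>j. norm (wd j f)"] that by (simp add: sobolev_norm_wd[OF f])
qed (auto intro: sobolev_linear(1))

lemma mean_cong_AE: "f \<in> \<L>2 ==> g \<in> \<L>2 ==> AE x in lborel. f x = g x ==> mean L f = mean L g"
 unfolding mean_itg by (simp add: itg_cong_AE L2_measurable)

lemma good_V: "good (V_space L k) (V_norm L k) k"
 unfolding good_def
proof (intro conjI exI[of _ "(1 + L) ^ k"] ballI allI impI)
 have C: "1 \<le> (1 + L) ^ k" using L_pos by (intro one_le_power) simp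
 show "V_space L k \<subseteq> sobolev L k" by (auto simp: V_space_def)
 fix f assume fV: "f \<in> V_space L k"
 then have f: "f \<in> sobolev L k" and m: "mean L f = 0" by (auto simp: V_space_def)
 show "(\<lambda>z. a * f z + b * g z) \<in> V_space L k" if "g \<in> V_space L k" for g a b
 proof -
  have g: "g \<in> sobolev L k" and mg: "mean L g = 0" using that by (auto simp: V_space_def)
  have "itg 0 L (\<lambda>z. a * f z + b * g z) = 0"
   using m mg L_pos by (simp add: itg_add itg_cmult locint_cmult L2_locint sobolev_L2[OF f] sobolev_L2[OF g] mean_itg)
  then show ?thesis using sobolev_linear(1)[OF f g] by (simp add: V_space_def mean_itg)
 qed
 show "0 \<le> V_norm L k f" by (simp add: V_norm_wd[OF f])
 have "norm (wd k f) \<le> (\<Sum>j\<le>k. norm (wd j f))" by (rule member_le_sum) auto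
 moreover have "0 \<le> (\<Sum>j\<le>k. norm (wd j f))" by (rule sum_nonneg) simp
 ultimately show "V_norm L k f \<le> (1 + L) ^ k * (\<Sum>j\<le>k. norm (wd j f))"
  unfolding V_norm_wd[OF f] using mult_right_mono[OF C, of "\<Sum>j\<le>k. norm (wd j f)"] by linarith
 obtain D where D: "chain k D" "AE x in lborel. f x = D 0 x" by (rule sobolev_chain[OF f])
 have "D 0 \<in> \<L>2" using D(1) by (simp add: chain_def)
 from mean_cong_AE[OF sobolev_L2[OF f] this D(2)] have "itg 0 L (D 0) = 0" using m L_pos by (simp add: mean_itg)
 from Poincare[OF D(1) this] show "norm (wd j f) \<le> (1 + L) ^ k * V_norm L k f" if "j \<le> k" for j
  unfolding V_norm_wd[OF f] chain_sobolev(2)[OF D(1) sobolev_L2[OF f] D(2) that] chain_sobolev(2)[OF D(1) sobolev_L2[OF f] D(2) order_refl] using that .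
qed

lemma good_tendsto:
 assumes g: "good X N k" and F: "\<And>s. s \<in> S ==> F s \<in> X"
 shows "((\<lambda>s. N (F s)) \<longlongrightarrow> 0) (at t within S) \<longleftrightarrow> (\<forall>j\<le>k. ((\<lambda>s. wd j (F s)) \<longlongrightarrow> 0) (at t within S))"
proof -
 obtain C where C: "\<And>f. f \<in> X ==> 0 \<le> N f \<and> N f \<le> C * (\<Sum>j\<le>k. norm (wd j f)) \<and> (\<forall>j\<le>k. norm (wd j f) \<le> C * N f)"
  using g unfolding good_def by blast
 have ev: "\<forall>\<^sub>F s in at t within S. P (F s)" if "\<And>f. f \<in> X ==> P f" for P
  using that F by (simp add: eventually_at_filter)
 show ?thesis
 proof (intro iffI allI impI)
  fix j assume N: "((\<lambda>s. N (F s)) \<longlongrightarrow> 0) (at t within S)" and j: "j \<le> k"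
  have "((\<lambda>s. C * N (F s)) \<longlongrightarrow> 0) (at t within S)" using tendsto_mult_right_zero[OF N] .
  then show "((\<lambda>s. wd j (F s)) \<longlongrightarrow> 0) (at t within S)"
   by (rule Lim_null_comparison[rotated]) (rule ev, use C j in auto)
 next
  assume w: "\<forall>j\<le>k. ((\<lambda>s. wd j (F s)) \<longlongrightarrow> 0) (at t within S)"
  have "((\<lambda>s. \<Sum>j\<le>k. norm (wd j (F s))) \<longlongrightarrow> 0) (at t within S)"
   by (intro tendsto_null_sum tendsto_norm_zero) (use w in auto)
  from tendsto_mult_right_zero[OF this, of C] show "((\<lambda>s. N (F s)) \<longlongrightarrow> 0) (at t within S)"
   by (rule Lim_null_comparison[rotated]) (rule ev, use C in auto)
 qed
qed

lemma C0_path_iff: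
 assumes g: "good X N k"
 shows "C0_path X N T f \<longleftrightarrow> (\<forall>t\<in>{0..T}. f t \<in> X) \<and> (\<forall>j\<le>k. continuous_on {0..T} (\<lambda>t. wd j (f t)))"
proof (cases "\<forall>t\<in>{0..T}. f t \<in> X")
 case True
 have lin: "(\<lambda>z. f s z - f t z) \<in> X" "j \<le> k ==> wd j (\<lambda>z. f s z - f t z) = wd j (f s) - wd j (f t)" if "s \<in> {0..T}" "t \<in> {0..T}" for s t j
 proof -
  have e: "(\<lambda>z. f s z - f t z) = (\<lambda>z. 1 * f s z + (-1) * f t z)" by auto
  have X: "f s \<in> X" "f t \<in> X" using True that by auto
  then have "(\<lambda>z. 1 * f s z + (-1) * f t z) \<in> X" using g unfolding good_def by blast
  then show "(\<lambda>z. f s z - f t z) \<in> X" unfolding e .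
  show "wd j (\<lambda>z. f s z - f t z) = wd j (f s) - wd j (f t)" if "j \<le> k"
   unfolding e using sobolev_linear(2)[of "f s" k "f t" j 1 "-1"] X g that by (auto simp: good_def simp del: mult_minus1 mult_1)
 qed
 have "((\<lambda>s. N (\<lambda>z. f s z - f t z)) \<longlongrightarrow> 0) (at t within {0..T}) \<longleftrightarrow> (\<forall>j\<le>k. ((\<lambda>s. wd j (f s)) \<longlongrightarrow> wd j (f t)) (at t within {0..T}))" if t: "t \<in> {0..T}" for t
 proof -
  have "((\<lambda>s. wd j (\<lambda>z. f s z - f t z)) \<longlongrightarrow> 0) (at t within {0..T}) \<longleftrightarrow> ((\<lambda>s. wd j (f s)) \<longlongrightarrow> wd j (f t)) (at t within {0..T})" if "j \<le> k" for j
   unfolding LIM_zero_iff[symmetric, of "\<lambda>s. wd j (f s)"] by (rule tendsto_cong) (use lin(2)[OF _ t that] in \<open>simp add: eventually_at_filter\<close>)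
  then show ?thesis using good_tendsto[OF g lin(1)[OF _ t], of "{0..T}"] by auto
 qed
 then show ?thesis using True by (auto simp: C0_path_def continuous_on_def)
qed (auto simp: C0_path_def)

lemma C1_path_iff:
 assumes g: "good X N k"
 shows "C1_path X N T f f' \<longleftrightarrow> C0_path X N T f \<and> C0_path X N T f' \<and>
  (\<forall>j\<le>k. \<forall>t\<in>{0..T}. ((\<lambda>t. wd j (f t)) has_vector_derivative wd j (f' t)) (at t within {0..T}))"
proof (cases "C0_path X N T f \<and> C0_path X N T f'")
 case True
 then have X: "f t \<in> X" "f' t \<in> X" if "t \<in> {0..T}" for t using that by (auto simp: C0_path_def)
 have "((\<lambda>s. N (\<lambda>z. (f s z - f t z) / (s - t) - f' t z)) \<longlongrightarrow> 0) (at t within {0..T}) \<longleftrightarrow>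
  (\<forall>j\<le>k. ((\<lambda>t. wd j (f t)) has_vector_derivative wd j (f' t)) (at t within {0..T}))" if t: "t \<in> {0..T}" for t
 proof -
  define q where "q s = (\<lambda>z. (1 / (s - t)) * f s z + (- 1 / (s - t)) * f t z)" for s
  have e: "(\<lambda>z. (f s z - f t z) / (s - t) - f' t z) = (\<lambda>z. 1 * q s z + (-1) * f' t z)" for s
   by (auto simp: q_def diff_divide_distrib)
  have q: "q s \<in> X" if "s \<in> {0..T}" for s using g X[OF that] X[OF t] unfolding q_def good_def by blast
  then have r: "(\<lambda>z. 1 * q s z + (-1) * f' t z) \<in> X" if "s \<in> {0..T}" for s using g X[OF t] that unfolding good_def by blast
  have w: "wd j (\<lambda>z. 1 * q s z + (-1) * f' t z) = (1 / (s - t)) *\<^sub>R wd j (f s) + (- 1 / (s - t)) *\<^sub>R wd j (f t) - wd j (f' t)"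
   if "s \<in> {0..T}" "j \<le> k" for s j
  proof -
   have S: "f s \<in> sobolev L k" "f t \<in> sobolev L k" "f' t \<in> sobolev L k" "q s \<in> sobolev L k"
    using g X t that q by (auto simp: good_def)
   show ?thesis unfolding sobolev_linear(2)[OF S(4,3) that(2)] unfolding q_def sobolev_linear(2)[OF S(1,2) that(2)] by simp
  qed
  have "((\<lambda>s. wd j (\<lambda>z. 1 * q s z + (-1) * f' t z)) \<longlongrightarrow> 0) (at t within {0..T}) \<longleftrightarrow>
   ((\<lambda>t. wd j (f t)) has_vector_derivative wd j (f' t)) (at t within {0..T})" if "j \<le> k" for j
   unfolding has_vector_derivative_iff_quotient by (rule tendsto_cong) (use w[OF _ that] in \<open>simp add: eventually_at_filter\<close>)
  moreover have "((\<lambda>s. N (\<lambda>z. 1 * q s z + (-1) * f' t z)) \<longlongrightarrow> 0) (at t within {0..T}) \<longleftrightarrow>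
   (\<forall>j\<le>k. ((\<lambda>s. wd j (\<lambda>z. 1 * q s z + (-1) * f' t z)) \<longlongrightarrow> 0) (at t within {0..T}))" by (rule good_tendsto[OF g r])
  ultimately show ?thesis unfolding e by (simp del: mult_minus1 mult_1)
 qed
 then show ?thesis using True by (auto simp: C1_path_def)
qed (auto simp: C1_path_def)

lemma fam_chain:
 "fam con0 B k f ==> \<exists>D. D 0 = f \<and> (\<forall>i\<le>k. con0 B (D i)) \<and> (\<forall>i<k. \<forall>t\<in>B. dvt (D i t) (D (Suc i) t))"
proof (induction k arbitrary: f)
 case 0
 then show ?case by (intro exI[of _ "\<lambda>i. f"]) simp
next
 case (Suc k)
 obtain f' where f': "\<And>t. t \<in> B ==> dvt (f t) (f' t)" "fam con0 B k f'" by (rule famE[OF Suc.prems]) blast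
 obtain D where D: "D 0 = f'" "\<forall>i\<le>k. con0 B (D i)" "\<forall>i<k. \<forall>t\<in>B. dvt (D i t) (D (Suc i) t)" using Suc.IH[OF f'(2)] by blast
 have "con0 B f" by (rule fam_0[OF Suc.prems])
 then show ?case
  using D f'(1) by (intro exI[of _ "\<lambda>i. case i of 0 => f | Suc i => D i"]) (auto split: nat.split simp: less_Suc_eq_0_disj)
qed

lemma fam_sobolev:
 assumes f: "fam con0 {0..T} k f"
 shows "\<And>t. t \<in> {0..T} ==> f t \<in> sobolev L k" "\<And>j. j \<le> k ==> continuous_on {0..T} (\<lambda>t. wd j (f t))"
proof -
 obtain D where D: "D 0 = f" "\<forall>i\<le>k. con0 {0..T} (D i)" "\<forall>i<k. \<forall>t\<in>{0..T}. dvt (D i t) (D (Suc i) t)" using fam_chain[OF f] by blast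
 have c: "chain k (\<lambda>i. D i t)" "f t \<in> \<L>2" if "t \<in> {0..T}" for t using D that by (auto simp: chain_def con0_def)
 have e: "f t \<in> sobolev L k" "j \<le> k ==> wd j (f t) = toL2 (D j t)" if "t \<in> {0..T}" for t j
  using chain_sobolev[OF c[OF that]] D(1) by auto
 show "f t \<in> sobolev L k" if "t \<in> {0..T}" for t by (rule e[OF that])
 show "continuous_on {0..T} (\<lambda>t. wd j (f t))" if "j \<le> k" for j
  using continuous_on_eq[of "{0..T}" "\<lambda>t. toL2 (D j t)" "\<lambda>t. wd j (f t)"] D(2) that e(2) by (auto simp: con0_def)
qed

lemma fam_vector_derivative:
 assumes f: "fam con0 {0..T} k f" and g: "fam con0 {0..T} k g" and T: "0 \<le> T"
  and d: "\<And>t. t \<in> {0..T} ==> ((\<lambda>t. toL2 (f t)) has_vector_derivative toL2 (g t)) (at t within {0..T})"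
 shows "j \<le> k ==> t \<in> {0..T} ==> ((\<lambda>t. wd j (f t)) has_vector_derivative wd j (g t)) (at t within {0..T})"
proof -
 obtain D where D: "D 0 = f" "\<forall>i\<le>k. con0 {0..T} (D i)" "\<forall>i<k. \<forall>t\<in>{0..T}. dvt (D i t) (D (Suc i) t)" using fam_chain[OF f] by blast
 obtain E where E: "E 0 = g" "\<forall>i\<le>k. con0 {0..T} (E i)" "\<forall>i<k. \<forall>t\<in>{0..T}. dvt (E i t) (E (Suc i) t)" using fam_chain[OF g] by blast
 have "chain k (\<lambda>i. D i t)" "f t \<in> \<L>2" "chain k (\<lambda>i. E i t)" "g t \<in> \<L>2" if "t \<in> {0..T}" for t using D E that by (auto simp: chain_def con0_def)
 then have e: "wd j (f t) = toL2 (D j t)" "wd j (g t) = toL2 (E j t)" if "t \<in> {0..T}" "j \<le> k" for t j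
  using chain_sobolev(2)[of k "\<lambda>i. D i t" "f t" j] chain_sobolev(2)[of k "\<lambda>i. E i t" "g t" j] D(1) E(1) that by auto
 assume j: "j \<le> k" and t: "t \<in> {0..T}"
 have "((\<lambda>t. toL2 (D j t)) has_vector_derivative toL2 (E j t)) (at t within {0..T})"
  using j t
 proof (induction j arbitrary: t)
  case 0
  then show ?case using d D(1) E(1) by simp
 next
  case (Suc j)
  show ?case
   by (rule vector_derivative_dvt[of T "D j" "D (Suc j)" "E j" "E (Suc j)"]) (use D E T Suc in \<open>auto simp: con0_def\<close>)
 qed
 then show ?thesis unfolding e(2)[OF t j] by (rule has_vector_derivative_transform[OF t e(1)[OF _ j], rotated])
qed

end

section \<open>Uniqueness\<close>

lemma norm_squared_has_derivative:
 fixes x :: "real => 'a::real_inner"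
 assumes "(x has_vector_derivative d) (at t within S)"
 shows "((\<lambda>t. (norm (x t))\<^sup>2) has_real_derivative 2 * inner (x t) d) (at t within S)"
proof -
 have x: "(x has_derivative (\<lambda>h. h *\<^sub>R d)) (at t within S)" using assms by (simp add: has_vector_derivative_def)
 have "((\<lambda>t. inner (x t) (x t)) has_derivative (\<lambda>h. inner (x t) (h *\<^sub>R d) + inner (h *\<^sub>R d) (x t))) (at t within S)"
  by (rule has_derivative_inner[OF x x])
 moreover have "(\<lambda>h. inner (x t) (h *\<^sub>R d) + inner (h *\<^sub>R d) (x t)) = times (2 * inner (x t) d)"
  by (auto simp: inner_commute)
 ultimately show ?thesis by (simp add: has_field_derivative_def power2_norm_eq_inner)
qed

text \<open>\<open>E t * exp (- (M * t))\<close> starts at 0 and does not increase. The one-sided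
  derivatives at the end points do no harm, since monotonicity uses the derivative in the interior
  and continuity at the ends.\<close>

lemma Gronwall_zero:
 assumes T: "0 \<le> T" and d: "\<And>t. t \<in> {0..T} ==> (E has_real_derivative E' t) (at t within {0..T})"
  and le: "\<And>t. t \<in> {0..T} ==> E' t \<le> M * E t" and E0: "E 0 = 0" and pos: "\<And>t. 0 \<le> E t" and t: "t \<in> {0..T}"
 shows "E t = (0::real)"
proof -
 define F where "F t = E t * exp (- (M * t))" for t
 have F: "(F has_real_derivative (E' s - M * E s) * exp (- (M * s))) (at s within {0..T})" if "s \<in> {0..T}" for s
  unfolding F_def[abs_def] by (auto intro!: derivative_eq_intros d that simp: algebra_simps)
 have "F t \<le> F 0"
 proof (cases "t = 0")
  case False
  show ?thesis
  proof (rule DERIV_nonpos_imp_decreasing_open[of 0 t F])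
   show "0 \<le> t" using t by simp
   show "continuous_on {0..t} F"
    by (rule continuous_on_subset[OF DERIV_continuous_on[OF F]]) (use t in auto)
   fix s assume s: "0 < s" "s < t"
   then have "(F has_real_derivative (E' s - M * E s) * exp (- (M * s))) (at s)"
    using F[of s] t by (simp add: at_within_Icc_at)
   moreover have "(E' s - M * E s) * exp (- (M * s)) \<le> 0" using le[of s] s t by (intro mult_nonpos_nonneg) auto
   ultimately show "\<exists>y. (F has_real_derivative y) (at s) \<and> y \<le> 0" by blast
  qed
 qed simp
 then have "E t * exp (- (M * t)) \<le> 0" using E0 by (simp add: F_def)
 then have "E t \<le> 0" by (simp add: mult_le_0_iff)
 then show ?thesis using pos[of t] by simp
qed

context circle
begin

text \<open>By parts, the integral equals minus one half of the integral of \<open>v'\<close> times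
  the square of \<open>f\<close>: the derivative of \<open>f\<close> disappears. The factor one half
  is given away.\<close>

lemma transport_energy:
 assumes f: "dvt f f'" and v: "dvt v v'" and K: "\<And>x. \<bar>v' x\<bar> \<le> K" and K0: "0 \<le> K"
 shows "\<bar>itg 0 L (\<lambda>x. f x * (v x * f' x))\<bar> \<le> K * (nrm f)\<^sup>2"
proof -
 note vf = dvt_mult[OF v f]
 note fL = dvtD(5)[OF f]
 note vm = L2_measurable[OF dvtD(2)[OF v]] L2_periodic[OF dvtD(2)[OF v]]
 have v'f: "(\<lambda>x. v' x * f x) \<in> \<L>2" by (rule L2_bounded_mult[OF vm K fL])
 have vf': "(\<lambda>x. v x * f' x) \<in> \<L>2" by (rule L2_cont_mult[OF dvtD(4,1)[OF v] dvtD(2)[OF f]])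
 have "(\<lambda>x. f' x * (v x * f x)) = (\<lambda>x. f x * (v x * f' x))" by auto
 moreover have "itg 0 L (\<lambda>x. f x * (v' x * f x + v x * f' x)) = itg 0 L (\<lambda>x. f x * (v' x * f x)) + itg 0 L (\<lambda>x. f x * (v x * f' x))"
  unfolding distrib_left by (rule itg_add[OF L2_mult_locint[OF fL v'f] L2_mult_locint[OF fL vf']])
 ultimately have "itg 0 L (\<lambda>x. f x * (v x * f' x)) = - (itg 0 L (\<lambda>x. f x * (v' x * f x)) + itg 0 L (\<lambda>x. f x * (v x * f' x)))"
  using itg_parts[OF f vf] by simp
 then have "2 * itg 0 L (\<lambda>x. f x * (v x * f' x)) = - itg 0 L (\<lambda>x. f x * (v' x * f x))" by simp
 moreover have "\<bar>itg 0 L (\<lambda>x. f x * (v' x * f x))\<bar> \<le> nrm f * (K * nrm f)"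
  using itg_toL2_bound[OF fL v'f] mult_left_mono[OF norm_toL2_mult_le[OF vm K fL] norm_ge_zero[of "toL2 f"]] by linarith
 ultimately have "2 * \<bar>itg 0 L (\<lambda>x. f x * (v x * f' x))\<bar> \<le> K * (nrm f)\<^sup>2" by (simp add: power2_eq_square mult_ac)
 then show ?thesis by linarith
qed

lemma wd_cong_AE:
 assumes f: "f \<in> sobolev L k" and g: "g \<in> sobolev L k" and e: "AE x in lborel. f x = g x" and j: "j \<le> k"
 shows "wd j f = wd j g"
proof -
 obtain D where D: "chain k D" "AE x in lborel. f x = D 0 x" by (rule sobolev_chain[OF f])
 have "AE x in lborel. g x = D 0 x" using D(2) e by eventually_elim simp
 then show ?thesis using chain_sobolev(2)[OF D(1) sobolev_L2[OF f] D(2) j] chain_sobolev(2)[OF D(1) sobolev_L2[OF g] _ j] by simp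
qed

text \<open>A solution consists of classes modulo null sets. At the given time, continuous
  representatives are fixed, the velocity is identified as \<open>Lam1 B0\<close>, and the equations
  become formulas for the time derivatives of the quantities in the energy. The formula for the
  first derivative of \<open>u\<close> comes from differentiating the first equation, possible as
  \<open>ut t\<close> lies in H^1.\<close>

lemma solution_at:
 assumes s: "is_solution L (Suc n) T u0 w0 u w" and t: "t \<in> {0..T}"
 obtains A0 A1 A2 B0 B1 where "dvt A0 A1" "dvt A1 A2" "dvt B0 B1"
  "wd 0 (u t) = toL2 A0" "wd 1 (u t) = toL2 A1" "wd 2 (u t) = toL2 A2" "wd 0 (w t) = toL2 B0" "wd 1 (w t) = toL2 B1"
  "AE x in lborel. u t x = A0 x" "AE x in lborel. w t x = B0 x"
  "((\<lambda>t. wd 0 (u t)) has_vector_derivative toL2 (\<lambda>x. - (Lam1 B0 x * A1 x))) (at t within {0..T})"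
  "((\<lambda>t. wd 1 (u t)) has_vector_derivative toL2 (\<lambda>x. - (Lam1 B1 x * A1 x + Lam1 B0 x * A2 x))) (at t within {0..T})"
  "((\<lambda>t. wd 0 (w t)) has_vector_derivative toL2 (\<lambda>x. A1 x - Lam1 B0 x * B1 x)) (at t within {0..T})"
proof -
 obtain ut wt v where C1: "C1_path (sobolev L (Suc n)) (sobolev_norm L (Suc n)) T u ut" "C1_path (V_space L n) (V_norm L n) T w wt"
  and v: "is_velocity L (w t) (v t)"
  and eq: "AE z in lborel. ut t z + v t z * weak_deriv L 1 (u t) z = 0"
   "AE z in lborel. wt t z + v t z * weak_deriv L 1 (w t) z = weak_deriv L 1 (u t) z"
  using s[unfolded is_solution_def Suc_eq_plus1[symmetric] diff_Suc_1] t by blast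
 have u: "u t \<in> sobolev L (Suc (Suc n))" and w: "w t \<in> sobolev L (Suc n)" "mean L (w t) = 0"
  using s t unfolding is_solution_def by (auto simp: C0_path_def V_space_def)
 have ut: "ut t \<in> sobolev L (Suc n)" and wt: "wt t \<in> sobolev L n" using C1 t by (auto simp: C1_path_def C0_path_def V_space_def)
 obtain D where D: "chain (Suc (Suc n)) D" "AE x in lborel. u t x = D 0 x" by (rule sobolev_chain[OF u])
 obtain E where E: "chain (Suc n) E" "AE x in lborel. w t x = E 0 x" by (rule sobolev_chain[OF w(1)])
 have d: "dvt (D 0) (D 1)" "dvt (D 1) (D 2)" "dvt (E 0) (E 1)"
  using D(1) E(1) by (auto simp: chain_def eval_nat_numeral)
 note uL = sobolev_L2[OF u] and wL = sobolev_L2[OF w(1)]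
 have "itg 0 L (E 0) = 0" using mean_cong_AE[OF wL dvtD(5)[OF d(3)] E(2)] w(2) L_pos by (simp add: mean_itg)
 then have vE: "v t = Lam1 (E 0)" using is_velocity_iff[OF d(3) _ wL E(2)] v by blast
 have "AE x in lborel. ut t x = - (Lam1 (E 0) x * D 1 x)" using eq(1) weak_deriv_1[OF d(1) uL D(2)]
  by eventually_elim (simp add: vE)
 moreover have "dvt (\<lambda>x. - (Lam1 (E 0) x * D 1 x)) (\<lambda>x. - (Lam1 (E 1) x * D 1 x + Lam1 (E 0) x * D 2 x))"
  using dvt_cmult[OF dvt_mult[OF Lam1_H1[OF d(3)] d(2)], of "-1"] by simp
 then have "chain 1 (\<lambda>i. if i = 0 then \<lambda>x. - (Lam1 (E 0) x * D 1 x) else (\<lambda>x. - (Lam1 (E 1) x * D 1 x + Lam1 (E 0) x * D 2 x)))"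
  (is "chain 1 ?F")
  by (auto simp: chain_def le_Suc_eq dvtD(2,5))
 ultimately have ud: "wd 0 (ut t) = toL2 (\<lambda>x. - (Lam1 (E 0) x * D 1 x))" "wd 1 (ut t) = toL2 (\<lambda>x. - (Lam1 (E 1) x * D 1 x + Lam1 (E 0) x * D 2 x))"
  using chain_sobolev(2)[of 1 ?F "ut t" 0] chain_sobolev(2)[of 1 ?F "ut t" 1] sobolev_L2[OF ut] by auto
 have "AE x in lborel. wt t x = D 1 x - Lam1 (E 0) x * E 1 x"
  using eq(2) weak_deriv_1[OF d(1) uL D(2)] weak_deriv_1[OF d(3) wL E(2)] by eventually_elim (simp add: vE)
 moreover have "chain 0 (\<lambda>i x. D 1 x - Lam1 (E 0) x * E 1 x)"
  using L2_diff[OF dvtD(2)[OF d(1)] L2_cont_mult[OF dvtD(4,1)[OF Lam1_H1[OF d(3)]] dvtD(2)[OF d(3)]]] by (simp add: chain_def)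
 ultimately have wdd: "wd 0 (wt t) = toL2 (\<lambda>x. D 1 x - Lam1 (E 0) x * E 1 x)"
  using chain_sobolev(2)[of 0 "\<lambda>i x. D 1 x - Lam1 (E 0) x * E 1 x" "wt t" 0] sobolev_L2[OF wt] by simp
 have du: "((\<lambda>t. wd j (u t)) has_vector_derivative wd j (ut t)) (at t within {0..T})" if "j \<le> Suc n" for j
  using C1(1) t that by (auto simp: C1_path_iff[OF good_sobolev])
 have dw: "((\<lambda>t. wd 0 (w t)) has_vector_derivative wd 0 (wt t)) (at t within {0..T})"
  using C1(2) t by (auto simp: C1_path_iff[OF good_V])
 note cu = chain_sobolev(2)[OF D(1) uL D(2)] and cw = chain_sobolev(2)[OF E(1) wL E(2)]
 show ?thesis
  by (rule that[OF d cu cu cu cw cw D(2) E(2) du[of 0, unfolded ud(1)] du[of 1, unfolded ud(2)] dw[unfolded wdd]]) simp_all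
qed

lemma solution_bound:
 assumes s: "is_solution L (Suc n) T u0 w0 u w"
 obtains K where "0 \<le> K" "\<And>t j. t \<in> {0..T} ==> j \<le> 2 ==> norm (wd j (u t)) \<le> K" "\<And>t j. t \<in> {0..T} ==> j \<le> 1 ==> norm (wd j (w t)) \<le> K"
proof -
 have c: "continuous_on {0..T} (\<lambda>t. wd j (u t))" if "j \<le> 2" for j
  using s that unfolding is_solution_def by (auto simp: C0_path_iff[OF good_sobolev])
 have c': "continuous_on {0..T} (\<lambda>t. wd j (w t))" if "j \<le> 1" for j
  using s that unfolding is_solution_def by (auto simp: C0_path_iff[OF good_V])
 let ?f = "\<lambda>t. (\<Sum>j\<le>2. norm (wd j (u t))) + (\<Sum>j\<le>1. norm (wd j (w t)))"
 have "continuous_on {0..T} ?f" by (intro continuous_intros c c') auto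
 then have "bounded (?f ` {0..T})" by (intro compact_imp_bounded compact_continuous_image) auto
 then obtain K where K: "0 < K" "\<And>t. t \<in> {0..T} ==> \<bar>?f t\<bar> \<le> K" unfolding bounded_pos by auto
 have n: "0 \<le> (\<Sum>j\<le>2. norm (wd j (u t)))" "0 \<le> (\<Sum>j\<le>1. norm (wd j (w t)))" for t by (auto intro: sum_nonneg)
 show ?thesis
 proof (rule that[of K])
  show "norm (wd j (u t)) \<le> K" if "t \<in> {0..T}" "j \<le> 2" for t j
  proof -
   have "norm (wd j (u t)) \<le> (\<Sum>j\<le>2. norm (wd j (u t)))" by (rule member_le_sum) (use that in auto)
   then show ?thesis using K(2)[OF that(1)] n(2)[of t] by linarith
  qed
  show "norm (wd j (w t)) \<le> K" if "t \<in> {0..T}" "j \<le> 1" for t j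
  proof -
   have "norm (wd j (w t)) \<le> (\<Sum>j\<le>1. norm (wd j (w t)))" by (rule member_le_sum) (use that in auto)
   then show ?thesis using K(2)[OF that(1)] n(1)[of t] by linarith
  qed
 qed (use K in simp)
qed

text \<open>The vorticity equation contains the derivative of \<open>u\<close>, so that derivative
  joins the energy; its own equation contains the derivative of the velocity difference, which the
  Hilbert transform bounds by \<gamma>. Thus the system closes. The excess derivatives
  \<open>a2\<close> and \<open>b1\<close> occur only multiplied by \<open>Lam1 B0\<close> and paired
  with \<open>a1\<close> and \<open>b0\<close>, where \<open>transport_energy\<close> removes
  them.\<close>

lemma energy_estimate:
 assumes A: "dvt A0 A1" "dvt A1 A2" "dvt B0 B1" and P: "dvt P0 P1" "dvt P1 P2" "dvt Q0 Q1"
  and K: "0 \<le> K" "nrm B0 \<le> K" "nrm B1 \<le> K" "nrm P1 \<le> K" "nrm P2 \<le> K" "nrm Q1 \<le> K"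
 defines "c \<equiv> nrm lam" and "\<alpha> \<equiv> norm (toL2 A0 - toL2 P0)" and "\<beta> \<equiv> norm (toL2 A1 - toL2 P1)" and "\<gamma> \<equiv> norm (toL2 B0 - toL2 Q0)"
 shows "inner (toL2 A0 - toL2 P0) (toL2 (\<lambda>x. - (Lam1 B0 x * A1 x)) - toL2 (\<lambda>x. - (Lam1 Q0 x * P1 x))) \<le> c * K * (\<alpha> * \<beta>) + c * K * (\<alpha> * \<gamma>)"
  "inner (toL2 A1 - toL2 P1) (toL2 (\<lambda>x. - (Lam1 B1 x * A1 x + Lam1 B0 x * A2 x)) - toL2 (\<lambda>x. - (Lam1 Q1 x * P1 x + Lam1 Q0 x * P2 x)))
   \<le> 2 * (c * K) * \<beta>\<^sup>2 + ((sqrt L + 1 / sqrt L) * (2 * K) + c * K) * (\<beta> * \<gamma>)"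
  "inner (toL2 B0 - toL2 Q0) (toL2 (\<lambda>x. A1 x - Lam1 B0 x * B1 x) - toL2 (\<lambda>x. P1 x - Lam1 Q0 x * Q1 x))
   \<le> \<beta> * \<gamma> + 2 * (c * K) * \<gamma>\<^sup>2"
proof -
 define a0 a1 a2 b0 b1 where "a0 x = A0 x - P0 x" and "a1 x = A1 x - P1 x" and "a2 x = A2 x - P2 x" and "b0 x = B0 x - Q0 x" and "b1 x = B1 x - Q1 x" for x
 have a: "dvt a0 a1" "dvt a1 a2" "dvt b0 b1"
  unfolding a0_def[abs_def] a1_def[abs_def] a2_def[abs_def] b0_def[abs_def] b1_def[abs_def] by (intro dvt_diff A P)+
 note L = dvtD(5)[OF A(1)] dvtD(5)[OF A(2)] dvtD(2)[OF A(2)] dvtD(5)[OF A(3)] dvtD(2)[OF A(3)]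
  dvtD(5)[OF P(1)] dvtD(5)[OF P(2)] dvtD(2)[OF P(2)] dvtD(5)[OF P(3)] dvtD(2)[OF P(3)]
 note l = dvtD(5)[OF a(1)] dvtD(5)[OF a(2)] dvtD(2)[OF a(2)] dvtD(5)[OF a(3)] dvtD(2)[OF a(3)]
 have t: "toL2 A0 - toL2 P0 = toL2 a0" "toL2 A1 - toL2 P1 = toL2 a1" "toL2 B0 - toL2 Q0 = toL2 b0"
  unfolding a0_def[abs_def] a1_def[abs_def] b0_def[abs_def] by (simp_all add: toL2_diff L)
 have n: "\<alpha> = nrm a0" "\<beta> = nrm a1" "\<gamma> = nrm b0" by (simp_all add: \<alpha>_def \<beta>_def \<gamma>_def t)
 define V where "V = Lam1 b0"
 define V' where "V' = Lam1 b1"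
 have c0: "0 \<le> c" by (simp add: c_def)
 have Ve: "Lam1 B0 x - Lam1 Q0 x = V x" "Lam1 B1 x - Lam1 Q1 x = V' x" for x
  unfolding V_def V'_def b0_def[abs_def] b1_def[abs_def] by (simp_all add: Lam1_diff L)
 have sup: "\<bar>Lam1 B0 x\<bar> \<le> c * K" "\<bar>Lam1 B1 x\<bar> \<le> c * K" "\<bar>V x\<bar> \<le> c * \<gamma>" for x
  unfolding V_def c_def n using order_trans[OF Lam1_sup mult_left_mono[OF K(2)]] order_trans[OF Lam1_sup mult_left_mono[OF K(3)]] Lam1_sup L l by auto
 have dV: "dvt (Lam1 B0) (Lam1 B1)" "dvt V V'" unfolding V_def V'_def by (rule Lam1_H1[OF A(3)] Lam1_H1[OF a(3)])+
 note cB0 = L2_measurable[OF dvtD(5)[OF dV(1)]] dvtD(1)[OF dV(1)]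
 note cB1 = L2_measurable[OF dvtD(2)[OF dV(1)]] L2_periodic[OF dvtD(2)[OF dV(1)]]
 note cV = L2_measurable[OF dvtD(5)[OF dV(2)]] dvtD(1)[OF dV(2)]
 have V'n: "nrm V' \<le> \<gamma>"
 proof -
  have "AE x in lborel. V' x = Hil b0 x" by (rule dvt_unique[OF dV(2)]) (simp add: V_def Lam1_dvt l)
  then have "toL2 V' = toL2 (Hil b0)" by (intro toL2_cong_AE dvtD(2)[OF dV(2)] dvtD(2)[OF Lam1_dvt(1)[OF l(4)]])
  then show ?thesis using Lam1_dvt(2)[OF l(4)] by (simp add: n)
 qed
 have P1s: "\<bar>P1 x\<bar> \<le> (sqrt L + 1 / sqrt L) * (2 * K)" for x
 proof -
  have "nrm P1 + nrm P2 \<le> 2 * K" using K by simp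
  then show ?thesis using order_trans[OF dvt_sup[OF P(2)] mult_left_mono] L_pos by simp
 qed
 have cVL: "(\<lambda>x. V x * g x) \<in> \<L>2" "nrm (\<lambda>x. V x * g x) \<le> c * \<gamma> * K" if "g \<in> \<L>2" "nrm g \<le> K" for g
  using L2_bounded_mult[OF cV sup(3) that(1)] order_trans[OF norm_toL2_mult_le[OF cV sup(3) that(1)] mult_left_mono[OF that(2), of "c * \<gamma>"]] c0 by (auto simp: n)
 have B0L: "(\<lambda>x. Lam1 B0 x * g x) \<in> \<L>2" "nrm (\<lambda>x. Lam1 B0 x * g x) \<le> c * K * nrm g" if "g \<in> \<L>2" for g
  using L2_bounded_mult[OF cB0 sup(1) that] norm_toL2_mult_le[OF cB0 sup(1) that] by auto
 have B1L: "(\<lambda>x. Lam1 B1 x * g x) \<in> \<L>2" "nrm (\<lambda>x. Lam1 B1 x * g x) \<le> c * K * nrm g" if "g \<in> \<L>2" for g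
  using L2_bounded_mult[OF cB1 sup(2) that] norm_toL2_mult_le[OF cB1 sup(2) that] by auto
 have PV: "(\<lambda>x. P1 x * V' x) \<in> \<L>2" "nrm (\<lambda>x. P1 x * V' x) \<le> (sqrt L + 1 / sqrt L) * (2 * K) * \<gamma>"
  using L2_bounded_mult[OF L2_measurable[OF L(7)] L2_periodic[OF L(7)] P1s dvtD(2)[OF dV(2)]]
   order_trans[OF norm_toL2_mult_le[OF L2_measurable[OF L(7)] L2_periodic[OF L(7)] P1s dvtD(2)[OF dV(2)]] mult_left_mono[OF V'n]] L_pos K(1) by auto
 have Q: "(\<lambda>x. Lam1 Q0 x * g x) \<in> \<L>2" "(\<lambda>x. Lam1 Q1 x * g x) \<in> \<L>2" if "g \<in> \<L>2" for g
  using L2_bounded_mult[OF _ _ Lam1_sup[OF L(9)] that] L2_bounded_mult[OF _ _ Lam1_sup[OF L(10)] that]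
   L2_measurable[OF dvtD(5)[OF Lam1_dvt(1)[OF L(9)]]] L2_measurable[OF dvtD(5)[OF Lam1_dvt(1)[OF L(10)]]] Lam1_periodic by auto
 have ii: "inner (toL2 f) (toL2 g) = itg 0 L (\<lambda>x. f x * g x)" if "f \<in> \<L>2" "g \<in> \<L>2" for f g by (rule inner_toL2[OF that])
 have te: "\<bar>inner (toL2 f) (toL2 (\<lambda>x. Lam1 B0 x * f' x))\<bar> \<le> c * K * (nrm f)\<^sup>2" if "dvt f f'" for f f'
  unfolding ii[OF dvtD(5)[OF that] B0L(1)[OF dvtD(2)[OF that]]] by (rule transport_energy[OF that dV(1) sup(2)]) (use c0 K in simp)
 have cs: "\<bar>inner x y\<bar> \<le> norm x * C" if "norm y \<le> C" for x y :: l2 and C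
  using Cauchy_Schwarz_ineq2[of x y] mult_left_mono[OF that norm_ge_zero[of x]] by linarith
 have "toL2 (\<lambda>x. - (Lam1 B0 x * A1 x)) - toL2 (\<lambda>x. - (Lam1 Q0 x * P1 x)) = toL2 (\<lambda>x. - (Lam1 B0 x * A1 x) - - (Lam1 Q0 x * P1 x))"
  by (rule toL2_diff[symmetric]) (intro L2_minus B0L Q L)+
 also have "(\<lambda>x. - (Lam1 B0 x * A1 x) - - (Lam1 Q0 x * P1 x)) = (\<lambda>x. - (Lam1 B0 x * a1 x + V x * P1 x))"
  by (auto simp: a1_def Ve[symmetric] algebra_simps)
 also have "toL2 \<dots> = - (toL2 (\<lambda>x. Lam1 B0 x * a1 x) + toL2 (\<lambda>x. V x * P1 x))"
  by (simp only: toL2_minus toL2_add L2_add B0L cVL l L K)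
 finally have eq1: "toL2 (\<lambda>x. - (Lam1 B0 x * A1 x)) - toL2 (\<lambda>x. - (Lam1 Q0 x * P1 x)) = - (toL2 (\<lambda>x. Lam1 B0 x * a1 x) + toL2 (\<lambda>x. V x * P1 x))" .
 show "inner (toL2 A0 - toL2 P0) (toL2 (\<lambda>x. - (Lam1 B0 x * A1 x)) - toL2 (\<lambda>x. - (Lam1 Q0 x * P1 x))) \<le> c * K * (\<alpha> * \<beta>) + c * K * (\<alpha> * \<gamma>)"
  using cs[OF B0L(2)[OF l(2)], of "toL2 a0"] cs[OF cVL(2)[OF L(7) K(4)], of "toL2 a0"]
  unfolding t eq1 inner_minus_right inner_diff_right inner_add_right n by (simp add: mult_ac abs_le_iff)
 have "toL2 (\<lambda>x. - (Lam1 B1 x * A1 x + Lam1 B0 x * A2 x)) - toL2 (\<lambda>x. - (Lam1 Q1 x * P1 x + Lam1 Q0 x * P2 x))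
  = toL2 (\<lambda>x. - (Lam1 B1 x * A1 x + Lam1 B0 x * A2 x) - - (Lam1 Q1 x * P1 x + Lam1 Q0 x * P2 x))"
  by (rule toL2_diff[symmetric]) (intro L2_minus L2_add B0L B1L Q L)+
 also have "(\<lambda>x. - (Lam1 B1 x * A1 x + Lam1 B0 x * A2 x) - - (Lam1 Q1 x * P1 x + Lam1 Q0 x * P2 x))
  = (\<lambda>x. - ((Lam1 B1 x * a1 x + P1 x * V' x) + (Lam1 B0 x * a2 x + V x * P2 x)))"
  by (auto simp: a1_def a2_def Ve[symmetric] algebra_simps)
 also have "toL2 \<dots> = - ((toL2 (\<lambda>x. Lam1 B1 x * a1 x) + toL2 (\<lambda>x. P1 x * V' x)) + (toL2 (\<lambda>x. Lam1 B0 x * a2 x) + toL2 (\<lambda>x. V x * P2 x)))"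
  by (simp only: toL2_minus toL2_add L2_add B0L B1L PV cVL l L K)
 finally have eq2: "toL2 (\<lambda>x. - (Lam1 B1 x * A1 x + Lam1 B0 x * A2 x)) - toL2 (\<lambda>x. - (Lam1 Q1 x * P1 x + Lam1 Q0 x * P2 x)) = - ((toL2 (\<lambda>x. Lam1 B1 x * a1 x) + toL2 (\<lambda>x. P1 x * V' x)) + (toL2 (\<lambda>x. Lam1 B0 x * a2 x) + toL2 (\<lambda>x. V x * P2 x)))" .
 show "inner (toL2 A1 - toL2 P1) (toL2 (\<lambda>x. - (Lam1 B1 x * A1 x + Lam1 B0 x * A2 x)) - toL2 (\<lambda>x. - (Lam1 Q1 x * P1 x + Lam1 Q0 x * P2 x)))
   \<le> 2 * (c * K) * \<beta>\<^sup>2 + ((sqrt L + 1 / sqrt L) * (2 * K) + c * K) * (\<beta> * \<gamma>)"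
  using cs[OF B1L(2)[OF l(2)], of "toL2 a1"] cs[OF PV(2), of "toL2 a1"] te[OF a(2)] cs[OF cVL(2)[OF L(8) K(5)], of "toL2 a1"]
  unfolding t eq2 inner_minus_right inner_diff_right inner_add_right n by (simp add: abs_le_iff power2_eq_square algebra_simps)
 have "toL2 (\<lambda>x. A1 x - Lam1 B0 x * B1 x) - toL2 (\<lambda>x. P1 x - Lam1 Q0 x * Q1 x) = toL2 (\<lambda>x. (A1 x - Lam1 B0 x * B1 x) - (P1 x - Lam1 Q0 x * Q1 x))"
  by (rule toL2_diff[symmetric]) (intro L2_diff B0L Q L)+
 also have "(\<lambda>x. (A1 x - Lam1 B0 x * B1 x) - (P1 x - Lam1 Q0 x * Q1 x)) = (\<lambda>x. a1 x - (Lam1 B0 x * b1 x + V x * Q1 x))"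
  by (auto simp: a1_def b1_def Ve[symmetric] algebra_simps)
 also have "toL2 \<dots> = toL2 a1 - (toL2 (\<lambda>x. Lam1 B0 x * b1 x) + toL2 (\<lambda>x. V x * Q1 x))"
  by (simp only: toL2_diff toL2_add L2_add B0L cVL l L K)
 finally have eq3: "toL2 (\<lambda>x. A1 x - Lam1 B0 x * B1 x) - toL2 (\<lambda>x. P1 x - Lam1 Q0 x * Q1 x) = toL2 a1 - (toL2 (\<lambda>x. Lam1 B0 x * b1 x) + toL2 (\<lambda>x. V x * Q1 x))" .
 show "inner (toL2 B0 - toL2 Q0) (toL2 (\<lambda>x. A1 x - Lam1 B0 x * B1 x) - toL2 (\<lambda>x. P1 x - Lam1 Q0 x * Q1 x)) \<le> \<beta> * \<gamma> + 2 * (c * K) * \<gamma>\<^sup>2"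
  using cs[OF order_refl, of "toL2 b0" "toL2 a1"] te[OF a(3)] cs[OF cVL(2)[OF L(10) K(6)], of "toL2 b0"]
  unfolding t eq3 inner_minus_right inner_diff_right inner_add_right n by (simp add: inner_add_right inner_diff_right abs_le_iff power2_eq_square algebra_simps)
qed

theorem solution_unique:
 assumes s: "is_solution L (Suc n) T u0 w0 u w" and s': "is_solution L (Suc n) T u0 w0 p r" and T: "0 \<le> T" and t: "t \<in> {0..T}"
 shows "(AE x in lborel. p t x = u t x) \<and> (AE x in lborel. r t x = w t x)"
proof -
 obtain K1 where K1: "0 \<le> K1" "\<And>t j. t \<in> {0..T} ==> j \<le> 2 ==> norm (wd j (u t)) \<le> K1" "\<And>t j. t \<in> {0..T} ==> j \<le> 1 ==> norm (wd j (w t)) \<le> K1"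
  by (rule solution_bound[OF s]) blast
 obtain K2 where K2: "0 \<le> K2" "\<And>t j. t \<in> {0..T} ==> j \<le> 2 ==> norm (wd j (p t)) \<le> K2" "\<And>t j. t \<in> {0..T} ==> j \<le> 1 ==> norm (wd j (r t)) \<le> K2"
  by (rule solution_bound[OF s']) blast
 define K where "K = K1 + K2"
 define c where "c = nrm lam"
 define x y z where "x t = wd 0 (u t) - wd 0 (p t)" and "y t = wd 1 (u t) - wd 1 (p t)" and "z t = wd 0 (w t) - wd 0 (r t)" for t
 define E where "E t = (norm (x t))\<^sup>2 + (norm (y t))\<^sup>2 + (norm (z t))\<^sup>2" for t
 define k s0 where "k = c * K" and "s0 = (sqrt L + 1 / sqrt L) * (2 * K) + k"
 \<comment> \<open>Twice the sum of the constants in the three estimates; each product or square of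
   norms occurring there is at most \<open>E t\<close>.\<close>
 define M where "M = 2 * (k + k + 2 * k + s0 + 1 + 2 * k)"
 have "\<exists>e. (E has_real_derivative e) (at t within {0..T}) \<and> e \<le> M * E t" if t: "t \<in> {0..T}" for t
 proof -
  obtain A0 A1 A2 B0 B1 where A: "dvt A0 A1" "dvt A1 A2" "dvt B0 B1"
   "wd 0 (u t) = toL2 A0" "wd 1 (u t) = toL2 A1" "wd 2 (u t) = toL2 A2" "wd 0 (w t) = toL2 B0" "wd 1 (w t) = toL2 B1"
   and Ad: "((\<lambda>t. wd 0 (u t)) has_vector_derivative toL2 (\<lambda>x. - (Lam1 B0 x * A1 x))) (at t within {0..T})"
   "((\<lambda>t. wd 1 (u t)) has_vector_derivative toL2 (\<lambda>x. - (Lam1 B1 x * A1 x + Lam1 B0 x * A2 x))) (at t within {0..T})"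
   "((\<lambda>t. wd 0 (w t)) has_vector_derivative toL2 (\<lambda>x. A1 x - Lam1 B0 x * B1 x)) (at t within {0..T})"
   by (rule solution_at[OF s t]) blast
  obtain P0 P1 P2 Q0 Q1 where P: "dvt P0 P1" "dvt P1 P2" "dvt Q0 Q1"
   "wd 0 (p t) = toL2 P0" "wd 1 (p t) = toL2 P1" "wd 2 (p t) = toL2 P2" "wd 0 (r t) = toL2 Q0" "wd 1 (r t) = toL2 Q1"
   and Pd: "((\<lambda>t. wd 0 (p t)) has_vector_derivative toL2 (\<lambda>x. - (Lam1 Q0 x * P1 x))) (at t within {0..T})"
   "((\<lambda>t. wd 1 (p t)) has_vector_derivative toL2 (\<lambda>x. - (Lam1 Q1 x * P1 x + Lam1 Q0 x * P2 x))) (at t within {0..T})"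
   "((\<lambda>t. wd 0 (r t)) has_vector_derivative toL2 (\<lambda>x. P1 x - Lam1 Q0 x * Q1 x)) (at t within {0..T})"
   by (rule solution_at[OF s' t]) blast
  have Kb: "0 \<le> K" "nrm B0 \<le> K" "nrm B1 \<le> K" "nrm P1 \<le> K" "nrm P2 \<le> K" "nrm Q1 \<le> K"
   using K1(1) K2(1) K1(3)[OF t, of 0] K1(3)[OF t, of 1] K2(2)[OF t, of 1] K2(2)[OF t, of 2] K2(3)[OF t, of 1]
   unfolding A(4-8) P(4-8) K_def by simp_all
  note est = energy_estimate[OF A(1-3) P(1-3) Kb, folded c_def A(4-8) P(4-8), folded x_def y_def z_def k_def, folded s0_def]
  define e where "e = 2 * inner (x t) (toL2 (\<lambda>x. - (Lam1 B0 x * A1 x)) - toL2 (\<lambda>x. - (Lam1 Q0 x * P1 x)))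
   + 2 * inner (y t) (toL2 (\<lambda>x. - (Lam1 B1 x * A1 x + Lam1 B0 x * A2 x)) - toL2 (\<lambda>x. - (Lam1 Q1 x * P1 x + Lam1 Q0 x * P2 x)))
   + 2 * inner (z t) (toL2 (\<lambda>x. A1 x - Lam1 B0 x * B1 x) - toL2 (\<lambda>x. P1 x - Lam1 Q0 x * Q1 x))"
  have "(E has_real_derivative e) (at t within {0..T})"
   unfolding E_def[abs_def] e_def
   by (intro DERIV_add norm_squared_has_derivative) (unfold x_def[abs_def] y_def[abs_def] z_def[abs_def], (rule has_vector_derivative_diff[OF Ad(1) Pd(1)]
    has_vector_derivative_diff[OF Ad(2) Pd(2)] has_vector_derivative_diff[OF Ad(3) Pd(3)])+)
  moreover have "e \<le> M * E t"
  proof -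
   have yg: "a * b \<le> E t" if "a\<^sup>2 + b\<^sup>2 \<le> 2 * E t" for a b :: real using that sum_squares_bound[of a b] by simp
   have q: "norm (x t) * norm (y t) \<le> E t" "norm (x t) * norm (z t) \<le> E t" "norm (y t) * norm (z t) \<le> E t" "(norm (y t))\<^sup>2 \<le> E t" "(norm (z t))\<^sup>2 \<le> E t"
    by (rule yg, simp add: E_def)+ (simp_all add: E_def)
   have k: "0 \<le> k" "0 \<le> 2 * k" "0 \<le> s0" using Kb(1) L_pos by (simp_all add: c_def k_def s0_def)
   define i1 i2 i3 where "i1 = inner (x t) (toL2 (\<lambda>x. - (Lam1 B0 x * A1 x)) - toL2 (\<lambda>x. - (Lam1 Q0 x * P1 x)))"
    and "i2 = inner (y t) (toL2 (\<lambda>x. - (Lam1 B1 x * A1 x + Lam1 B0 x * A2 x)) - toL2 (\<lambda>x. - (Lam1 Q1 x * P1 x + Lam1 Q0 x * P2 x)))"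
    and "i3 = inner (z t) (toL2 (\<lambda>x. A1 x - Lam1 B0 x * B1 x) - toL2 (\<lambda>x. P1 x - Lam1 Q0 x * Q1 x))"
   have "i1 \<le> k * E t + k * E t" unfolding i1_def using mult_left_mono[OF q(1) k(1)] mult_left_mono[OF q(2) k(1)] by (intro order_trans[OF est(1)] add_mono)
   moreover have "i2 \<le> 2 * k * E t + s0 * E t" unfolding i2_def using mult_left_mono[OF q(4) k(2)] mult_left_mono[OF q(3) k(3)] by (intro order_trans[OF est(2)] add_mono)
   moreover have "i3 \<le> E t + 2 * k * E t" unfolding i3_def using q(3) mult_left_mono[OF q(5) k(2)] by (intro order_trans[OF est(3)] add_mono)
   moreover have "e = 2 * i1 + 2 * i2 + 2 * i3" by (simp only: e_def i1_def i2_def i3_def)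
   ultimately have "e / 2 \<le> (k * E t + k * E t) + (2 * k * E t + s0 * E t) + (E t + 2 * k * E t)" by linarith
   also have "\<dots> = M * E t / 2" by (simp add: M_def algebra_simps)
   finally show ?thesis by simp
  qed
  ultimately show ?thesis by blast
 qed
 then obtain E' where E': "\<And>t. t \<in> {0..T} ==> (E has_real_derivative E' t) (at t within {0..T})" "\<And>t. t \<in> {0..T} ==> E' t \<le> M * E t" by metis
 have E0: "E 0 = 0"
 proof -
  have 0: "0 \<in> {0..T}" using T by auto
  have "u 0 \<in> sobolev L (Suc (Suc n))" "p 0 \<in> sobolev L (Suc (Suc n))" "w 0 \<in> sobolev L (Suc n)" "r 0 \<in> sobolev L (Suc n)"
   using s s' 0 unfolding is_solution_def by (auto simp: C0_path_def V_space_def)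
  moreover have "AE x in lborel. u 0 x = p 0 x" "AE x in lborel. w 0 x = r 0 x"
   using s s' unfolding is_solution_def by auto
  ultimately have "wd 0 (u 0) = wd 0 (p 0)" "wd 1 (u 0) = wd 1 (p 0)" "wd 0 (w 0) = wd 0 (r 0)"
   using wd_cong_AE[of "u 0" "Suc (Suc n)" "p 0"] wd_cong_AE[of "w 0" "Suc n" "r 0" 0] by auto
  then show ?thesis by (simp add: E_def x_def y_def z_def)
 qed
 have "E t = 0" by (rule Gronwall_zero[where E=E and E'=E' and M=M, OF T E' E0 _ t]) (simp_all add: E_def)
 then have "x t = 0" "z t = 0" by (auto simp: E_def add_nonneg_eq_0_iff)
 then have xz: "wd 0 (u t) = wd 0 (p t)" "wd 0 (w t) = wd 0 (r t)" by (auto simp: x_def z_def)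
 obtain A0 A1 B0 B1 where A: "dvt A0 A1" "dvt B0 B1" "wd 0 (u t) = toL2 A0" "wd 0 (w t) = toL2 B0" "AE x in lborel. u t x = A0 x" "AE x in lborel. w t x = B0 x"
  by (rule solution_at[OF s t]) blast
 obtain P0 P1 Q0 Q1 where P: "dvt P0 P1" "dvt Q0 Q1" "wd 0 (p t) = toL2 P0" "wd 0 (r t) = toL2 Q0" "AE x in lborel. p t x = P0 x" "AE x in lborel. r t x = Q0 x"
  by (rule solution_at[OF s' t]) blast
 have "AE x in lborel. A0 x = P0 x" "AE x in lborel. B0 x = Q0 x"
  using xz unfolding A(3,4) P(3,4) by (simp_all add: toL2_eq_iff dvtD(5)[OF A(1)] dvtD(5)[OF A(2)] dvtD(5)[OF P(1)] dvtD(5)[OF P(2)])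
 then show ?thesis using A(5,6) P(5,6) by auto
qed


section \<open>Existence\<close>

text \<open>The norms of the data are the L^2 norms of their top weak derivatives, so the bound
  \<open>R\<close> passes on unchanged. The free constant in \<open>Euler_solution\<close> is 0,
  because \<open>u0\<close> has mean zero.\<close>

theorem solution_exists:
 fixes n :: nat and R :: real
 assumes R: "0 \<le> R"
 shows "\<exists>T>0. \<forall>u0\<in>V_space L (Suc (Suc n)). \<forall>w0\<in>V_space L (Suc n).
  V_norm L (Suc (Suc n)) u0 \<le> R \<longrightarrow> V_norm L (Suc n) w0 \<le> R \<longrightarrow> (\<exists>u w. is_solution L (Suc n) T u0 w0 u w)"
proof -
 obtain T where T: "0 < T" and sol: "\<forall>q\<in>\<L>2. \<forall>h\<in>\<L>2. \<forall>c. nrm q \<le> R \<longrightarrow> nrm h \<le> R \<longrightarrow>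
  (\<exists>u ut ux w wt wx. fam con0 {0..T} (Suc (Suc n)) u \<and> fam con0 {0..T} (Suc n) ut \<and> fam con0 {0..T} (Suc n) w \<and> fam con0 {0..T} n wt \<and>
   u 0 = (\<lambda>x. c + pw (Suc (Suc n)) q x) \<and> w 0 = pw (Suc n) h \<and>
   (\<forall>t\<in>{0..T}. dvt (u t) (ux t) \<and> dvt (w t) (wx t) \<and> itg 0 L (w t) = 0 \<and> itg 0 L (wt t) = 0 \<and>
    ((\<lambda>t. toL2 (u t)) has_vector_derivative toL2 (ut t)) (at t within {0..T}) \<and>
    ((\<lambda>t. toL2 (w t)) has_vector_derivative toL2 (wt t)) (at t within {0..T}) \<and>
    (\<forall>x. ut t x = - (Lam1 (w t) x * ux t x) \<and> wt t x = ux t x - Lam1 (w t) x * wx t x)))"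
  using Euler_solution[OF R, of n] by (elim exE conjE) (rule that)
 show ?thesis
 proof (intro exI[of _ T] conjI T ballI impI)
  fix u0 w0 assume u0: "u0 \<in> V_space L (Suc (Suc n))" and w0: "w0 \<in> V_space L (Suc n)"
   and nu: "V_norm L (Suc (Suc n)) u0 \<le> R" and nw: "V_norm L (Suc n) w0 \<le> R"
  define q where "q = weak_deriv L (Suc (Suc n)) u0"
  define h where "h = weak_deriv L (Suc n) w0"
  have uS: "u0 \<in> sobolev L (Suc (Suc n))" "mean L u0 = 0" and wS: "w0 \<in> sobolev L (Suc n)" "mean L w0 = 0"
   using u0 w0 by (auto simp: V_space_def)
  note rq = sobolev_repr[OF uS(1), folded q_def] and rh = sobolev_repr[OF wS(1), folded h_def]
  have nq: "nrm q \<le> R" "nrm h \<le> R"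
   using nu nw V_norm_wd[OF uS(1)] V_norm_wd[OF wS(1)] by (simp_all add: wd_def q_def h_def)
  obtain u ut ux w wt wx where f: "fam con0 {0..T} (Suc (Suc n)) u" "fam con0 {0..T} (Suc n) ut" "fam con0 {0..T} (Suc n) w" "fam con0 {0..T} n wt"
   and i: "u 0 = (\<lambda>x. 0 + pw (Suc (Suc n)) q x)" "w 0 = pw (Suc n) h"
   and A: "\<forall>t\<in>{0..T}. dvt (u t) (ux t) \<and> dvt (w t) (wx t) \<and> itg 0 L (w t) = 0 \<and> itg 0 L (wt t) = 0 \<and>
    ((\<lambda>t. toL2 (u t)) has_vector_derivative toL2 (ut t)) (at t within {0..T}) \<and>
    ((\<lambda>t. toL2 (w t)) has_vector_derivative toL2 (wt t)) (at t within {0..T}) \<and>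
    (\<forall>x. ut t x = - (Lam1 (w t) x * ux t x) \<and> wt t x = ux t x - Lam1 (w t) x * wx t x)"
   using sol[THEN bspec, OF rq(1), THEN bspec, OF rh(1), THEN spec[of _ 0], THEN mp, OF nq(1), THEN mp, OF nq(2)]
   by (elim exE conjE) (rule that)
  have d: "dvt (u t) (ux t)" "dvt (w t) (wx t)" "itg 0 L (w t) = 0" "itg 0 L (wt t) = 0" "ut t x = - (Lam1 (w t) x * ux t x)" "wt t x = ux t x - Lam1 (w t) x * wx t x"
   and vd: "((\<lambda>t. toL2 (u t)) has_vector_derivative toL2 (ut t)) (at t within {0..T})"
    "((\<lambda>t. toL2 (w t)) has_vector_derivative toL2 (wt t)) (at t within {0..T})" if "t \<in> {0..T}" for t x
   using A that by blast+
  have m: "mean L (w t) = 0" "mean L (wt t) = 0" if "t \<in> {0..T}" for t using d(3,4)[OF that] by (simp_all add: mean_itg)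
  note T0 = less_imp_le[OF T]
  have C: "C0_path (sobolev L (Suc (Suc n))) (sobolev_norm L (Suc (Suc n))) T u" "C0_path (V_space L (Suc n)) (V_norm L (Suc n)) T w"
   "C0_path (sobolev L (Suc n)) (sobolev_norm L (Suc n)) T u" "C0_path (sobolev L (Suc n)) (sobolev_norm L (Suc n)) T ut"
   "C0_path (V_space L n) (V_norm L n) T w" "C0_path (V_space L n) (V_norm L n) T wt"
   unfolding C0_path_iff[OF good_sobolev] C0_path_iff[OF good_V]
   using fam_sobolev[OF f(1)] fam_sobolev[OF fam_Suc[OF f(1)]] fam_sobolev[OF f(2)] fam_sobolev[OF f(3)] fam_sobolev[OF fam_Suc[OF f(3)]] fam_sobolev[OF f(4)] m
   by (auto simp: V_space_def)
  have C1: "C1_path (sobolev L (Suc n)) (sobolev_norm L (Suc n)) T u ut" "C1_path (V_space L n) (V_norm L n) T w wt"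
   using C fam_vector_derivative[OF fam_Suc[OF f(1)] f(2) T0 vd(1)] fam_vector_derivative[OF fam_Suc[OF f(3)] f(4) T0 vd(2)]
   by (auto simp: C1_path_iff[OF good_sobolev] C1_path_iff[OF good_V])
  have "AE z in lborel. u 0 z = u0 z" using rq(3) by eventually_elim (simp add: i uS del: pw.simps)
  moreover have "AE z in lborel. w 0 z = w0 z" using rh(3) by eventually_elim (simp add: i wS del: pw.simps)
  moreover have "is_velocity L (w t) (Lam1 (w t)) \<and> (AE z in lborel. ut t z + Lam1 (w t) z * weak_deriv L 1 (u t) z = 0) \<and>
   (AE z in lborel. wt t z + Lam1 (w t) z * weak_deriv L 1 (w t) z = weak_deriv L 1 (u t) z)" if t: "t \<in> {0..T}" for t
  proof (intro conjI)
   note du = d(1)[OF t] and dw = d(2)[OF t]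
   note wu = weak_deriv_1[OF du dvtD(5)[OF du]] and ww = weak_deriv_1[OF dw dvtD(5)[OF dw]]
   show "is_velocity L (w t) (Lam1 (w t))" using is_velocity_iff[OF dw d(3)[OF t] dvtD(5)[OF dw]] by simp
   have "AE x in lborel. weak_deriv L 1 (u t) x = ux t x" by (rule wu) simp
   then show "AE z in lborel. ut t z + Lam1 (w t) z * weak_deriv L 1 (u t) z = 0"
    by eventually_elim (simp add: d(5)[OF t])
   have "AE x in lborel. weak_deriv L 1 (u t) x = ux t x" "AE x in lborel. weak_deriv L 1 (w t) x = wx t x" by (rule wu ww, simp)+
   then show "AE z in lborel. wt t z + Lam1 (w t) z * weak_deriv L 1 (w t) z = weak_deriv L 1 (u t) z"
    by eventually_elim (simp add: d(6)[OF t])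
  qed
  ultimately have "is_solution L (Suc n) T u0 w0 u w"
   unfolding is_solution_def Suc_eq_plus1[symmetric] diff_Suc_1
   using C(1,2) C1 by (intro conjI exI[of _ ut] exI[of _ wt] exI[of _ "\<lambda>t. Lam1 (w t)"]) auto
  then show "\<exists>u w. is_solution L (Suc n) T u0 w0 u w" by blast
 qed
qed

end

theorem theorem2p1:
 fixes L :: real and m :: nat
 assumes "L > 0" and "m \<ge> 1"
 shows "\<exists>\<tau> :: real \<Rightarrow> real \<Rightarrow> real.
  (\<forall>a b. \<tau> a b > 0) \<and>
  (\<forall>u0 \<in> V_space L (m + 1). \<forall>\<omega>0 \<in> V_space L m.
   let T = \<tau> (V_norm L (m + 1) u0) (V_norm L m \<omega>0) in
   \<exists>u \<omega>. is_solution L m T u0 \<omega>0 u \<omega> \<and>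
    (\<forall>u' \<omega>'. is_solution L m T u0 \<omega>0 u' \<omega>' \<longrightarrow>
      (\<forall>t\<in>{0..T}. (AE z in lborel. u' t z = u t z) \<and>
            (AE z in lborel. \<omega>' t z = \<omega> t z))))"
proof -
 interpret circle L by standard (rule assms(1))
 obtain n where m: "m = Suc n" using assms(2) by (cases m) auto
 have "\<forall>R. \<exists>T. 0 \<le> R \<longrightarrow> T > 0 \<and> (\<forall>u0\<in>V_space L (m + 1). \<forall>w0\<in>V_space L m.
  V_norm L (m + 1) u0 \<le> R \<longrightarrow> V_norm L m w0 \<le> R \<longrightarrow> (\<exists>u w. is_solution L m T u0 w0 u w))"
  using solution_exists[of _ n] unfolding m Suc_eq_plus1[symmetric] by blast
 then obtain \<sigma> where \<sigma>: "\<And>R. 0 \<le> R ==> \<sigma> R > 0" "\<And>R u0 w0. 0 \<le> R ==> u0 \<in> V_space L (m + 1) ==> w0 \<in> V_space L m ==>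
  V_norm L (m + 1) u0 \<le> R ==> V_norm L m w0 \<le> R ==> \<exists>u w. is_solution L m (\<sigma> R) u0 w0 u w"
  unfolding choice_iff by blast
 \<comment> \<open>\<open>\<tau>\<close> must be positive for all real arguments, also for negative
   ones that no norm attains; hence the maximum with 0.\<close>
 define \<tau> where "\<tau> a b = \<sigma> (max 0 (max a b))" for a b
 show ?thesis
 proof (intro exI[of _ \<tau>] conjI allI ballI)
  show pos: "\<tau> a b > 0" for a b by (simp add: \<tau>_def \<sigma>(1))
  fix u0 \<omega>0 assume u0: "u0 \<in> V_space L (m + 1)" and \<omega>0: "\<omega>0 \<in> V_space L m"
  define T where "T = \<tau> (V_norm L (m + 1) u0) (V_norm L m \<omega>0)"
  define R where "R = max 0 (max (V_norm L (m + 1) u0) (V_norm L m \<omega>0))"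
  have "0 \<le> R" "V_norm L (m + 1) u0 \<le> R" "V_norm L m \<omega>0 \<le> R" by (simp_all add: R_def le_max_iff_disj)
  from \<sigma>(2)[OF this(1) u0 \<omega>0 this(2,3)] obtain u \<omega> where s: "is_solution L m T u0 \<omega>0 u \<omega>"
   unfolding T_def \<tau>_def R_def by blast
  have "(AE z in lborel. u' t z = u t z) \<and> (AE z in lborel. \<omega>' t z = \<omega> t z)"
   if "is_solution L m T u0 \<omega>0 u' \<omega>'" "t \<in> {0..T}" for u' \<omega>' t
   by (rule solution_unique[OF s[unfolded m] that(1)[unfolded m] _ that(2)]) (use pos in \<open>simp add: T_def less_imp_le\<close>)
  then show "let T = \<tau> (V_norm L (m + 1) u0) (V_norm L m \<omega>0) in
   \<exists>u \<omega>. is_solution L m T u0 \<omega>0 u \<omega> \<and>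
    (\<forall>u' \<omega>'. is_solution L m T u0 \<omega>0 u' \<omega>' \<longrightarrow>
      (\<forall>t\<in>{0..T}. (AE z in lborel. u' t z = u t z) \<and> (AE z in lborel. \<omega>' t z = \<omega> t z)))"
   unfolding T_def[symmetric] Let_def using s by blast
 qed
qed

end
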